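(* Let $M$ be a preGarside monoid of FC type, and let $G(M)$ be its enveloping group. (P1) The natural morphism $\iota : M \to G(M)$ is injective (so $M$ is regarded as a submonoid of $G(M)$). (P2) Let $N$ be a standard parabolic submonoid of $M$. The standard parabolic subgroup of $G(M)$ generated by $N$ is isomorphic to $G(N)$ and, identifying $G(N)$ with this subgroup, $G(N) \cap M = N$. (P3) Let $N, N'$ be standard parabolic submonoids of $M$. Then $N \cap N'$ is a standard parabolic submonoid of $M$, and $G(N) \cap G(N') = G(N \cap N')$ in $G(M)$. (P4) $G(M)$ is torsion free.
   Context: For a monoid $M$: $b\preceq_L a$ means $a=bc$ for some $c\in M$; $c\preceq_R a$ means $a=bc$ for some $b \in M$; $b$ is a factor of $a$ if $a=cbd$ for some $c,d \in M$. $M$ is cancellative if $cad=cbd$ implies $a=b$. $M$ is atomic if there is a map $\nu:M\to\mathbb{N}$ (a norm) with $\nu(a)>0$ for $a\ne 1$ and $\nu(ab)\ge\nu(a)+\nu(b)$ for all $a,b$; then $\preceq_L,\preceq_R$ are partial orders. A preGarside monoid is a cancellative atomic monoid $M$ such that, for all $a,b \in M$, if $a,b$ have a common upper bound for $\preceq_L$ then they have a least one, $a\vee_L b$, and if they have a common upper bound for $\preceq_R$ then they have a least one, $a\vee_R b$. A Garside element of a preGarside monoid is an element whose set of left-divisors equals its set of right-divisors (balanced) and whose set of factors generates the monoid; a Garside monoid is a preGarside monoid having a Garside element (no finite generation is assumed). A submonoid $N$ of a preGarside monoid $M$ is a standard parabolic submonoid if (a) it is special, i.e. $ab\in N$ implies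 $a,b\in N$ for all $a,b\in M$; and (b) for all $a,b\in N$, $a\vee_L b\in N$ whenever $a \vee_L b$ exists in $M$, and $a\vee_R b\in N$ whenever $a\vee_R b$ exists in $M$. Such an $N$ is itself a preGarside monoid. $G(M)$ denotes the enveloping (universal) group of $M$ and $\iota:M\to G(M)$ the canonical morphism; a standard parabolic subgroup of $G(M)$ is a subgroup generated by $\iota(N)$ for a standard parabolic submonoid $N$. If $\iota_1:N\to M_1$, $\iota_2:N\to M_2$ are injective monoid morphisms, $M_1*_N M_2$ denotes the amalgamated product (pushout in the category of monoids). If $M_1,M_2$ are preGarside and $\iota_1(N),\iota_2(N)$ are standard parabolic submonoids ("$N$ is a common standard parabolic submonoid"), then $M_1*_NM_2$ is a preGarside monoid. The family of preGarside monoids of FC type is the smallest family of preGarside monoids (up to isomorphism) containing all Garside monoids and closed under amalgamation above common standard parabolic submonoids. *)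

theory Defs
  imports "HOL-Algebra.Generated_Groups"
begin

section \<open>PreGarside monoids\<close>

text \<open>
  The library's \<^const>\<open>hom\<close> is about multiplication only; a morphism of monoids also
  preserves the unit.
\<close>

definition mon_hom :: "('a, 'm) monoid_scheme \<Rightarrow> ('b, 'n) monoid_scheme \<Rightarrow> ('a \<Rightarrow> 'b) set" where
  "mon_hom M N = {h \<in> hom M N. h \<one>\<^bsub>M\<^esub> = \<one>\<^bsub>N\<^esub>}"

definition ldiv :: "('a, 'm) monoid_scheme \<Rightarrow> 'a \<Rightarrow> 'a \<Rightarrow> bool" where
  "ldiv M b a \<longleftrightarrow> (\<exists>c\<in>carrier M. a = b \<otimes>\<^bsub>M\<^esub> c)"

definition rdiv :: "('a, 'm) monoid_scheme \<Rightarrow> 'a \<Rightarrow> 'a \<Rightarrow> bool" where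
  "rdiv M c a \<longleftrightarrow> (\<exists>b\<in>carrier M. a = b \<otimes>\<^bsub>M\<^esub> c)"

definition factor_of :: "('a, 'm) monoid_scheme \<Rightarrow> 'a \<Rightarrow> 'a \<Rightarrow> bool" where
  "factor_of M b a \<longleftrightarrow> (\<exists>c\<in>carrier M. \<exists>d\<in>carrier M. a = c \<otimes>\<^bsub>M\<^esub> b \<otimes>\<^bsub>M\<^esub> d)"

definition cancellative :: "('a, 'm) monoid_scheme \<Rightarrow> bool" where
  "cancellative M \<longleftrightarrow>
    (\<forall>a\<in>carrier M. \<forall>b\<in>carrier M. \<forall>c\<in>carrier M. \<forall>d\<in>carrier M.
      c \<otimes>\<^bsub>M\<^esub> a \<otimes>\<^bsub>M\<^esub> d = c \<otimes>\<^bsub>M\<^esub> b \<otimes>\<^bsub>M\<^esub> d \<longrightarrow> a = b)"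

definition atomic :: "('a, 'm) monoid_scheme \<Rightarrow> bool" where
  "atomic M \<longleftrightarrow>
    (\<exists>\<nu> :: 'a \<Rightarrow> nat.
      (\<forall>a\<in>carrier M. a \<noteq> \<one>\<^bsub>M\<^esub> \<longrightarrow> \<nu> a > 0) \<and>
      (\<forall>a\<in>carrier M. \<forall>b\<in>carrier M. \<nu> (a \<otimes>\<^bsub>M\<^esub> b) \<ge> \<nu> a + \<nu> b))"

definition upper_bound :: "('a, 'm) monoid_scheme \<Rightarrow> ('a \<Rightarrow> 'a \<Rightarrow> bool) \<Rightarrow> 'a \<Rightarrow> 'a \<Rightarrow> 'a \<Rightarrow> bool" where
  "upper_bound M r a b c \<longleftrightarrow> c \<in> carrier M \<and> r a c \<and> r b c"

definition is_join :: "('a, 'm) monoid_scheme \<Rightarrow> ('a \<Rightarrow> 'a \<Rightarrow> bool) \<Rightarrow> 'a \<Rightarrow> 'a \<Rightarrow> 'a \<Rightarrow> bool" where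
  "is_join M r a b c \<longleftrightarrow> upper_bound M r a b c \<and> (\<forall>d. upper_bound M r a b d \<longrightarrow> r c d)"

definition pregarside :: "('a, 'm) monoid_scheme \<Rightarrow> bool" where
  "pregarside M \<longleftrightarrow> monoid M \<and> cancellative M \<and> atomic M \<and>
    (\<forall>a\<in>carrier M. \<forall>b\<in>carrier M.
      ((\<exists>c. upper_bound M (ldiv M) a b c) \<longrightarrow> (\<exists>c. is_join M (ldiv M) a b c)) \<and>
      ((\<exists>c. upper_bound M (rdiv M) a b c) \<longrightarrow> (\<exists>c. is_join M (rdiv M) a b c)))"

definition garside_element :: "('a, 'm) monoid_scheme \<Rightarrow> 'a \<Rightarrow> bool" where
  "garside_element M \<Delta> \<longleftrightarrow> \<Delta> \<in> carrier M \<and>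
    {a \<in> carrier M. ldiv M a \<Delta>} = {a \<in> carrier M. rdiv M a \<Delta>} \<and>
    \<Inter>{H. submonoid H M \<and> {a \<in> carrier M. factor_of M a \<Delta>} \<subseteq> H} = carrier M"

definition garside :: "('a, 'm) monoid_scheme \<Rightarrow> bool" where
  "garside M \<longleftrightarrow> pregarside M \<and> (\<exists>\<Delta>. garside_element M \<Delta>)"

definition std_parabolic :: "'a set \<Rightarrow> ('a, 'm) monoid_scheme \<Rightarrow> bool" where
  "std_parabolic N M \<longleftrightarrow> submonoid N M \<and>
    (\<forall>a\<in>carrier M. \<forall>b\<in>carrier M. a \<otimes>\<^bsub>M\<^esub> b \<in> N \<longrightarrow> a \<in> N \<and> b \<in> N) \<and>
    (\<forall>a\<in>N. \<forall>b\<in>N. \<forall>c. is_join M (ldiv M) a b c \<longrightarrow> c \<in> N) \<and>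
    (\<forall>a\<in>N. \<forall>b\<in>N. \<forall>c. is_join M (rdiv M) a b c \<longrightarrow> c \<in> N)"


section \<open>Monoids given by generators and relations\<close>

inductive_set pres_cong :: "'x set \<Rightarrow> ('x list \<times> 'x list) set \<Rightarrow> ('x list \<times> 'x list) set"
  for X R where
  base: "(u, v) \<in> R \<Longrightarrow> u \<in> lists X \<Longrightarrow> v \<in> lists X \<Longrightarrow> (u, v) \<in> pres_cong X R"
| refl: "u \<in> lists X \<Longrightarrow> (u, u) \<in> pres_cong X R"
| sym: "(u, v) \<in> pres_cong X R \<Longrightarrow> (v, u) \<in> pres_cong X R"
| trans: "(u, v) \<in> pres_cong X R \<Longrightarrow> (v, w) \<in> pres_cong X R \<Longrightarrow> (u, w) \<in> pres_cong X R"
| append: "(u, u') \<in> pres_cong X R \<Longrightarrow> (v, v') \<in> pres_cong X R \<Longrightarrow> (u @ v, u' @ v') \<in> pres_cong X R"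

definition pres_class :: "'x set \<Rightarrow> ('x list \<times> 'x list) set \<Rightarrow> 'x list \<Rightarrow> 'x list set" where
  "pres_class X R u = pres_cong X R `` {u}"

definition presented_monoid :: "'x set \<Rightarrow> ('x list \<times> 'x list) set \<Rightarrow> 'x list set monoid" where
  "presented_monoid X R =
    \<lparr>carrier = lists X // pres_cong X R,
     mult = (\<lambda>A B. \<Union>u\<in>A. \<Union>v\<in>B. pres_class X R (u @ v)),
     one = pres_class X R []\<rparr>"

lemma pres_cong_lists: "(u, v) \<in> pres_cong X R \<Longrightarrow> u \<in> lists X \<and> v \<in> lists X"
  by (induction rule: pres_cong.induct) auto

lemma equiv_pres_cong: "equiv (lists X) (pres_cong X R)"
proof (rule equivI)
  show "pres_cong X R \<subseteq> lists X \<times> lists X"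
    using pres_cong_lists by fastforce
  show "refl_on (lists X) (pres_cong X R)"
    by (auto simp: refl_on_def intro: pres_cong.refl dest: pres_cong_lists)
  show "sym (pres_cong X R)"
    by (auto intro: symI pres_cong.sym)
  show "trans (pres_cong X R)"
    by (auto intro: transI pres_cong.trans)
qed

lemma pres_class_eq_iff:
  "u \<in> lists X \<Longrightarrow> v \<in> lists X \<Longrightarrow>
    pres_class X R u = pres_class X R v \<longleftrightarrow> (u, v) \<in> pres_cong X R"
  unfolding pres_class_def by (metis equiv_pres_cong eq_equiv_class_iff)

lemma pres_class_eqI:
  "(u, v) \<in> R \<Longrightarrow> u \<in> lists X \<Longrightarrow> v \<in> lists X \<Longrightarrow> pres_class X R u = pres_class X R v"
  by (simp add: pres_class_eq_iff pres_cong.base)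

lemma pres_class_mem_iff: "w \<in> pres_class X R u \<longleftrightarrow> (u, w) \<in> pres_cong X R"
  by (simp add: pres_class_def)

lemma pres_class_carrier [simp]:
  "u \<in> lists X \<Longrightarrow> pres_class X R u \<in> carrier (presented_monoid X R)"
  by (auto simp: presented_monoid_def pres_class_def intro: quotientI)

lemma presented_carrierE:
  assumes "A \<in> carrier (presented_monoid X R)"
  obtains u where "u \<in> lists X" "A = pres_class X R u"
  using assms by (auto simp: presented_monoid_def pres_class_def elim!: quotientE)

lemma presented_one: "\<one>\<^bsub>presented_monoid X R\<^esub> = pres_class X R []"
  by (simp add: presented_monoid_def)

lemma presented_mult:
  assumes "u \<in> lists X" "v \<in> lists X"
  shows "pres_class X R u \<otimes>\<^bsub>presented_monoid X R\<^esub> pres_class X R v = pres_class X R (u @ v)"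
proof -
  have "pres_class X R (u' @ v') = pres_class X R (u @ v)"
    if "u' \<in> pres_class X R u" "v' \<in> pres_class X R v" for u' v'
  proof -
    have "(u @ v, u' @ v') \<in> pres_cong X R"
      using that by (simp add: pres_class_mem_iff pres_cong.append)
    then show ?thesis
      using pres_cong_lists[of "u @ v" "u' @ v'" X R] pres_class_eq_iff[of "u @ v" X "u' @ v'" R]
      by simp
  qed
  moreover have "u \<in> pres_class X R u" "v \<in> pres_class X R v"
    using assms by (auto simp: pres_class_mem_iff intro: pres_cong.refl)
  ultimately have "(\<Union>u'\<in>pres_class X R u. \<Union>v'\<in>pres_class X R v. pres_class X R (u' @ v')) =
      pres_class X R (u @ v)"
    by blast
  then show ?thesis
    by (simp add: presented_monoid_def)
qed

lemma presented_monoid_is_monoid: "monoid (presented_monoid X R)"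
proof (rule monoidI)
  show "\<one>\<^bsub>presented_monoid X R\<^esub> \<in> carrier (presented_monoid X R)"
    by (simp add: presented_one)
next
  fix x y assume "x \<in> carrier (presented_monoid X R)" "y \<in> carrier (presented_monoid X R)"
  then show "x \<otimes>\<^bsub>presented_monoid X R\<^esub> y \<in> carrier (presented_monoid X R)"
    by (elim presented_carrierE) (simp only: presented_mult, simp)
next
  fix x y z assume "x \<in> carrier (presented_monoid X R)" "y \<in> carrier (presented_monoid X R)"
    "z \<in> carrier (presented_monoid X R)"
  then show "x \<otimes>\<^bsub>presented_monoid X R\<^esub> y \<otimes>\<^bsub>presented_monoid X R\<^esub> z =
      x \<otimes>\<^bsub>presented_monoid X R\<^esub> (y \<otimes>\<^bsub>presented_monoid X R\<^esub> z)"
    by (elim presented_carrierE) (simp add: presented_mult)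
next
  fix x assume "x \<in> carrier (presented_monoid X R)"
  then show "\<one>\<^bsub>presented_monoid X R\<^esub> \<otimes>\<^bsub>presented_monoid X R\<^esub> x = x"
    by (elim presented_carrierE) (simp add: presented_mult presented_one)
next
  fix x assume "x \<in> carrier (presented_monoid X R)"
  then show "x \<otimes>\<^bsub>presented_monoid X R\<^esub> \<one>\<^bsub>presented_monoid X R\<^esub> = x"
    by (elim presented_carrierE) (simp add: presented_mult presented_one)
qed

definition word_eval :: "('b, 'm) monoid_scheme \<Rightarrow> ('x \<Rightarrow> 'b) \<Rightarrow> 'x list \<Rightarrow> 'b" where
  "word_eval H f u = foldr (\<lambda>x y. f x \<otimes>\<^bsub>H\<^esub> y) u \<one>\<^bsub>H\<^esub>"

lemma word_eval_simps [simp]: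
  "word_eval H f [] = \<one>\<^bsub>H\<^esub>"
  "word_eval H f (x # u) = f x \<otimes>\<^bsub>H\<^esub> word_eval H f u"
  by (simp_all add: word_eval_def)

lemma word_eval_closed:
  assumes "monoid H" "f \<in> X \<rightarrow> carrier H" "u \<in> lists X"
  shows "word_eval H f u \<in> carrier H"
proof -
  interpret monoid H by fact
  show ?thesis using assms(3) by (induction u) (use assms(2) in auto)
qed

lemma word_eval_append:
  assumes "monoid H" "f \<in> X \<rightarrow> carrier H" "u \<in> lists X" "v \<in> lists X"
  shows "word_eval H f (u @ v) = word_eval H f u \<otimes>\<^bsub>H\<^esub> word_eval H f v"
proof -
  interpret monoid H by fact
  show ?thesis
    using assms(3)
  proof (induction u)
    case Nil
    then show ?case using word_eval_closed[OF assms(1,2,4)] by simp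
  next
    case (Cons x u)
    then show ?case
      using word_eval_closed[OF assms(1,2,4)] word_eval_closed[OF assms(1,2), of u] assms(2)
      by (auto simp: m_assoc Pi_iff)
  qed
qed

lemma word_eval_cong:
  assumes "monoid H" "f \<in> X \<rightarrow> carrier H"
    and "\<And>u v. (u, v) \<in> R \<Longrightarrow> u \<in> lists X \<Longrightarrow> v \<in> lists X \<Longrightarrow> word_eval H f u = word_eval H f v"
    and "(u, v) \<in> pres_cong X R"
  shows "word_eval H f u = word_eval H f v"
  using assms(4)
proof (induction rule: pres_cong.induct)
  case (append u u' v v')
  then show ?case
    using word_eval_append[OF assms(1,2)] by (metis pres_cong_lists)
qed (auto intro: assms(3))

text \<open>The universal property of a presentation, for target monoids on any type.\<close>

lemma presented_monoid_universal:
  assumes "monoid H" "f \<in> X \<rightarrow> carrier H"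
    and "\<And>u v. (u, v) \<in> R \<Longrightarrow> u \<in> lists X \<Longrightarrow> v \<in> lists X \<Longrightarrow> word_eval H f u = word_eval H f v"
  shows "\<exists>h \<in> mon_hom (presented_monoid X R) H. \<forall>x\<in>X. h (pres_class X R [x]) = f x"
proof -
  interpret monoid H by fact
  define h where "h = (\<lambda>A. word_eval H f (SOME u. u \<in> A))"
  have h: "h (pres_class X R u) = word_eval H f u" if "u \<in> lists X" for u
  proof -
    have "u \<in> pres_class X R u"
      using that by (simp add: pres_class_mem_iff pres_cong.refl)
    then have "(SOME v. v \<in> pres_class X R u) \<in> pres_class X R u"
      by (rule someI)
    then show ?thesis
      unfolding h_def pres_class_mem_iff by (metis word_eval_cong[OF assms])
  qed
  have "h \<in> hom (presented_monoid X R) H"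
  proof (rule homI)
    fix x assume "x \<in> carrier (presented_monoid X R)"
    then show "h x \<in> carrier H"
      by (elim presented_carrierE) (simp add: h word_eval_closed[OF assms(1,2)])
  next
    fix x y assume "x \<in> carrier (presented_monoid X R)" "y \<in> carrier (presented_monoid X R)"
    then show "h (x \<otimes>\<^bsub>presented_monoid X R\<^esub> y) = h x \<otimes>\<^bsub>H\<^esub> h y"
      by (elim presented_carrierE)
        (simp add: presented_mult h word_eval_append[OF assms(1,2)])
  qed
  moreover have "h \<one>\<^bsub>presented_monoid X R\<^esub> = \<one>\<^bsub>H\<^esub>"
    by (simp add: presented_one h)
  moreover have "\<forall>x\<in>X. h (pres_class X R [x]) = f x"
    using assms(2) by (auto simp: h Pi_iff)
  ultimately show ?thesis
    by (auto simp: mon_hom_def)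
qed

lemma presented_monoid_unique:
  assumes "h \<in> mon_hom (presented_monoid X R) H" "k \<in> mon_hom (presented_monoid X R) H"
    and "\<And>x. x \<in> X \<Longrightarrow> h (pres_class X R [x]) = k (pres_class X R [x])"
    and "A \<in> carrier (presented_monoid X R)"
  shows "h A = k A"
proof -
  have "h (pres_class X R u) = k (pres_class X R u)" if "u \<in> lists X" for u
    using that
  proof (induction u)
    case Nil
    then show ?case using assms(1,2) by (simp add: mon_hom_def presented_one)
  next
    case (Cons x u)
    then have eq: "pres_class X R (x # u) =
        pres_class X R [x] \<otimes>\<^bsub>presented_monoid X R\<^esub> pres_class X R u"
      by (simp add: presented_mult)
    have mem: "pres_class X R [x] \<in> carrier (presented_monoid X R)"
      "pres_class X R u \<in> carrier (presented_monoid X R)"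
      using Cons.hyps by (auto intro!: pres_class_carrier)
    have "h (pres_class X R [x] \<otimes>\<^bsub>presented_monoid X R\<^esub> pres_class X R u) =
        h (pres_class X R [x]) \<otimes>\<^bsub>H\<^esub> h (pres_class X R u)"
      using assms(1) by (intro hom_mult mem) (simp add: mon_hom_def)
    moreover have "k (pres_class X R [x] \<otimes>\<^bsub>presented_monoid X R\<^esub> pres_class X R u) =
        k (pres_class X R [x]) \<otimes>\<^bsub>H\<^esub> k (pres_class X R u)"
      using assms(2) by (intro hom_mult mem) (simp add: mon_hom_def)
    ultimately show ?case
      unfolding eq using Cons.IH assms(3)[OF Cons.hyps(1)] by simp
  qed
  moreover obtain u where "u \<in> lists X" "A = pres_class X R u"
    using assms(4) by (rule presented_carrierE)
  ultimately show ?thesis by simp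
qed


section \<open>Amalgamated products\<close>

definition amalgam_rels ::
  "('c, 'k) monoid_scheme \<Rightarrow> ('c \<Rightarrow> 'a) \<Rightarrow> ('c \<Rightarrow> 'b) \<Rightarrow> ('a, 'm) monoid_scheme \<Rightarrow> ('b, 'n) monoid_scheme
    \<Rightarrow> (('a + 'b) list \<times> ('a + 'b) list) set" where
  "amalgam_rels N i1 i2 M1 M2 =
    {([], [Inl \<one>\<^bsub>M1\<^esub>]), ([], [Inr \<one>\<^bsub>M2\<^esub>])} \<union>
    {([Inl a, Inl b], [Inl (a \<otimes>\<^bsub>M1\<^esub> b)]) | a b. a \<in> carrier M1 \<and> b \<in> carrier M1} \<union>
    {([Inr a, Inr b], [Inr (a \<otimes>\<^bsub>M2\<^esub> b)]) | a b. a \<in> carrier M2 \<and> b \<in> carrier M2} \<union>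
    {([Inl (i1 n)], [Inr (i2 n)]) | n. n \<in> carrier N}"

definition amalgam ::
  "('c, 'k) monoid_scheme \<Rightarrow> ('c \<Rightarrow> 'a) \<Rightarrow> ('c \<Rightarrow> 'b) \<Rightarrow> ('a, 'm) monoid_scheme \<Rightarrow> ('b, 'n) monoid_scheme
    \<Rightarrow> ('a + 'b) list set monoid" where
  "amalgam N i1 i2 M1 M2 =
    presented_monoid (carrier M1 <+> carrier M2) (amalgam_rels N i1 i2 M1 M2)"

definition amalgam_in1 ::
  "('c, 'k) monoid_scheme \<Rightarrow> ('c \<Rightarrow> 'a) \<Rightarrow> ('c \<Rightarrow> 'b) \<Rightarrow> ('a, 'm) monoid_scheme \<Rightarrow> ('b, 'n) monoid_scheme
    \<Rightarrow> 'a \<Rightarrow> ('a + 'b) list set" where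
  "amalgam_in1 N i1 i2 M1 M2 a =
    pres_class (carrier M1 <+> carrier M2) (amalgam_rels N i1 i2 M1 M2) [Inl a]"

definition amalgam_in2 ::
  "('c, 'k) monoid_scheme \<Rightarrow> ('c \<Rightarrow> 'a) \<Rightarrow> ('c \<Rightarrow> 'b) \<Rightarrow> ('a, 'm) monoid_scheme \<Rightarrow> ('b, 'n) monoid_scheme
    \<Rightarrow> 'b \<Rightarrow> ('a + 'b) list set" where
  "amalgam_in2 N i1 i2 M1 M2 b =
    pres_class (carrier M1 <+> carrier M2) (amalgam_rels N i1 i2 M1 M2) [Inr b]"

text \<open>The construction is the pushout in the category of monoids (the next three lemmas).\<close>

lemma amalgam_cocone:
  assumes "monoid M1" "monoid M2" "i1 \<in> mon_hom N M1" "i2 \<in> mon_hom N M2"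
  shows "amalgam_in1 N i1 i2 M1 M2 \<in> mon_hom M1 (amalgam N i1 i2 M1 M2)"
    and "amalgam_in2 N i1 i2 M1 M2 \<in> mon_hom M2 (amalgam N i1 i2 M1 M2)"
    and "n \<in> carrier N \<Longrightarrow>
      amalgam_in1 N i1 i2 M1 M2 (i1 n) = amalgam_in2 N i1 i2 M1 M2 (i2 n)"
proof -
  interpret M1: monoid M1 by fact
  interpret M2: monoid M2 by fact
  let ?X = "carrier M1 <+> carrier M2" and ?R = "amalgam_rels N i1 i2 M1 M2"
  show "amalgam_in1 N i1 i2 M1 M2 \<in> mon_hom M1 (amalgam N i1 i2 M1 M2)"
    unfolding mon_hom_def
  proof (intro CollectI conjI homI)
    fix x assume "x \<in> carrier M1"
    then show "amalgam_in1 N i1 i2 M1 M2 x \<in> carrier (amalgam N i1 i2 M1 M2)"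
      by (auto simp: amalgam_in1_def amalgam_def intro!: pres_class_carrier)
  next
    fix x y assume xy: "x \<in> carrier M1" "y \<in> carrier M1"
    then have "pres_class ?X ?R [Inl x, Inl y] = pres_class ?X ?R [Inl (x \<otimes>\<^bsub>M1\<^esub> y)]"
      by (intro pres_class_eqI) (auto simp: amalgam_rels_def)
    then show "amalgam_in1 N i1 i2 M1 M2 (x \<otimes>\<^bsub>M1\<^esub> y) =
        amalgam_in1 N i1 i2 M1 M2 x \<otimes>\<^bsub>amalgam N i1 i2 M1 M2\<^esub> amalgam_in1 N i1 i2 M1 M2 y"
      using xy by (simp add: amalgam_in1_def amalgam_def presented_mult InlI InrI)
  next
    have "pres_class ?X ?R [] = pres_class ?X ?R [Inl \<one>\<^bsub>M1\<^esub>]"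
      by (intro pres_class_eqI) (auto simp: amalgam_rels_def)
    then show "amalgam_in1 N i1 i2 M1 M2 \<one>\<^bsub>M1\<^esub> = \<one>\<^bsub>amalgam N i1 i2 M1 M2\<^esub>"
      by (simp add: amalgam_in1_def amalgam_def presented_one)
  qed
  show "amalgam_in2 N i1 i2 M1 M2 \<in> mon_hom M2 (amalgam N i1 i2 M1 M2)"
    unfolding mon_hom_def
  proof (intro CollectI conjI homI)
    fix x assume "x \<in> carrier M2"
    then show "amalgam_in2 N i1 i2 M1 M2 x \<in> carrier (amalgam N i1 i2 M1 M2)"
      by (auto simp: amalgam_in2_def amalgam_def intro!: pres_class_carrier)
  next
    fix x y assume xy: "x \<in> carrier M2" "y \<in> carrier M2"
    then have "pres_class ?X ?R [Inr x, Inr y] = pres_class ?X ?R [Inr (x \<otimes>\<^bsub>M2\<^esub> y)]"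
      by (intro pres_class_eqI) (auto simp: amalgam_rels_def)
    then show "amalgam_in2 N i1 i2 M1 M2 (x \<otimes>\<^bsub>M2\<^esub> y) =
        amalgam_in2 N i1 i2 M1 M2 x \<otimes>\<^bsub>amalgam N i1 i2 M1 M2\<^esub> amalgam_in2 N i1 i2 M1 M2 y"
      using xy by (simp add: amalgam_in2_def amalgam_def presented_mult InlI InrI)
  next
    have "pres_class ?X ?R [] = pres_class ?X ?R [Inr \<one>\<^bsub>M2\<^esub>]"
      by (intro pres_class_eqI) (auto simp: amalgam_rels_def)
    then show "amalgam_in2 N i1 i2 M1 M2 \<one>\<^bsub>M2\<^esub> = \<one>\<^bsub>amalgam N i1 i2 M1 M2\<^esub>"
      by (simp add: amalgam_in2_def amalgam_def presented_one)
  qed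
  show "amalgam_in1 N i1 i2 M1 M2 (i1 n) = amalgam_in2 N i1 i2 M1 M2 (i2 n)" if "n \<in> carrier N"
    unfolding amalgam_in1_def amalgam_in2_def
  proof (rule pres_class_eqI)
    show "([Inl (i1 n)], [Inr (i2 n)]) \<in> ?R"
      using that by (auto simp: amalgam_rels_def)
    have "i1 n \<in> carrier M1" "i2 n \<in> carrier M2"
      using that assms(3,4) by (auto simp: mon_hom_def hom_def)
    then show "[Inl (i1 n)] \<in> lists ?X" "[Inr (i2 n)] \<in> lists ?X"
      by auto
  qed
qed

lemma amalgam_universal:
  assumes "monoid M1" "monoid M2" "monoid H"
    and "f1 \<in> mon_hom M1 H" "f2 \<in> mon_hom M2 H"
    and "\<And>n. n \<in> carrier N \<Longrightarrow> f1 (i1 n) = f2 (i2 n)"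
  shows "\<exists>h \<in> mon_hom (amalgam N i1 i2 M1 M2) H.
    (\<forall>a\<in>carrier M1. h (amalgam_in1 N i1 i2 M1 M2 a) = f1 a) \<and>
    (\<forall>b\<in>carrier M2. h (amalgam_in2 N i1 i2 M1 M2 b) = f2 b)"
proof -
  interpret H: monoid H by fact
  let ?X = "carrier M1 <+> carrier M2" and ?R = "amalgam_rels N i1 i2 M1 M2"
  have cl: "f1 a \<in> carrier H" if "a \<in> carrier M1" for a
    using that assms(4) by (auto simp: mon_hom_def hom_def)
  have cl': "f2 a \<in> carrier H" if "a \<in> carrier M2" for a
    using that assms(5) by (auto simp: mon_hom_def hom_def)
  have "\<exists>h \<in> mon_hom (presented_monoid ?X ?R) H.
      \<forall>x\<in>?X. h (pres_class ?X ?R [x]) = case_sum f1 f2 x"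
  proof (rule presented_monoid_universal[OF assms(3)])
    show "case_sum f1 f2 \<in> ?X \<rightarrow> carrier H"
      using cl cl' by (auto split: sum.split)
  next
    fix u v assume "(u, v) \<in> ?R" "u \<in> lists ?X" "v \<in> lists ?X"
    then show "word_eval H (case_sum f1 f2) u = word_eval H (case_sum f1 f2) v"
      using assms(4-6) cl cl' by (auto simp: amalgam_rels_def mon_hom_def hom_mult)
  qed
  then obtain h where h: "h \<in> mon_hom (amalgam N i1 i2 M1 M2) H"
    "\<forall>x\<in>?X. h (pres_class ?X ?R [x]) = case_sum f1 f2 x"
    unfolding amalgam_def by blast
  then show ?thesis
    unfolding amalgam_in1_def amalgam_in2_def
    using h(2)[THEN bspec, OF InlI] h(2)[THEN bspec, OF InrI] by (intro bexI[OF _ h(1)]) auto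
qed

lemma amalgam_unique:
  assumes "h \<in> mon_hom (amalgam N i1 i2 M1 M2) H" "k \<in> mon_hom (amalgam N i1 i2 M1 M2) H"
    and "\<And>a. a \<in> carrier M1 \<Longrightarrow>
      h (amalgam_in1 N i1 i2 M1 M2 a) = k (amalgam_in1 N i1 i2 M1 M2 a)"
    and "\<And>b. b \<in> carrier M2 \<Longrightarrow>
      h (amalgam_in2 N i1 i2 M1 M2 b) = k (amalgam_in2 N i1 i2 M1 M2 b)"
    and "A \<in> carrier (amalgam N i1 i2 M1 M2)"
  shows "h A = k A"
proof (rule presented_monoid_unique[where h = h and k = k and A = A])
  show "h \<in> mon_hom (presented_monoid (carrier M1 <+> carrier M2) (amalgam_rels N i1 i2 M1 M2)) H"
    "k \<in> mon_hom (presented_monoid (carrier M1 <+> carrier M2) (amalgam_rels N i1 i2 M1 M2)) H"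
    "A \<in> carrier (presented_monoid (carrier M1 <+> carrier M2) (amalgam_rels N i1 i2 M1 M2))"
    using assms(1,2,5) unfolding amalgam_def by auto
next
  fix x assume "x \<in> carrier M1 <+> carrier M2"
  then show "h (pres_class (carrier M1 <+> carrier M2) (amalgam_rels N i1 i2 M1 M2) [x]) =
      k (pres_class (carrier M1 <+> carrier M2) (amalgam_rels N i1 i2 M1 M2) [x])"
    using assms(3,4) unfolding amalgam_in1_def amalgam_in2_def by (elim PlusE) simp_all
qed


section \<open>FC type\<close>

text \<open>
  All members of the family live on one type, so the amalgam, which lives on another type, enters
  up to isomorphism. Nothing is lost: the factors embed in the amalgam over a common standard
  parabolic submonoid, so they have copies on the type of \<open>M\<close>.
\<close>

inductive fc_type :: "'a monoid \<Rightarrow> bool" where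
  garside: "garside M \<Longrightarrow> fc_type M"
| amalgam: "\<lbrakk>fc_type M1; fc_type M2; monoid (N :: 'a monoid);
    i1 \<in> mon_hom N M1; inj_on i1 (carrier N); std_parabolic (i1 ` carrier N) M1;
    i2 \<in> mon_hom N M2; inj_on i2 (carrier N); std_parabolic (i2 ` carrier N) M2;
    monoid M; M \<cong> amalgam N i1 i2 M1 M2\<rbrakk> \<Longrightarrow> fc_type M"


section \<open>The enveloping group\<close>

text \<open>The generator \<open>Inr a\<close> is the formal inverse of \<open>Inl a\<close>.\<close>

definition env_rels :: "('a, 'm) monoid_scheme \<Rightarrow> (('a + 'a) list \<times> ('a + 'a) list) set" where
  "env_rels M =
    {([], [Inl \<one>\<^bsub>M\<^esub>])} \<union>
    {([Inl a, Inl b], [Inl (a \<otimes>\<^bsub>M\<^esub> b)]) | a b. a \<in> carrier M \<and> b \<in> carrier M} \<union>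
    {([Inl a, Inr a], []) | a. a \<in> carrier M} \<union>
    {([Inr a, Inl a], []) | a. a \<in> carrier M}"

definition env_group :: "('a, 'm) monoid_scheme \<Rightarrow> ('a + 'a) list set monoid" where
  "env_group M = presented_monoid (carrier M <+> carrier M) (env_rels M)"

definition env_map :: "('a, 'm) monoid_scheme \<Rightarrow> 'a \<Rightarrow> ('a + 'a) list set" where
  "env_map M a = pres_class (carrier M <+> carrier M) (env_rels M) [Inl a]"

lemma env_group_is_group: "group (env_group M)"
proof -
  let ?X = "carrier M <+> carrier M" and ?R = "env_rels M"
  interpret G: monoid "env_group M"
    unfolding env_group_def by (rule presented_monoid_is_monoid)
  have gen: "\<exists>B\<in>carrier (env_group M). B \<otimes>\<^bsub>env_group M\<^esub> pres_class ?X ?R [x] = \<one>\<^bsub>env_group M\<^esub>"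
    if x: "x \<in> ?X" for x
  proof -
    let ?y = "case x of Inl a \<Rightarrow> Inr a | Inr a \<Rightarrow> Inl a"
    have y: "?y \<in> ?X" using x by (auto split: sum.split)
    have "([?y, x], []) \<in> ?R" using x by (auto simp: env_rels_def)
    then have "pres_class ?X ?R [?y, x] = pres_class ?X ?R []"
      using x y by (subst pres_class_eq_iff) (auto intro: pres_cong.base)
    then have "pres_class ?X ?R [?y] \<otimes>\<^bsub>env_group M\<^esub> pres_class ?X ?R [x] = \<one>\<^bsub>env_group M\<^esub>"
      using x y unfolding env_group_def by (simp add: presented_mult presented_one)
    moreover have "pres_class ?X ?R [?y] \<in> carrier (env_group M)"
      unfolding env_group_def by (rule pres_class_carrier) (use y in auto)
    ultimately show ?thesis by blast
  qed
  have "\<exists>B\<in>carrier (env_group M). B \<otimes>\<^bsub>env_group M\<^esub> pres_class ?X ?R u = \<one>\<^bsub>env_group M\<^esub>"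
    if "u \<in> lists ?X" for u
    using that
  proof (induction u)
    case Nil
    then show ?case
      by (metis G.l_one G.one_closed env_group_def presented_one)
  next
    case (Cons x u)
    then obtain B where B: "B \<in> carrier (env_group M)"
      "B \<otimes>\<^bsub>env_group M\<^esub> pres_class ?X ?R u = \<one>\<^bsub>env_group M\<^esub>" by auto
    obtain C where C: "C \<in> carrier (env_group M)"
      "C \<otimes>\<^bsub>env_group M\<^esub> pres_class ?X ?R [x] = \<one>\<^bsub>env_group M\<^esub>" using gen[of x] Cons.hyps(1) by blast
    have split: "pres_class ?X ?R (x # u) =
        pres_class ?X ?R [x] \<otimes>\<^bsub>env_group M\<^esub> pres_class ?X ?R u"
      using Cons by (simp add: env_group_def presented_mult)
    have mem: "pres_class ?X ?R [x] \<in> carrier (env_group M)"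
      "pres_class ?X ?R u \<in> carrier (env_group M)"
      unfolding env_group_def using Cons by (auto intro!: pres_class_carrier)
    have "(B \<otimes>\<^bsub>env_group M\<^esub> C) \<otimes>\<^bsub>env_group M\<^esub> pres_class ?X ?R (x # u) =
        B \<otimes>\<^bsub>env_group M\<^esub> (C \<otimes>\<^bsub>env_group M\<^esub> pres_class ?X ?R [x]) \<otimes>\<^bsub>env_group M\<^esub> pres_class ?X ?R u"
      unfolding split using B(1) C(1) mem by (simp add: G.m_assoc)
    also have "\<dots> = \<one>\<^bsub>env_group M\<^esub>"
      using B C by simp
    finally show ?case
      using B(1) C(1) by blast
  qed
  then have "\<exists>B\<in>carrier (env_group M). B \<otimes>\<^bsub>env_group M\<^esub> A = \<one>\<^bsub>env_group M\<^esub>"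
    if "A \<in> carrier (env_group M)" for A
    using that unfolding env_group_def by (metis presented_carrierE)
  then show ?thesis
    by (intro groupI G.m_closed G.one_closed G.m_assoc G.l_one)
qed

lemma env_map_mon_hom:
  assumes "monoid M"
  shows "env_map M \<in> mon_hom M (env_group M)"
proof -
  interpret M: monoid M by fact
  let ?X = "carrier M <+> carrier M" and ?R = "env_rels M"
  show ?thesis
    unfolding mon_hom_def
  proof (intro CollectI conjI homI)
    fix x assume "x \<in> carrier M"
    then show "env_map M x \<in> carrier (env_group M)"
      by (auto simp: env_map_def env_group_def intro!: pres_class_carrier)
  next
    fix x y assume xy: "x \<in> carrier M" "y \<in> carrier M"
    then have "pres_class ?X ?R [Inl x, Inl y] = pres_class ?X ?R [Inl (x \<otimes>\<^bsub>M\<^esub> y)]"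
      by (intro pres_class_eqI) (auto simp: env_rels_def)
    then show "env_map M (x \<otimes>\<^bsub>M\<^esub> y) =
        env_map M x \<otimes>\<^bsub>env_group M\<^esub> env_map M y"
      using xy by (simp add: env_map_def env_group_def presented_mult InlI InrI)
  next
    have "pres_class ?X ?R [] = pres_class ?X ?R [Inl \<one>\<^bsub>M\<^esub>]"
      by (intro pres_class_eqI) (auto simp: env_rels_def)
    then show "env_map M \<one>\<^bsub>M\<^esub> = \<one>\<^bsub>env_group M\<^esub>"
      by (simp add: env_map_def env_group_def presented_one)
  qed
qed

lemma env_group_universal:
  assumes "monoid M" "group H" "f \<in> mon_hom M H"
  shows "\<exists>h \<in> hom (env_group M) H. \<forall>a\<in>carrier M. h (env_map M a) = f a"
proof -
  interpret H: group H by fact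
  let ?X = "carrier M <+> carrier M" and ?R = "env_rels M"
  let ?f = "case_sum f (\<lambda>a. inv\<^bsub>H\<^esub> (f a))"
  have cl: "f a \<in> carrier H" if "a \<in> carrier M" for a
    using that assms(3) by (auto simp: mon_hom_def hom_def)
  have "\<exists>h \<in> mon_hom (presented_monoid ?X ?R) H. \<forall>x\<in>?X. h (pres_class ?X ?R [x]) = ?f x"
  proof (rule presented_monoid_universal[OF H.monoid_axioms])
    show "?f \<in> ?X \<rightarrow> carrier H"
      using cl by (auto split: sum.split)
  next
    fix u v assume "(u, v) \<in> ?R" "u \<in> lists ?X" "v \<in> lists ?X"
    then show "word_eval H ?f u = word_eval H ?f v"
      using assms(3) cl by (auto simp: env_rels_def mon_hom_def hom_mult)
  qed
  then obtain h where h: "h \<in> mon_hom (env_group M) H" "\<forall>x\<in>?X. h (pres_class ?X ?R [x]) = ?f x"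
    unfolding env_group_def by blast
  then show ?thesis
    unfolding env_map_def
    using h(1) h(2)[THEN bspec, OF InlI] by (intro bexI[of _ h]) (auto simp: mon_hom_def)
qed

lemma env_group_unique:
  assumes "monoid M" "group H" "h \<in> hom (env_group M) H" "k \<in> hom (env_group M) H"
    and "\<And>a. a \<in> carrier M \<Longrightarrow> h (env_map M a) = k (env_map M a)"
    and "A \<in> carrier (env_group M)"
  shows "h A = k A"
proof -
  let ?X = "carrier M <+> carrier M" and ?R = "env_rels M"
  interpret G: group "env_group M" by (rule env_group_is_group)
  interpret H: group H by fact
  interpret h: group_hom "env_group M" H h by unfold_locales fact
  interpret k: group_hom "env_group M" H k by unfold_locales fact
  have "h (pres_class ?X ?R [x]) = k (pres_class ?X ?R [x])" if x: "x \<in> ?X" for x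
  proof (cases x)
    case (Inl a)
    then show ?thesis using assms(5) x by (auto simp: env_map_def)
  next
    case (Inr a)
    then have a: "a \<in> carrier M" using x by auto
    have mem: "pres_class ?X ?R [Inr a] \<in> carrier (env_group M)" "env_map M a \<in> carrier (env_group M)"
      unfolding env_group_def env_map_def using a by (auto intro!: pres_class_carrier)
    have "pres_class ?X ?R [Inr a, Inl a] = pres_class ?X ?R []"
      using a by (subst pres_class_eq_iff) (auto simp: env_rels_def intro!: pres_cong.base)
    then have "pres_class ?X ?R [Inr a] \<otimes>\<^bsub>env_group M\<^esub> env_map M a = \<one>\<^bsub>env_group M\<^esub>"
      using a by (simp add: env_map_def env_group_def presented_mult presented_one InlI InrI)
    then have "pres_class ?X ?R [Inr a] = inv\<^bsub>env_group M\<^esub> (env_map M a)"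
      using mem by (metis G.inv_equality)
    then show ?thesis using Inr mem assms(5)[OF a] by simp
  qed
  moreover have "h \<in> mon_hom (presented_monoid ?X ?R) H" "k \<in> mon_hom (presented_monoid ?X ?R) H"
    using assms(3,4) h.hom_one k.hom_one unfolding mon_hom_def env_group_def by auto
  moreover have "A \<in> carrier (presented_monoid ?X ?R)"
    using assms(6) unfolding env_group_def .
  ultimately show ?thesis
    by (intro presented_monoid_unique[where X = ?X and R = ?R and H = H and h = h and k = k and A = A])
qed

abbreviation std_parabolic_subgroup :: "('a, 'm) monoid_scheme \<Rightarrow> 'a set \<Rightarrow> ('a + 'a) list set set" where
  "std_parabolic_subgroup M N \<equiv> generate (env_group M) (env_map M ` N)"

definition torsion_free :: "('a, 'm) monoid_scheme \<Rightarrow> bool" where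
  "torsion_free G \<longleftrightarrow> (\<forall>g\<in>carrier G. \<forall>n::nat. n > 0 \<and> g [^]\<^bsub>G\<^esub> n = \<one>\<^bsub>G\<^esub> \<longrightarrow> g = \<one>\<^bsub>G\<^esub>)"

end

theory Submission
  imports Defs "HOL-Algebra.Bij"
begin

text \<open>
  Everything takes place inside groups: a monoid is replaced by its image in the enveloping group,
  and \<open>a\<close> divides \<open>b\<close> when \<open>a\<^sup>-\<^sup>1 b\<close> lies in that image. In a Garside monoid all joins exist, so every
  element of the group is a left fraction, and the left fraction with coprime numerator and
  denominator is unique; since parabolic submonoids are closed under factors, this fraction stays
  inside every parabolic submonoid, which gives (P2) and (P3). The finite set of powers of a torsion
  element has a least upper bound, which translation by that element fixes, hence (P4).

  The induction over amalgams needs a stronger statement: for each standard parabolic \<open>P\<close>, every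
  coset of \<open>G(P)\<close> has a distinguished representative that lies in all standard parabolic subgroups
  meeting the coset, and in the monoid if the coset meets it. With such representatives, normal forms
  in the amalgamated product of the groups can be compared letter by letter without leaving a
  parabolic subgroup or the monoid. This yields (P1)-(P3), the existence of joins in the amalgam, and
  representatives of the same kind for the amalgam; torsion elements are conjugate into a factor by
  cyclic reduction.
\<close>

section \<open>Submonoids of groups\<close>

text \<open>Compatibility with all parabolic submonoids at once is the obstacle. For
  \<open>g\<close> in \<open>generate G Q\<close>, an arbitrary representative of its coset may lie
  outside \<open>generate G Q\<close>, so normal forms made for one parabolic submonoid say nothing
  about a second one; hence \<open>coset_reps\<close> asks a single set to serve every
  \<open>Q\<close>. A second obstacle is that the copies of \<open>N\<close> in the two factors
  generate a priori different groups. The clause \<open>extends_homs\<close> gives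
  \<open>generate G P\<close> the universal property of the enveloping group of \<open>P\<close>;
  this identifies the two groups and later yields the isomorphism in (P2). Its targets are groups on
  the type of \<open>G\<close>, which suffices because the enveloping groups of monoids on one type
  share a type. Statements about right divisibility come from \<open>opp\<close>, the reversed
  multiplication. The enveloping group of an amalgam is never built as an amalgamated product: the
  factors act on normal forms, and the universal properties of the monoid amalgam and of the
  enveloping group extend this action, which is enough for the normal form theorem.\<close>

definition opp :: "'g monoid \<Rightarrow> 'g monoid" where
  "opp G = \<lparr>carrier = carrier G, mult = (\<lambda>x y. y \<otimes>\<^bsub>G\<^esub> x), one = \<one>\<^bsub>G\<^esub>\<rparr>"

lemma opp_simps [simp]:
  "carrier (opp G) = carrier G" "x \<otimes>\<^bsub>opp G\<^esub> y = y \<otimes>\<^bsub>G\<^esub> x" "\<one>\<^bsub>opp G\<^esub> = \<one>\<^bsub>G\<^esub>"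
  by (simp_all add: opp_def)

lemma opp_opp [simp]: "opp (opp G) = G"
  by (simp add: opp_def)

context group
begin

lemma inv_cancel_left:
  "x \<in> carrier G \<Longrightarrow> y \<in> carrier G \<Longrightarrow> inv x \<otimes> (x \<otimes> y) = y"
  "x \<in> carrier G \<Longrightarrow> y \<in> carrier G \<Longrightarrow> x \<otimes> (inv x \<otimes> y) = y"
  by (simp_all flip: m_assoc)

lemmas group_nf = m_assoc inv_mult_group inv_cancel_left

lemma inv_mult_eq_iff:
  "x \<in> carrier G \<Longrightarrow> y \<in> carrier G \<Longrightarrow> inv x \<otimes> y = z \<longleftrightarrow> z \<in> carrier G \<and> y = x \<otimes> z"
  by (auto simp: inv_cancel_left)

lemma inv_mult_eq_one_iff:
  "x \<in> carrier G \<Longrightarrow> y \<in> carrier G \<Longrightarrow> inv x \<otimes> y = \<one> \<longleftrightarrow> x = y"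
  by (metis inv_mult_eq_iff one_closed r_one)

end

lemma group_opp:
  fixes G :: "'g monoid"
  assumes "group G"
  shows "group (opp G)"
proof -
  interpret group G by fact
  show ?thesis
  proof (rule groupI)
    fix x assume "x \<in> carrier (opp G)"
    then show "\<exists>y\<in>carrier (opp G). y \<otimes>\<^bsub>opp G\<^esub> x = \<one>\<^bsub>opp G\<^esub>"
      by (intro bexI[of _ "inv\<^bsub>G\<^esub> x"]) simp_all
  qed (simp_all add: m_assoc)
qed

lemma inv_opp [simp]:
  fixes G :: "'g monoid"
  assumes "group G" "x \<in> carrier G"
  shows "inv\<^bsub>opp G\<^esub> x = inv\<^bsub>G\<^esub> x"
proof -
  interpret group G by fact
  interpret o: group "opp G" by (rule group_opp[OF assms(1)])
  show ?thesis
    using assms(2) by (intro o.inv_equality) simp_all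
qed

lemma submonoid_opp [simp]: "submonoid M (opp G) \<longleftrightarrow> submonoid M G"
  by (auto simp: submonoid_def)

lemma generate_opp [simp]:
  fixes G :: "'g monoid"
  assumes "group G" "P \<subseteq> carrier G"
  shows "generate (opp G) P = generate G P"
proof -
  have *: "generate (opp G) P \<subseteq> generate G P" if "group G" "P \<subseteq> carrier G" for G :: "'g monoid"
  proof
    fix x assume "x \<in> generate (opp G) P"
    then show "x \<in> generate G P"
    proof induction
      case (inv h)
      then have "inv\<^bsub>opp G\<^esub> h = inv\<^bsub>G\<^esub> h" using that by (intro inv_opp) auto
      then show ?case using inv by (simp add: generate.inv)
    qed (auto intro: generate.intros)
  qed
  show ?thesis
    using *[OF assms] *[of "opp G"] assms group_opp[OF assms(1)] by (simp add: subset_antisym)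
qed

section \<open>Divisibility, parabolic submonoids and representatives inside a group\<close>

text \<open>Left divisibility as membership of a quotient in \<open>M\<close>: it applies to
  arbitrary elements of the group and is invariant under left translation. Over \<open>opp G\<close>
  it becomes right divisibility.\<close>

definition pos_le :: "'g monoid \<Rightarrow> 'g set \<Rightarrow> 'g \<Rightarrow> 'g \<Rightarrow> bool" where
  "pos_le G M a b \<longleftrightarrow> inv\<^bsub>G\<^esub> a \<otimes>\<^bsub>G\<^esub> b \<in> M"

definition pos_join :: "'g monoid \<Rightarrow> 'g set \<Rightarrow> 'g \<Rightarrow> 'g \<Rightarrow> 'g \<Rightarrow> bool" where
  "pos_join G M a b c \<longleftrightarrow> c \<in> M \<and> pos_le G M a c \<and> pos_le G M b c \<and>
    (\<forall>d\<in>M. pos_le G M a d \<longrightarrow> pos_le G M b d \<longrightarrow> pos_le G M c d)"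

definition parabolic :: "'g monoid \<Rightarrow> 'g set \<Rightarrow> 'g set \<Rightarrow> bool" where
  "parabolic G M P \<longleftrightarrow> submonoid P G \<and> P \<subseteq> M \<and>
    (\<forall>a\<in>M. \<forall>b\<in>M. a \<otimes>\<^bsub>G\<^esub> b \<in> P \<longrightarrow> a \<in> P \<and> b \<in> P) \<and>
    (\<forall>a\<in>P. \<forall>b\<in>P. \<forall>c. pos_join G M a b c \<longrightarrow> c \<in> P) \<and>
    (\<forall>a\<in>P. \<forall>b\<in>P. \<forall>c. pos_join (opp G) M a b c \<longrightarrow> c \<in> P)"

text \<open>
  A set of representatives of the cosets of the subgroup of \<open>P\<close> that is adapted to all standard
  parabolic subgroups and to the monoid at once.
\<close>

definition coset_reps :: "'g monoid \<Rightarrow> 'g set \<Rightarrow> 'g set \<Rightarrow> 'g set \<Rightarrow> bool" where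
  "coset_reps G M P R \<longleftrightarrow> R \<subseteq> generate G M \<and>
    (\<forall>r\<in>R. \<forall>s\<in>R. inv\<^bsub>G\<^esub> r \<otimes>\<^bsub>G\<^esub> s \<in> generate G P \<longrightarrow> r = s) \<and>
    (\<forall>Q. parabolic G M Q \<longrightarrow>
      (\<forall>g\<in>generate G Q. \<exists>r\<in>R \<inter> generate G Q. inv\<^bsub>G\<^esub> r \<otimes>\<^bsub>G\<^esub> g \<in> generate G P)) \<and>
    (\<forall>g\<in>M. \<exists>r\<in>R \<inter> M. inv\<^bsub>G\<^esub> r \<otimes>\<^bsub>G\<^esub> g \<in> P)"

definition bounded_joins :: "'g monoid \<Rightarrow> 'g set \<Rightarrow> bool" where
  "bounded_joins G M \<longleftrightarrow> (\<forall>a\<in>M. \<forall>b\<in>M. \<forall>d\<in>M. pos_le G M a d \<longrightarrow> pos_le G M b d \<longrightarrow>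
    (\<exists>c. pos_join G M a b c))"

definition has_reps :: "'g monoid \<Rightarrow> 'g set \<Rightarrow> bool" where
  "has_reps G M \<longleftrightarrow> (\<forall>P. parabolic G M P \<longrightarrow> (\<exists>R. coset_reps G M P R))"

text \<open>The universal property of the enveloping group of \<open>P\<close>, claimed for
  \<open>generate G P\<close>. For a submonoid \<open>P\<close> such an \<open>f\<close> preserves
  the unit, since \<open>f \<one>\<close> is idempotent in the group \<open>L\<close>.\<close>

definition extends_homs :: "'g monoid \<Rightarrow> 'g set \<Rightarrow> bool" where
  "extends_homs G P \<longleftrightarrow> (\<forall>L :: 'g monoid. \<forall>f. group L \<longrightarrow> f \<in> P \<rightarrow> carrier L \<longrightarrow>
    (\<forall>a\<in>P. \<forall>b\<in>P. f (a \<otimes>\<^bsub>G\<^esub> b) = f a \<otimes>\<^bsub>L\<^esub> f b) \<longrightarrow>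
    (\<exists>\<psi>\<in>generate G P \<rightarrow> carrier L.
      (\<forall>x\<in>generate G P. \<forall>y\<in>generate G P. \<psi> (x \<otimes>\<^bsub>G\<^esub> y) = \<psi> x \<otimes>\<^bsub>L\<^esub> \<psi> y) \<and>
      (\<forall>a\<in>P. \<psi> a = f a)))"

text \<open>The part of the induction hypothesis that is symmetric under \<open>opp\<close>: joins
  and representatives are asked for on both sides, so a one-sided argument about amalgams can be
  repeated in the opposite group.\<close>

locale pos_pair = group G + submonoid M G for G :: "'g monoid" (structure) and M :: "'g set" +
  assumes joins: "bounded_joins G M" and joins_opp: "bounded_joins (opp G) M"
    and reps: "has_reps G M" and reps_opp: "has_reps (opp G) M"
    and inter: "parabolic G M P \<Longrightarrow> parabolic G M Q \<Longrightarrow>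
      generate G P \<inter> generate G Q \<subseteq> generate G (P \<inter> Q)"

definition good :: "'g monoid \<Rightarrow> 'g set \<Rightarrow> bool" where
  "good G M \<longleftrightarrow> pos_pair G M \<and> (\<forall>P. parabolic G M P \<longrightarrow> extends_homs G P) \<and>
    (\<forall>g\<in>generate G M. \<forall>n::nat. n > 0 \<longrightarrow> g [^]\<^bsub>G\<^esub> n = \<one>\<^bsub>G\<^esub> \<longrightarrow> g = \<one>\<^bsub>G\<^esub>)"

lemma parabolic_opp [simp]: "parabolic (opp G) M P \<longleftrightarrow> parabolic G M P"
  by (auto simp: parabolic_def)

lemma parabolicD:
  assumes "parabolic G M P"
  shows "submonoid P G" "P \<subseteq> M" "P \<subseteq> carrier G"
    "\<And>a b. a \<in> M \<Longrightarrow> b \<in> M \<Longrightarrow> a \<otimes>\<^bsub>G\<^esub> b \<in> P \<Longrightarrow> a \<in> P"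
    "\<And>a b. a \<in> M \<Longrightarrow> b \<in> M \<Longrightarrow> a \<otimes>\<^bsub>G\<^esub> b \<in> P \<Longrightarrow> b \<in> P"
    "\<And>a b c. a \<in> P \<Longrightarrow> b \<in> P \<Longrightarrow> pos_join G M a b c \<Longrightarrow> c \<in> P"
    "\<And>a b c. a \<in> P \<Longrightarrow> b \<in> P \<Longrightarrow> pos_join (opp G) M a b c \<Longrightarrow> c \<in> P"
    "\<one>\<^bsub>G\<^esub> \<in> P" "\<And>a b. a \<in> P \<Longrightarrow> b \<in> P \<Longrightarrow> a \<otimes>\<^bsub>G\<^esub> b \<in> P"
  using assms unfolding parabolic_def submonoid_def by blast+

lemma parabolic_Int:
  assumes P: "parabolic G M P" and Q: "parabolic G M Q"
  shows "parabolic G M (P \<inter> Q)"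
  unfolding parabolic_def
proof (intro conjI ballI impI allI)
  note P' = parabolicD[OF P] and Q' = parabolicD[OF Q]
  show "submonoid (P \<inter> Q) G"
    by (rule submonoid.intro) (use P'(3,8,9) Q'(8,9) in blast)+
  show "P \<inter> Q \<subseteq> M" using P'(2) by blast
  show "a \<in> P \<inter> Q" "b \<in> P \<inter> Q" if "a \<in> M" "b \<in> M" "a \<otimes>\<^bsub>G\<^esub> b \<in> P \<inter> Q" for a b
    using P'(4,5)[OF that(1,2)] Q'(4,5)[OF that(1,2)] that(3) by blast+
  show "c \<in> P \<inter> Q" if "a \<in> P \<inter> Q" "b \<in> P \<inter> Q" "pos_join G M a b c" for a b c
    using P'(6)[OF _ _ that(3)] Q'(6)[OF _ _ that(3)] that(1,2) by blast
  show "c \<in> P \<inter> Q" if "a \<in> P \<inter> Q" "b \<in> P \<inter> Q" "pos_join (opp G) M a b c" for a b c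
    using P'(7)[OF _ _ that(3)] Q'(7)[OF _ _ that(3)] that(1,2) by blast
qed

lemma parabolic_self: "submonoid M G \<Longrightarrow> parabolic G M M"
  by (simp add: parabolic_def pos_join_def)

lemma pos_le_opp:
  "group G \<Longrightarrow> a \<in> carrier G \<Longrightarrow> pos_le (opp G) M a b \<longleftrightarrow> b \<otimes>\<^bsub>G\<^esub> inv\<^bsub>G\<^esub> a \<in> M"
  by (simp add: pos_le_def)

context group
begin

lemma gen_subset: "P \<subseteq> generate G P"
  by (auto intro: generate.incl)

lemma gen_closed:
  assumes "P \<subseteq> carrier G"
  shows "generate G P \<subseteq> carrier G" "\<one> \<in> generate G P"
    "\<And>x y. x \<in> generate G P \<Longrightarrow> y \<in> generate G P \<Longrightarrow> x \<otimes> y \<in> generate G P"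
    "\<And>x. x \<in> generate G P \<Longrightarrow> inv x \<in> generate G P"
  using generate_is_subgroup[OF assms] by (auto simp: subgroup_def)

lemma gen_least: "P \<subseteq> K \<Longrightarrow> subgroup K G \<Longrightarrow> generate G P \<subseteq> K"
  by (rule generate_subgroup_incl)

lemma hom_on_generate_eq:
  assumes "group L" "Q \<subseteq> carrier G" 
    and f: "\<And>x. x \<in> generate G Q \<Longrightarrow> f x \<in> carrier L"
      "\<And>x y. x \<in> generate G Q \<Longrightarrow> y \<in> generate G Q \<Longrightarrow> f (x \<otimes> y) = f x \<otimes>\<^bsub>L\<^esub> f y"
    and g: "\<And>x. x \<in> generate G Q \<Longrightarrow> g x \<in> carrier L"
      "\<And>x y. x \<in> generate G Q \<Longrightarrow> y \<in> generate G Q \<Longrightarrow> g (x \<otimes> y) = g x \<otimes>\<^bsub>L\<^esub> g y"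
    and eq: "\<And>x. x \<in> Q \<Longrightarrow> f x = g x" and "x \<in> generate G Q"
  shows "f x = g x"
proof -
  interpret f: group_hom "G\<lparr>carrier := generate G Q\<rparr>" L f
    using subgroup.subgroup_is_group[OF generate_is_subgroup[OF assms(2)] group_axioms] assms(1) f
    by (intro group_hom.intro) (auto simp: group_hom_axioms_def hom_def)
  interpret g: group_hom "G\<lparr>carrier := generate G Q\<rparr>" L g
    using subgroup.subgroup_is_group[OF generate_is_subgroup[OF assms(2)] group_axioms] assms(1) g
    by (intro group_hom.intro) (auto simp: group_hom_axioms_def hom_def)
  show ?thesis
    using assms(8)
  proof induction
    case one
    then show ?case using f.hom_one g.hom_one by simp
  next
    case (inv h)
    then have h: "h \<in> generate G Q" by (rule generate.incl)
    have "inv\<^bsub>G\<lparr>carrier := generate G Q\<rparr>\<^esub> h = inv h"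
      using m_inv_consistent[OF generate_is_subgroup[OF assms(2)] h] .
    moreover have "f (inv\<^bsub>G\<lparr>carrier := generate G Q\<rparr>\<^esub> h) = inv\<^bsub>L\<^esub> f h"
      "g (inv\<^bsub>G\<lparr>carrier := generate G Q\<rparr>\<^esub> h) = inv\<^bsub>L\<^esub> g h"
      using f.hom_inv g.hom_inv h by simp_all
    ultimately show ?case using eq[OF inv] by simp
  next
    case (eng x y)
    then show ?case using f(2) g(2) by simp
  qed (rule eq)
qed

end

lemma (in pos_pair) pos_pair_opp: "pos_pair (opp G) M"
proof (intro pos_pair.intro pos_pair_axioms.intro)
  show "group (opp G)" by (rule group_opp) (rule group_axioms)
  show "submonoid M (opp G)" using is_submonoid by simp
  show "bounded_joins (opp G) M" by (rule joins_opp)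
  show "bounded_joins (opp (opp G)) M" unfolding opp_opp by (rule joins)
  show "has_reps (opp G) M" by (rule reps_opp)
  show "has_reps (opp (opp G)) M" unfolding opp_opp by (rule reps)
  fix P Q assume "parabolic (opp G) M P" "parabolic (opp G) M Q"
  then have "parabolic G M P" "parabolic G M Q" unfolding parabolic_opp by this+
  then show "generate (opp G) P \<inter> generate (opp G) Q \<subseteq> generate (opp G) (P \<inter> Q)"
    using inter[of P Q] parabolicD(3)[of G M P] parabolicD(3)[of G M Q] group_axioms
    by (simp add: le_infI1)
qed

context pos_pair
begin

lemma ex_join:
  "a \<in> M \<Longrightarrow> b \<in> M \<Longrightarrow> d \<in> M \<Longrightarrow> pos_le G M a d \<Longrightarrow> pos_le G M b d \<Longrightarrow> \<exists>c. pos_join G M a b c"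
  using joins by (auto simp: bounded_joins_def)

text \<open>\<open>g\<close> and \<open>\<one>\<close> lie in the same coset, so the monoid clause
  of \<open>coset_reps\<close> gives them one common representative in \<open>M\<close>, and it
  differs from each of them by an element of \<open>P\<close>.\<close>

lemma generate_Int_monoid:
  assumes P: "parabolic G M P"
  shows "generate G P \<inter> M = P"
proof
  note P' = parabolicD[OF P]
  show "P \<subseteq> generate G P \<inter> M" using P'(2) gen_subset by blast
  show "generate G P \<inter> M \<subseteq> P"
  proof
    fix g assume g: "g \<in> generate G P \<inter> M"
    then have gc: "g \<in> carrier G" using subset by auto
    obtain R where R: "coset_reps G M P R" using reps P by (auto simp: has_reps_def)
    obtain r where r: "r \<in> R" "r \<in> M" "inv r \<otimes> g \<in> P"
      using R g unfolding coset_reps_def by blast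
    obtain s where s: "s \<in> R" "s \<in> M" "inv s \<otimes> \<one> \<in> P"
      using R one_closed unfolding coset_reps_def by blast
    have c: "r \<in> carrier G" "s \<in> carrier G" using r s subset by blast+
    have "inv r \<otimes> s = (inv r \<otimes> g) \<otimes> (inv g \<otimes> inv (inv s))"
      using c gc by (simp add: group_nf)
    moreover have "inv s \<in> P" using s c by simp
    then have "inv g \<otimes> inv (inv s) \<in> generate G P"
      using g gen_closed(3,4)[OF P'(3)] generate.incl by (metis IntD1)
    ultimately have "inv r \<otimes> s \<in> generate G P"
      using gen_closed(3)[OF P'(3)] generate.incl[OF r(3)] by metis
    then have "r = s" using R r s unfolding coset_reps_def by blast
    \<comment> \<open>The product is trivial, hence in \<open>P\<close>; both factors lie in
      \<open>M\<close>, so speciality puts \<open>s\<close> itself into \<open>P\<close>.\<close>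
    have "s \<otimes> inv s \<in> P" using c P'(8) by simp
    then have "s \<in> P" using P'(4)[of s "inv s"] s(2) \<open>inv s \<in> P\<close> P'(2) by blast
    then have "r \<otimes> (inv r \<otimes> g) \<in> P" using r(3) \<open>r = s\<close> P'(9) by blast
    then show "g \<in> P" using c gc by (simp add: group_nf)
  qed
qed

end

section \<open>Groups of fractions of monoids with all joins\<close>

text \<open>The situation of a Garside monoid, where all pairs have joins and not only the bounded
  ones. The norm \<open>\<nu>\<close> is controlled on \<open>M\<close> only.\<close>

locale lattice_pair = group G + submonoid M G for G :: "'g monoid" (structure) and M :: "'g set" +
  fixes \<nu> :: "'g \<Rightarrow> nat"
  assumes norm_pos: "a \<in> M \<Longrightarrow> a \<noteq> \<one> \<Longrightarrow> \<nu> a > 0"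
    and norm_mult: "a \<in> M \<Longrightarrow> b \<in> M \<Longrightarrow> \<nu> (a \<otimes> b) \<ge> \<nu> a + \<nu> b"
    and ex_lub: "a \<in> M \<Longrightarrow> b \<in> M \<Longrightarrow> \<exists>c. pos_join G M a b c"
    and ex_lub_opp: "a \<in> M \<Longrightarrow> b \<in> M \<Longrightarrow> \<exists>c. pos_join (opp G) M a b c"
begin

lemma lattice_opp: "lattice_pair (opp G) M \<nu>"
proof (intro lattice_pair.intro lattice_pair_axioms.intro)
  show "group (opp G)" by (rule group_opp) (rule group_axioms)
  show "submonoid M (opp G)" using is_submonoid by simp
  show "\<exists>c. pos_join (opp (opp G)) M a b c" if "a \<in> M" "b \<in> M" for a b
    unfolding opp_opp by (rule ex_lub[OF that])
  show "\<nu> (a \<otimes>\<^bsub>opp G\<^esub> b) \<ge> \<nu> a + \<nu> b" if "a \<in> M" "b \<in> M" for a b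
    using norm_mult[OF that(2,1)] by simp
qed (simp_all add: norm_pos ex_lub_opp)

text \<open>The inequality \<open>\<nu> \<one> \<ge> \<nu> \<one> + \<nu> \<one>\<close> forces
  \<open>\<nu> \<one> = 0\<close>, which leaves no room for a nontrivial element with its inverse in
  \<open>M\<close>.\<close>

lemma conical: 
  assumes "a \<in> M" "inv a \<in> M"
  shows "a = \<one>"
proof (rule ccontr)
  assume "a \<noteq> \<one>"
  then have "\<nu> a > 0" using assms norm_pos by blast
  moreover have "\<nu> \<one> \<ge> \<nu> a + \<nu> (inv a)" using norm_mult[OF assms] assms by simp
  moreover have "\<nu> \<one> \<ge> \<nu> \<one> + \<nu> \<one>" using norm_mult[of \<one> \<one>] by simp
  ultimately show False by simp
qed

text \<open>The join lies in \<open>P\<close> by closure, and the cofactors \<open>u\<close> and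
  \<open>v\<close> are factors of it, so speciality keeps them in \<open>P\<close> as well. All
  later computations with fractions therefore stay inside a given parabolic submonoid.\<close>

lemma lub_in_parabolic:
  assumes P: "parabolic G M P" and "a \<in> P" "b \<in> P"
  obtains u v where "u \<in> P" "v \<in> P" "a \<otimes> u = b \<otimes> v"
    "\<And>d. d \<in> M \<Longrightarrow> inv a \<otimes> d \<in> M \<Longrightarrow> inv b \<otimes> d \<in> M \<Longrightarrow> inv (a \<otimes> u) \<otimes> d \<in> M"
proof -
  note P' = parabolicD[OF P]
  have ab: "a \<in> M" "b \<in> M" using assms P'(2) by blast+
  then obtain c where c: "pos_join G M a b c" using ex_lub by blast
  then have cP: "c \<in> P" using P'(6) assms by blast
  have cM: "c \<in> M" "inv a \<otimes> c \<in> M" "inv b \<otimes> c \<in> M"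
    using c by (auto simp: pos_join_def pos_le_def)
  have eq: "a \<otimes> (inv a \<otimes> c) = c" "b \<otimes> (inv b \<otimes> c) = c"
    using ab cM by (simp_all add: group_nf)
  have "inv a \<otimes> c \<in> P" "inv b \<otimes> c \<in> P"
    using P'(5)[OF ab(1) cM(2)] P'(5)[OF ab(2) cM(3)] cP eq by simp_all
  then show ?thesis
    using c by (intro that[of "inv a \<otimes> c" "inv b \<otimes> c"]) (simp_all add: eq pos_join_def pos_le_def)
qed

lemma right_lub_in_parabolic:
  assumes P: "parabolic G M P" and "a \<in> P" "b \<in> P"
  obtains u v where "u \<in> P" "v \<in> P" "u \<otimes> a = v \<otimes> b"
    "\<And>d. d \<in> M \<Longrightarrow> d \<otimes> inv a \<in> M \<Longrightarrow> d \<otimes> inv b \<in> M \<Longrightarrow> d \<otimes> inv (u \<otimes> a) \<in> M"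
proof -
  interpret o: lattice_pair "opp G" M \<nu> by (rule lattice_opp)
  note P' = parabolicD[OF P]
  obtain u v where uv: "u \<in> P" "v \<in> P" "a \<otimes>\<^bsub>opp G\<^esub> u = b \<otimes>\<^bsub>opp G\<^esub> v"
    "\<And>d. d \<in> M \<Longrightarrow> inv\<^bsub>opp G\<^esub> a \<otimes>\<^bsub>opp G\<^esub> d \<in> M \<Longrightarrow> inv\<^bsub>opp G\<^esub> b \<otimes>\<^bsub>opp G\<^esub> d \<in> M \<Longrightarrow>
      inv\<^bsub>opp G\<^esub> (a \<otimes>\<^bsub>opp G\<^esub> u) \<otimes>\<^bsub>opp G\<^esub> d \<in> M"
    using o.lub_in_parabolic[of P a b] P assms by (metis parabolic_opp)
  have c: "a \<in> carrier G" "b \<in> carrier G" "u \<in> carrier G" "v \<in> carrier G"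
    using assms uv(1,2) P'(3) by blast+
  show ?thesis
    using uv c group_axioms by (intro that[of u v]) simp_all
qed

text \<open>The Ore condition inside \<open>P\<close>: a common left multiple
  \<open>u \<otimes> b = v \<otimes> c\<close> turns the inner quotient
  \<open>b \<otimes> inv c\<close> into \<open>inv u \<otimes> v\<close>, with \<open>u\<close> and
  \<open>v\<close> still in \<open>P\<close>.\<close>

lemma fraction:
  assumes P: "parabolic G M P" and "g \<in> generate G P"
  shows "\<exists>a\<in>P. \<exists>b\<in>P. g = inv a \<otimes> b"
  using assms(2)
proof induction
  note P' = parabolicD[OF P]
  case one
  then show ?case using P'(8) by (intro bexI[of _ \<one>]) simp_all
next
  note P' = parabolicD[OF P]
  case (incl h)
  then show ?case using P'(3,8) by (intro bexI[of _ \<one>] bexI[of _ h]) auto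
next
  note P' = parabolicD[OF P]
  case (inv h)
  then show ?case using P'(3,8) by (intro bexI[of _ h] bexI[of _ \<one>]) auto
next
  note P' = parabolicD[OF P]
  case (eng g h)
  then obtain a b c d where *: "a \<in> P" "b \<in> P" "c \<in> P" "d \<in> P" "g = inv a \<otimes> b" "h = inv c \<otimes> d"
    by blast
  obtain u v where uv: "u \<in> P" "v \<in> P" "u \<otimes> b = v \<otimes> c"
    using right_lub_in_parabolic[OF P *(2,3)] by metis
  have cc: "a \<in> carrier G" "b \<in> carrier G" "c \<in> carrier G" "d \<in> carrier G"
    "u \<in> carrier G" "v \<in> carrier G"
    using * uv P'(3) by blast+
  have "b = inv u \<otimes> (v \<otimes> c)" using cc uv(3) by (metis inv_cancel_left(1))
  then have "g \<otimes> h = inv (u \<otimes> a) \<otimes> (v \<otimes> d)"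
    using cc *(5,6) by (simp add: group_nf)
  then show ?case using P'(9) * uv by blast
qed

lemma right_fraction:
  assumes P: "parabolic G M P" and "g \<in> generate G P"
  shows "\<exists>a\<in>P. \<exists>b\<in>P. g = a \<otimes> inv b"
proof -
  interpret o: lattice_pair "opp G" M \<nu> by (rule lattice_opp)
  note P' = parabolicD[OF P]
  obtain a b where "a \<in> P" "b \<in> P" "g = inv\<^bsub>opp G\<^esub> a \<otimes>\<^bsub>opp G\<^esub> b"
    using o.fraction[of P g] P assms(2) P'(3) group_axioms by auto
  moreover then have "a \<in> carrier G" using P'(3) by blast
  ultimately show ?thesis
    using group_axioms by auto
qed

section \<open>Coprime left fractions\<close>

definition lcoprime :: "'g \<Rightarrow> 'g \<Rightarrow> bool" where
  "lcoprime a b \<longleftrightarrow> (\<forall>s\<in>M. inv s \<otimes> a \<in> M \<longrightarrow> inv s \<otimes> b \<in> M \<longrightarrow> s = \<one>)"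

lemma lcoprime_decomp:
  assumes "a \<in> M" "b \<in> M"
  shows "\<exists>s\<in>M. \<exists>c\<in>M. \<exists>d\<in>M. a = s \<otimes> c \<and> b = s \<otimes> d \<and> lcoprime c d"
  using assms
proof (induction "\<nu> a" arbitrary: a b rule: less_induct)
  case less
  have [simp]: "a \<in> carrier G" "b \<in> carrier G" using less.prems by simp_all
  show ?case
  proof (cases "lcoprime a b")
    case True
    then show ?thesis using less.prems by (intro bexI[of _ \<one>] bexI[of _ a] bexI[of _ b]) simp_all
  next
    case False
    then obtain s where s: "s \<in> M" "s \<noteq> \<one>" "inv s \<otimes> a \<in> M" "inv s \<otimes> b \<in> M"
      by (auto simp: lcoprime_def)
    have [simp]: "s \<in> carrier G" using s by simp
    have eq: "s \<otimes> (inv s \<otimes> a) = a" "s \<otimes> (inv s \<otimes> b) = b" by (simp_all add: group_nf)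
    have "\<nu> a \<ge> \<nu> s + \<nu> (inv s \<otimes> a)"
      using norm_mult[OF s(1,3)] eq by simp
    then have "\<nu> (inv s \<otimes> a) < \<nu> a"
      using norm_pos[OF s(1,2)] by simp
    from less.hyps[OF this s(3,4)] obtain t c d where t: "t \<in> M" "c \<in> M" "d \<in> M"
      "inv s \<otimes> a = t \<otimes> c" "inv s \<otimes> b = t \<otimes> d" "lcoprime c d" by blast
    have "a = s \<otimes> t \<otimes> c" "b = s \<otimes> t \<otimes> d" using eq t s by (simp_all add: m_assoc)
    then show ?thesis using t s by blast
  qed
qed

lemma lcoprime_fraction:
  assumes P: "parabolic G M P" and "a \<in> P" "b \<in> P"
  shows "\<exists>c\<in>P. \<exists>d\<in>P. inv a \<otimes> b = inv c \<otimes> d \<and> lcoprime c d"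
proof -
  note P' = parabolicD[OF P]
  obtain s c d where s: "s \<in> M" "c \<in> M" "d \<in> M" "a = s \<otimes> c" "b = s \<otimes> d" "lcoprime c d"
    using lcoprime_decomp[of a b] assms(2,3) P'(2) by blast
  have "c \<in> P" "d \<in> P"
    using P'(5)[OF s(1,2)] P'(5)[OF s(1,3)] s(4,5) assms(2,3) by simp_all
  moreover have "inv a \<otimes> b = inv c \<otimes> d" using s by (simp add: group_nf)
  ultimately show ?thesis using s(6) by blast
qed

text \<open>A common left multiple \<open>u \<otimes> a = v \<otimes> c\<close> of the denominators
  entails \<open>u \<otimes> b = v \<otimes> d\<close>. The join
  \<open>u \<otimes> s = v \<otimes> t\<close> divides both products on the left, so
  \<open>s\<close> divides \<open>a\<close> and \<open>b\<close>, and \<open>t\<close> divides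
  \<open>c\<close> and \<open>d\<close>. Coprimality makes \<open>s\<close> and \<open>t\<close>
  trivial, whence \<open>u = v\<close>.\<close>

lemma lcoprime_unique:
  assumes M: "a \<in> M" "b \<in> M" "c \<in> M" "d \<in> M"
    and eq: "inv a \<otimes> b = inv c \<otimes> d" and "lcoprime a b" "lcoprime c d"
  shows "a = c \<and> b = d"
proof -
  note self = parabolic_self[OF is_submonoid]
  obtain u v where uv: "u \<in> M" "v \<in> M" "u \<otimes> a = v \<otimes> c"
    using right_lub_in_parabolic[OF self M(1,3)] by metis
  obtain s t where st: "s \<in> M" "t \<in> M" "u \<otimes> s = v \<otimes> t"
    "\<And>d. d \<in> M \<Longrightarrow> inv u \<otimes> d \<in> M \<Longrightarrow> inv v \<otimes> d \<in> M \<Longrightarrow> inv (u \<otimes> s) \<otimes> d \<in> M"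
    using lub_in_parabolic[OF self uv(1,2)] by metis
  have cc [simp]: "a \<in> carrier G" "b \<in> carrier G" "c \<in> carrier G" "d \<in> carrier G"
    "u \<in> carrier G" "v \<in> carrier G" "s \<in> carrier G" "t \<in> carrier G"
    using M uv st subset by blast+
  have "u \<otimes> b = (u \<otimes> a) \<otimes> (inv a \<otimes> b)" by (simp add: group_nf)
  also have "\<dots> = v \<otimes> d" unfolding eq uv(3) by (simp add: group_nf)
  finally have ub: "u \<otimes> b = v \<otimes> d" .
  have "inv v \<otimes> (u \<otimes> a) \<in> M" unfolding uv(3) using M by (simp add: group_nf)
  then have 1: "inv (u \<otimes> s) \<otimes> (u \<otimes> a) \<in> M"
    using M uv(1) by (intro st(4)) (simp_all add: group_nf)
  have "inv v \<otimes> (u \<otimes> b) \<in> M" unfolding ub using M by (simp add: group_nf)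
  then have 2: "inv (u \<otimes> s) \<otimes> (u \<otimes> b) \<in> M"
    using M uv(1) by (intro st(4)) (simp_all add: group_nf)
  have "inv s \<otimes> a \<in> M" "inv s \<otimes> b \<in> M" using 1 2 by (simp_all add: group_nf)
  then have "s = \<one>" using assms(6) st(1) by (auto simp: lcoprime_def)
  moreover have "inv t \<otimes> c \<in> M" "inv t \<otimes> d \<in> M"
    using 1 2 unfolding st(3) uv(3) ub by (simp_all add: group_nf)
  then have "t = \<one>" using assms(7) st(2) by (auto simp: lcoprime_def)
  ultimately have "u = v" using st(3) by simp
  then show ?thesis using uv(3) ub by simp
qed

lemma inter_generate:
  assumes P: "parabolic G M P" and Q: "parabolic G M Q"
  shows "generate G P \<inter> generate G Q \<subseteq> generate G (P \<inter> Q)"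
proof
  fix g assume g: "g \<in> generate G P \<inter> generate G Q"
  note P' = parabolicD[OF P] and Q' = parabolicD[OF Q]
  obtain a b where ab: "a \<in> P" "b \<in> P" "g = inv a \<otimes> b" "lcoprime a b"
    using fraction[OF P, of g] lcoprime_fraction[OF P] g by (metis IntD1)
  obtain c d where cd: "c \<in> Q" "d \<in> Q" "g = inv c \<otimes> d" "lcoprime c d"
    using fraction[OF Q, of g] lcoprime_fraction[OF Q] g by (metis IntD2)
  have "a = c \<and> b = d"
    using ab cd P'(2) Q'(2) by (intro lcoprime_unique) auto
  then have "a \<in> P \<inter> Q" "b \<in> P \<inter> Q" using ab cd by auto
  then show "g \<in> generate G (P \<inter> Q)"
    unfolding ab(3) by (intro generate.eng generate.inv generate.incl)
qed

text \<open>On a left fraction the extension must be the quotient of the images. Two fractions of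
  one element agree after both are expanded to a common left multiple of their denominators, and the
  expanded terms lie in \<open>P\<close>, where \<open>f\<close> is multiplicative.\<close>

lemma extends: 
  assumes P: "parabolic G M P"
  shows "extends_homs G P"
  unfolding extends_homs_def
proof (intro allI impI)
  fix L :: "'g monoid" and f
  assume "group L" and fc: "f \<in> P \<rightarrow> carrier L"
    and fm: "\<forall>a\<in>P. \<forall>b\<in>P. f (a \<otimes> b) = f a \<otimes>\<^bsub>L\<^esub> f b"
  interpret L: group L by (rule \<open>group L\<close>)
  note P' = parabolicD[OF P]
  have cL: "f a \<in> carrier L" if "a \<in> P" for a using fc that by auto
  have cG: "a \<in> carrier G" if "a \<in> P" for a using P'(3) that by auto
  have wd: "inv\<^bsub>L\<^esub> f a \<otimes>\<^bsub>L\<^esub> f b = inv\<^bsub>L\<^esub> f c \<otimes>\<^bsub>L\<^esub> f d"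
    if abcd: "a \<in> P" "b \<in> P" "c \<in> P" "d \<in> P" and eq: "inv a \<otimes> b = inv c \<otimes> d" for a b c d
  proof -
    obtain u v where uv: "u \<in> P" "v \<in> P" "u \<otimes> a = v \<otimes> c"
      using right_lub_in_parabolic[OF P abcd(1,3)] by metis
    have "u \<otimes> b = (u \<otimes> a) \<otimes> (inv a \<otimes> b)" using uv(1) abcd cG by (simp add: group_nf)
    also have "\<dots> = v \<otimes> d" unfolding eq uv(3) using uv(2) abcd cG by (simp add: group_nf)
    finally have ub: "u \<otimes> b = v \<otimes> d" .
    have "inv\<^bsub>L\<^esub> f a \<otimes>\<^bsub>L\<^esub> f b = inv\<^bsub>L\<^esub> (f u \<otimes>\<^bsub>L\<^esub> f a) \<otimes>\<^bsub>L\<^esub> (f u \<otimes>\<^bsub>L\<^esub> f b)"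
      using uv(1) abcd cL by (simp add: L.group_nf)
    also have "\<dots> = inv\<^bsub>L\<^esub> f (u \<otimes> a) \<otimes>\<^bsub>L\<^esub> f (u \<otimes> b)" using fm uv(1,2) abcd by simp
    also have "\<dots> = inv\<^bsub>L\<^esub> f (v \<otimes> c) \<otimes>\<^bsub>L\<^esub> f (v \<otimes> d)" by (simp only: uv(3) ub)
    also have "\<dots> = inv\<^bsub>L\<^esub> (f v \<otimes>\<^bsub>L\<^esub> f c) \<otimes>\<^bsub>L\<^esub> (f v \<otimes>\<^bsub>L\<^esub> f d)" using fm uv(1,2) abcd by simp
    also have "\<dots> = inv\<^bsub>L\<^esub> f c \<otimes>\<^bsub>L\<^esub> f d" using uv(2) abcd cL by (simp add: L.group_nf)
    finally show ?thesis .
  qed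
  obtain \<alpha> \<beta> where ab: "\<And>g. g \<in> generate G P \<Longrightarrow> \<alpha> g \<in> P \<and> \<beta> g \<in> P \<and> g = inv \<alpha> g \<otimes> \<beta> g"
    using fraction[OF P] by metis
  define \<psi> where "\<psi> g = inv\<^bsub>L\<^esub> f (\<alpha> g) \<otimes>\<^bsub>L\<^esub> f (\<beta> g)" for g
  have \<psi>: "\<psi> (inv a \<otimes> b) = inv\<^bsub>L\<^esub> f a \<otimes>\<^bsub>L\<^esub> f b" if "a \<in> P" "b \<in> P" for a b
  proof -
    have "inv a \<otimes> b \<in> generate G P" using that by (intro generate.eng generate.inv generate.incl)
    from ab[OF this] show ?thesis unfolding \<psi>_def using that by (intro wd) auto
  qed
  have "f \<one> \<otimes>\<^bsub>L\<^esub> f \<one> = f \<one>" using fm P'(8) by (metis r_one cG)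
  then have f1: "f \<one> = \<one>\<^bsub>L\<^esub>" using cL P'(8) by simp
  show "\<exists>\<psi>\<in>generate G P \<rightarrow> carrier L.
      (\<forall>x\<in>generate G P. \<forall>y\<in>generate G P. \<psi> (x \<otimes> y) = \<psi> x \<otimes>\<^bsub>L\<^esub> \<psi> y) \<and> (\<forall>a\<in>P. \<psi> a = f a)"
  proof (intro bexI[of _ \<psi>] conjI ballI)
    fix a assume a: "a \<in> P"
    have "a = inv \<one> \<otimes> a" using a cG by simp
    then have "\<psi> a = inv\<^bsub>L\<^esub> f \<one> \<otimes>\<^bsub>L\<^esub> f a" using \<psi>[OF P'(8) a] by simp
    then show "\<psi> a = f a" using a cL by (simp add: f1)
  next
    show "\<psi> \<in> generate G P \<rightarrow> carrier L"
      unfolding \<psi>_def using ab cL by auto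
  next
    fix x y assume xy: "x \<in> generate G P" "y \<in> generate G P"
    obtain a b where a: "a \<in> P" "b \<in> P" "x = inv a \<otimes> b" using fraction[OF P xy(1)] by blast
    obtain c d where c: "c \<in> P" "d \<in> P" "y = inv c \<otimes> d" using fraction[OF P xy(2)] by blast
    obtain u v where uv: "u \<in> P" "v \<in> P" "u \<otimes> b = v \<otimes> c"
      using right_lub_in_parabolic[OF P a(2) c(1)] by metis
    note cG' [simp] = cG[OF a(1)] cG[OF a(2)] cG[OF c(1)] cG[OF c(2)] cG[OF uv(1)] cG[OF uv(2)]
    note cL' [simp] = cL[OF a(1)] cL[OF a(2)] cL[OF c(1)] cL[OF c(2)] cL[OF uv(1)] cL[OF uv(2)]
    have "b = inv u \<otimes> (v \<otimes> c)" using uv(3) cG' by (metis inv_cancel_left(1))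
    then have "x \<otimes> y = inv (u \<otimes> a) \<otimes> (v \<otimes> d)"
      using a(3) c(3) by (simp add: group_nf)
    moreover have "u \<otimes> a \<in> P" "v \<otimes> d \<in> P" using uv a c P'(9) by blast+
    ultimately have eq: "\<psi> (x \<otimes> y) = inv\<^bsub>L\<^esub> f (u \<otimes> a) \<otimes>\<^bsub>L\<^esub> f (v \<otimes> d)"
      using \<psi> by simp
    have "f u \<otimes>\<^bsub>L\<^esub> f b = f v \<otimes>\<^bsub>L\<^esub> f c" using fm uv a c by metis
    then have "f b = inv\<^bsub>L\<^esub> f u \<otimes>\<^bsub>L\<^esub> (f v \<otimes>\<^bsub>L\<^esub> f c)" using cL' by (metis L.inv_cancel_left(1))
    then have "\<psi> x \<otimes>\<^bsub>L\<^esub> \<psi> y = inv\<^bsub>L\<^esub> (f u \<otimes>\<^bsub>L\<^esub> f a) \<otimes>\<^bsub>L\<^esub> (f v \<otimes>\<^bsub>L\<^esub> f d)"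
      unfolding a(3) c(3) \<psi>[OF a(1,2)] \<psi>[OF c(1,2)] by (simp add: L.group_nf)
    then show "\<psi> (x \<otimes> y) = \<psi> x \<otimes>\<^bsub>L\<^esub> \<psi> y"
      unfolding eq using fm uv a c by simp
  qed
qed

section \<open>Least upper bounds in the group of fractions, and torsion\<close>

text \<open>The order is invariant under left translation, and the common multiple
  \<open>u \<otimes> a = v \<otimes> c\<close> of the denominators translates \<open>x\<close> and
  \<open>y\<close> into \<open>M\<close>. The join found there is translated back.\<close>

lemma lub_in_group:
  assumes "x \<in> generate G M" "y \<in> generate G M"
  obtains z where "z \<in> generate G M" "inv x \<otimes> z \<in> M" "inv y \<otimes> z \<in> M"
    "\<And>w. w \<in> generate G M \<Longrightarrow> inv x \<otimes> w \<in> M \<Longrightarrow> inv y \<otimes> w \<in> M \<Longrightarrow> inv z \<otimes> w \<in> M"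
proof -
  note self = parabolic_self[OF is_submonoid]
  obtain a b where a: "a \<in> M" "b \<in> M" "x = inv a \<otimes> b" using fraction[OF self assms(1)] by blast
  obtain c e where c: "c \<in> M" "e \<in> M" "y = inv c \<otimes> e" using fraction[OF self assms(2)] by blast
  obtain u v where uv: "u \<in> M" "v \<in> M" "u \<otimes> a = v \<otimes> c"
    using right_lub_in_parabolic[OF self a(1) c(1)] by metis
  have "u \<otimes> b \<in> M" "v \<otimes> e \<in> M" using a c uv by simp_all
  then obtain s t where st: "s \<in> M" "t \<in> M" "(u \<otimes> b) \<otimes> s = (v \<otimes> e) \<otimes> t"
    "\<And>d. d \<in> M \<Longrightarrow> inv (u \<otimes> b) \<otimes> d \<in> M \<Longrightarrow> inv (v \<otimes> e) \<otimes> d \<in> M \<Longrightarrow> inv ((u \<otimes> b) \<otimes> s) \<otimes> d \<in> M"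
    using lub_in_parabolic[OF self] by metis
  define z where "z = inv (u \<otimes> a) \<otimes> ((u \<otimes> b) \<otimes> s)"
  have [simp]: "a \<in> carrier G" "b \<in> carrier G" "c \<in> carrier G" "e \<in> carrier G"
    "u \<in> carrier G" "v \<in> carrier G" "s \<in> carrier G" "t \<in> carrier G"
    using a c uv st by simp_all
  have z': "z = inv (v \<otimes> c) \<otimes> ((v \<otimes> e) \<otimes> t)" unfolding z_def uv(3) st(3) ..
  show ?thesis
  proof (rule that)
    show "z \<in> generate G M" unfolding z_def
      using uv(1,2) a(1,2) st(1,2) by (intro generate.eng generate.inv generate.incl) simp_all
    show "inv x \<otimes> z \<in> M" unfolding z_def a(3) using st(1) by (simp add: group_nf)
    show "inv y \<otimes> z \<in> M" unfolding z' c(3) using st(2) by (simp add: group_nf)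
  next
    fix w assume w: "w \<in> generate G M" "inv x \<otimes> w \<in> M" "inv y \<otimes> w \<in> M"
    have [simp]: "w \<in> carrier G" using w(1) generate_in_carrier[OF subset] by blast
    define d where "d = u \<otimes> a \<otimes> w"
    have d': "d = v \<otimes> c \<otimes> w" unfolding d_def uv(3) ..
    have 1: "inv (u \<otimes> b) \<otimes> d \<in> M" using w(2) unfolding d_def a(3) by (simp add: group_nf)
    have 2: "inv (v \<otimes> e) \<otimes> d \<in> M" using w(3) unfolding d' c(3) by (simp add: group_nf)
    have "(u \<otimes> b) \<otimes> (inv (u \<otimes> b) \<otimes> d) \<in> M" using 1 \<open>u \<otimes> b \<in> M\<close> by blast
    then have "d \<in> M" by (simp add: d_def group_nf)
    from st(4)[OF this 1 2] show "inv z \<otimes> w \<in> M"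
      unfolding z_def d_def by (simp add: group_nf)
  qed
qed

text \<open>A least upper bound of the powers of \<open>g\<close> is fixed by translation by \<open>g\<close>.\<close>

lemma torsion:
  assumes g: "g \<in> generate G M" and n: "n > 0" "g [^] (n::nat) = \<one>"
  shows "g = \<one>"
proof -
  have gc [simp]: "g \<in> carrier G" using g generate_in_carrier[OF subset] by blast
  have pow_in: "g [^] i \<in> generate G M" for i :: nat
    by (induction i) (auto intro: generate.one generate.eng g)
  define ub where "ub k w \<longleftrightarrow> w \<in> generate G M \<and> (\<forall>i\<le>k. inv (g [^] i) \<otimes> w \<in> M)" for k :: nat and w
  have ubD: "w \<in> generate G M" "i \<le> k \<Longrightarrow> inv (g [^] i) \<otimes> w \<in> M" if "ub k w" for i k w
    using that by (simp_all add: ub_def)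
  have "\<exists>x. ub k x \<and> (\<forall>w. ub k w \<longrightarrow> inv x \<otimes> w \<in> M)" for k
  proof (induction k)
    case 0
    show ?case
      using generate_in_carrier[OF subset] by (intro exI[of _ \<one>]) (auto simp: ub_def intro: generate.one)
  next
    case (Suc k)
    then obtain x where x: "ub k x" "\<And>w. ub k w \<Longrightarrow> inv x \<otimes> w \<in> M" by blast
    obtain z where z: "z \<in> generate G M" "inv x \<otimes> z \<in> M" "inv (g [^] Suc k) \<otimes> z \<in> M"
      "\<And>w. w \<in> generate G M \<Longrightarrow> inv x \<otimes> w \<in> M \<Longrightarrow> inv (g [^] Suc k) \<otimes> w \<in> M \<Longrightarrow> inv z \<otimes> w \<in> M"
      using lub_in_group[OF ubD(1)[OF x(1)] pow_in[of "Suc k"]] by metis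
    have [simp]: "x \<in> carrier G" "z \<in> carrier G"
      using ubD(1)[OF x(1)] z(1) generate_in_carrier[OF subset] by blast+
    have *: "inv (g [^] i) \<otimes> z \<in> M" if "i \<le> k" for i
    proof -
      have "inv (g [^] i) \<otimes> z = (inv (g [^] i) \<otimes> x) \<otimes> (inv x \<otimes> z)" by (simp add: group_nf)
      then show ?thesis using ubD(2)[OF x(1) that] z(2) by simp
    qed
    have "ub (Suc k) z"
      unfolding ub_def
    proof (intro conjI allI impI)
      fix i assume "i \<le> Suc k"
      then show "inv (g [^] i) \<otimes> z \<in> M"
        using *[of i] z(3) by (cases "i = Suc k") simp_all
    qed (rule z(1))
    moreover have "inv z \<otimes> w \<in> M" if w: "ub (Suc k) w" for w
    proof (rule z(4))
      have "ub k w" using w by (simp add: ub_def)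
      then show "inv x \<otimes> w \<in> M" by (rule x(2))
      show "w \<in> generate G M" using w by (rule ubD(1))
      show "inv (g [^] Suc k) \<otimes> w \<in> M" using w by (rule ubD(2)) simp
    qed
    ultimately show ?case by blast
  qed
  then obtain x where ubx: "ub n x" and lub: "\<And>w. ub n w \<Longrightarrow> inv x \<otimes> w \<in> M" by blast
  note x = ubD(1)[OF ubx] ubD(2)[OF ubx]
  have [simp]: "x \<in> carrier G" using x(1) generate_in_carrier[OF subset] by blast
  have "inv x \<otimes> (g \<otimes> x) \<in> M"
  proof (intro lub ub_def[THEN iffD2] conjI allI impI)
    show "g \<otimes> x \<in> generate G M" using g x(1) by (rule generate.eng)
    have pos: "inv (g [^] Suc j) \<otimes> (g \<otimes> x) \<in> M" if "j \<le> n" for j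
      using x(2)[OF that] unfolding nat_pow_Suc2[OF gc] by (simp add: group_nf)
    \<comment> \<open>For \<open>i = 0\<close> the exponent \<open>n\<close> takes its place, since
      \<open>g [^] n = \<one>\<close>. Taking bounds over the exponents from \<open>0\<close> to
      \<open>n\<close> makes the family invariant under translation by \<open>g\<close> and by
      \<open>inv g\<close>.\<close>
    fix i assume "i \<le> n"
    then show "inv (g [^] i) \<otimes> (g \<otimes> x) \<in> M"
      using pos[of "i - 1"] pos[of "n - 1"] n by (cases i) auto
  qed
  moreover have "inv x \<otimes> (inv g \<otimes> x) \<in> M"
  proof (intro lub ub_def[THEN iffD2] conjI allI impI)
    show "inv g \<otimes> x \<in> generate G M"
      using gen_closed(3,4)[OF subset] g x(1) by blast
    have pos: "inv (g [^] j) \<otimes> (inv g \<otimes> x) \<in> M" if "Suc j \<le> n" for j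
      using x(2)[OF that] unfolding nat_pow_Suc2[OF gc] by (simp add: group_nf)
    fix i assume "i \<le> n"
    then show "inv (g [^] i) \<otimes> (inv g \<otimes> x) \<in> M"
      using pos[of i] pos[of 0] n by (cases "i = n") auto
  qed
  \<comment> \<open>The two elements just placed in \<open>M\<close> are inverse to each other, so
    \<open>conical\<close> applies.\<close>
  ultimately have "inv x \<otimes> (g \<otimes> x) = \<one>"
    by (intro conical) (simp_all add: group_nf)
  then have "g \<otimes> x = x" by (simp add: inv_mult_eq_one_iff)
  then show ?thesis by simp
qed

section \<open>Coset representatives with least denominator\<close>

definition rreduced :: "'g set \<Rightarrow> 'g \<Rightarrow> bool" where
  "rreduced P b \<longleftrightarrow> (\<forall>n\<in>P. b \<otimes> inv n \<in> M \<longrightarrow> n = \<one>)"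

lemma rreduced_ex:
  assumes P: "parabolic G M P" and "b \<in> M"
  shows "\<exists>c\<in>M. \<exists>n\<in>P. b = c \<otimes> n \<and> rreduced P c"
  using assms(2)
proof (induction "\<nu> b" arbitrary: b rule: less_induct)
  case less
  note P' = parabolicD[OF P]
  have [simp]: "b \<in> carrier G" using less.prems by simp
  show ?case
  proof (cases "rreduced P b")
    case True
    then show ?thesis using less.prems P'(8) by (intro bexI[of _ b] bexI[of _ \<one>]) simp_all
  next
    case False
    then obtain n where n: "n \<in> P" "b \<otimes> inv n \<in> M" "n \<noteq> \<one>" by (auto simp: rreduced_def)
    have [simp]: "n \<in> carrier G" and nM: "n \<in> M" using n P'(2,3) by blast+
    have b: "b = (b \<otimes> inv n) \<otimes> n" by (simp add: group_nf)
    have "\<nu> b \<ge> \<nu> (b \<otimes> inv n) + \<nu> n" using norm_mult[OF n(2) nM] b by simp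
    then have "\<nu> (b \<otimes> inv n) < \<nu> b" using norm_pos[OF nM n(3)] by simp
    from less.hyps[OF this n(2)] obtain c m where c: "c \<in> M" "m \<in> P" "b \<otimes> inv n = c \<otimes> m" "rreduced P c"
      by blast
    have "b = c \<otimes> (m \<otimes> n)" using b c P'(3) by (metis \<open>n \<in> carrier G\<close> m_assoc mem_carrier subsetD)
    then show ?thesis using c P'(9)[OF c(2) n(1)] by blast
  qed
qed

text \<open>Write the quotient as \<open>n \<otimes> inv m\<close> over \<open>P\<close>. Then
  \<open>e \<otimes> n\<close> is right-divisible by \<open>n\<close> and by \<open>m\<close>, hence
  by their right join \<open>u \<otimes> n\<close>. So \<open>u\<close> is a right divisor of
  \<open>e\<close> in \<open>P\<close> and therefore trivial, which turns the fraction into the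
  element \<open>v\<close> of \<open>P\<close>.\<close>

lemma rreduced_coset:
  assumes P: "parabolic G M P" and M: "e \<in> M" "f \<in> M" and "rreduced P e" "inv e \<otimes> f \<in> generate G P"
  shows "inv e \<otimes> f \<in> P"
proof -
  note P' = parabolicD[OF P]
  obtain n m where nm: "n \<in> P" "m \<in> P" "inv e \<otimes> f = n \<otimes> inv m"
    using right_fraction[OF P assms(5)] by blast
  obtain u v where uv: "u \<in> P" "v \<in> P" "u \<otimes> n = v \<otimes> m"
    "\<And>d. d \<in> M \<Longrightarrow> d \<otimes> inv n \<in> M \<Longrightarrow> d \<otimes> inv m \<in> M \<Longrightarrow> d \<otimes> inv (u \<otimes> n) \<in> M"
    using right_lub_in_parabolic[OF P nm(1,2)] by metis
  have inM: "n \<in> M" "m \<in> M" "u \<in> M" "v \<in> M" using nm uv P'(2) by blast+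
  then have [simp]: "n \<in> carrier G" "m \<in> carrier G" "u \<in> carrier G" "v \<in> carrier G"
    "e \<in> carrier G" "f \<in> carrier G" using M by simp_all
  have f: "f = e \<otimes> (n \<otimes> inv m)" using nm(3) by (metis inv_cancel_left(2) \<open>e \<in> carrier G\<close> \<open>f \<in> carrier G\<close>)
  have "(e \<otimes> n) \<otimes> inv (u \<otimes> n) \<in> M"
  proof (rule uv(4))
    show "e \<otimes> n \<otimes> inv m \<in> M" using M(2) f by (simp add: group_nf)
  qed (use M inM in \<open>simp_all add: group_nf\<close>)
  then have "e \<otimes> inv u \<in> M" by (simp add: group_nf)
  then have "u = \<one>" using assms(4) uv(1) by (auto simp: rreduced_def)
  then have "n \<otimes> inv m = v" using uv(3) by (simp add: group_nf)
  then show ?thesis using nm(3) uv(2) by simp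
qed

text \<open>A coset is represented by \<open>inv a \<otimes> b\<close>, where \<open>a\<close>
  right-divides the denominator of every left fraction of every element of the coset and
  \<open>b\<close> has no nontrivial right divisor in \<open>P\<close>. This description does not
  mention \<open>Q\<close>, so one set \<open>R\<close> serves every \<open>Q\<close>; the submonoid
  \<open>Q\<close> enters only in the search for such a fraction, where minimality of
  \<open>\<nu>\<close> is used to reach minimality for divisibility.\<close>

lemma coset_reps_ex:
  assumes P: "parabolic G M P"
  shows "\<exists>R. coset_reps G M P R"
proof -
  note P' = parabolicD[OF P]
  define R where "R = {inv a \<otimes> b | a b. a \<in> M \<and> b \<in> M \<and> rreduced P b \<and>
    (\<forall>h\<in>generate G P. \<forall>c\<in>M. \<forall>d\<in>M. inv a \<otimes> b \<otimes> h = inv c \<otimes> d \<longrightarrow> c \<otimes> inv a \<in> M)}"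
  have RI: "inv a \<otimes> b \<in> R" if "a \<in> M" "b \<in> M" "rreduced P b"
    "\<And>h c d. h \<in> generate G P \<Longrightarrow> c \<in> M \<Longrightarrow> d \<in> M \<Longrightarrow> inv a \<otimes> b \<otimes> h = inv c \<otimes> d \<Longrightarrow>
      c \<otimes> inv a \<in> M" for a b
    unfolding R_def using that by blast
  have gen_c: "h \<in> carrier G" if "h \<in> generate G P" for h
    using that generate_in_carrier[OF P'(3)] by blast
  have "coset_reps G M P R"
    unfolding coset_reps_def
  proof (intro conjI allI impI ballI)
    show "R \<subseteq> generate G M"
      unfolding R_def by (auto intro: generate.eng generate.inv generate.incl)
  next
    fix r s assume "r \<in> R" "s \<in> R" and rs: "inv r \<otimes> s \<in> generate G P"
    from \<open>r \<in> R\<close> obtain a b where a: "r = inv a \<otimes> b" "a \<in> M" "b \<in> M" "rreduced P b"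
      "\<And>h c d. h \<in> generate G P \<Longrightarrow> c \<in> M \<Longrightarrow> d \<in> M \<Longrightarrow> r \<otimes> h = inv c \<otimes> d \<Longrightarrow> c \<otimes> inv a \<in> M"
      unfolding R_def by blast
    from \<open>s \<in> R\<close> obtain c d where c: "s = inv c \<otimes> d" "c \<in> M" "d \<in> M" "rreduced P d"
      "\<And>h a b. h \<in> generate G P \<Longrightarrow> a \<in> M \<Longrightarrow> b \<in> M \<Longrightarrow> s \<otimes> h = inv a \<otimes> b \<Longrightarrow> a \<otimes> inv c \<in> M"
      unfolding R_def by blast
    have [simp]: "a \<in> carrier G" "b \<in> carrier G" "c \<in> carrier G" "d \<in> carrier G"
      using a c by simp_all
    have sr: "inv s \<otimes> r \<in> generate G P"
      using gen_closed(4)[OF P'(3) rs] by (simp add: a(1) c(1) group_nf)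
    have "c \<otimes> inv a \<in> M"
      using rs by (intro a(5)[of "inv r \<otimes> s" c d]) (simp_all add: a(1) c(1-3) group_nf)
    moreover have "a \<otimes> inv c \<in> M"
      using sr by (intro c(5)[of "inv s \<otimes> r" a b]) (simp_all add: c(1) a(1-3) group_nf)
    ultimately have "a \<otimes> inv c = \<one>"
      by (intro conical) (simp_all add: group_nf)
    then have "inv (inv a) \<otimes> inv c = \<one>" by simp
    then have "inv a = inv c" by (subst (asm) inv_mult_eq_one_iff) simp_all
    then have ac: "a = c" by (simp add: inv_eq_1_iff inj_onD[OF inv_inj])
    have "inv b \<otimes> d \<in> generate G P" using rs by (simp add: a(1) c(1) ac group_nf)
    then have bd: "inv b \<otimes> d \<in> P" using rreduced_coset[OF P a(3) c(3) a(4)] by blast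
    have "inv d \<otimes> b \<in> generate G P" using sr by (simp add: a(1) c(1) ac group_nf)
    then have "inv d \<otimes> b \<in> P" using rreduced_coset[OF P c(3) a(3) c(4)] by blast
    then have "inv b \<otimes> d = \<one>"
      using bd P'(2) by (intro conical) (auto simp: group_nf)
    then have "b = d" by (simp add: inv_mult_eq_one_iff)
    then show "r = s" by (simp add: a(1) c(1) ac)
  next
    fix g assume g: "g \<in> M"
    then obtain c n where c: "c \<in> M" "n \<in> P" "g = c \<otimes> n" "rreduced P c"
      using rreduced_ex[OF P] by blast
    have [simp]: "c \<in> carrier G" "n \<in> carrier G" using c P'(3) by auto
    \<comment> \<open>The denominator \<open>\<one>\<close> divides every denominator, so the
      representative of a coset meeting \<open>M\<close> lies in \<open>M\<close>.\<close>
    have "inv \<one> \<otimes> c \<in> R" using c by (intro RI) simp_all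
    moreover have "inv c \<otimes> g = n" using c(3) by (simp add: group_nf)
    ultimately show "\<exists>r\<in>R \<inter> M. inv r \<otimes> g \<in> P"
      using c by (intro bexI[of _ c]) simp_all
  next
    fix Q g assume Q: "parabolic G M Q" and g: "g \<in> generate G Q"
    note Q' = parabolicD[OF Q]
    have gQc: "h \<in> carrier G" if "h \<in> generate G Q" for h
      using that generate_in_carrier[OF Q'(3)] by blast
    \<comment> \<open>Denominators are sought in \<open>Q\<close> but numerators in all of
      \<open>M\<close>, since the coset of \<open>g\<close> may leave \<open>generate G Q\<close>.
      That the chosen numerator lies in \<open>Q\<close> is shown at the end.\<close>
    define den where "den a \<longleftrightarrow> a \<in> Q \<and> (\<exists>b\<in>M. inv g \<otimes> (inv a \<otimes> b) \<in> generate G P)" for a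
    have [simp]: "g \<in> carrier G" using g by (rule gQc)
    have "\<exists>a. den a"
    proof -
      obtain a b where ab: "a \<in> Q" "b \<in> Q" "g = inv a \<otimes> b" using fraction[OF Q g] by blast
      have "inv g \<otimes> (inv a \<otimes> b) = \<one>" unfolding ab(3)[symmetric] by simp
      then have "den a" unfolding den_def using ab(1,2) Q'(2) by (metis generate.one subsetD)
      then show ?thesis ..
    qed
    then obtain a where a: "den a" "\<And>c. den c \<Longrightarrow> \<nu> a \<le> \<nu> c"
      by (metis (no_types, lifting) ex_has_least_nat)
    obtain b0 where b0: "b0 \<in> M" "inv g \<otimes> (inv a \<otimes> b0) \<in> generate G P" and aQ: "a \<in> Q"
      using a(1) by (auto simp: den_def)
    obtain b n where b: "b \<in> M" "n \<in> P" "b0 = b \<otimes> n" "rreduced P b"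
      using rreduced_ex[OF P b0(1)] by blast
    have aM: "a \<in> M" using aQ Q'(2) by blast
    have [simp]: "a \<in> carrier G" "b \<in> carrier G" "n \<in> carrier G" using aM b P'(3) by auto
    define r where "r = inv a \<otimes> b"
    have [simp]: "r \<in> carrier G" by (simp add: r_def)
    have "inv g \<otimes> r = (inv g \<otimes> (inv a \<otimes> b0)) \<otimes> inv n" by (simp add: r_def b(3) group_nf)
    then have gr: "inv g \<otimes> r \<in> generate G P"
      using b0(2) b(2) generate.inv[of n P G] generate.eng[of _ G P] by metis
    have "r \<in> R" unfolding r_def
    proof (rule RI[OF aM b(1,4)])
      fix h c d assume h: "h \<in> generate G P" and cd: "c \<in> M" "d \<in> M" "inv a \<otimes> b \<otimes> h = inv c \<otimes> d"
      obtain m k where mk: "m \<in> P" "k \<in> P" "h = m \<otimes> inv k" using right_fraction[OF P h] by blast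
      have [simp]: "c \<in> carrier G" "d \<in> carrier G" "m \<in> carrier G" "k \<in> carrier G"
        using cd mk P'(3) by auto
      have bm: "b \<otimes> m \<in> M" "d \<otimes> k \<in> M" using b cd mk P'(2) by auto
      have eq: "inv a \<otimes> (b \<otimes> m) = inv c \<otimes> (d \<otimes> k)"
      proof -
        have "inv a \<otimes> (b \<otimes> m) = (inv a \<otimes> b \<otimes> h) \<otimes> k" by (simp add: mk(3) group_nf)
        then show ?thesis by (simp add: cd(3) m_assoc)
      qed
      \<comment> \<open>Both fractions describe one element, so their coprime forms agree. The
        coprime denominator \<open>x\<close> is a factor of \<open>a\<close>, hence lies in
        \<open>Q\<close> and is again admissible; minimality of \<open>\<nu> a\<close> forces
        \<open>s = \<one>\<close>, and then \<open>a = x\<close> divides \<open>c\<close>.\<close>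
      obtain s x y where x: "s \<in> M" "x \<in> M" "y \<in> M" "a = s \<otimes> x" "b \<otimes> m = s \<otimes> y" "lcoprime x y"
        using lcoprime_decomp[OF aM bm(1)] by blast
      obtain t x' y' where t: "t \<in> M" "x' \<in> M" "y' \<in> M" "c = t \<otimes> x'" "d \<otimes> k = t \<otimes> y'"
        "lcoprime x' y'"
        using lcoprime_decomp[OF cd(1) bm(2)] by blast
      have [simp]: "s \<in> carrier G" "x \<in> carrier G" "y \<in> carrier G" "t \<in> carrier G"
        "x' \<in> carrier G" "y' \<in> carrier G"
        using x t by simp_all
      have axy: "inv a \<otimes> (b \<otimes> m) = inv x \<otimes> y" unfolding x(4,5) by (simp add: group_nf)
      have "inv c \<otimes> (d \<otimes> k) = inv x' \<otimes> y'" unfolding t(4,5) by (simp add: group_nf)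
      then have "inv x \<otimes> y = inv x' \<otimes> y'" using eq axy by simp
      then have "x = x'" using lcoprime_unique[OF x(2,3) t(2,3) _ x(6) t(6)] by blast
      have "x \<in> Q" using Q'(5)[OF x(1,2)] x(4) aQ by simp
      moreover have "inv g \<otimes> (inv x \<otimes> y) = (inv g \<otimes> r) \<otimes> m"
        unfolding axy[symmetric] by (simp add: r_def group_nf)
      then have "inv g \<otimes> (inv x \<otimes> y) \<in> generate G P"
        using gr mk(1) by (metis generate.incl generate.eng)
      ultimately have "den x" unfolding den_def using x(3) by blast
      then have "\<nu> a \<le> \<nu> x" by (rule a(2))
      moreover have "\<nu> a \<ge> \<nu> s + \<nu> x" unfolding x(4) by (rule norm_mult[OF x(1,2)])
      ultimately have "s = \<one>" using norm_pos[OF x(1)] by fastforce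
      then have "c \<otimes> inv a = t" using x(4) t(4) \<open>x = x'\<close> by (simp add: group_nf)
      then show "c \<otimes> inv a \<in> M" using t(1) by simp
    qed
    moreover have "r \<in> generate G Q"
    proof -
      have "a \<otimes> g \<in> generate G Q" by (intro generate.eng[OF generate.incl[OF aQ] g])
      then obtain x y where xy: "x \<in> Q" "y \<in> Q" "a \<otimes> g = inv x \<otimes> y" using fraction[OF Q] by blast
      obtain y1 n1 where y1: "y1 \<in> M" "n1 \<in> P" "y = y1 \<otimes> n1" "rreduced P y1"
        using rreduced_ex[OF P, of y] xy Q'(2) by blast
      have n1M: "n1 \<in> M" using y1 P'(2) by blast
      have y1Q: "y1 \<in> Q" using Q'(4)[OF y1(1) n1M] y1(3) xy(2) by simp
      have xM: "x \<in> M" using xy Q'(2) by blast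
      have [simp]: "x \<in> carrier G" "y1 \<in> carrier G" "n1 \<in> carrier G"
        using xM y1 n1M by simp_all
      have g_eq: "g = inv a \<otimes> (inv x \<otimes> (y1 \<otimes> n1))"
        using xy(3) y1(3) \<open>g \<in> carrier G\<close> \<open>a \<in> carrier G\<close> by (metis inv_cancel_left(1))
      have "inv y1 \<otimes> (x \<otimes> b) = n1 \<otimes> (inv g \<otimes> r)"
        by (simp add: g_eq r_def group_nf)
      then have "inv y1 \<otimes> (x \<otimes> b) \<in> generate G P"
        using y1(2) gr by (metis generate.incl generate.eng)
      then have n2: "inv y1 \<otimes> (x \<otimes> b) \<in> P"
        using rreduced_coset[OF P y1(1) _ y1(4)] xM b(1) by blast
      \<comment> \<open>The join \<open>x \<otimes> u\<close> of \<open>x\<close> and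
        \<open>y1\<close> divides \<open>x \<otimes> b\<close>. The cofactor
        \<open>inv u \<otimes> b\<close> is a factor of an element of \<open>P\<close>, so it is a
        right divisor of \<open>b\<close> in \<open>P\<close> and must be trivial. Thus
        \<open>b\<close> equals \<open>u\<close>, which lies in \<open>Q\<close>.\<close>
      obtain u v where uv: "u \<in> Q" "v \<in> Q" "x \<otimes> u = y1 \<otimes> v"
        "\<And>d. d \<in> M \<Longrightarrow> inv x \<otimes> d \<in> M \<Longrightarrow> inv y1 \<otimes> d \<in> M \<Longrightarrow> inv (x \<otimes> u) \<otimes> d \<in> M"
        using lub_in_parabolic[OF Q xy(1) y1Q] by metis
      have uM: "u \<in> M" "v \<in> M" using uv Q'(2) by blast+
      then have [simp]: "u \<in> carrier G" "v \<in> carrier G" by simp_all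
      have "inv (x \<otimes> u) \<otimes> (x \<otimes> b) \<in> M"
        using n2 P'(2) xM b(1) by (intro uv(4)) (auto simp: group_nf)
      then have w: "inv u \<otimes> b \<in> M" by (simp add: group_nf)
      have "v \<otimes> (inv u \<otimes> b) = inv y1 \<otimes> (x \<otimes> u) \<otimes> (inv u \<otimes> b)"
        unfolding uv(3) by (simp add: group_nf)
      also have "\<dots> = inv y1 \<otimes> (x \<otimes> b)" by (simp add: group_nf)
      finally have "inv u \<otimes> b \<in> P" using P'(5)[OF uM(2) w] n2 by simp
      moreover have "b \<otimes> inv (inv u \<otimes> b) \<in> M" using uM by (simp add: group_nf)
      ultimately have "inv u \<otimes> b = \<one>" using b(4) by (auto simp: rreduced_def)
      then have "b = u" by (simp add: inv_mult_eq_one_iff)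
      then show ?thesis unfolding r_def using aQ uv(1) by (auto intro: generate.eng generate.inv generate.incl)
    qed
    moreover have "inv r \<otimes> g \<in> generate G P"
      using gen_closed(4)[OF P'(3) gr] by (simp add: group_nf)
    ultimately show "\<exists>r\<in>R \<inter> generate G Q. inv r \<otimes> g \<in> generate G P" by blast
  qed
  then show ?thesis ..
qed

lemma lattice_half: "bounded_joins G M" "has_reps G M"
  using ex_lub coset_reps_ex unfolding bounded_joins_def has_reps_def by blast+

lemma lattice_good: "good G M"
proof -
  interpret o: lattice_pair "opp G" M \<nu> by (rule lattice_opp)
  have "pos_pair G M"
    by (intro pos_pair.intro pos_pair_axioms.intro group_axioms is_submonoid lattice_half
        o.lattice_half inter_generate)
  then show ?thesis
    unfolding good_def using extends torsion by blast
qed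

end

section \<open>Alternating words\<close>

text \<open>The flag names the factor of the first letter. The predicate is applied to the groups
  \<open>A\<close>, the monoids \<open>Mb\<close>, the subgroups \<open>K P\<close>, graphs of
  homomorphisms, and letters of an abstract monoid.\<close>

fun alt :: "(bool \<Rightarrow> 'g set) \<Rightarrow> 'g set \<Rightarrow> bool \<Rightarrow> 'g list \<Rightarrow> bool" where
  "alt S H b [] = True"
| "alt S H b (x # xs) = (x \<in> S b \<and> x \<notin> H \<and> alt S H (\<not> b) xs)"

primrec wprod :: "('g, 'm) monoid_scheme \<Rightarrow> 'g list \<Rightarrow> 'g" where
  "wprod G [] = \<one>\<^bsub>G\<^esub>"
| "wprod G (x # xs) = x \<otimes>\<^bsub>G\<^esub> wprod G xs"

text \<open>Only the leading letter is allowed to lie in \<open>H\<close>; this covers the elements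
  of \<open>H\<close> themselves and leaves a place where amalgamated remainders can be
  collected.\<close>

definition padded :: "('g, 'm) monoid_scheme \<Rightarrow> (bool \<Rightarrow> 'g set) \<Rightarrow> 'g set \<Rightarrow> bool \<Rightarrow> 'g set" where
  "padded G S H b = {x \<otimes>\<^bsub>G\<^esub> wprod G xs | x xs. x \<in> S b \<and> alt S H (\<not> b) xs}"

lemma paddedI: "x \<in> S b \<Longrightarrow> alt S H (\<not> b) xs \<Longrightarrow> x \<otimes>\<^bsub>G\<^esub> wprod G xs \<in> padded G S H b"
  by (auto simp: padded_def)

lemma paddedE:
  assumes "g \<in> padded G S H b"
  obtains x xs where "x \<in> S b" "alt S H (\<not> b) xs" "g = x \<otimes>\<^bsub>G\<^esub> wprod G xs"
  using assms by (auto simp: padded_def)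

lemma alt_mono: "alt S H b xs \<Longrightarrow> (\<And>b. S b \<subseteq> T b) \<Longrightarrow> alt T H b xs"
  by (induction xs arbitrary: b) auto

lemma alt_append:
  "alt S H b (xs @ ys) \<longleftrightarrow> alt S H b xs \<and> alt S H (if even (length xs) then b else \<not> b) ys"
  by (induction xs arbitrary: b) auto

lemma alt_rev: "alt S H b xs \<Longrightarrow> alt S H (if even (length xs) then \<not> b else b) (rev xs)"
proof (induction xs arbitrary: b)
  case (Cons x xs)
  have "alt S H (if even (length xs) then b else \<not> b) (rev xs)"
    using Cons.IH[of "\<not> b"] Cons.prems by (cases "even (length xs)") simp_all
  then show ?case
    using Cons.prems by (cases "even (length xs)") (simp_all add: alt_append)
qed simp

lemma wprod_closed: "monoid G \<Longrightarrow> set xs \<subseteq> carrier G \<Longrightarrow> wprod G xs \<in> carrier G"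
  by (induction xs) (auto intro: monoid.m_closed)

lemma alt_set: "alt S H b xs \<Longrightarrow> (\<And>b. S b \<subseteq> C) \<Longrightarrow> set xs \<subseteq> C"
  by (induction xs arbitrary: b) auto

lemma wprod_append:
  assumes "monoid G" "set xs \<subseteq> carrier G" "set ys \<subseteq> carrier G"
  shows "wprod G (xs @ ys) = wprod G xs \<otimes>\<^bsub>G\<^esub> wprod G ys"
  using assms(2)
proof (induction xs)
  case (Cons x xs)
  then show ?case
    using assms wprod_closed[of G xs] wprod_closed[of G ys] by (simp add: monoid.m_assoc)
qed (use assms wprod_closed[of G ys] in \<open>simp add: monoid.l_one\<close>)

lemma wprod_opp:
  fixes G :: "'g monoid"
  assumes "group G" "set xs \<subseteq> carrier G"
  shows "wprod (opp G) xs = wprod G (rev xs)"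
proof -
  interpret group G by (rule assms(1))
  show ?thesis
    using assms(2) by (induction xs) (simp_all add: wprod_append is_monoid)
qed

locale alt_system = monoid G for G :: "('g, 'm) monoid_scheme" (structure) +
  fixes S :: "bool \<Rightarrow> 'g set" and H :: "'g set"
  assumes sys_carrier: "S b \<subseteq> carrier G" and sys_one: "\<one> \<in> S b"
    and sys_mult: "x \<in> S b \<Longrightarrow> y \<in> S b \<Longrightarrow> x \<otimes> y \<in> S b"
    and sys_flip: "x \<in> S b \<Longrightarrow> x \<in> H \<Longrightarrow> x \<in> S (\<not> b)"
begin

lemma sys_in: "x \<in> S b \<Longrightarrow> x \<in> carrier G"
  using sys_carrier by blast

lemma alt_in: "alt S H b xs \<Longrightarrow> wprod G xs \<in> carrier G"
  using wprod_closed[OF monoid_axioms] alt_set[of S H b xs "carrier G"] sys_carrier by blast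

text \<open>A leading letter in \<open>H\<close> changes sides by \<open>sys_flip\<close> and is
  absorbed by the next letter; one outside \<open>H\<close> becomes the first letter of the word
  behind the padding \<open>\<one>\<close>. Hence the set is independent of the side and closed
  under left multiplication by letters of either factor.\<close>

lemma padded_flip_subset: "padded G S H b \<subseteq> padded G S H (\<not> b)"
proof
  fix g assume "g \<in> padded G S H b"
  then obtain x xs where x: "x \<in> S b" "alt S H (\<not> b) xs" "g = x \<otimes> wprod G xs" by (rule paddedE)
  show "g \<in> padded G S H (\<not> b)"
  proof (cases "x \<in> H")
    case True
    then have x': "x \<in> S (\<not> b)" using x(1) sys_flip by blast
    show ?thesis
    proof (cases xs)
      case Nil
      then show ?thesis using paddedI[of x S "\<not> b" H "[]" G] x' x(3) by simp
    next
      case (Cons y ys)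
      then have "(x \<otimes> y) \<otimes> wprod G ys \<in> padded G S H (\<not> b)"
        using x x' by (intro paddedI sys_mult) simp_all
      moreover have "(x \<otimes> y) \<otimes> wprod G ys = g"
        using x Cons sys_in[of x b] sys_in[of y "\<not> b"] alt_in[of b ys] by (simp add: m_assoc)
      ultimately show ?thesis by simp
    qed
  next
    case False
    then have "\<one> \<otimes> wprod G (x # xs) \<in> padded G S H (\<not> b)"
      using x by (intro paddedI sys_one) simp
    moreover have "wprod G (x # xs) = g" "g \<in> carrier G"
      using x sys_in alt_in[of "\<not> b" xs] by simp_all
    ultimately show ?thesis by simp
  qed
qed

lemma padded_eq: "padded G S H b = padded G S H c"
  using padded_flip_subset[of b] padded_flip_subset[of "\<not> b"] by (cases "b = c") (auto simp: neq_commute)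

lemma padded_closed: "padded G S H b \<subseteq> carrier G"
  using sys_in alt_in by (auto elim!: paddedE)

lemma sys_subset_padded: "S c \<subseteq> padded G S H b"
proof
  fix x assume x: "x \<in> S c"
  then have "x \<otimes> wprod G [] \<in> padded G S H c" by (intro paddedI) simp_all
  then show "x \<in> padded G S H b" using x sys_in padded_eq[of b c] by simp
qed

lemma alt_padded: "alt S H c xs \<Longrightarrow> wprod G xs \<in> padded G S H b"
  using paddedI[of \<one> S "\<not> c" H xs G] sys_one alt_in padded_eq[of b "\<not> c"] by simp

lemma padded_lmult:
  assumes "y \<in> S c" "g \<in> padded G S H b"
  shows "y \<otimes> g \<in> padded G S H b"
proof -
  have "g \<in> padded G S H c" using assms(2) padded_eq[of b c] by simp
  then obtain x xs where x: "x \<in> S c" "alt S H (\<not> c) xs" "g = x \<otimes> wprod G xs" by (rule paddedE)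
  have "(y \<otimes> x) \<otimes> wprod G xs \<in> padded G S H c"
    using x assms by (intro paddedI sys_mult)
  moreover have "(y \<otimes> x) \<otimes> wprod G xs = y \<otimes> g"
    using x assms sys_in alt_in[of "\<not> c" xs] by (simp add: m_assoc)
  ultimately show ?thesis using padded_eq[of b c] by simp
qed

lemma padded_least:
  assumes "\<And>c. S c \<subseteq> T" "\<And>x y. x \<in> T \<Longrightarrow> y \<in> T \<Longrightarrow> x \<otimes> y \<in> T" "\<one> \<in> T"
  shows "padded G S H b \<subseteq> T"
proof
  have w: "wprod G xs \<in> T" if "alt S H c xs" for c xs
    using that
  proof (induction xs arbitrary: c)
    case (Cons x xs)
    then have "x \<in> T" "wprod G xs \<in> T" using assms(1)[of c] by auto
    then show ?case by (simp add: assms(2))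
  qed (simp add: assms(3))
  fix g assume "g \<in> padded G S H b"
  then show "g \<in> T" using assms(1)[of b] assms(2) w by (elim paddedE) blast
qed

lemma padded_mult:
  assumes "g \<in> padded G S H b" "h \<in> padded G S H b"
  shows "g \<otimes> h \<in> padded G S H b"
proof -
  have hc: "h \<in> carrier G" using assms(2) padded_closed by blast
  have w: "wprod G xs \<otimes> h \<in> padded G S H b" if "alt S H c xs" for c xs
    using that
  proof (induction xs arbitrary: c)
    case Nil
    then show ?case using assms(2) hc by simp
  next
    case (Cons x xs)
    then have x: "x \<in> S c" "alt S H (\<not> c) xs" by simp_all
    have "x \<otimes> (wprod G xs \<otimes> h) \<in> padded G S H b"
      using x by (intro padded_lmult Cons.IH)
    then show ?case
      using sys_in[OF x(1)] alt_in[OF x(2)] hc by (simp add: m_assoc)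
  qed
  obtain x xs where x: "x \<in> S b" "alt S H (\<not> b) xs" "g = x \<otimes> wprod G xs"
    using assms(1) by (rule paddedE)
  then show ?thesis
    using padded_lmult[OF x(1) w[OF x(2)]] sys_in alt_in hc by (simp add: m_assoc)
qed

lemma padded_submonoid: "submonoid (padded G S H b) G"
  using padded_closed padded_mult sys_subset_padded[of b b] sys_one[of b]
  by (intro submonoid.intro) blast+

end

section \<open>Normal forms in an amalgamated product of groups\<close>

text \<open>An amalgamated product seen from inside: \<open>alt_notin\<close> is the normal form
  theorem. The group \<open>G\<close> may be larger than the subgroup generated by the two
  factors.\<close>

locale amalgam_group = group G for G :: "'g monoid" (structure) +
  fixes A :: "bool \<Rightarrow> 'g set" and H :: "'g set"
  assumes A_subgroup: "subgroup (A b) G" and H_subgroup: "subgroup H G"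
    and A_Int: "A b \<inter> A (\<not> b) = H"
    and alt_notin: "alt A H b xs \<Longrightarrow> wprod G xs \<in> H \<Longrightarrow> xs = []"
begin

sublocale A: alt_system G A H
proof unfold_locales
  show "A b \<subseteq> carrier G" for b using A_subgroup by (rule subgroup.subset)
  show "\<one> \<in> A b" for b using A_subgroup by (rule subgroup.one_closed)
  show "x \<otimes> y \<in> A b" if "x \<in> A b" "y \<in> A b" for x y b
    using A_subgroup that by (rule subgroup.m_closed)
  show "x \<in> A (\<not> b)" if "x \<in> H" for x b using A_Int that by blast
qed

lemma A_inv: "x \<in> A b \<Longrightarrow> inv x \<in> A b"
  using A_subgroup by (rule subgroup.m_inv_closed)

lemma H_subset: "H \<subseteq> A b" "x \<in> H \<Longrightarrow> x \<in> A b"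
  using A_Int by blast+

lemma H_closed: "x \<in> H \<Longrightarrow> y \<in> H \<Longrightarrow> x \<otimes> y \<in> H" "x \<in> H \<Longrightarrow> inv x \<in> H" "\<one> \<in> H"
  "x \<in> H \<Longrightarrow> x \<in> carrier G"
  using H_subgroup by (simp_all add: subgroup.m_closed subgroup.m_inv_closed subgroup.one_closed
      subgroup.mem_carrier)

text \<open>Moving the first letter of \<open>vs\<close> to the other side prolongs
  \<open>us\<close> to a reduced word again, because the two words begin in different factors. Once
  all letters are moved, \<open>alt_notin\<close> applies.\<close>

lemma alt_disjoint:
  "alt A H b us \<Longrightarrow> alt A H (\<not> b) vs \<Longrightarrow> wprod G us = wprod G vs \<Longrightarrow> us = [] \<and> vs = []"
proof (induction vs arbitrary: b us)
  case Nil
  then show ?case using alt_notin[of b us] H_closed(3) by simp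
next
  case (Cons v vs)
  have v: "v \<in> A (\<not> b)" "v \<notin> H" "alt A H b vs" using Cons.prems by simp_all
  have c: "v \<in> carrier G" "wprod G us \<in> carrier G" "wprod G vs \<in> carrier G"
    using v Cons.prems A.sys_in A.alt_in by blast+
  have "inv v \<notin> H" using v(2) H_closed(2)[of "inv v"] c by auto
  then have "alt A H (\<not> b) (inv v # us)" using v Cons.prems(1) A_inv by simp
  moreover have "wprod G (inv v # us) = wprod G vs" using Cons.prems(3) c by (simp add: group_nf)
  ultimately have "inv v # us = []" using Cons.IH[of "\<not> b" "inv v # us"] v(3) by simp
  then show ?case by simp
qed

text \<open>A quotient \<open>inv y \<otimes> x\<close> outside \<open>H\<close> would prolong
  \<open>xs\<close> to a reduced word beginning in the other factor than \<open>ys\<close>, against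
  \<open>alt_disjoint\<close>. Inside \<open>H\<close> it is absorbed by the next letter, and the
  tails are again of the same form.\<close>

lemma padded_unique:
  assumes "x \<in> A b" "y \<in> A b" "alt A H (\<not> b) xs" "alt A H (\<not> b) ys"
    "x \<otimes> wprod G xs = y \<otimes> wprod G ys"
  shows "inv y \<otimes> x \<in> H \<and> length xs = length ys"
  using assms
proof (induction xs arbitrary: b x y ys)
  case (Cons x1 xs)
  have c: "x \<in> carrier G" "y \<in> carrier G" "wprod G (x1 # xs) \<in> carrier G" "wprod G ys \<in> carrier G"
    "wprod G xs \<in> carrier G" "x1 \<in> carrier G"
    using Cons.prems A.sys_in A.alt_in[of "\<not> b"] A.alt_in[of b] by auto
  have eq: "(inv y \<otimes> x) \<otimes> wprod G (x1 # xs) = wprod G ys"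
    using Cons.prems(5) c by (simp add: m_assoc inv_cancel_left(1))
  have zA: "inv y \<otimes> x \<in> A b" using Cons.prems A_inv A.sys_mult by blast
  have zH: "inv y \<otimes> x \<in> H"
  proof (rule ccontr)
    assume "inv y \<otimes> x \<notin> H"
    then have "alt A H b ((inv y \<otimes> x) # x1 # xs)" using Cons.prems zA by simp
    from alt_disjoint[OF this Cons.prems(4)] show False using eq by simp
  qed
  show ?case
  proof (cases ys)
    case Nil
    then have "wprod G (x1 # xs) = inv (inv y \<otimes> x)"
      using eq c by (metis inv_closed m_closed inv_equality inv_inv wprod.simps(1))
    then have "wprod G (x1 # xs) \<in> H" using zH H_closed(2) by metis
    then show ?thesis using alt_notin[OF Cons.prems(3)] by simp
  next
    case (Cons y1 ys')
    have "(inv y \<otimes> x \<otimes> x1) \<otimes> wprod G xs = y1 \<otimes> wprod G ys'"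
      using eq c Cons by (simp add: m_assoc)
    moreover have "inv y \<otimes> x \<otimes> x1 \<in> A (\<not> b)"
      using zH H_subset(2) Cons.prems(3) A.sys_mult by simp
    ultimately have "length xs = length ys'"
      using Cons.IH[of "inv y \<otimes> x \<otimes> x1" "\<not> b" y1 ys'] Cons.prems(3,4) Cons by simp
    then show ?thesis using Cons zH by simp
  qed
next
  case Nil
  have c: "x \<in> carrier G" "y \<in> carrier G" "wprod G ys \<in> carrier G"
    using Nil.prems A.sys_in A.alt_in by blast+
  have eq: "inv y \<otimes> x = wprod G ys" using Nil.prems(5) c by (simp add: inv_cancel_left(1))
  have zA: "inv y \<otimes> x \<in> A b" using Nil.prems A_inv A.sys_mult by blast
  have zH: "inv y \<otimes> x \<in> H"
  proof (rule ccontr)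
    assume "inv y \<otimes> x \<notin> H"
    then have "alt A H b [inv y \<otimes> x]" using zA by simp
    from alt_disjoint[OF this Nil.prems(4)] show False using eq c by simp
  qed
  then show ?case using eq alt_notin[OF Nil.prems(4)] by simp
qed

lemma amalgam_group_opp: "amalgam_group (opp G) A H"
proof (intro amalgam_group.intro amalgam_group_axioms.intro)
  show "group (opp G)" by (rule group_opp) (rule group_axioms)
  have sg: "subgroup K (opp G)" if "subgroup K G" for K
    using that group_axioms by (simp add: subgroup_def subset_iff)
  show "subgroup (A b) (opp G)" "subgroup H (opp G)" for b
    using A_subgroup H_subgroup sg by blast+
  show "A b \<inter> A (\<not> b) = H" for b by (rule A_Int)
  fix b xs assume xs: "alt A H b xs" "wprod (opp G) xs \<in> H"
  then have "wprod G (rev xs) \<in> H"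
    using wprod_opp[of G xs] group_axioms alt_set[OF xs(1) A.sys_carrier] by simp
  then show "xs = []" using alt_notin[OF alt_rev[OF xs(1)]] by simp
qed

end

section \<open>Joins in an amalgam\<close>

locale amalgam_pair = amalgam_group G A H for G :: "'g monoid" (structure) and A H +
  fixes Mb :: "bool \<Rightarrow> 'g set" and N :: "'g set"
  assumes pair: "pos_pair G (Mb b)" and N_parabolic: "parabolic G (Mb b) N"
    and A_eq: "A b = generate G (Mb b)" and H_eq: "H = generate G N"
begin

lemma Mb_subset: "Mb b \<subseteq> A b" "x \<in> Mb b \<Longrightarrow> x \<in> A b"
  unfolding A_eq using gen_subset by blast+

lemma Mb_H: "Mb b \<inter> H = N" "x \<in> Mb b \<Longrightarrow> x \<in> H \<Longrightarrow> x \<in> N"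
  using pos_pair.generate_Int_monoid[OF pair N_parabolic, of b] H_eq by blast+

lemma N_subset: "x \<in> N \<Longrightarrow> x \<in> Mb b" "x \<in> N \<Longrightarrow> x \<in> H" "x \<in> N \<Longrightarrow> x \<in> carrier G"
  using Mb_H H_closed(4) by blast+

sublocale S: alt_system G Mb H
proof unfold_locales
  fix b
  interpret pos_pair G "Mb b" by (rule pair)
  show "Mb b \<subseteq> carrier G" by (rule subset)
  show "\<one> \<in> Mb b" by (rule one_closed)
  show "x \<otimes> y \<in> Mb b" if "x \<in> Mb b" "y \<in> Mb b" for x y using that by simp
  show "x \<in> Mb (\<not> b)" if "x \<in> Mb b" "x \<in> H" for x using Mb_H(2)[OF that] N_subset(1) by blast
qed

definition M where "M = padded G Mb H True"

lemma M_eq: "M = padded G Mb H b"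
  unfolding M_def by (rule S.padded_eq)

lemma M_submonoid: "submonoid M G"
  unfolding M_def by (rule S.padded_submonoid)

sublocale M: submonoid M G by (rule M_submonoid)

lemma Mb_M: "x \<in> Mb b \<Longrightarrow> x \<in> M"
  using S.sys_subset_padded M_def by blast

lemma alt_M: "alt Mb H b xs \<Longrightarrow> wprod G xs \<in> M"
  unfolding M_def by (rule S.alt_padded)

lemma alt_A: "alt Mb H b xs \<Longrightarrow> alt A H b xs"
  using alt_mono[of Mb H b xs A] Mb_subset(1) by blast

lemma M_cases:
  assumes "g \<in> M"
  obtains x xs where "x \<in> Mb b" "alt Mb H (\<not> b) xs" "g = x \<otimes> wprod G xs"
  using assms M_eq[of b] paddedE[of g G Mb H b] by blast

lemma M_wordI: "x \<in> Mb b \<Longrightarrow> alt Mb H c xs \<Longrightarrow> x \<otimes> wprod G xs \<in> M"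
  by (intro M.m_closed Mb_M alt_M)

lemma M_unique:
  assumes "x \<in> Mb b" "y \<in> Mb b" "alt Mb H (\<not> b) xs" "alt Mb H (\<not> b) ys"
    "x \<otimes> wprod G xs = y \<otimes> wprod G ys"
  shows "inv y \<otimes> x \<in> H" "length xs = length ys"
  using padded_unique[of x b y xs ys] assms alt_A Mb_subset(2) by blast+

lemma M_Int_A: 
  assumes "g \<in> M" "g \<in> A b"
  shows "g \<in> Mb b"
proof -
  obtain x xs where x: "x \<in> Mb b" "alt Mb H (\<not> b) xs" "g = x \<otimes> wprod G xs"
    using assms(1) by (rule M_cases)
  have "x \<otimes> wprod G xs = g \<otimes> wprod G []"
    using x(3) assms by simp
  from padded_unique[OF _ assms(2) alt_A[OF x(2)] _ this] have "length xs = 0"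
    using x(1) Mb_subset(2) by simp
  then show ?thesis using x S.sys_in by simp
qed

lemma N_special: "x \<in> Mb b \<Longrightarrow> y \<in> Mb b \<Longrightarrow> x \<otimes> y \<in> N \<Longrightarrow> x \<in> N"
  "x \<in> Mb b \<Longrightarrow> y \<in> Mb b \<Longrightarrow> x \<otimes> y \<in> N \<Longrightarrow> y \<in> N"
  using parabolicD(4,5)[OF N_parabolic] by blast+

section \<open>Representatives modulo the amalgamated subgroup\<close>

definition NR where "NR b = (SOME R. coset_reps G (Mb b) N R)"

lemma NR: "coset_reps G (Mb b) N (NR b)"
proof -
  have "\<exists>R. coset_reps G (Mb b) N R"
    using pos_pair.reps[OF pair[of b]] N_parabolic[of b] unfolding has_reps_def by (elim allE) (rule mp)
  then show ?thesis unfolding NR_def by (rule someI_ex)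
qed

lemma NR_unique: "t \<in> NR b \<Longrightarrow> s \<in> NR b \<Longrightarrow> inv t \<otimes> s \<in> H \<Longrightarrow> t = s"
  using NR[of b] H_eq unfolding coset_reps_def by blast

lemma NR_parabolic:
  assumes "parabolic G (Mb b) Q" "g \<in> generate G Q"
  obtains t where "t \<in> NR b" "t \<in> generate G Q" "inv t \<otimes> g \<in> H"
  using NR[of b] assms H_eq unfolding coset_reps_def by blast

lemma NR_ex:
  assumes "x \<in> Mb b"
  obtains t where "t \<in> NR b" "t \<in> Mb b" "inv t \<otimes> x \<in> N"
  using NR[of b] assms unfolding coset_reps_def by blast

text \<open>\<open>y\<close> has its own representative, with remainder in \<open>N\<close>, and
  this lies in the same coset of \<open>H\<close> as \<open>t\<close>, so it is \<open>t\<close>.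
  Thus all first letters from one coset of \<open>H\<close> that lie in the monoid share the left
  divisor \<open>t\<close>, with cofactors in \<open>N\<close>.\<close>

lemma NR_transfer:
  assumes "x \<in> Mb b" "y \<in> Mb b" "inv y \<otimes> x \<in> H" "t \<in> NR b" "t \<in> Mb b" "inv t \<otimes> x \<in> N"
  shows "inv t \<otimes> y \<in> N"
proof -
  obtain s where s: "s \<in> NR b" "s \<in> Mb b" "inv s \<otimes> y \<in> N" using NR_ex[OF assms(2)] .
  have [simp]: "x \<in> carrier G" "y \<in> carrier G" "s \<in> carrier G" "t \<in> carrier G"
    using assms s S.sys_in by blast+
  have "inv s \<otimes> t = (inv s \<otimes> y) \<otimes> (inv y \<otimes> x) \<otimes> inv (inv t \<otimes> x)"
    by (simp add: group_nf)
  then have "inv s \<otimes> t \<in> H"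
    using assms s N_subset(2) H_closed by metis
  then show ?thesis using NR_unique s assms by blast
qed

text \<open>A divisor from the factor reaches only into the first letter: if \<open>a\<close>
  divides the word, the multiple can be written with first letter \<open>a \<otimes> y\<close>,
  which lies in the coset of \<open>x\<close> and is therefore \<open>t \<otimes> n\<close> with
  \<open>n\<close> in \<open>N\<close>.\<close>

lemma short_divisor:
  assumes a: "a \<in> Mb b" and x: "x \<in> Mb b" "alt Mb H (\<not> b) xs"
    and t: "t \<in> NR b" "t \<in> Mb b" "inv t \<otimes> x \<in> N"
    and le: "inv a \<otimes> (x \<otimes> wprod G xs) \<in> M"
  shows "\<exists>n\<in>N. inv a \<otimes> (t \<otimes> n) \<in> Mb b \<and> inv n \<otimes> (inv t \<otimes> (x \<otimes> wprod G xs)) \<in> M"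
proof -
  obtain y ys where y: "y \<in> Mb b" "alt Mb H (\<not> b) ys" "inv a \<otimes> (x \<otimes> wprod G xs) = y \<otimes> wprod G ys"
    using le by (rule M_cases)
  have [simp]: "a \<in> carrier G" "x \<in> carrier G" "t \<in> carrier G" "y \<in> carrier G"
    "wprod G xs \<in> carrier G" "wprod G ys \<in> carrier G"
    using a x y t S.sys_in S.alt_in by blast+
  have ay: "a \<otimes> y \<in> Mb b" using a y S.sys_mult by blast
  have d: "x \<otimes> wprod G xs = (a \<otimes> y) \<otimes> wprod G ys"
    using y(3) inv_mult_eq_iff[of a "x \<otimes> wprod G xs"] by (simp add: m_assoc)
  have "inv (a \<otimes> y) \<otimes> x \<in> H" by (rule M_unique(1)[OF x(1) ay x(2) y(2) d])
  then have n: "inv t \<otimes> (a \<otimes> y) \<in> N" using NR_transfer[OF x(1) ay _ t] by blast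
  moreover have "inv a \<otimes> (t \<otimes> (inv t \<otimes> (a \<otimes> y))) \<in> Mb b" using y(1) by (simp add: group_nf)
  moreover have "inv (inv t \<otimes> (a \<otimes> y)) \<otimes> (inv t \<otimes> (x \<otimes> wprod G xs)) \<in> M"
    unfolding d using alt_M[OF y(2)] by (simp add: group_nf)
  ultimately show ?thesis by blast
qed

text \<open>Descent along the normal form of the upper bound, alternating between the two factors.\<close>

lemma bound_in_factor:
  assumes "a \<in> Mb b" "a' \<in> Mb b" "x \<in> Mb b" "alt Mb H (\<not> b) xs"
    "inv a \<otimes> (x \<otimes> wprod G xs) \<in> M" "inv a' \<otimes> (x \<otimes> wprod G xs) \<in> M"
  shows "\<exists>u\<in>Mb b. inv a \<otimes> u \<in> Mb b \<and> inv a' \<otimes> u \<in> Mb b \<and> inv u \<otimes> (x \<otimes> wprod G xs) \<in> M"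
  using assms
proof (induction xs arbitrary: a a' x b)
  case Nil
  have [simp]: "a \<in> carrier G" "a' \<in> carrier G" "x \<in> carrier G"
    using Nil.prems S.sys_in by blast+
  have "inv a \<otimes> x \<in> A b" "inv a' \<otimes> x \<in> A b"
    using Nil.prems Mb_subset(2) A_inv A.sys_mult by blast+
  then show ?case using Nil.prems M_Int_A by (intro bexI[of _ x]) simp_all
next
  case (Cons x1 xs)
  define d where "d = x \<otimes> wprod G (x1 # xs)"
  obtain t where t: "t \<in> NR b" "t \<in> Mb b" "inv t \<otimes> x \<in> N" using NR_ex[OF Cons.prems(3)] .
  obtain n where n: "n \<in> N" "inv a \<otimes> (t \<otimes> n) \<in> Mb b" "inv n \<otimes> (inv t \<otimes> d) \<in> M"
    using short_divisor[OF Cons.prems(1,3,4) t Cons.prems(5)] d_def by blast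
  obtain m where m: "m \<in> N" "inv a' \<otimes> (t \<otimes> m) \<in> Mb b" "inv m \<otimes> (inv t \<otimes> d) \<in> M"
    using short_divisor[OF Cons.prems(2,3,4) t Cons.prems(6)] d_def by blast
  have x1: "x1 \<in> Mb (\<not> b)" "alt Mb H b xs" using Cons.prems(4) by simp_all
  have [simp]: "a \<in> carrier G" "a' \<in> carrier G" "x \<in> carrier G" "x1 \<in> carrier G"
    "t \<in> carrier G" "n \<in> carrier G" "m \<in> carrier G" "wprod G xs \<in> carrier G"
    using Cons.prems x1 t n m S.sys_in S.alt_in N_subset(3) by blast+
  have tx: "inv t \<otimes> x \<otimes> x1 \<in> Mb (\<not> b)" using t(3) N_subset(1) x1 S.sys_mult by blast
  have d': "inv t \<otimes> d = (inv t \<otimes> x \<otimes> x1) \<otimes> wprod G xs" by (simp add: d_def group_nf)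
  have [simp]: "d \<in> carrier G" by (simp add: d_def)
  \<comment> \<open>\<open>n\<close> and \<open>m\<close> also belong to the other factor, where the
    shorter word \<open>inv t \<otimes> d\<close> is a common multiple. The induction hypothesis
    bounds them there by \<open>u\<close>, their join \<open>l\<close> stays in \<open>N\<close>
    because \<open>N\<close> is parabolic, and \<open>t \<otimes> l\<close> is the required
    bound.\<close>
  obtain u where u: "u \<in> Mb (\<not> b)" "inv n \<otimes> u \<in> Mb (\<not> b)" "inv m \<otimes> u \<in> Mb (\<not> b)"
    "inv u \<otimes> (inv t \<otimes> d) \<in> M"
    using Cons.IH[of n "\<not> b" m "inv t \<otimes> x \<otimes> x1"] n m N_subset(1) tx x1(2) unfolding d' by auto
  interpret B: pos_pair G "Mb (\<not> b)" by (rule pair)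
  obtain l where l: "pos_join G (Mb (\<not> b)) n m l"
    using B.ex_join[of n m u] N_subset(1)[OF n(1)] N_subset(1)[OF m(1)] u
    unfolding pos_le_def by blast
  then have lN: "l \<in> N" using parabolicD(6)[OF N_parabolic n(1) m(1)] by blast
  have l': "inv n \<otimes> l \<in> Mb (\<not> b)" "inv m \<otimes> l \<in> Mb (\<not> b)" "inv l \<otimes> u \<in> Mb (\<not> b)"
    using l u unfolding pos_join_def pos_le_def by blast+
  have [simp]: "l \<in> carrier G" "u \<in> carrier G" using lN N_subset(3) u(1) S.sys_in by blast+
  have nl: "inv n \<otimes> l \<in> N" "inv m \<otimes> l \<in> N"
    using l' lN n m by (blast intro: Mb_H(2) H_closed(1,2) N_subset(2))+
  have "inv a \<otimes> (t \<otimes> l) = (inv a \<otimes> (t \<otimes> n)) \<otimes> (inv n \<otimes> l)"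
    "inv a' \<otimes> (t \<otimes> l) = (inv a' \<otimes> (t \<otimes> m)) \<otimes> (inv m \<otimes> l)" by (simp_all add: group_nf)
  moreover have "(inv a \<otimes> (t \<otimes> n)) \<otimes> (inv n \<otimes> l) \<in> Mb b" "(inv a' \<otimes> (t \<otimes> m)) \<otimes> (inv m \<otimes> l) \<in> Mb b"
    using n m nl N_subset(1) S.sys_mult by blast+
  moreover have "inv (t \<otimes> l) \<otimes> d = (inv l \<otimes> u) \<otimes> (inv u \<otimes> (inv t \<otimes> d))" by (simp add: group_nf)
  then have "inv (t \<otimes> l) \<otimes> d \<in> M" using l'(3) u(4) Mb_M by simp
  moreover have "t \<otimes> l \<in> Mb b" using t(2) lN N_subset(1) S.sys_mult by blast
  ultimately show ?case unfolding d_def by (intro bexI[of _ "t \<otimes> l"]) simp_all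
qed

text \<open>By \<open>bound_in_factor\<close> every common multiple in \<open>M\<close> is a
  multiple of some common multiple \<open>u\<close> inside the factor, so a least one in the factor
  is least in \<open>M\<close>.\<close>

lemma join_lift:
  assumes a: "a \<in> Mb b" "a' \<in> Mb b" and c: "pos_join G (Mb b) a a' c"
  shows "pos_join G M a a' c"
  unfolding pos_join_def pos_le_def
proof (intro conjI ballI impI)
  have c': "c \<in> Mb b" "inv a \<otimes> c \<in> Mb b" "inv a' \<otimes> c \<in> Mb b"
    and min: "\<And>d. d \<in> Mb b \<Longrightarrow> inv a \<otimes> d \<in> Mb b \<Longrightarrow> inv a' \<otimes> d \<in> Mb b \<Longrightarrow> inv c \<otimes> d \<in> Mb b"
    using c unfolding pos_join_def pos_le_def by blast+
  show "c \<in> M" "inv a \<otimes> c \<in> M" "inv a' \<otimes> c \<in> M" using c' Mb_M by blast+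
  fix d assume d: "d \<in> M" "inv a \<otimes> d \<in> M" "inv a' \<otimes> d \<in> M"
  obtain x xs where x: "x \<in> Mb b" "alt Mb H (\<not> b) xs" "d = x \<otimes> wprod G xs" using d(1) by (rule M_cases)
  obtain u where u: "u \<in> Mb b" "inv a \<otimes> u \<in> Mb b" "inv a' \<otimes> u \<in> Mb b" "inv u \<otimes> d \<in> M"
    using bound_in_factor[OF a x(1,2)] d x(3) by blast
  have "(inv c \<otimes> u) \<otimes> (inv u \<otimes> d) \<in> M" using min[OF u(1-3)] u(4) Mb_M by simp
  moreover have "c \<in> carrier G" "u \<in> carrier G" "d \<in> carrier G" using c' u d S.sys_in by auto
  ultimately show "inv c \<otimes> d \<in> M" by (simp add: group_nf)
qed

text \<open>No cancellation occurs in the monoid: since \<open>N\<close> is special, a last letter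
  outside \<open>H\<close> stays outside \<open>H\<close> when it is multiplied on the right by a
  letter of its factor.\<close>

lemma long_product:
  assumes "alt Mb H b xs" "xs \<noteq> []" "z \<in> M"
  shows "\<exists>zs. zs \<noteq> [] \<and> alt Mb H b zs \<and> wprod G xs \<otimes> z = wprod G zs"
  using assms
proof (induction xs arbitrary: b)
  case (Cons x xs)
  have x: "x \<in> Mb b" "x \<notin> H" "alt Mb H (\<not> b) xs" using Cons.prems by simp_all
  have [simp]: "x \<in> carrier G" "wprod G xs \<in> carrier G" "z \<in> carrier G"
    using x S.sys_in S.alt_in Cons.prems(3) by auto
  show ?case
  proof (cases "xs = []")
    case True
    obtain y ys where y: "y \<in> Mb b" "alt Mb H (\<not> b) ys" "z = y \<otimes> wprod G ys"
      using Cons.prems(3) by (rule M_cases)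
    have [simp]: "y \<in> carrier G" "wprod G ys \<in> carrier G" using y S.sys_in S.alt_in by blast+
    have xy: "x \<otimes> y \<in> Mb b" using x y S.sys_mult by blast
    have "x \<otimes> y \<notin> H"
      using N_special(1)[OF x(1) y(1)] Mb_H(2)[OF xy] x(2) N_subset(2) by blast
    then have "alt Mb H b ((x \<otimes> y) # ys)" using xy y by simp
    moreover have "wprod G (x # xs) \<otimes> z = wprod G ((x \<otimes> y) # ys)"
      using True y(3) by (simp add: m_assoc)
    ultimately show ?thesis by blast
  next
    case False
    then obtain zs where zs: "zs \<noteq> []" "alt Mb H (\<not> b) zs" "wprod G xs \<otimes> z = wprod G zs"
      using Cons.IH[OF x(3)] Cons.prems(3) by blast
    then have "alt Mb H b (x # zs)" "wprod G (x # xs) \<otimes> z = wprod G (x # zs)"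
      using x by (simp_all add: m_assoc)
    then show ?thesis by blast
  qed
qed simp

lemma pos_join_sym: "pos_join G K a b c \<longleftrightarrow> pos_join G K b a c"
  by (auto simp: pos_join_def)

lemma long_divisor:
  assumes y: "y \<in> Mb b" "alt Mb H (\<not> b) ys" "ys \<noteq> []"
    and f: "f \<in> M" "inv (y \<otimes> wprod G ys) \<otimes> f \<in> M"
  shows "\<exists>zs. zs \<noteq> [] \<and> alt Mb H (\<not> b) zs \<and> f = y \<otimes> wprod G zs"
proof -
  obtain zs where zs: "zs \<noteq> []" "alt Mb H (\<not> b) zs"
    "wprod G ys \<otimes> (inv (y \<otimes> wprod G ys) \<otimes> f) = wprod G zs"
    using long_product[OF y(2,3) f(2)] by blast
  have "y \<in> carrier G" "wprod G ys \<in> carrier G" "f \<in> carrier G" using y f S.sys_in S.alt_in by auto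
  then have "f = y \<otimes> wprod G zs"
    unfolding zs(3)[symmetric] by (simp add: group_nf)
  then show ?thesis using zs by blast
qed

text \<open>If both elements lie in the factor, \<open>bound_in_factor\<close> and
  \<open>join_lift\<close> suffice. If \<open>a'\<close> needs further letters, every multiple of
  \<open>a'\<close> is divisible by the representative \<open>t\<close> of its first letter, and
  divisibility by \<open>a\<close> can be restated for the remaining part. The join is
  \<open>t\<close> times a join of two divisors of \<open>inv t \<otimes> d\<close>, which has fewer
  letters.\<close>

lemma join_ex:
  assumes "a \<in> M" "a' \<in> M" "x \<in> Mb b" "alt Mb H (\<not> b) xs"
    "inv a \<otimes> (x \<otimes> wprod G xs) \<in> M" "inv a' \<otimes> (x \<otimes> wprod G xs) \<in> M"
  shows "\<exists>c. pos_join G M a a' c"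
  using assms
proof (induction xs arbitrary: a a' x b rule: length_induct)
  case (1 xs)
  define d where "d = x \<otimes> wprod G xs"
  have x: "x \<in> Mb b" "alt Mb H (\<not> b) xs" using 1(4,5) .
  have dM: "d \<in> M" unfolding d_def by (rule M_wordI[OF x])
  have key: "\<exists>c. pos_join G M a a' c"
    if a: "a \<in> M" "inv a \<otimes> d \<in> M" and a': "a' \<in> M" "inv a' \<otimes> d \<in> M" "a' \<notin> Mb b" for a a'
  proof -
    obtain y ys where y: "y \<in> Mb b" "alt Mb H (\<not> b) ys" "a' = y \<otimes> wprod G ys"
      using a'(1) by (rule M_cases)
    have ne: "ys \<noteq> []" using a'(3) y S.sys_in by auto
    obtain t where t: "t \<in> NR b" "t \<in> Mb b" "inv t \<otimes> y \<in> N" using NR_ex[OF y(1)] .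
    have [simp]: "a \<in> carrier G" "a' \<in> carrier G" "d \<in> carrier G" "y \<in> carrier G"
      "x \<in> carrier G" "t \<in> carrier G" "wprod G xs \<in> carrier G" "wprod G ys \<in> carrier G"
      using a a' dM x y t S.sys_in S.alt_in by auto
    have long: "\<exists>zs. zs \<noteq> [] \<and> alt Mb H (\<not> b) zs \<and> f = y \<otimes> wprod G zs"
      if "f \<in> M" "inv a' \<otimes> f \<in> M" for f
      using long_divisor[OF y(1,2) ne that(1)] that(2) y(3) by simp
    have tail: "inv t \<otimes> f \<in> M" if f: "f \<in> M" "inv a' \<otimes> f \<in> M" for f
    proof -
      obtain zs where zs: "alt Mb H (\<not> b) zs" "f = y \<otimes> wprod G zs" using long[OF f] by blast
      have "(inv t \<otimes> y) \<otimes> wprod G zs \<in> M"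
        using t(3) N_subset(1) zs(1) by (intro M_wordI)
      then show ?thesis using zs S.alt_in[OF zs(1)] by (simp add: m_assoc)
    qed
    have a'': "inv t \<otimes> a' \<in> M" using tail[OF a'(1)] by simp
    obtain ds where ds: "ds \<noteq> []" "alt Mb H (\<not> b) ds" "d = y \<otimes> wprod G ds"
      using long[OF dM a'(2)] by blast
    have "inv y \<otimes> x \<in> H" "length xs = length ds"
      using M_unique[OF x(1) y(1) x(2) ds(2)] ds(3) by (simp_all add: d_def)
    then obtain x1 xs1 where xs: "xs = x1 # xs1" using ds(1) by (cases xs) auto
    have x1: "x1 \<in> Mb (\<not> b)" "alt Mb H (\<not> \<not> b) xs1" using x(2) xs by simp_all
    have [simp]: "x1 \<in> carrier G" "wprod G xs1 \<in> carrier G" using x1 S.sys_in S.alt_in by blast+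
    have "inv x \<otimes> y = inv (inv y \<otimes> x)" by (simp add: group_nf)
    then have "inv x \<otimes> y \<in> H" using \<open>inv y \<otimes> x \<in> H\<close> H_closed(2) by simp
    then have tx: "inv t \<otimes> x \<in> N" using NR_transfer[OF y(1) x(1) _ t] by blast
    have d': "inv t \<otimes> d = (inv t \<otimes> x \<otimes> x1) \<otimes> wprod G xs1" by (simp add: d_def xs group_nf)
    \<comment> \<open>Among the multiples \<open>f\<close> of \<open>a'\<close>, those of
      \<open>a\<close> are characterised by a divisor \<open>s\<close> of
      \<open>inv t \<otimes> f\<close>. If \<open>a\<close> also has further letters, its first
      letter lies in the coset of \<open>t\<close> and \<open>s\<close> is
      \<open>inv t \<otimes> a\<close>.\<close>
    have "\<exists>s\<in>M. \<forall>f\<in>M. inv a' \<otimes> f \<in> M \<longrightarrow> (inv a \<otimes> f \<in> M \<longleftrightarrow> inv s \<otimes> (inv t \<otimes> f) \<in> M)"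
    proof (cases "a \<in> Mb b")
      case False
      obtain z zs where z: "z \<in> Mb b" "alt Mb H (\<not> b) zs" "a = z \<otimes> wprod G zs"
        using a(1) by (rule M_cases)
      have "zs \<noteq> []" using False z S.sys_in by auto
      then obtain es where es: "alt Mb H (\<not> b) es" "d = z \<otimes> wprod G es"
        using long_divisor[OF z(1,2) _ dM] a(2) z(3) by blast
      have "inv z \<otimes> y \<in> H" using M_unique(1)[OF y(1) z(1) ds(2) es(1)] ds(3) es(2) by simp
      then have "inv t \<otimes> z \<in> N" using NR_transfer[OF y(1) z(1) _ t] by blast
      then have "(inv t \<otimes> z) \<otimes> wprod G zs \<in> M" using N_subset(1) z(2) by (intro M_wordI)
      moreover have "(inv t \<otimes> z) \<otimes> wprod G zs = inv t \<otimes> a"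
        using z S.sys_in[OF z(1)] S.alt_in[OF z(2)] by (simp add: m_assoc)
      ultimately have "inv t \<otimes> a \<in> M" by simp
      then show ?thesis by (intro bexI[of _ "inv t \<otimes> a"]) (auto simp: group_nf)
    next
      case True
      interpret B: pos_pair G "Mb b" by (rule pair)
      have short: "\<exists>n\<in>N. inv a \<otimes> (t \<otimes> n) \<in> Mb b \<and> inv n \<otimes> (inv t \<otimes> f) \<in> M"
        if f: "f \<in> M" "inv a' \<otimes> f \<in> M" "inv a \<otimes> f \<in> M" for f
      proof -
        obtain zs where "alt Mb H (\<not> b) zs" "f = y \<otimes> wprod G zs" using long[OF f(1,2)] by blast
        then show ?thesis using short_divisor[OF True y(1) _ t] f(3) by blast
      qed
      obtain n where n: "n \<in> N" "inv a \<otimes> (t \<otimes> n) \<in> Mb b" using short[OF dM a'(2) a(2)] by blast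
      have tn: "t \<otimes> m \<in> Mb b" "inv t \<otimes> (t \<otimes> m) \<in> Mb b" if "m \<in> N" for m
        using that t(2) N_subset(1)[OF that, of b] N_subset(3)[OF that] by (simp_all add: group_nf)
      \<comment> \<open>A one-letter \<open>a\<close> is replaced by its join \<open>w\<close> with
        \<open>t\<close> in the factor, which exists because \<open>t \<otimes> n\<close> is a
        common multiple. By \<open>short_divisor\<close>, a multiple of both \<open>a\<close> and
        \<open>a'\<close> is a multiple of some such \<open>t \<otimes> m\<close>, hence of
        \<open>w\<close>; so \<open>s\<close> is \<open>inv t \<otimes> w\<close>.\<close>
      obtain w where w: "pos_join G (Mb b) a t w"
        using B.ex_join[OF True t(2) tn(1)[OF n(1)]] n(2) tn(2)[OF n(1)] unfolding pos_le_def by blast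
      have w': "w \<in> Mb b" "inv a \<otimes> w \<in> Mb b" "inv t \<otimes> w \<in> Mb b" "w \<in> carrier G"
        and wmin: "\<And>e. e \<in> Mb b \<Longrightarrow> inv a \<otimes> e \<in> Mb b \<Longrightarrow> inv t \<otimes> e \<in> Mb b \<Longrightarrow> inv w \<otimes> e \<in> Mb b"
        using w S.sys_in unfolding pos_join_def pos_le_def by blast+
      have wn: "inv w \<otimes> (t \<otimes> m) \<in> Mb b" if "m \<in> N" "inv a \<otimes> (t \<otimes> m) \<in> Mb b" for m
        using wmin[OF tn(1)[OF that(1)] that(2) tn(2)[OF that(1)]] .
      have "(inv t \<otimes> w) \<otimes> (inv w \<otimes> (t \<otimes> n)) = n" using w'(4) N_subset(3)[OF n(1)] by (simp add: group_nf)
      then have n0: "inv t \<otimes> w \<in> N" using N_special(1)[OF w'(3) wn[OF n]] n(1) by simp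
      show ?thesis
      proof (intro bexI[of _ "inv t \<otimes> w"] ballI impI iffI)
        show "inv t \<otimes> w \<in> M" using w'(3) Mb_M by blast
      next
        fix f assume f: "f \<in> M" "inv a' \<otimes> f \<in> M" "inv a \<otimes> f \<in> M"
        obtain m where m: "m \<in> N" "inv a \<otimes> (t \<otimes> m) \<in> Mb b" "inv m \<otimes> (inv t \<otimes> f) \<in> M"
          using short[OF f] by blast
        have "(inv w \<otimes> (t \<otimes> m)) \<otimes> (inv m \<otimes> (inv t \<otimes> f)) \<in> M"
          using wn[OF m(1,2)] m(3) Mb_M by simp
        then show "inv (inv t \<otimes> w) \<otimes> (inv t \<otimes> f) \<in> M"
          using w'(4) N_subset(3)[OF m(1)] f(1) by (simp add: group_nf)
      next
        fix f assume f: "f \<in> M" "inv a' \<otimes> f \<in> M" "inv (inv t \<otimes> w) \<otimes> (inv t \<otimes> f) \<in> M"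
        have "(inv a \<otimes> w) \<otimes> (inv (inv t \<otimes> w) \<otimes> (inv t \<otimes> f)) \<in> M"
          using w'(2) f(3) Mb_M by simp
        then show "inv a \<otimes> f \<in> M" using w'(4) f(1) by (simp add: group_nf)
      qed
    qed
    then obtain s where s: "s \<in> M" "\<And>f. f \<in> M \<Longrightarrow> inv a' \<otimes> f \<in> M \<Longrightarrow>
      inv a \<otimes> f \<in> M \<longleftrightarrow> inv s \<otimes> (inv t \<otimes> f) \<in> M" by blast
    have "inv s \<otimes> (inv t \<otimes> d) \<in> M" using s(2)[OF dM a'(2)] a(2) by blast
    moreover have "inv (inv t \<otimes> a') \<otimes> (inv t \<otimes> d) \<in> M" using a'(2) by (simp add: group_nf)
    moreover have "inv t \<otimes> x \<otimes> x1 \<in> Mb (\<not> b)" using tx N_subset(1) x1(1) S.sys_mult by blast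
    moreover have "length xs1 < length xs" by (simp add: xs)
    ultimately obtain c where c: "pos_join G M s (inv t \<otimes> a') c"
      using 1(1)[rule_format, OF _ s(1) a'' _ x1(2)] unfolding d' by blast
    have c': "c \<in> M" "inv s \<otimes> c \<in> M" "inv (inv t \<otimes> a') \<otimes> c \<in> M"
      and cmin: "\<And>f. f \<in> M \<Longrightarrow> inv s \<otimes> f \<in> M \<Longrightarrow> inv (inv t \<otimes> a') \<otimes> f \<in> M \<Longrightarrow> inv c \<otimes> f \<in> M"
      using c unfolding pos_join_def pos_le_def by blast+
    have [simp]: "c \<in> carrier G" using c'(1) by simp
    have tc: "t \<otimes> c \<in> M" "inv a' \<otimes> (t \<otimes> c) \<in> M"
      using t(2) Mb_M c'(1,3) by (simp_all add: group_nf)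
    have "pos_join G M a a' (t \<otimes> c)"
      unfolding pos_join_def pos_le_def
    proof (intro conjI ballI impI)
      show "inv a \<otimes> (t \<otimes> c) \<in> M" using s(2)[OF tc] c'(2) by (simp add: group_nf)
    next
      fix f assume f: "f \<in> M" "inv a \<otimes> f \<in> M" "inv a' \<otimes> f \<in> M"
      have "inv c \<otimes> (inv t \<otimes> f) \<in> M"
      proof (rule cmin)
        show "inv t \<otimes> f \<in> M" using tail f by blast
        show "inv s \<otimes> (inv t \<otimes> f) \<in> M" using s(2) f by blast
        show "inv (inv t \<otimes> a') \<otimes> (inv t \<otimes> f) \<in> M" using f(1,3) by (simp add: group_nf)
      qed
      then show "inv (t \<otimes> c) \<otimes> f \<in> M" using f(1) by (simp add: group_nf)
    qed (rule tc)+
    then show ?thesis ..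
  qed
  show ?case
  proof (cases "a \<in> Mb b \<and> a' \<in> Mb b")
    case True
    then obtain u where "u \<in> Mb b" "inv a \<otimes> u \<in> Mb b" "inv a' \<otimes> u \<in> Mb b"
      using bound_in_factor[of a b a' x xs] x 1(6,7) by blast
    then obtain c where "pos_join G (Mb b) a a' c"
      using pos_pair.ex_join[OF pair[of b], of a a' u] True unfolding pos_le_def by blast
    then show ?thesis using join_lift True by blast
  next
    case False
    then show ?thesis
      using key[of a a'] key[of a' a] pos_join_sym[of M a a'] 1(2,3,6,7) by (auto simp: d_def)
  qed
qed

lemma M_bounded_joins: "bounded_joins G M"
  unfolding bounded_joins_def pos_le_def
proof (intro ballI impI)
  fix a b d assume "a \<in> M" "b \<in> M" "d \<in> M" "inv a \<otimes> d \<in> M" "inv b \<otimes> d \<in> M"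
  moreover obtain x xs where "x \<in> Mb True" "alt Mb H (\<not> True) xs" "d = x \<otimes> wprod G xs"
    using \<open>d \<in> M\<close> by (rule M_cases)
  ultimately show "\<exists>c. pos_join G M a b c" using join_ex by blast
qed

lemma amalgam_pair_opp: "amalgam_pair (opp G) A H Mb N"
proof (intro amalgam_pair.intro amalgam_pair_axioms.intro)
  show "amalgam_group (opp G) A H" by (rule amalgam_group_opp)
  fix b
  interpret B: pos_pair G "Mb b" by (rule pair)
  show "pos_pair (opp G) (Mb b)" by (rule B.pos_pair_opp)
  show "parabolic (opp G) (Mb b) N" using N_parabolic by simp
  show "A b = generate (opp G) (Mb b)" using A_eq generate_opp[OF group_axioms B.subset] by simp
  have "N \<subseteq> carrier G" using N_subset(3) by blast
  then show "H = generate (opp G) N" using H_eq generate_opp[OF group_axioms] by simp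
qed

lemma M_opp: "amalgam_pair.M (opp G) H Mb = M"
proof -
  interpret o: amalgam_pair "opp G" A H Mb N by (rule amalgam_pair_opp)
  show ?thesis
  proof
    show "o.M \<subseteq> M" unfolding o.M_def using Mb_M by (intro o.S.padded_least) auto
    show "M \<subseteq> o.M" unfolding M_def using o.Mb_M o.M.m_closed o.M.one_closed by (intro S.padded_least) auto
  qed
qed

text \<open>Left and right joins in the factor are joins in \<open>M\<close> by
  \<open>join_lift\<close>, so closure of \<open>P\<close> under joins passes to its part in the
  factor.\<close>

lemma parabolic_restrict:
  assumes P: "parabolic G M P"
  shows "parabolic G (Mb b) (P \<inter> Mb b)"
  unfolding parabolic_def
proof (intro conjI ballI impI allI)
  interpret o: amalgam_pair "opp G" A H Mb N by (rule amalgam_pair_opp)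
  note P' = parabolicD[OF P]
  show "submonoid (P \<inter> Mb b) G"
    by (rule submonoid.intro) (use P'(3,8,9) S.sys_one S.sys_mult in blast)+
  show "x \<in> P \<inter> Mb b" "y \<in> P \<inter> Mb b" if "x \<in> Mb b" "y \<in> Mb b" "x \<otimes> y \<in> P \<inter> Mb b" for x y
    using P'(4)[of x y] P'(5)[of x y] that Mb_M by blast+
  show "c \<in> P \<inter> Mb b" if "x \<in> P \<inter> Mb b" "y \<in> P \<inter> Mb b" "pos_join G (Mb b) x y c" for x y c
    using P'(6)[of x y c] join_lift[of x b y c] that unfolding pos_join_def by blast
  show "c \<in> P \<inter> Mb b" if "x \<in> P \<inter> Mb b" "y \<in> P \<inter> Mb b" "pos_join (opp G) (Mb b) x y c" for x y c
    using P'(7)[of x y c] o.join_lift[of x b y c] that unfolding M_opp pos_join_def by blast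
qed simp

end

section \<open>Standard parabolic subgroups of an amalgam\<close>

lemma (in alt_system) padded_inv:
  assumes "group G" and S_inv: "\<And>x b. x \<in> S b \<Longrightarrow> inv x \<in> S b" and g: "g \<in> padded G S H b"
  shows "inv g \<in> padded G S H b"
proof -
  interpret group G by fact
  have w: "inv (wprod G xs) \<in> padded G S H b" if "alt S H c xs" for c xs
    using that
  proof (induction xs arbitrary: c)
    case Nil
    then show ?case using sys_subset_padded[of b b] sys_one[of b] by auto
  next
    case (Cons x xs)
    then have x: "x \<in> S c" "alt S H (\<not> c) xs" by simp_all
    have "inv (wprod G xs) \<otimes> inv x \<in> padded G S H b"
      using Cons.IH[OF x(2)] S_inv[OF x(1)] sys_subset_padded by (intro padded_mult) blast+
    then show ?case using sys_in[OF x(1)] alt_in[OF x(2)] by (simp add: inv_mult_group)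
  qed
  obtain x xs where x: "x \<in> S b" "alt S H (\<not> b) xs" "g = x \<otimes> wprod G xs"
    using g by (rule paddedE)
  have "inv (wprod G xs) \<otimes> inv x \<in> padded G S H b"
    using w[OF x(2)] S_inv[OF x(1)] sys_subset_padded by (intro padded_mult) blast+
  then show ?thesis using sys_in[OF x(1)] alt_in[OF x(2)] x(3) by (simp add: inv_mult_group)
qed

context amalgam_pair
begin

text \<open>By \<open>gen_Int_A\<close> this turns out to be the full intersection of
  \<open>generate G P\<close> with the factor \<open>A b\<close>.\<close>

definition K where "K P b = generate G (P \<inter> Mb b)"

lemma K_subset:
  shows "K P b \<subseteq> A b" "x \<in> K P b \<Longrightarrow> x \<in> A b" "x \<in> K P b \<Longrightarrow> x \<in> carrier G"
proof -
  show "K P b \<subseteq> A b" unfolding K_def A_eq by (intro mono_generate) blast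
  then show "x \<in> K P b \<Longrightarrow> x \<in> A b" "x \<in> K P b \<Longrightarrow> x \<in> carrier G"
    using A.sys_in by blast+
qed

lemma K_closed: "\<one> \<in> K P b" "x \<in> K P b \<Longrightarrow> y \<in> K P b \<Longrightarrow> x \<otimes> y \<in> K P b"
  "x \<in> K P b \<Longrightarrow> inv x \<in> K P b"
  unfolding K_def using gen_closed(2-4)[of "P \<inter> Mb b"] S.sys_carrier[of b] by (auto simp: le_infI2)

text \<open>The intersection property of the factor, applied to \<open>N\<close> and the part of
  \<open>P\<close> in it. It makes the two groups \<open>K P b\<close> agree on \<open>H\<close>,
  which is the condition \<open>sys_flip\<close> for words in these letters.\<close>

lemma K_H:
  assumes P: "parabolic G M P" and "x \<in> K P b" "x \<in> H"
  shows "x \<in> generate G (P \<inter> N)"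
proof -
  have "x \<in> generate G (P \<inter> Mb b) \<inter> generate G N"
    using assms(2,3) unfolding K_def H_eq by blast
  then have "x \<in> generate G (P \<inter> Mb b \<inter> N)"
    using pos_pair.inter[OF pair parabolic_restrict[OF P] N_parabolic] by blast
  moreover have "P \<inter> Mb b \<inter> N = P \<inter> N" using N_subset(1) by blast
  ultimately show ?thesis by simp
qed

lemma generate_N_K: "generate G (P \<inter> N) \<subseteq> K P b" "generate G (P \<inter> N) \<subseteq> H"
  unfolding K_def H_eq using N_subset(1) by (intro mono_generate; blast)+

lemma PN_parabolic:
  assumes "parabolic G M P"
  shows "parabolic G (Mb b) (P \<inter> N)"
proof -
  have "P \<inter> Mb b \<inter> N = P \<inter> N" using N_subset(1) by blast
  then show ?thesis using parabolic_Int[OF parabolic_restrict[OF assms, of b] N_parabolic] by simp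
qed

lemma K_system:
  assumes P: "parabolic G M P"
  shows "alt_system G (K P) H"
proof (intro alt_system.intro alt_system_axioms.intro)
  show "monoid G" by (rule is_monoid)
  show "K P b \<subseteq> carrier G" for b using K_subset(3) by blast
  show "x \<in> K P (\<not> b)" if "x \<in> K P b" "x \<in> H" for x b
    using K_H[OF P that] generate_N_K(1) by blast
qed (rule K_closed; assumption)+

lemma P_system:
  assumes P: "parabolic G M P"
  shows "alt_system G (\<lambda>b. P \<inter> Mb b) H"
proof (intro alt_system.intro alt_system_axioms.intro)
  note P' = parabolicD[OF P]
  show "monoid G" by (rule is_monoid)
  show "P \<inter> Mb b \<subseteq> carrier G" "\<one> \<in> P \<inter> Mb b" for b using P'(3,8) S.sys_one by blast+
  show "x \<otimes> y \<in> P \<inter> Mb b" if "x \<in> P \<inter> Mb b" "y \<in> P \<inter> Mb b" for x y b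
    using that P'(9) S.sys_mult by blast
  show "x \<in> P \<inter> Mb (\<not> b)" if "x \<in> P \<inter> Mb b" "x \<in> H" for x b
    using that S.sys_flip by blast
qed

lemma P_padded:
  assumes P: "parabolic G M P" and p: "p \<in> P"
  shows "p \<in> padded G (\<lambda>b. P \<inter> Mb b) H b"
proof -
  note P' = parabolicD[OF P]
  have w: "alt (\<lambda>b. P \<inter> Mb b) H c xs" if "alt Mb H c xs" "wprod G xs \<in> P" for c xs
    using that
  proof (induction xs arbitrary: c)
    case (Cons x xs)
    then have x: "x \<in> Mb c" "alt Mb H (\<not> c) xs" "x \<otimes> wprod G xs \<in> P" by simp_all
    have "x \<in> P" "wprod G xs \<in> P"
      using P'(4)[OF _ _ x(3)] P'(5)[OF _ _ x(3)] Mb_M[OF x(1)] alt_M[OF x(2)] by blast+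
    then show ?case using Cons.IH[OF x(2)] Cons.prems(1) by simp
  qed simp
  have "p \<in> M" using p P'(2) by blast
  then obtain x xs where x: "x \<in> Mb b" "alt Mb H (\<not> b) xs" "p = x \<otimes> wprod G xs" by (rule M_cases)
  have xP: "x \<otimes> wprod G xs \<in> P" using x(3) p by simp
  have "x \<in> P" "wprod G xs \<in> P"
    using P'(4)[OF _ _ xP] P'(5)[OF _ _ xP] Mb_M[OF x(1)] alt_M[OF x(2)] by blast+
  then show ?thesis unfolding x(3) using x w by (intro paddedI) blast+
qed

text \<open>Words in the letters \<open>K P\<close> form a subgroup that contains \<open>P\<close>,
  because the letters of an element of \<open>P\<close> are factors of it. Such words are also
  reduced words over \<open>A\<close>, so normal forms for different parabolic submonoids can be
  compared in the same group.\<close>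

lemma generate_padded:
  assumes P: "parabolic G M P"
  shows "generate G P = padded G (K P) H b"
proof
  interpret K: alt_system G "K P" H by (rule K_system[OF P])
  interpret PM: alt_system G "\<lambda>b. P \<inter> Mb b" H by (rule P_system[OF P])
  note P' = parabolicD[OF P]
  have "padded G (\<lambda>b. P \<inter> Mb b) H b \<subseteq> padded G (K P) H b"
  proof (rule PM.padded_least)
    show "P \<inter> Mb c \<subseteq> padded G (K P) H b" for c
      using K.sys_subset_padded[of c b] gen_subset[of "P \<inter> Mb c"] unfolding K_def by (rule subset_trans[rotated])
    show "\<one> \<in> padded G (K P) H b" using K.sys_subset_padded[of b b] K.sys_one[of b] by blast
  qed (rule K.padded_mult)
  then have "P \<subseteq> padded G (K P) H b" using P_padded[OF P] by blast
  moreover have "subgroup (padded G (K P) H b) G"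
    using K.padded_closed K.padded_mult K.sys_subset_padded[of b b] K.sys_one[of b]
      K.padded_inv[OF group_axioms] K_closed(3)
    by (intro subgroup.intro) blast+
  ultimately show "generate G P \<subseteq> padded G (K P) H b" by (rule gen_least)
  show "padded G (K P) H b \<subseteq> generate G P"
  proof (rule K.padded_least)
    show "K P c \<subseteq> generate G P" for c unfolding K_def by (rule mono_generate) blast
  qed (use gen_closed[OF P'(3)] in blast)+
qed

lemma gen_E:
  assumes "parabolic G M P" "g \<in> generate G P"
  obtains x xs where "x \<in> K P b" "alt (K P) H (\<not> b) xs" "g = x \<otimes> wprod G xs"
  using assms(2) unfolding generate_padded[OF assms(1), of b] by (rule paddedE)

lemma alt_K_A: "alt (K P) H b xs \<Longrightarrow> alt A H b xs"
  using alt_mono[of "K P" H b xs A] K_subset(1) by blast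

lemma alt_K_gen:
  assumes "parabolic G M P" "alt (K P) H b xs"
  shows "wprod G xs \<in> generate G P"
  using alt_system.alt_padded[OF K_system[OF assms(1)] assms(2)] generate_padded[OF assms(1)] by blast

lemma K_gen: "K P b \<subseteq> generate G P"
  unfolding K_def by (rule mono_generate) blast

lemma gen_Int_A:
  assumes P: "parabolic G M P" and g: "g \<in> generate G P" "g \<in> A b"
  shows "g \<in> K P b"
proof -
  obtain x xs where x: "x \<in> K P b" "alt (K P) H (\<not> b) xs" "g = x \<otimes> wprod G xs"
    using gen_E[OF P g(1)] .
  have "x \<otimes> wprod G xs = g \<otimes> wprod G []" using x(3) A.sys_in[OF g(2)] by simp
  then have "length xs = 0"
    using padded_unique[OF K_subset(2)[OF x(1)] g(2) alt_K_A[OF x(2)], of "[]"] by simp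
  then show ?thesis using x K_subset(3) by simp
qed

lemma gen_Int_H: "parabolic G M P \<Longrightarrow> g \<in> generate G P \<Longrightarrow> g \<in> H \<Longrightarrow> g \<in> generate G (P \<inter> N)"
  using gen_Int_A[of P g True] K_H H_subset(2) by blast

text \<open>The first letters lie in one coset of \<open>H\<close>. The set \<open>NR b\<close>
  represents it inside \<open>K P b\<close> and inside \<open>K Q b\<close>, and uniqueness makes
  the two representatives one element \<open>t\<close>, which the intersection property of the
  factor places in \<open>generate G (P \<inter> Q)\<close>. After \<open>t\<close> is stripped off,
  both remainders lie in \<open>H\<close> and are absorbed by the second letters.\<close>

lemma inter_words:
  assumes P: "parabolic G M P" and Q: "parabolic G M Q"
    and "x \<in> K P b" "alt (K P) H (\<not> b) xs" "y \<in> K Q b" "alt (K Q) H (\<not> b) ys"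
    and "x \<otimes> wprod G xs = y \<otimes> wprod G ys"
  shows "x \<otimes> wprod G xs \<in> generate G (P \<inter> Q)"
  using assms(3-)
proof (induction xs arbitrary: x y b ys)
  case Nil
  have c: "x \<in> carrier G" "y \<in> carrier G" using Nil.prems K_subset(3) by blast+
  have "length [] = length ys"
    using padded_unique[of x b y "[]" ys] Nil.prems K_subset(2)[of x P b] K_subset(2)[of y Q b]
      alt_K_A[of Q "\<not> b" ys] by simp
  then have "x = y" using Nil.prems(5) c by simp
  then have "x \<in> generate G (P \<inter> Mb b \<inter> (Q \<inter> Mb b))"
    using pos_pair.inter[OF pair parabolic_restrict[OF P] parabolic_restrict[OF Q]] Nil.prems(1,3)
    unfolding K_def by blast
  moreover have "generate G (P \<inter> Mb b \<inter> (Q \<inter> Mb b)) \<subseteq> generate G (P \<inter> Q)"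
    by (rule mono_generate) blast
  ultimately show ?case using c by auto
next
  case (Cons x1 xs)
  have eq: "inv y \<otimes> x \<in> H" "length (x1 # xs) = length ys"
    using padded_unique[OF K_subset(2)[OF Cons.prems(1)] K_subset(2)[OF Cons.prems(3)]
      alt_K_A[OF Cons.prems(2)] alt_K_A[OF Cons.prems(4)] Cons.prems(5)] by blast+
  then obtain y1 ys1 where ys: "ys = y1 # ys1" by (cases ys) auto
  have x1: "x1 \<in> K P (\<not> b)" "alt (K P) H (\<not> \<not> b) xs" "y1 \<in> K Q (\<not> b)" "alt (K Q) H (\<not> \<not> b) ys1"
    using Cons.prems ys by simp_all
  obtain t where t: "t \<in> NR b" "t \<in> K P b" "inv t \<otimes> x \<in> H"
    using NR_parabolic[OF parabolic_restrict[OF P]] Cons.prems(1) unfolding K_def by metis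
  obtain s where s: "s \<in> NR b" "s \<in> K Q b" "inv s \<otimes> y \<in> H"
    using NR_parabolic[OF parabolic_restrict[OF Q]] Cons.prems(3) unfolding K_def by metis
  have [simp]: "x \<in> carrier G" "y \<in> carrier G" "t \<in> carrier G" "s \<in> carrier G" "x1 \<in> carrier G"
    "y1 \<in> carrier G" "wprod G xs \<in> carrier G" "wprod G ys1 \<in> carrier G"
    using Cons.prems t s x1 K_subset(3) alt_K_A A.alt_in by blast+
  have "inv s \<otimes> t = (inv s \<otimes> y) \<otimes> (inv y \<otimes> x) \<otimes> inv (inv t \<otimes> x)" by (simp add: group_nf)
  then have "inv s \<otimes> t \<in> H" using s(3) eq(1) t(3) H_closed by metis
  then have "s = t" using NR_unique s t by blast
  have sg: "t \<in> generate G (P \<inter> Mb b \<inter> (Q \<inter> Mb b))"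
    using pos_pair.inter[OF pair parabolic_restrict[OF P] parabolic_restrict[OF Q]] t(2) s(2) \<open>s = t\<close>
    unfolding K_def by blast
  moreover have "generate G (P \<inter> Mb b \<inter> (Q \<inter> Mb b)) \<subseteq> generate G (P \<inter> Q)"
    by (rule mono_generate) blast
  ultimately have tPQ: "t \<in> generate G (P \<inter> Q)" by blast
  have "inv t \<otimes> x \<in> K P b" "inv t \<otimes> y \<in> K Q b"
    using Cons.prems t s \<open>s = t\<close> K_closed by blast+
  then have h: "inv t \<otimes> x \<in> K P (\<not> b)" "inv t \<otimes> y \<in> K Q (\<not> b)"
    using t(3) s(3) \<open>s = t\<close> alt_system.sys_flip[OF K_system[OF P]] alt_system.sys_flip[OF K_system[OF Q]]
    by blast+
  have "(inv t \<otimes> x \<otimes> x1) \<otimes> wprod G xs = inv t \<otimes> (x \<otimes> wprod G (x1 # xs))" by (simp add: group_nf)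
  also have "\<dots> = (inv t \<otimes> y \<otimes> y1) \<otimes> wprod G ys1" using Cons.prems(5) ys by (simp add: group_nf)
  finally have "(inv t \<otimes> x \<otimes> x1) \<otimes> wprod G xs \<in> generate G (P \<inter> Q)"
    using Cons.IH[of "inv t \<otimes> x \<otimes> x1" "\<not> b" "inv t \<otimes> y \<otimes> y1" ys1] h x1 K_closed(2) by blast
  then have "t \<otimes> ((inv t \<otimes> x \<otimes> x1) \<otimes> wprod G xs) \<in> generate G (P \<inter> Q)"
    by (rule generate.eng[OF tPQ])
  then show ?case by (simp add: group_nf)
qed

lemma M_inter:
  assumes P: "parabolic G M P" and Q: "parabolic G M Q"
  shows "generate G P \<inter> generate G Q \<subseteq> generate G (P \<inter> Q)"
proof
  fix g assume g: "g \<in> generate G P \<inter> generate G Q"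
  obtain x xs where x: "x \<in> K P True" "alt (K P) H (\<not> True) xs" "g = x \<otimes> wprod G xs"
    using gen_E[OF P] g by blast
  obtain y ys where y: "y \<in> K Q True" "alt (K Q) H (\<not> True) ys" "g = y \<otimes> wprod G ys"
    using gen_E[OF Q] g by blast
  show "g \<in> generate G (P \<inter> Q)" using inter_words[OF P Q x(1,2) y(1,2)] x(3) y(3) by simp
qed

lemma M_parabolic: "parabolic G M M"
  by (rule parabolic_self) (rule M_submonoid)

lemma K_M: "K M = A"
proof
  fix b
  have "M \<inter> Mb b = Mb b" using Mb_M by blast
  then show "K M b = A b" by (simp add: K_def A_eq)
qed

lemma gen_M: "generate G M = padded G A H b"
  using generate_padded[OF M_parabolic] by (simp add: K_M)

section \<open>Torsion in an amalgam\<close>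

lemma pow_conj:
  assumes "z \<in> carrier G" "g \<in> carrier G"
  shows "(z \<otimes> g \<otimes> inv z) [^] (n::nat) = z \<otimes> g [^] n \<otimes> inv z"
  using assms by (induction n) (simp_all add: group_nf)

text \<open>Cyclic reduction: conjugating by the last letter shortens words of odd length.\<close>

lemma word_torsion:
  assumes tf: "\<And>b x n. x \<in> A b \<Longrightarrow> n > 0 \<Longrightarrow> x [^] (n::nat) = \<one> \<Longrightarrow> x = \<one>"
    and "alt A H b xs" "n > 0" "wprod G xs [^] (n::nat) = \<one>"
  shows "wprod G xs = \<one>"
  using assms(2,4)
proof (induction xs arbitrary: b rule: length_induct)
  case (1 xs)
  have sub: "set xs \<subseteq> carrier G" using alt_set[OF 1(2) A.sys_carrier] .
  show ?case
  proof (cases "even (length xs)")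
    case True
    \<comment> \<open>In even length the first and last letters lie in different factors, so
      repeated concatenation is again reduced and represents the power; \<open>alt_notin\<close>
      leaves only the empty word.\<close>
    have "alt A H b (concat (replicate k xs)) \<and> even (length (concat (replicate k xs))) \<and>
        wprod G (concat (replicate k xs)) = wprod G xs [^] k" for k
    proof (induction k)
      case (Suc k)
      have "set (concat (replicate k xs)) \<subseteq> carrier G" using sub by (induction k) auto
      then show ?case
        using Suc True 1(2) sub nat_pow_Suc2[OF A.alt_in[OF 1(2)], of k]
        by (simp add: alt_append wprod_append is_monoid)
    qed simp
    from this[of n] have "concat (replicate n xs) = []"
      using alt_notin[of b "concat (replicate n xs)"] 1(3) H_closed(3) by metis
    then have "xs = []" using assms(3) by auto
    then show ?thesis by simp
  next
    case False
    then obtain x ys where xs: "xs = x # ys" by (cases xs) auto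
    have xb: "x \<in> A b" "x \<in> carrier G" using 1(2) xs A.sys_in by auto
    show ?thesis
    proof (cases ys rule: rev_cases)
      case Nil
      then show ?thesis using tf[OF xb(1) assms(3)] 1(3) xs xb by simp
    next
      case (snoc zs z)
      have ev: "odd (length zs)" using False xs snoc by simp
      have al: "alt A H (\<not> b) zs" "z \<in> A b"
        using 1(2) xs snoc ev by (simp_all add: alt_append)
      have [simp]: "z \<in> carrier G" "x \<in> carrier G" "wprod G zs \<in> carrier G"
        using al xb A.sys_in A.alt_in by blast+
      have sz: "set zs \<subseteq> carrier G" using sub xs snoc by auto
      have g: "wprod G xs = x \<otimes> (wprod G zs \<otimes> z)"
        using xs snoc sz by (simp add: wprod_append is_monoid)
      \<comment> \<open>In odd length greater than one the first and last letters lie in the same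
        factor. Conjugation by \<open>z\<close> merges them, which saves one letter, or two if
        \<open>z \<otimes> x\<close> falls into \<open>H\<close> and is absorbed by the next
        letter.\<close>
      have conj: "z \<otimes> wprod G xs \<otimes> inv z = (z \<otimes> x) \<otimes> wprod G zs" unfolding g by (simp add: group_nf)
      have "(z \<otimes> wprod G xs \<otimes> inv z) [^] n = z \<otimes> wprod G xs [^] n \<otimes> inv z"
        by (rule pow_conj) (simp_all add: g)
      then have tor: "((z \<otimes> x) \<otimes> wprod G zs) [^] n = \<one>" using 1(3) conj by simp
      have zx: "z \<otimes> x \<in> A b" using al(2) xb(1) A.sys_mult by blast
      have "(z \<otimes> x) \<otimes> wprod G zs = \<one>"
      proof (cases "z \<otimes> x \<in> H")
        case False
        then have "alt A H b ((z \<otimes> x) # zs)" using zx al by simp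
        moreover have "length ((z \<otimes> x) # zs) < length xs" using xs snoc by simp
        ultimately show ?thesis using 1(1) tor by (metis wprod.simps(2))
      next
        case True
        obtain y us where zs: "zs = y # us" using ev by (cases zs) auto
        have y: "y \<in> A (\<not> b)" "y \<notin> H" "alt A H (\<not> \<not> b) us" using al(1) zs by simp_all
        have [simp]: "y \<in> carrier G" "wprod G us \<in> carrier G" using y A.sys_in A.alt_in by blast+
        have "z \<otimes> x \<otimes> y \<notin> H"
        proof
          assume "z \<otimes> x \<otimes> y \<in> H"
          then have "inv (z \<otimes> x) \<otimes> (z \<otimes> x \<otimes> y) \<in> H" using True H_closed(1,2) by blast
          then show False using y(2) by (simp add: inv_cancel_left)
        qed
        then have "alt A H (\<not> b) ((z \<otimes> x \<otimes> y) # us)"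
          using y True H_subset(2) A.sys_mult by simp
        moreover have "length ((z \<otimes> x \<otimes> y) # us) < length xs" using xs snoc zs by simp
        moreover have "wprod G ((z \<otimes> x \<otimes> y) # us) = (z \<otimes> x) \<otimes> wprod G zs"
          by (simp add: zs m_assoc)
        ultimately show ?thesis using 1(1) tor by metis
      qed
      then have "z \<otimes> wprod G xs \<otimes> inv z = \<one>" using conj by simp
      then have "inv (inv z) \<otimes> (wprod G xs \<otimes> inv z) = \<one>" by (simp add: g m_assoc)
      then have "inv z = wprod G xs \<otimes> inv z" by (subst (asm) inv_mult_eq_one_iff) (simp_all add: g)
      then show ?thesis by (simp add: g)
    qed
  qed
qed

lemma M_torsion:
  assumes tf: "\<And>b x n. x \<in> A b \<Longrightarrow> n > 0 \<Longrightarrow> x [^] (n::nat) = \<one> \<Longrightarrow> x = \<one>"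
    and g: "g \<in> generate G M" "n > 0" "g [^] (n::nat) = \<one>"
  shows "g = \<one>"
proof -
  obtain x xs where x: "x \<in> A True" "alt A H (\<not> True) xs" "g = x \<otimes> wprod G xs"
    using g(1) unfolding gen_M[of True] by (rule paddedE)
  have [simp]: "x \<in> carrier G" "wprod G xs \<in> carrier G" using x A.sys_in A.alt_in by blast+
  show ?thesis
  proof (cases "x \<in> H")
    case False
    then have "alt A H True (x # xs)" using x by simp
    from word_torsion[OF tf this g(2)] show ?thesis using g(3) x(3) by simp
  next
    case True
    show ?thesis
    proof (cases xs)
      case Nil
      then show ?thesis using tf[OF x(1) g(2)] g(3) x(3) by simp
    next
      case (Cons y ys)
      then have y: "y \<in> A False" "y \<notin> H" "alt A H True ys" using x(2) by simp_all
      have [simp]: "y \<in> carrier G" "wprod G ys \<in> carrier G" using y A.sys_in A.alt_in by blast+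
      have "x \<otimes> y \<notin> H"
      proof
        assume "x \<otimes> y \<in> H"
        then have "inv x \<otimes> (x \<otimes> y) \<in> H" using True H_closed(1,2) by blast
        then show False using y(2) by (simp add: inv_cancel_left)
      qed
      then have "alt A H False ((x \<otimes> y) # ys)" using y True H_subset(2) A.sys_mult by simp
      from word_torsion[OF tf this g(2)] show ?thesis using g(3) x(3) Cons by (simp add: m_assoc)
    qed
  qed
qed

section \<open>Extension of homomorphisms from a parabolic submonoid\<close>

text \<open>The extension is read off from its graph, the subgroup of \<open>G \<times> L\<close> generated by the graphs on
  the two factors.\<close>

lemma M_extends:
  assumes P: "parabolic G M P" and ext: "\<And>b. extends_homs G (P \<inter> Mb b)"
  shows "extends_homs G P"
  unfolding extends_homs_def
proof (intro allI impI)
  fix L :: "'g monoid" and f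
  assume L: "group L" and fc: "f \<in> P \<rightarrow> carrier L"
    and fm: "\<forall>a\<in>P. \<forall>b\<in>P. f (a \<otimes> b) = f a \<otimes>\<^bsub>L\<^esub> f b"
  interpret L: group L by (rule L)
  interpret K: alt_system G "K P" H by (rule K_system[OF P])
  interpret PM: alt_system G "\<lambda>b. P \<inter> Mb b" H by (rule P_system[OF P])
  note P' = parabolicD[OF P]
  have "\<exists>\<psi>\<in>K P b \<rightarrow> carrier L. (\<forall>x\<in>K P b. \<forall>y\<in>K P b. \<psi> (x \<otimes> y) = \<psi> x \<otimes>\<^bsub>L\<^esub> \<psi> y) \<and>
      (\<forall>a\<in>P \<inter> Mb b. \<psi> a = f a)" for b
    using ext[of b, unfolded extends_homs_def, rule_format, OF L, of f] fc fm unfolding K_def by auto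
  then obtain \<psi> where \<psi>: "\<And>b. \<psi> b \<in> K P b \<rightarrow> carrier L"
    "\<And>b x y. x \<in> K P b \<Longrightarrow> y \<in> K P b \<Longrightarrow> \<psi> b (x \<otimes> y) = \<psi> b x \<otimes>\<^bsub>L\<^esub> \<psi> b y"
    "\<And>b a. a \<in> P \<Longrightarrow> a \<in> Mb b \<Longrightarrow> \<psi> b a = f a"
    by (metis IntI)
  have \<psi>c: "\<psi> b x \<in> carrier L" if "x \<in> K P b" for b x using \<psi>(1)[of b] that by blast
  have \<psi>1: "\<psi> b \<one> = \<one>\<^bsub>L\<^esub>" for b
    using \<psi>(2)[OF K_closed(1) K_closed(1), of b] \<psi>c[OF K_closed(1), of b] by simp
  \<comment> \<open>\<open>K_H\<close> confines \<open>x\<close> to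
    \<open>generate G (P \<inter> N)\<close>, and there both maps are homomorphisms that restrict to
    \<open>f\<close> on \<open>P \<inter> N\<close>.\<close>
  have agree: "\<psi> b x = \<psi> (\<not> b) x" if "x \<in> K P b" "x \<in> H" for b x
  proof (rule hom_on_generate_eq[OF L, where Q = "P \<inter> N" and f = "\<psi> b" and g = "\<psi> (\<not> b)"])
    show "P \<inter> N \<subseteq> carrier G" using P'(3) by blast
    show "x \<in> generate G (P \<inter> N)" by (rule K_H[OF P that])
    have sub: "y \<in> K P c" if "y \<in> generate G (P \<inter> N)" for y c
      using that generate_N_K(1)[of P c] by blast
    show "\<psi> b y \<in> carrier L" "\<psi> (\<not> b) y \<in> carrier L" if "y \<in> generate G (P \<inter> N)" for y
      using \<psi>c sub[OF that] by blast+
    show "\<psi> b (y \<otimes> z) = \<psi> b y \<otimes>\<^bsub>L\<^esub> \<psi> b z" "\<psi> (\<not> b) (y \<otimes> z) = \<psi> (\<not> b) y \<otimes>\<^bsub>L\<^esub> \<psi> (\<not> b) z"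
      if "y \<in> generate G (P \<inter> N)" "z \<in> generate G (P \<inter> N)" for y z
      using \<psi>(2) sub[OF that(1)] sub[OF that(2)] by blast+
    show "\<psi> b y = \<psi> (\<not> b) y" if "y \<in> P \<inter> N" for y
      using \<psi>(3)[of y b] \<psi>(3)[of y "\<not> b"] that N_subset(1) by simp
  qed
  define E where "E = G \<times>\<times> L"
  define S where "S b = (\<lambda>x. (x, \<psi> b x)) ` K P b" for b
  \<comment> \<open>Whether a letter of the graph is amalgamated is decided by its first component
    alone.\<close>
  define H' where "H' = H \<times> (UNIV :: 'g set)"
  interpret E: group E unfolding E_def by (rule DirProd_group) (rule group_axioms, rule L)
  have E_simps: "(a, l) \<otimes>\<^bsub>E\<^esub> (c, m) = (a \<otimes> c, l \<otimes>\<^bsub>L\<^esub> m)" "\<one>\<^bsub>E\<^esub> = (\<one>, \<one>\<^bsub>L\<^esub>)" for a c l m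
    by (simp_all add: E_def)
  interpret ES: alt_system E S H'
  proof (intro alt_system.intro alt_system_axioms.intro)
    show "monoid E" by (rule E.is_monoid)
    show "S b \<subseteq> carrier E" for b unfolding S_def E_def using K.sys_in \<psi>c by auto
    show "\<one>\<^bsub>E\<^esub> \<in> S b" for b unfolding S_def E_simps using K_closed(1) \<psi>1 by (intro image_eqI[of _ _ \<one>]) simp_all
    show "x \<otimes>\<^bsub>E\<^esub> y \<in> S b" if xy: "x \<in> S b" "y \<in> S b" for x y b
    proof -
      obtain u v where "u \<in> K P b" "x = (u, \<psi> b u)" "v \<in> K P b" "y = (v, \<psi> b v)"
        using xy unfolding S_def by blast
      then show ?thesis
        unfolding S_def using \<psi>(2) K_closed(2) by (intro image_eqI[of _ _ "u \<otimes> v"]) (simp_all add: E_simps)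
    qed
    show "x \<in> S (\<not> b)" if x: "x \<in> S b" "x \<in> H'" for x b
    proof -
      obtain u where u: "u \<in> K P b" "u \<in> H" "x = (u, \<psi> b u)" using x unfolding S_def H'_def by blast
      show ?thesis
        unfolding u(3) agree[OF u(1,2)] S_def using K.sys_flip[OF u(1,2)] by (rule imageI)
    qed
  qed
  define \<Gamma> where "\<Gamma> = padded E S H' True"
  have S_inv: "inv\<^bsub>E\<^esub> x \<in> S b" if xS: "x \<in> S b" for x b
  proof -
    obtain y where y: "y \<in> K P b" "x = (y, \<psi> b y)" using xS unfolding S_def by blast
    have "\<psi> b (inv y) \<otimes>\<^bsub>L\<^esub> \<psi> b y = \<one>\<^bsub>L\<^esub>"
      using \<psi>(2)[OF K_closed(3)[OF y(1)] y(1)] \<psi>1 K.sys_in[OF y(1)] by simp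
    then have "inv\<^bsub>L\<^esub> \<psi> b y = \<psi> b (inv y)"
      using \<psi>c K_closed(3) y(1) by (intro L.inv_equality) blast+
    moreover have "inv\<^bsub>E\<^esub> x = (inv y, inv\<^bsub>L\<^esub> \<psi> b y)"
      unfolding E_def y(2) using K.sys_in \<psi>c y(1) by (intro inv_DirProd group_axioms L) blast+
    ultimately show ?thesis unfolding S_def using K_closed(3)[OF y(1)] by simp
  qed
  have fst_alt: "alt (K P) H b (map fst ws) \<and> fst (wprod E ws) = wprod G (map fst ws)"
    if "alt S H' b ws" for b ws
    using that
  proof (induction ws arbitrary: b)
    case Nil
    then show ?case by (simp add: E_simps)
  next
    case (Cons w ws)
    moreover have "fst (w \<otimes>\<^bsub>E\<^esub> wprod E ws) = fst w \<otimes> fst (wprod E ws)"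
      by (cases w, cases "wprod E ws") (simp add: E_simps)
    ultimately show ?case by (auto simp: S_def H'_def)
  qed
  \<comment> \<open>The first components of a reduced word over the graphs form a reduced word over
    \<open>A\<close>. A trivial first component leaves only the padding letter, whose second
    component is then the image of \<open>\<one>\<close>. Hence the subgroup is the graph of a
    function.\<close>
  have kernel: "l = \<one>\<^bsub>L\<^esub>" if l: "(\<one>, l) \<in> \<Gamma>" for l
  proof -
    obtain x ws where x: "x \<in> S True" "alt S H' (\<not> True) ws" "(\<one>, l) = x \<otimes>\<^bsub>E\<^esub> wprod E ws"
      using l unfolding \<Gamma>_def by (rule paddedE)
    then obtain y where y: "y \<in> K P True" "x = (y, \<psi> True y)" unfolding S_def by blast
    note w = fst_alt[OF x(2)]
    obtain w1 w2 where ww: "wprod E ws = (w1, w2)" by (cases "wprod E ws")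
    have "fst (x \<otimes>\<^bsub>E\<^esub> wprod E ws) = \<one>" unfolding x(3)[symmetric] by simp
    then have "y \<otimes> wprod G (map fst ws) = \<one>"
      using w y(2) ww by (simp add: E_simps)
    then have "y \<otimes> wprod G (map fst ws) = \<one> \<otimes> wprod G []" by simp
    then have "length (map fst ws) = 0"
      using padded_unique[OF K_subset(2)[OF y(1)] A.sys_one alt_K_A[OF w[THEN conjunct1]], of "[]"] by simp
    then have "ws = []" by simp
    then have "(\<one>, l) = x" using x(1,3) ES.sys_in by simp
    then show ?thesis using y \<psi>1 by simp
  qed
  have unique: "l = m" if "(g, l) \<in> \<Gamma>" "(g, m) \<in> \<Gamma>" for g l m
  proof -
    have c: "g \<in> carrier G" "l \<in> carrier L" "m \<in> carrier L"
      using that ES.padded_closed unfolding \<Gamma>_def E_def by auto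
    have "inv\<^bsub>E\<^esub> (g, l) \<otimes>\<^bsub>E\<^esub> (g, m) \<in> \<Gamma>"
      using that ES.padded_inv[OF E.group_axioms S_inv] ES.padded_mult unfolding \<Gamma>_def by blast
    moreover have "inv\<^bsub>E\<^esub> (g, l) = (inv g, inv\<^bsub>L\<^esub> l)"
      unfolding E_def using c by (intro inv_DirProd group_axioms L)
    ultimately have "inv\<^bsub>L\<^esub> l \<otimes>\<^bsub>L\<^esub> m = \<one>\<^bsub>L\<^esub>" using c by (intro kernel) (simp add: E_simps)
    then show ?thesis using c L.inv_mult_eq_one_iff by blast
  qed
  have \<Gamma>_S: "(x, \<psi> c x) \<in> \<Gamma>" if "x \<in> K P c" for x c
    using ES.sys_subset_padded[of c True] imageI[OF that, of "\<lambda>x. (x, \<psi> c x)"]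
    unfolding \<Gamma>_def S_def by (rule subsetD)
  have \<Gamma>_one: "(\<one>, \<one>\<^bsub>L\<^esub>) \<in> \<Gamma>"
    using \<Gamma>_S[OF K_closed(1), of True] by (simp add: \<psi>1)
  have \<Gamma>_mult: "(x \<otimes> y, l \<otimes>\<^bsub>L\<^esub> m) \<in> \<Gamma>" if "(x, l) \<in> \<Gamma>" "(y, m) \<in> \<Gamma>" for x y l m
    using ES.padded_mult[OF that[unfolded \<Gamma>_def]] by (simp add: E_simps \<Gamma>_def)
  have total: "\<exists>l. (g, l) \<in> \<Gamma>" if "g \<in> generate G P" for g
  proof -
    have "padded G (K P) H True \<subseteq> {g. \<exists>l. (g, l) \<in> \<Gamma>}"
    proof (rule K.padded_least)
      show "K P c \<subseteq> {g. \<exists>l. (g, l) \<in> \<Gamma>}" for c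
        using \<Gamma>_S by blast
      show "x \<otimes> y \<in> {g. \<exists>l. (g, l) \<in> \<Gamma>}" if "x \<in> {g. \<exists>l. (g, l) \<in> \<Gamma>}" "y \<in> {g. \<exists>l. (g, l) \<in> \<Gamma>}" for x y
        using that \<Gamma>_mult by blast
      show "\<one> \<in> {g. \<exists>l. (g, l) \<in> \<Gamma>}"
        using \<Gamma>_one by blast
    qed
    then show ?thesis using that generate_padded[OF P] by blast
  qed
  define \<phi> where "\<phi> g = (SOME l. (g, l) \<in> \<Gamma>)" for g
  have \<phi>: "(g, \<phi> g) \<in> \<Gamma>" if "g \<in> generate G P" for g
    unfolding \<phi>_def using total[OF that] by (rule someI_ex)
  have \<phi>I: "\<phi> g = l" if "g \<in> generate G P" "(g, l) \<in> \<Gamma>" for g l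
    using unique[OF \<phi>[OF that(1)] that(2)] .
  have f1: "f \<one> = \<one>\<^bsub>L\<^esub>" using \<psi>(3)[OF P'(8) S.sys_one] \<psi>1 by simp
  have graph: "(a, f a) \<in> \<Gamma>" if "a \<in> P" for a
  proof -
    have "padded G (\<lambda>b. P \<inter> Mb b) H True \<subseteq> {a \<in> P. (a, f a) \<in> \<Gamma>}"
    proof (rule PM.padded_least)
      show "P \<inter> Mb c \<subseteq> {a \<in> P. (a, f a) \<in> \<Gamma>}" for c
      proof
        fix a assume a: "a \<in> P \<inter> Mb c"
        then have "a \<in> K P c" unfolding K_def by (rule generate.incl)
        then show "a \<in> {a \<in> P. (a, f a) \<in> \<Gamma>}" using \<Gamma>_S[of a c] a \<psi>(3)[of a c] by simp
      qed
      show "x \<otimes> y \<in> {a \<in> P. (a, f a) \<in> \<Gamma>}" if "x \<in> {a \<in> P. (a, f a) \<in> \<Gamma>}" "y \<in> {a \<in> P. (a, f a) \<in> \<Gamma>}" for x y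
        using that \<Gamma>_mult[of x "f x" y "f y"] fm P'(9)[of x y] by simp
      show "\<one> \<in> {a \<in> P. (a, f a) \<in> \<Gamma>}"
        using \<Gamma>_one P'(8) f1 by simp
    qed
    then show ?thesis using P_padded[OF P that] by blast
  qed
  show "\<exists>\<psi>\<in>generate G P \<rightarrow> carrier L.
      (\<forall>x\<in>generate G P. \<forall>y\<in>generate G P. \<psi> (x \<otimes> y) = \<psi> x \<otimes>\<^bsub>L\<^esub> \<psi> y) \<and> (\<forall>a\<in>P. \<psi> a = f a)"
  proof (intro bexI[of _ \<phi>] conjI ballI)
    show "\<phi> \<in> generate G P \<rightarrow> carrier L"
      using \<phi> ES.padded_closed unfolding \<Gamma>_def E_def by fastforce
    show "\<phi> a = f a" if "a \<in> P" for a
      using \<phi>I[OF generate.incl[OF that] graph[OF that]] .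
    show "\<phi> (x \<otimes> y) = \<phi> x \<otimes>\<^bsub>L\<^esub> \<phi> y" if "x \<in> generate G P" "y \<in> generate G P" for x y
      using \<phi>I[OF generate.eng[OF that] \<Gamma>_mult[OF \<phi>[OF that(1)] \<phi>[OF that(2)]]] .
  qed
qed

end

section \<open>Coset representatives in an amalgam\<close>

fun mixed :: "(bool \<Rightarrow> 'g set) \<Rightarrow> (bool \<Rightarrow> 'g set) \<Rightarrow> bool \<Rightarrow> 'g list \<Rightarrow> bool" where
  "mixed T U b [] = False"
| "mixed T U b [s] = (s \<in> U b)"
| "mixed T U b (t # u # zs) = (t \<in> T b \<and> mixed T U (\<not> b) (u # zs))"

lemma mixed_Cons: "zs \<noteq> [] \<Longrightarrow> mixed T U b (t # zs) \<longleftrightarrow> t \<in> T b \<and> mixed T U (\<not> b) zs"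
  by (cases zs) auto

lemma mixed_nonempty: "mixed T U b zs \<Longrightarrow> zs \<noteq> []"
  by auto

text \<open>
  Each coset of \<open>generate G P\<close> has a shortest alternating word whose last letter is a representative
  modulo the part of \<open>P\<close> in its factor and whose other letters are representatives modulo \<open>H\<close>;
  the cosets that meet \<open>H\<close> are treated apart.
\<close>

locale amalgam_parabolic = amalgam_pair G A H Mb N
  for G :: "'g monoid" (structure) and A H Mb N +
  fixes P U U0
  assumes P: "parabolic G (amalgam_pair.M G H Mb) P"
    and U: "coset_reps G (Mb b) (P \<inter> Mb b) (U b)"
    and U0: "coset_reps G (Mb True) (P \<inter> N) U0"
begin

lemmas P_simps = parabolicD[OF P]

abbreviation "red \<equiv> mixed NR U"

lemma gen_P_closed: "x \<in> generate G P \<Longrightarrow> y \<in> generate G P \<Longrightarrow> x \<otimes> y \<in> generate G P"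
  "x \<in> generate G P \<Longrightarrow> inv x \<in> generate G P" "x \<in> generate G P \<Longrightarrow> x \<in> carrier G"
  using gen_closed[OF P_simps(3)] by blast+

lemma U_unique: "s \<in> U b \<Longrightarrow> t \<in> U b \<Longrightarrow> inv s \<otimes> t \<in> K P b \<Longrightarrow> s = t"
  using U[of b] unfolding coset_reps_def K_def by blast

lemma U_parabolic:
  assumes "parabolic G (Mb b) Q" "g \<in> generate G Q"
  obtains s where "s \<in> U b" "s \<in> generate G Q" "inv s \<otimes> g \<in> K P b"
  using U[of b] assms unfolding coset_reps_def K_def by blast

lemma U_Mb:
  assumes "g \<in> Mb b"
  obtains s where "s \<in> U b" "s \<in> Mb b" "inv s \<otimes> g \<in> P \<inter> Mb b"
  using U[of b] assms unfolding coset_reps_def by blast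

lemma gen_P_E:
  assumes "k \<in> generate G P"
  obtains x xs where "x \<in> K P b" "alt (K P) H (\<not> b) xs" "k = x \<otimes> wprod G xs"
  using gen_E[OF P assms] .

section \<open>Uniqueness of reduced words modulo a parabolic subgroup\<close>

text \<open>Stripping letters leaves a remainder in \<open>H\<close> each time, so the last letter
  decides. If \<open>s = h \<otimes> x\<close> with \<open>x\<close> in \<open>K P c\<close>, the
  clause of \<open>U\<close> for the parabolic submonoid \<open>N\<close> provides a representative
  of this coset inside \<open>H\<close>; by uniqueness it is \<open>s\<close>, which lies outside
  \<open>H\<close>.\<close>

lemma red_not_H_gen:
  assumes "alt A H c zs" "red c zs" "h \<in> H" "k \<in> generate G P"
  shows "wprod G zs \<noteq> h \<otimes> k"
  using assms
proof (induction zs arbitrary: c h k)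
  case (Cons s zs)
  show ?case
  proof
    assume eq: "wprod G (s # zs) = h \<otimes> k"
    obtain x xs where x: "x \<in> K P c" "alt (K P) H (\<not> c) xs" "k = x \<otimes> wprod G xs"
      using gen_P_E[OF Cons.prems(4)] .
    have s: "s \<in> A c" "s \<notin> H" "alt A H (\<not> c) zs" using Cons.prems(1) by simp_all
    have xA: "alt A H (\<not> c) xs" using alt_K_A[OF x(2)] .
    have [simp]: "s \<in> carrier G" "h \<in> carrier G" "x \<in> carrier G" "wprod G xs \<in> carrier G"
      "wprod G zs \<in> carrier G"
      using s Cons.prems(3) x(1) xA A.sys_in A.alt_in K_subset(3) H_closed(4) by blast+
    have hx: "h \<otimes> x \<in> A c" using Cons.prems(3) x(1) H_subset(2) K_subset(2) A.sys_mult by blast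
    have eq': "s \<otimes> wprod G zs = (h \<otimes> x) \<otimes> wprod G xs" using eq x(3) by (simp add: m_assoc)
    note u = padded_unique[OF s(1) hx s(3) xA eq']
    show False
    proof (cases "zs = []")
      case True
      then have "xs = []" using u by simp
      then have shx: "s = h \<otimes> x" using eq' True by simp
      have sU: "s \<in> U c" using Cons.prems(2) True by simp
      have "h \<in> generate G N" using Cons.prems(3) H_eq by simp
      then obtain r where r: "r \<in> U c" "r \<in> generate G N" "inv r \<otimes> h \<in> K P c"
        using U_parabolic[OF N_parabolic] by blast
      have "r \<in> H" using r(2) H_eq by simp
      then have [simp]: "r \<in> carrier G" by (rule H_closed(4))
      have "inv r \<otimes> s = (inv r \<otimes> h) \<otimes> x" by (simp add: shx m_assoc)
      then have "r = s" using U_unique[OF r(1) sU] K_closed(2)[OF r(3) x(1)] by simp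
      then show False using \<open>r \<in> H\<close> s(2) by simp
    next
      case False
      have "inv s \<otimes> (h \<otimes> x) = inv (inv (h \<otimes> x) \<otimes> s)" by (simp add: group_nf)
      then have e: "inv s \<otimes> (h \<otimes> x) \<in> H" using u H_closed(2) by metis
      have "wprod G zs = inv s \<otimes> ((h \<otimes> x) \<otimes> wprod G xs)" unfolding eq'[symmetric] by (simp add: group_nf)
      then have "wprod G zs = (inv s \<otimes> (h \<otimes> x)) \<otimes> wprod G xs" by (simp add: m_assoc)
      moreover have "red (\<not> c) zs" using Cons.prems(2) mixed_Cons[OF False] by blast
      ultimately show False using Cons.IH[OF s(3) _ e alt_K_gen[OF P x(2)]] by blast
    qed
  qed
qed simp

text \<open>The factor \<open>k\<close> meets only the last letter: with \<open>x\<close> the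
  leading letter of \<open>k\<close>, the product \<open>s \<otimes> x\<close> stays outside
  \<open>H\<close> by \<open>red_not_H_gen\<close>, and the rest of \<open>k\<close> can be
  appended.\<close>

lemma red_mult:
  assumes "alt A H b zs" "red b zs" "k \<in> generate G P"
  shows "\<exists>ys. ys \<noteq> [] \<and> alt A H b ys \<and> wprod G zs \<otimes> k = wprod G ys"
  using assms
proof (induction zs arbitrary: b)
  case (Cons s zs)
  have s: "s \<in> A b" "s \<notin> H" "alt A H (\<not> b) zs" using Cons.prems(1) by simp_all
  have [simp]: "s \<in> carrier G" "wprod G zs \<in> carrier G" "k \<in> carrier G"
    using s A.sys_in A.alt_in gen_P_closed(3)[OF Cons.prems(3)] by blast+
  show ?case
  proof (cases "zs = []")
    case True
    obtain x xs where x: "x \<in> K P b" "alt (K P) H (\<not> b) xs" "k = x \<otimes> wprod G xs"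
      using gen_P_E[OF Cons.prems(3)] .
    have xA: "alt A H (\<not> b) xs" using alt_K_A[OF x(2)] .
    have [simp]: "x \<in> carrier G" "wprod G xs \<in> carrier G" using x(1) K_subset(3) xA A.alt_in by blast+
    have "s \<otimes> x \<notin> H"
    proof
      assume "s \<otimes> x \<in> H"
      moreover have "wprod G (s # zs) = (s \<otimes> x) \<otimes> inv x" using True by (simp add: m_assoc)
      moreover have "inv x \<in> generate G P" using K_closed(3)[OF x(1)] K_gen by blast
      ultimately show False using red_not_H_gen[OF Cons.prems(1,2)] by blast
    qed
    then have al: "alt A H b ((s \<otimes> x) # xs)" using A.sys_mult[OF s(1) K_subset(2)[OF x(1)]] xA by simp
    have "wprod G (s # zs) \<otimes> k = wprod G ((s \<otimes> x) # xs)" using True x(3) by (simp add: m_assoc)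
    then show ?thesis by (intro exI[of _ "(s \<otimes> x) # xs"] conjI al list.distinct(2))
  next
    case False
    then have "red (\<not> b) zs" using Cons.prems(2) mixed_Cons[of zs] by blast
    then obtain ys where ys: "alt A H (\<not> b) ys" "wprod G zs \<otimes> k = wprod G ys"
      using Cons.IH[OF s(3) _ Cons.prems(3)] by blast
    then have "alt A H b (s # ys)" "wprod G (s # zs) \<otimes> k = wprod G (s # ys)"
      using s by (simp_all add: m_assoc)
    then show ?thesis by blast
  qed
qed simp

text \<open>A longer word \<open>t # ts\<close> would place its tail in \<open>H\<close> times
  \<open>generate G P\<close>, which \<open>red_not_H_gen\<close> forbids. With one letter left,
  \<open>U_unique\<close> fixes it.\<close>

lemma red_single_unique:
  assumes s: "s \<in> A b" "s \<notin> H" "s \<in> U b"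
    and zs: "alt A H b zs" "red b zs" and k: "k \<in> generate G P" "wprod G zs = s \<otimes> k"
  shows "zs = [s]"
proof -
  obtain x xs where x: "x \<in> K P b" "alt (K P) H (\<not> b) xs" "k = x \<otimes> wprod G xs"
    using gen_P_E[OF k(1)] .
  have xA: "alt A H (\<not> b) xs" using alt_K_A[OF x(2)] .
  obtain t ts where zs_eq: "zs = t # ts" using mixed_nonempty[OF zs(2)] by (cases zs) auto
  have t: "t \<in> A b" "alt A H (\<not> b) ts" using zs(1) zs_eq by simp_all
  have [simp]: "s \<in> carrier G" "t \<in> carrier G" "x \<in> carrier G" "wprod G xs \<in> carrier G"
    "wprod G ts \<in> carrier G"
    using s t x(1) xA A.sys_in A.alt_in K_subset(3) by blast+
  have eq: "(s \<otimes> x) \<otimes> wprod G xs = t \<otimes> wprod G ts"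
    using k(2) x(3) zs_eq by (simp add: m_assoc)
  have sx: "s \<otimes> x \<in> A b" by (rule A.sys_mult[OF s(1) K_subset(2)[OF x(1)]])
  note u = padded_unique[OF sx t(1) xA t(2) eq]
  have "ts = []"
  proof (rule ccontr)
    assume ne: "ts \<noteq> []"
    then have r: "red (\<not> b) ts" using zs(2) zs_eq mixed_Cons[of ts] by simp
    have "wprod G ts = inv t \<otimes> ((s \<otimes> x) \<otimes> wprod G xs)" unfolding eq by (simp add: group_nf)
    then have "wprod G ts = (inv t \<otimes> (s \<otimes> x)) \<otimes> wprod G xs" by (simp add: m_assoc)
    then show False
      using red_not_H_gen[OF t(2) r u[THEN conjunct1] alt_K_gen[OF P x(2)]] by (rule notE[rotated])
  qed
  moreover then have "xs = []" using u by simp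
  ultimately have "t = s \<otimes> x" using eq by simp
  then have "inv s \<otimes> t = x" by (simp add: inv_cancel_left)
  then have "s = t" using U_unique[OF s(3), of t] x(1) zs(2) zs_eq \<open>ts = []\<close> by simp
  then show ?thesis using zs_eq \<open>ts = []\<close> by simp
qed

lemma red_same_side:
  assumes zs: "alt A H b zs" "red b zs" and ys: "alt A H c ys" "red c ys"
    and k: "k \<in> generate G P" "wprod G ys = wprod G zs \<otimes> k"
  shows "c = b"
proof (rule ccontr)
  assume "c \<noteq> b"
  then have c: "c = (\<not> b)" by auto
  obtain us where us: "us \<noteq> []" "alt A H b us" "wprod G zs \<otimes> k = wprod G us"
    using red_mult[OF zs k(1)] by blast
  show False using alt_disjoint[OF us(2), of ys] ys(1) c k(2) us(1,3) by simp
qed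

text \<open>By \<open>red_mult\<close> the letters before the last do not feel \<open>k\<close>, so
  they are compared modulo \<open>H\<close> through \<open>NR_unique\<close>. Once one of the words
  has a single letter, \<open>red_single_unique\<close> finishes.\<close>

lemma red_unique:
  assumes "alt A H b zs" "red b zs" "alt A H b ys" "red b ys"
    and "k \<in> generate G P" "wprod G ys = wprod G zs \<otimes> k"
  shows "zs = ys"
  using assms
proof (induction zs arbitrary: b ys)
  case (Cons s zs)
  have s: "s \<in> A b" "s \<notin> H" "alt A H (\<not> b) zs" using Cons.prems(1) by simp_all
  obtain t ts where ys: "ys = t # ts" using mixed_nonempty[OF Cons.prems(4)] by (cases ys) auto
  have t: "t \<in> A b" "t \<notin> H" "alt A H (\<not> b) ts" using Cons.prems(3) ys by simp_all
  have [simp]: "s \<in> carrier G" "t \<in> carrier G" "wprod G zs \<in> carrier G" "wprod G ts \<in> carrier G"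
    "k \<in> carrier G"
    using s t A.sys_in A.alt_in gen_P_closed(3)[OF Cons.prems(5)] by blast+
  show ?case
  proof (cases "zs = []")
    case True
    then have "s \<in> U b" "wprod G ys = s \<otimes> k" using Cons.prems(2,6) by simp_all
    from red_single_unique[OF s(1,2) this(1) Cons.prems(3-5) this(2)] show ?thesis using True by simp
  next
    case zs_ne: False
    show ?thesis
    proof (cases "ts = []")
      case True
      then have tU: "t \<in> U b" using Cons.prems(4) ys by simp
      have "wprod G (s # zs) = t \<otimes> inv k"
        using Cons.prems(6) ys True by (simp add: m_assoc)
      then have "s # zs = [t]"
        using red_single_unique[OF t(1,2) tU Cons.prems(1,2) gen_P_closed(2)[OF Cons.prems(5)]] by blast
      then show ?thesis using zs_ne by simp
    next
      case ts_ne: False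
      have r: "red (\<not> b) zs" "s \<in> NR b" "red (\<not> b) ts" "t \<in> NR b"
        using Cons.prems(2,4) ys mixed_Cons[OF zs_ne] mixed_Cons[OF ts_ne] by blast+
      obtain us where us: "alt A H (\<not> b) us" "wprod G zs \<otimes> k = wprod G us"
        using red_mult[OF s(3) r(1) Cons.prems(5)] by blast
      have "s \<otimes> wprod G us = t \<otimes> wprod G ts"
        unfolding us(2)[symmetric] using Cons.prems(6) ys by (simp add: m_assoc)
      then have "inv t \<otimes> s \<in> H" using padded_unique[OF s(1) t(1) us(1) t(3)] by blast
      then have "t = s" using NR_unique[OF r(4,2)] by blast
      have "s \<otimes> wprod G ts = s \<otimes> (wprod G zs \<otimes> k)"
        using Cons.prems(6) ys \<open>t = s\<close> by (simp add: m_assoc)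
      then have "wprod G ts = wprod G zs \<otimes> k" by simp
      then have "zs = ts" using Cons.IH[OF s(3) r(1) t(3) r(3) Cons.prems(5)] by blast
      then show ?thesis using ys \<open>t = s\<close> by simp
    qed
  qed
qed simp

text \<open>A coset that meets \<open>H\<close> belongs to neither factor in particular. It is
  represented by an element of \<open>U0\<close> in \<open>H\<close>, which lies in both
  factors.\<close>

definition R where
  "R = {wprod G zs | b zs. alt A H b zs \<and> red b zs} \<union> (U0 \<inter> H)"

lemma R_unique:
  assumes "r \<in> R" "s \<in> R" and rs: "inv r \<otimes> s \<in> generate G P"
  shows "r = s"
proof -
  have Rc: "x \<in> carrier G" if "x \<in> R" for x using that A.alt_in H_closed(4) unfolding R_def by blast
  have [simp]: "r \<in> carrier G" "s \<in> carrier G" using assms Rc by blast+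
  have s_eq: "s = r \<otimes> (inv r \<otimes> s)" and r_eq: "r = s \<otimes> inv (inv r \<otimes> s)" by (simp_all add: group_nf)
  note rs' = gen_P_closed(2)[OF rs]
  show ?thesis
  proof (cases "r \<in> H")
    case rH: True
    show ?thesis
    proof (cases "s \<in> H")
      case True
      have in_U0: "x \<in> U0" if x: "x \<in> R" "x \<in> H" for x
      proof (rule ccontr)
        assume "x \<notin> U0"
        then obtain b zs where "alt A H b zs" "red b zs" "x = wprod G zs"
          using x(1) unfolding R_def by blast
        then show False using red_not_H_gen[of b zs x \<one>] x(2) Rc[OF x(1)] generate.one[of G P] by simp
      qed
      have "inv r \<otimes> s \<in> generate G (P \<inter> N)"
        using gen_Int_H[OF P rs] rH True H_closed(1,2) by blast
      then show ?thesis
        using U0 in_U0[OF assms(1) rH] in_U0[OF assms(2) True] unfolding coset_reps_def by blast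
    next
      case False
      then obtain b zs where "alt A H b zs" "red b zs" "s = wprod G zs"
        using assms(2) unfolding R_def by blast
      then show ?thesis using red_not_H_gen[of b zs r] rH rs s_eq by metis
    qed
  next
    case rH: False
    then obtain b zs where zs: "alt A H b zs" "red b zs" "r = wprod G zs"
      using assms(1) unfolding R_def by blast
    show ?thesis
    proof (cases "s \<in> H")
      case True
      then show ?thesis using red_not_H_gen[OF zs(1,2) True rs'] r_eq zs(3) by metis
    next
      case False
      then obtain c ys where ys: "alt A H c ys" "red c ys" "s = wprod G ys"
        using assms(2) unfolding R_def by blast
      have eq: "wprod G ys = wprod G zs \<otimes> (inv r \<otimes> s)" using s_eq zs(3) ys(3) by simp
      have "c = b" using red_same_side[OF zs(1,2) ys(1,2) rs eq] .
      then show ?thesis using red_unique[OF zs(1,2) _ _ rs eq] ys zs(3) by blast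
    qed
  qed
qed

end

section \<open>Existence of reduced words inside a given system of letters\<close>

text \<open>One argument serves both existence clauses of \<open>coset_reps\<close>: with
  \<open>X = K Q\<close> and \<open>Y = generate G P\<close>, and with \<open>X = Mb\<close> and
  \<open>Y = P\<close>. The assumptions say that normalising a letter stays inside \<open>X\<close>
  and leaves a remainder in \<open>H\<close> or in \<open>Y\<close>. In the second case
  \<open>Y\<close> is a mere submonoid, so remainders are only ever multiplied, as in
  \<open>chain\<close>.\<close>

locale adapted_system = amalgam_parabolic G A H Mb N P U U0 + X: alt_system G X H
  for G :: "'g monoid" (structure) and A H Mb N P U U0 and X +
  fixes Y :: "'g set"
  assumes X_A: "X b \<subseteq> A b"
    and X_NR: "x \<in> X b \<Longrightarrow> \<exists>t\<in>NR b \<inter> X b. inv t \<otimes> x \<in> X b \<inter> H"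
    and X_U: "x \<in> X b \<Longrightarrow> \<exists>s\<in>U b \<inter> X b. inv s \<otimes> x \<in> Y"
    and X_U0: "x \<in> X b \<Longrightarrow> x \<in> H \<Longrightarrow> \<exists>s\<in>U0 \<inter> H \<inter> X b. inv s \<otimes> x \<in> Y"
    and Y_gen: "Y \<subseteq> generate G P" and Y_mult: "x \<in> Y \<Longrightarrow> y \<in> Y \<Longrightarrow> x \<otimes> y \<in> Y" and Y_one: "\<one> \<in> Y"
begin

definition RX where
  "RX = {wprod G zs | b zs. alt X H b zs \<and> red b zs} \<union> (U0 \<inter> H \<inter> X True)"

lemma RX_wordI: "alt X H b zs \<Longrightarrow> red b zs \<Longrightarrow> wprod G zs \<in> RX"
  unfolding RX_def by blast

lemma X_H: "x \<in> X b \<Longrightarrow> x \<in> H \<Longrightarrow> x \<in> X c"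
  using X.sys_flip[of x b] by (cases "c = b") (simp, cases b, simp_all)

lemma alt_X_A: "alt X H b zs \<Longrightarrow> alt A H b zs"
  using alt_mono[of X H b zs A] X_A by blast

lemma RX_R: "RX \<subseteq> R"
  unfolding RX_def R_def using alt_X_A by blast

lemma RX_padded: "RX \<subseteq> padded G X H b"
  unfolding RX_def using X.alt_padded X.sys_subset_padded by blast

lemma RX_in: "r \<in> RX \<Longrightarrow> r \<in> carrier G"
  using RX_padded X.padded_closed by blast

lemma chain:
  assumes "inv r \<otimes> s \<in> Y" "inv s \<otimes> g \<in> Y" "r \<in> carrier G" "s \<in> carrier G" "g \<in> carrier G"
  shows "inv r \<otimes> g \<in> Y"
  using Y_mult[OF assms(1,2)] assms(3-) by (simp add: group_nf)

text \<open>If the representative from \<open>U\<close> falls into \<open>H\<close>, it cannot serve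
  as a letter and is replaced by one from \<open>U0\<close>.\<close>

lemma rep_letter:
  assumes "y \<in> X c"
  shows "\<exists>r\<in>RX. inv r \<otimes> y \<in> Y"
proof -
  obtain s where s: "s \<in> U c" "s \<in> X c" "inv s \<otimes> y \<in> Y" using X_U[OF assms] by blast
  show ?thesis
  proof (cases "s \<in> H")
    case True
    then obtain r where r: "r \<in> U0" "r \<in> H" "r \<in> X c" "inv r \<otimes> s \<in> Y" using X_U0[OF s(2)] by blast
    have "inv r \<otimes> y \<in> Y" using chain[OF r(4) s(3)] r(3) s(2) assms X.sys_in by blast
    moreover have "r \<in> RX" unfolding RX_def using r X_H by blast
    ultimately show ?thesis by blast
  next
    case False
    then have "wprod G [s] \<in> RX" using s by (intro RX_wordI[of c]) simp_all
    then show ?thesis using s X.sys_in[OF s(2)] by (intro bexI[of _ s]) simp_all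
  qed
qed

text \<open>\<open>h\<close> travels from left to right: each letter absorbs it, is replaced by its
  representative from \<open>NR\<close>, and hands a remainder in \<open>H\<close> to the next
  letter. At the last letter the representative comes from \<open>U\<close> and the remainder falls
  into \<open>Y\<close>. No letter drops into \<open>H\<close>, so the alternation persists.\<close>

lemma H_lmult_word:
  assumes "alt X H c zs" "red c zs" "h \<in> X c" "h \<in> H"
  shows "\<exists>ys. alt X H c ys \<and> red c ys \<and> inv (wprod G ys) \<otimes> (h \<otimes> wprod G zs) \<in> Y"
  using assms
proof (induction zs arbitrary: c h)
  case (Cons s zs)
  have s: "s \<in> X c" "s \<notin> H" "alt X H (\<not> c) zs" using Cons.prems(1) by simp_all
  have hs: "h \<otimes> s \<in> X c" using Cons.prems(3) s(1) X.sys_mult by blast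
  have [simp]: "s \<in> carrier G" "h \<in> carrier G" "wprod G zs \<in> carrier G"
    using s Cons.prems(3) X.sys_in X.alt_in by blast+
  show ?case
  proof (cases "zs = []")
    case True
    obtain r where r: "r \<in> U c" "r \<in> X c" "inv r \<otimes> (h \<otimes> s) \<in> Y" using X_U[OF hs] by blast
    have [simp]: "r \<in> carrier G" using r(2) X.sys_in by blast
    \<comment> \<open>Otherwise the one-letter word \<open>[s]\<close> would lie in \<open>H\<close>
      times \<open>generate G P\<close>, against \<open>red_not_H_gen\<close>.\<close>
    have "r \<notin> H"
    proof
      assume "r \<in> H"
      then have "inv h \<otimes> r \<in> H" using Cons.prems(4) H_closed by blast
      moreover have "wprod G (s # zs) = (inv h \<otimes> r) \<otimes> (inv r \<otimes> (h \<otimes> s))"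
        using True by (simp add: group_nf)
      ultimately show False
        using red_not_H_gen[OF alt_X_A[OF Cons.prems(1)] Cons.prems(2)] r(3) Y_gen by blast
    qed
    then have "alt X H c [r]" "red c [r]" using r(1,2) by simp_all
    moreover have "inv (wprod G [r]) \<otimes> (h \<otimes> wprod G (s # zs)) \<in> Y" using r(3) True by simp
    ultimately show ?thesis by (intro exI[of _ "[r]"] conjI)
  next
    case False
    then have red: "s \<in> NR c" "red (\<not> c) zs" using Cons.prems(2) mixed_Cons[of zs] by simp_all
    obtain t where t: "t \<in> NR c" "t \<in> X c" "inv t \<otimes> (h \<otimes> s) \<in> X c" "inv t \<otimes> (h \<otimes> s) \<in> H"
      using X_NR[OF hs] by blast
    have [simp]: "t \<in> carrier G" using t(2) X.sys_in by blast
    have tH: "t \<notin> H"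
    proof
      assume "t \<in> H"
      then have "inv h \<otimes> (t \<otimes> (inv t \<otimes> (h \<otimes> s))) \<in> H" by (intro H_closed(1) H_closed(2)[OF Cons.prems(4)] t(4))
      then show False using s(2) by (simp add: group_nf)
    qed
    obtain ys where ys: "alt X H (\<not> c) ys" "red (\<not> c) ys"
      "inv (wprod G ys) \<otimes> ((inv t \<otimes> (h \<otimes> s)) \<otimes> wprod G zs) \<in> Y"
      using Cons.IH[OF s(3) red(2) X_H[OF t(3,4)] t(4)] by blast
    have [simp]: "wprod G ys \<in> carrier G" using X.alt_in[OF ys(1)] .
    have "red c (t # ys)" using mixed_Cons[OF mixed_nonempty[OF ys(2)]] t(1) ys(2) by simp
    moreover have "alt X H c (t # ys)" using t(2) tH ys(1) by simp
    moreover have "inv (wprod G (t # ys)) \<otimes> (h \<otimes> wprod G (s # zs)) =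
        inv (wprod G ys) \<otimes> ((inv t \<otimes> (h \<otimes> s)) \<otimes> wprod G zs)" by (simp add: group_nf)
    ultimately show ?thesis using ys(3) by metis
  qed
qed simp

lemma rep_lmult_same_side:
  assumes zs: "alt X H c zs" "red c zs" and x: "x \<in> X c"
  shows "\<exists>r\<in>RX. inv r \<otimes> (x \<otimes> wprod G zs) \<in> Y"
proof -
  obtain s ts where zs_eq: "zs = s # ts" using mixed_nonempty[OF zs(2)] by (cases zs) auto
  have s: "s \<in> X c" "s \<notin> H" "alt X H (\<not> c) ts" using zs(1) zs_eq by simp_all
  have xs: "x \<otimes> s \<in> X c" using x s(1) X.sys_mult by blast
  have [simp]: "s \<in> carrier G" "x \<in> carrier G" "wprod G ts \<in> carrier G"
    using s x X.sys_in X.alt_in by blast+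
  show ?thesis
  proof (cases "ts = []")
    case True
    then show ?thesis using rep_letter[OF xs] zs_eq by simp
  next
    case False
    then have red: "s \<in> NR c" "red (\<not> c) ts" using zs(2) zs_eq mixed_Cons[of ts] by simp_all
    obtain t where t: "t \<in> NR c" "t \<in> X c" "inv t \<otimes> (x \<otimes> s) \<in> X c" "inv t \<otimes> (x \<otimes> s) \<in> H"
      using X_NR[OF xs] by blast
    have [simp]: "t \<in> carrier G" using t(2) X.sys_in by blast
    obtain ys where ys: "alt X H (\<not> c) ys" "red (\<not> c) ys"
      "inv (wprod G ys) \<otimes> ((inv t \<otimes> (x \<otimes> s)) \<otimes> wprod G ts) \<in> Y"
      using H_lmult_word[OF s(3) red(2) X_H[OF t(3,4)] t(4)] by blast
    have [simp]: "wprod G ys \<in> carrier G" using X.alt_in[OF ys(1)] .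
    have eq: "inv (wprod G (t # ys)) \<otimes> (x \<otimes> wprod G zs) =
        inv (wprod G ys) \<otimes> ((inv t \<otimes> (x \<otimes> s)) \<otimes> wprod G ts)" by (simp add: zs_eq group_nf)
    show ?thesis
    proof (cases "t \<in> H")
      case False
      have "red c (t # ys)" using mixed_Cons[OF mixed_nonempty[OF ys(2)]] t(1) ys(2) by simp
      moreover have "alt X H c (t # ys)" using t(2) False ys(1) by simp
      ultimately have "wprod G (t # ys) \<in> RX" by (intro RX_wordI)
      then show ?thesis using ys(3) eq by metis
    next
      case True
      \<comment> \<open>A representative \<open>t\<close> in \<open>H\<close> cannot be a letter, so
        it is pushed through the remaining word in its turn; the two remainders multiply within
        \<open>Y\<close>.\<close>
      obtain us where us: "alt X H (\<not> c) us" "red (\<not> c) us"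
        "inv (wprod G us) \<otimes> (t \<otimes> wprod G ys) \<in> Y"
        using H_lmult_word[OF ys(1,2) X_H[OF t(2) True] True] by blast
      have "inv (t \<otimes> wprod G ys) \<otimes> (x \<otimes> wprod G zs) \<in> Y" using ys(3) eq by simp
      then have "inv (wprod G us) \<otimes> (x \<otimes> wprod G zs) \<in> Y"
        using chain[OF us(3)] X.alt_in[OF us(1)] by (simp add: zs_eq)
      then show ?thesis using RX_wordI[OF us(1,2)] by blast
    qed
  qed
qed

text \<open>If \<open>r\<close> is a word beginning in the other factor and \<open>x\<close> lies
  outside \<open>H\<close>, the representative of \<open>x\<close> becomes a new first letter and
  only the remainder in \<open>H\<close> is pushed through \<open>r\<close>. Otherwise
  \<open>x\<close> merges with the first letter, or with \<open>r\<close> itself when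
  \<open>r\<close> lies in \<open>H\<close>.\<close>

lemma rep_lmult:
  assumes x: "x \<in> X c" and r: "r \<in> RX"
  shows "\<exists>s\<in>RX. inv s \<otimes> (x \<otimes> r) \<in> Y"
proof (cases "r \<in> U0 \<inter> H \<inter> X True")
  case True
  then have "x \<otimes> r \<in> X c" using x X_H X.sys_mult by blast
  then show ?thesis by (rule rep_letter)
next
  case False
  then obtain b zs where zs: "alt X H b zs" "red b zs" "r = wprod G zs"
    using r unfolding RX_def by blast
  show ?thesis
  proof (cases "b = c \<or> x \<in> H")
    case True
    then have "x \<in> X b" using x X_H by blast
    then show ?thesis using rep_lmult_same_side[OF zs(1,2)] zs(3) by blast
  next
    case bc: False
    then have b: "b = (\<not> c)" by auto
    obtain t where t: "t \<in> NR c" "t \<in> X c" "inv t \<otimes> x \<in> X c" "inv t \<otimes> x \<in> H"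
      using X_NR[OF x] by blast
    have [simp]: "t \<in> carrier G" "x \<in> carrier G" "wprod G zs \<in> carrier G"
      using t(2) x zs(1) X.sys_in X.alt_in by blast+
    have tH: "t \<notin> H"
    proof
      assume "t \<in> H"
      then have "t \<otimes> (inv t \<otimes> x) \<in> H" by (rule H_closed(1)[OF _ t(4)])
      then show False using bc by (simp add: inv_cancel_left)
    qed
    obtain ys where ys: "alt X H b ys" "red b ys" "inv (wprod G ys) \<otimes> ((inv t \<otimes> x) \<otimes> wprod G zs) \<in> Y"
      using H_lmult_word[OF zs(1,2) X_H[OF t(3,4)] t(4)] by blast
    have [simp]: "wprod G ys \<in> carrier G" using X.alt_in[OF ys(1)] .
    have "red c (t # ys)" using mixed_Cons[OF mixed_nonempty[OF ys(2)]] t(1) ys(2) b by simp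
    moreover have "alt X H c (t # ys)" using t(2) tH ys(1) b by simp
    ultimately have "wprod G (t # ys) \<in> RX" by (intro RX_wordI)
    moreover have "inv (wprod G (t # ys)) \<otimes> (x \<otimes> r) \<in> Y" using ys(3) zs(3) by (simp add: group_nf)
    ultimately show ?thesis by blast
  qed
qed

lemma rep_ex:
  assumes "g \<in> padded G X H b"
  shows "\<exists>r\<in>RX. inv r \<otimes> g \<in> Y"
proof -
  have step: "\<exists>r\<in>RX. inv r \<otimes> (x \<otimes> g) \<in> Y" if x: "x \<in> X c" and g: "g \<in> carrier G" "\<exists>r\<in>RX. inv r \<otimes> g \<in> Y"
    for x g c
  proof -
    obtain r where r: "r \<in> RX" "inv r \<otimes> g \<in> Y" using g by blast
    obtain s where s: "s \<in> RX" "inv s \<otimes> (x \<otimes> r) \<in> Y" using rep_lmult[OF x r(1)] by blast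
    have [simp]: "x \<in> carrier G" "r \<in> carrier G" "s \<in> carrier G" using x r s X.sys_in RX_in by blast+
    have "inv (x \<otimes> r) \<otimes> (x \<otimes> g) \<in> Y" using r(2) g(1) by (simp add: group_nf)
    then have "inv s \<otimes> (x \<otimes> g) \<in> Y" using chain[OF s(2)] g(1) by simp
    then show ?thesis using s(1) by blast
  qed
  have w: "\<exists>r\<in>RX. inv r \<otimes> wprod G xs \<in> Y" if "alt X H c xs" for c xs
    using that
  proof (induction xs arbitrary: c)
    case Nil
    show ?case using rep_letter[OF X.sys_one] by simp
  next
    case (Cons x xs)
    then have x: "x \<in> X c" "alt X H (\<not> c) xs" by simp_all
    show ?case using step[OF x(1) X.alt_in[OF x(2)] Cons.IH[OF x(2)]] by simp
  qed
  obtain x xs where x: "x \<in> X b" "alt X H (\<not> b) xs" "g = x \<otimes> wprod G xs" using assms by (rule paddedE)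
  show ?thesis unfolding x(3) by (rule step[OF x(1) X.alt_in[OF x(2)] w[OF x(2)]])
qed

end

context amalgam_parabolic
begin

lemma adapted_parabolic:
  assumes Q: "parabolic G M Q"
  shows "adapted_system G A H Mb N P U U0 (K Q) (generate G P)"
proof (intro adapted_system.intro adapted_system_axioms.intro)
  show "amalgam_parabolic G A H Mb N P U U0" by (rule amalgam_parabolic_axioms)
  show "alt_system G (K Q) H" by (rule K_system[OF Q])
  show "K Q b \<subseteq> A b" for b by (rule K_subset)
  show "\<exists>t\<in>NR b \<inter> K Q b. inv t \<otimes> x \<in> K Q b \<inter> H" if x: "x \<in> K Q b" for x b
  proof -
    obtain t where "t \<in> NR b" "t \<in> K Q b" "inv t \<otimes> x \<in> H"
      using NR_parabolic[OF parabolic_restrict[OF Q]] x unfolding K_def by blast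
    then show ?thesis using K_closed(2,3) x by blast
  qed
  show "\<exists>s\<in>U b \<inter> K Q b. inv s \<otimes> x \<in> generate G P" if x: "x \<in> K Q b" for x b
  proof -
    obtain s where "s \<in> U b" "s \<in> K Q b" "inv s \<otimes> x \<in> K P b"
      using U_parabolic[OF parabolic_restrict[OF Q]] x unfolding K_def by blast
    then show ?thesis using K_gen by blast
  qed
  show "\<exists>s\<in>U0 \<inter> H \<inter> K Q b. inv s \<otimes> x \<in> generate G P" if x: "x \<in> K Q b" "x \<in> H" for x b
  proof -
    \<comment> \<open>\<open>U0\<close> was chosen in the factor \<open>Mb True\<close>. Its clause
      for the parabolic submonoid \<open>Q \<inter> N\<close> gives a representative in
      \<open>H\<close>, which belongs to the letters of either side.\<close>
    obtain s where s: "s \<in> U0" "s \<in> generate G (Q \<inter> N)" "inv s \<otimes> x \<in> generate G (P \<inter> N)"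
      using U0 PN_parabolic[OF Q, of True] K_H[OF Q x] unfolding coset_reps_def by blast
    then have "s \<in> H" "s \<in> K Q b" "inv s \<otimes> x \<in> generate G P"
      using generate_N_K(2)[of Q] generate_N_K(1)[of Q b] generate_N_K(1)[of P True] K_gen[of P True] by blast+
    then show ?thesis using s(1) by blast
  qed
  show "x \<otimes> y \<in> generate G P" if "x \<in> generate G P" "y \<in> generate G P" for x y
    using that by (rule gen_P_closed(1))
  show "\<one> \<in> generate G P" by (rule generate.one)
qed simp

lemma adapted_monoid: "adapted_system G A H Mb N P U U0 Mb P"
proof (intro adapted_system.intro adapted_system_axioms.intro)
  show "amalgam_parabolic G A H Mb N P U U0" by (rule amalgam_parabolic_axioms)
  show "alt_system G Mb H" by (rule S.alt_system_axioms)
  show "Mb b \<subseteq> A b" for b by (rule Mb_subset)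
  show "\<exists>t\<in>NR b \<inter> Mb b. inv t \<otimes> x \<in> Mb b \<inter> H" if "x \<in> Mb b" for x b
    using NR_ex[OF that] N_subset(1)[of _ b] N_subset(2) by (metis IntI)
  show "\<exists>s\<in>U b \<inter> Mb b. inv s \<otimes> x \<in> P" if "x \<in> Mb b" for x b
    using U_Mb[OF that] by (metis IntD1 IntI)
  show "\<exists>s\<in>U0 \<inter> H \<inter> Mb b. inv s \<otimes> x \<in> P" if x: "x \<in> Mb b" "x \<in> H" for x b
  proof -
    have xN: "x \<in> N" using Mb_H(2) x by blast
    obtain s where s: "s \<in> U0" "s \<in> Mb True" "inv s \<otimes> x \<in> P \<inter> N"
      using U0 N_subset(1)[OF xN, of True] unfolding coset_reps_def by blast
    have c: "s \<in> carrier G" "x \<in> carrier G" using s(2) x(1) S.sys_in by blast+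
    have "inv s \<otimes> x \<in> H" using s(3) N_subset(2) by blast
    then have "x \<otimes> inv (inv s \<otimes> x) \<in> H" by (rule H_closed(1)[OF x(2) H_closed(2)])
    then have "s \<in> H" using c by (simp add: group_nf)
    then have "s \<in> Mb b" using Mb_H(2)[OF s(2)] N_subset(1) by blast
    then show ?thesis using s \<open>s \<in> H\<close> by blast
  qed
  show "P \<subseteq> generate G P" by (rule gen_subset)
qed (rule P_simps; assumption)+

lemma R_coset_reps: "coset_reps G M P R"
  unfolding coset_reps_def
proof (intro conjI ballI allI impI)
  note AM = gen_M[of True]
  have alt_gen: "wprod G zs \<in> generate G M" if "alt A H b zs" for b zs
    unfolding AM using that by (rule A.alt_padded)
  have H_gen: "H \<subseteq> generate G M" unfolding AM using H_subset(1)[of True] A.sys_subset_padded by blast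
  show "R \<subseteq> generate G M" unfolding R_def using alt_gen H_gen by blast
  show "r = s" if "r \<in> R" "s \<in> R" "inv r \<otimes> s \<in> generate G P" for r s
    using R_unique[OF that] .
next
  fix Q g assume Q: "parabolic G M Q" and g: "g \<in> generate G Q"
  interpret X: adapted_system G A H Mb N P U U0 "K Q" "generate G P" by (rule adapted_parabolic[OF Q])
  have "g \<in> padded G (K Q) H True" using g generate_padded[OF Q] by blast
  then obtain r where "r \<in> X.RX" "inv r \<otimes> g \<in> generate G P" using X.rep_ex by blast
  moreover have "r \<in> generate G Q" using X.RX_padded[of True] \<open>r \<in> X.RX\<close> generate_padded[OF Q, of True] by blast
  ultimately show "\<exists>r\<in>R \<inter> generate G Q. inv r \<otimes> g \<in> generate G P" using X.RX_R by blast
next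
  fix g assume g: "g \<in> M"
  interpret X: adapted_system G A H Mb N P U U0 Mb P by (rule adapted_monoid)
  obtain r where r: "r \<in> X.RX" "inv r \<otimes> g \<in> P" using X.rep_ex[of g True] g M_def by blast
  moreover have "r \<in> M" using X.RX_padded[of True] r(1) M_def by blast
  ultimately show "\<exists>r\<in>R \<inter> M. inv r \<otimes> g \<in> P" using X.RX_R by blast
qed

end

context amalgam_pair
begin

lemma M_has_reps: "has_reps G M"
  unfolding has_reps_def
proof (intro allI impI)
  fix P assume P: "parabolic G M P"
  have ex: "\<exists>U. coset_reps G (Mb b) Q U" if "parabolic G (Mb b) Q" for b Q
    using pos_pair.reps[OF pair[of b]] that unfolding has_reps_def by blast
  have "\<forall>b. \<exists>U. coset_reps G (Mb b) (P \<inter> Mb b) U" using ex parabolic_restrict[OF P] by blast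
  then obtain U where U: "\<And>b. coset_reps G (Mb b) (P \<inter> Mb b) (U b)" by metis
  obtain U0 where U0: "coset_reps G (Mb True) (P \<inter> N) U0" using ex PN_parabolic[OF P] by blast
  interpret amalgam_parabolic G A H Mb N P U U0
    using P U U0 amalgam_pair_axioms by (intro amalgam_parabolic.intro amalgam_parabolic_axioms.intro)
  show "\<exists>R. coset_reps G M P R" using R_coset_reps by blast
qed

lemma M_pos_pair: "pos_pair G M"
proof -
  interpret o: amalgam_pair "opp G" A H Mb N by (rule amalgam_pair_opp)
  show ?thesis
    using M_bounded_joins o.M_bounded_joins M_has_reps o.M_has_reps unfolding M_opp
    by (intro pos_pair.intro pos_pair_axioms.intro group_axioms M_submonoid M_inter)
qed

lemma M_good:
  assumes "\<And>b. good G (Mb b)"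
  shows "good G M"
  unfolding good_def
proof (intro conjI allI impI ballI)
  show "pos_pair G M" by (rule M_pos_pair)
  show "extends_homs G P" if P: "parabolic G M P" for P
  proof (rule M_extends[OF P])
    show "extends_homs G (P \<inter> Mb b)" for b
      using assms[of b] parabolic_restrict[OF P, of b] unfolding good_def by blast
  qed
  have "x = \<one>" if "x \<in> A b" "n > 0" "x [^] n = \<one>" for b x and n :: nat
    using assms[of b] that unfolding good_def A_eq by blast
  then show "g = \<one>" if "g \<in> generate G M" "n > 0" "g [^] n = \<one>" for g and n :: nat
    using M_torsion that by blast
qed

end

section \<open>Transport along embeddings\<close>

locale monoid_embedding = group G for M :: "'a monoid" and G :: "'g monoid" and \<iota> +
  assumes M_monoid: "monoid M" and hom: "\<iota> \<in> mon_hom M G" and inj: "inj_on \<iota> (carrier M)"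
begin

lemma hom_simps: "a \<in> carrier M \<Longrightarrow> \<iota> a \<in> carrier G"
  "a \<in> carrier M \<Longrightarrow> b \<in> carrier M \<Longrightarrow> \<iota> (a \<otimes>\<^bsub>M\<^esub> b) = \<iota> a \<otimes>\<^bsub>G\<^esub> \<iota> b" "\<iota> \<one>\<^bsub>M\<^esub> = \<one>\<^bsub>G\<^esub>"
  using hom by (auto simp: mon_hom_def hom_def)

abbreviation "im \<equiv> \<iota> ` carrier M"

lemma im_iff: "X \<subseteq> carrier M \<Longrightarrow> x \<in> carrier M \<Longrightarrow> \<iota> x \<in> \<iota> ` X \<longleftrightarrow> x \<in> X"
  by (rule inj_on_image_mem_iff[OF inj])

lemma im_submonoid: "submonoid im G"
proof -
  interpret M: monoid M by (rule M_monoid)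
  show ?thesis
  proof (rule submonoid.intro)
    show "im \<subseteq> carrier G" using hom_simps(1) by blast
    show "\<one>\<^bsub>G\<^esub> \<in> im" using hom_simps(3) M.one_closed by (metis imageI)
    show "x \<otimes>\<^bsub>G\<^esub> y \<in> im" if "x \<in> im" "y \<in> im" for x y
      using that hom_simps(2) M.m_closed by (metis (no_types, lifting) image_iff)
  qed
qed

lemma pos_le_iff:
  assumes "a \<in> carrier M" "b \<in> carrier M"
  shows "pos_le G im (\<iota> a) (\<iota> b) \<longleftrightarrow> ldiv M a b" "pos_le (opp G) im (\<iota> a) (\<iota> b) \<longleftrightarrow> rdiv M a b"
proof -
  interpret M: monoid M by (rule M_monoid)
  have inj': "\<iota> x = \<iota> y \<longleftrightarrow> x = y" if "x \<in> carrier M" "y \<in> carrier M" for x y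
    using inj that by (auto dest: inj_onD)
  show "pos_le G im (\<iota> a) (\<iota> b) \<longleftrightarrow> ldiv M a b"
  proof -
    have "inv\<^bsub>G\<^esub> \<iota> a \<otimes>\<^bsub>G\<^esub> \<iota> b = \<iota> c \<longleftrightarrow> b = a \<otimes>\<^bsub>M\<^esub> c" if "c \<in> carrier M" for c
      using inv_mult_eq_iff[of "\<iota> a" "\<iota> b" "\<iota> c"] assms that hom_simps(1) inj'[of b "a \<otimes>\<^bsub>M\<^esub> c"]
      by (simp add: hom_simps(2))
    then show ?thesis unfolding pos_le_def ldiv_def by auto
  qed
  show "pos_le (opp G) im (\<iota> a) (\<iota> b) \<longleftrightarrow> rdiv M a b"
  proof -
    have "\<iota> b \<otimes>\<^bsub>G\<^esub> inv\<^bsub>G\<^esub> \<iota> a = \<iota> c \<longleftrightarrow> b = c \<otimes>\<^bsub>M\<^esub> a" if "c \<in> carrier M" for c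
      using inv_solve_right'[of "\<iota> c" "\<iota> b" "\<iota> a"] assms that hom_simps(1) inj'[of b "c \<otimes>\<^bsub>M\<^esub> a"]
      by (simp add: hom_simps(2))
    then show ?thesis
      using pos_le_opp[OF group_axioms hom_simps(1)[OF assms(1)], of im "\<iota> b"] unfolding rdiv_def by auto
  qed
qed

lemma pos_join_iff:
  assumes "a \<in> carrier M" "b \<in> carrier M" "c \<in> carrier M"
  shows "pos_join G im (\<iota> a) (\<iota> b) (\<iota> c) \<longleftrightarrow> is_join M (ldiv M) a b c"
    "pos_join (opp G) im (\<iota> a) (\<iota> b) (\<iota> c) \<longleftrightarrow> is_join M (rdiv M) a b c"
  unfolding pos_join_def is_join_def upper_bound_def
  using pos_le_iff assms by (auto simp: image_iff)

lemma parabolic_iff: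
  assumes N: "N \<subseteq> carrier M"
  shows "parabolic G im (\<iota> ` N) \<longleftrightarrow> std_parabolic N M"
proof -
  interpret M: monoid M by (rule M_monoid)
  have Nc: "x \<in> carrier M" if "x \<in> N" for x using that N by blast
  have mult: "\<iota> a \<otimes>\<^bsub>G\<^esub> \<iota> b \<in> \<iota> ` N \<longleftrightarrow> a \<otimes>\<^bsub>M\<^esub> b \<in> N" if "a \<in> carrier M" "b \<in> carrier M" for a b
    using im_iff[OF N, of "a \<otimes>\<^bsub>M\<^esub> b"] that by (simp add: hom_simps(2))
  have sub: "submonoid (\<iota> ` N) G \<longleftrightarrow> submonoid N M"
  proof -
    have "\<iota> ` N \<subseteq> carrier G" using Nc hom_simps(1) by blast
    moreover have "(\<forall>x y. x \<in> \<iota> ` N \<longrightarrow> y \<in> \<iota> ` N \<longrightarrow> x \<otimes>\<^bsub>G\<^esub> y \<in> \<iota> ` N) \<longleftrightarrow>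
        (\<forall>x y. x \<in> N \<longrightarrow> y \<in> N \<longrightarrow> x \<otimes>\<^bsub>M\<^esub> y \<in> N)"
      using mult Nc by blast
    moreover have "\<one>\<^bsub>G\<^esub> \<in> \<iota> ` N \<longleftrightarrow> \<one>\<^bsub>M\<^esub> \<in> N"
      using im_iff[OF N M.one_closed] by (simp add: hom_simps(3))
    ultimately show ?thesis unfolding submonoid_def using N by blast
  qed
  have special: "(\<forall>a\<in>im. \<forall>b\<in>im. a \<otimes>\<^bsub>G\<^esub> b \<in> \<iota> ` N \<longrightarrow> a \<in> \<iota> ` N \<and> b \<in> \<iota> ` N) \<longleftrightarrow>
      (\<forall>a\<in>carrier M. \<forall>b\<in>carrier M. a \<otimes>\<^bsub>M\<^esub> b \<in> N \<longrightarrow> a \<in> N \<and> b \<in> N)"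
    using mult im_iff[OF N] by (simp add: ball_simps)
  have join: "(\<forall>a\<in>\<iota> ` N. \<forall>b\<in>\<iota> ` N. \<forall>c. J' a b c \<longrightarrow> c \<in> \<iota> ` N) \<longleftrightarrow>
      (\<forall>a\<in>N. \<forall>b\<in>N. \<forall>c. J a b c \<longrightarrow> c \<in> N)"
    if J: "\<And>a b c. a \<in> carrier M \<Longrightarrow> b \<in> carrier M \<Longrightarrow> c \<in> carrier M \<Longrightarrow> J' (\<iota> a) (\<iota> b) (\<iota> c) \<longleftrightarrow> J a b c"
      and JM: "\<And>a b c. J a b c \<Longrightarrow> c \<in> carrier M" "\<And>a b c. J' a b c \<Longrightarrow> c \<in> im" for J J'
  proof
    assume l: "\<forall>a\<in>\<iota> ` N. \<forall>b\<in>\<iota> ` N. \<forall>c. J' a b c \<longrightarrow> c \<in> \<iota> ` N"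
    show "\<forall>a\<in>N. \<forall>b\<in>N. \<forall>c. J a b c \<longrightarrow> c \<in> N"
    proof (intro ballI allI impI)
      fix a b c assume abc: "a \<in> N" "b \<in> N" "J a b c"
      then have c: "c \<in> carrier M" using JM(1) by blast
      have "J' (\<iota> a) (\<iota> b) (\<iota> c)" using J[OF Nc[OF abc(1)] Nc[OF abc(2)] c] abc(3) by simp
      then have "\<iota> c \<in> \<iota> ` N" using l abc by blast
      then show "c \<in> N" using im_iff[OF N c] by simp
    qed
  next
    assume r: "\<forall>a\<in>N. \<forall>b\<in>N. \<forall>c. J a b c \<longrightarrow> c \<in> N"
    show "\<forall>a\<in>\<iota> ` N. \<forall>b\<in>\<iota> ` N. \<forall>c. J' a b c \<longrightarrow> c \<in> \<iota> ` N"
    proof (intro ballI allI impI)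
      fix a' b' c' assume abc: "a' \<in> \<iota> ` N" "b' \<in> \<iota> ` N" "J' a' b' c'"
      obtain a b c where ab: "a \<in> N" "b \<in> N" "c \<in> carrier M" "a' = \<iota> a" "b' = \<iota> b" "c' = \<iota> c"
        using abc JM(2)[OF abc(3)] by blast
      have "J a b c" using J[OF Nc[OF ab(1)] Nc[OF ab(2)] ab(3)] abc(3) ab by simp
      then show "c' \<in> \<iota> ` N" using r ab by blast
    qed
  qed
  have join1: "(\<forall>a\<in>\<iota> ` N. \<forall>b\<in>\<iota> ` N. \<forall>c. pos_join G im a b c \<longrightarrow> c \<in> \<iota> ` N) \<longleftrightarrow>
      (\<forall>a\<in>N. \<forall>b\<in>N. \<forall>c. is_join M (ldiv M) a b c \<longrightarrow> c \<in> N)"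
    by (rule join) (simp_all add: pos_join_iff, simp_all add: pos_join_def is_join_def upper_bound_def)
  have join2: "(\<forall>a\<in>\<iota> ` N. \<forall>b\<in>\<iota> ` N. \<forall>c. pos_join (opp G) im a b c \<longrightarrow> c \<in> \<iota> ` N) \<longleftrightarrow>
      (\<forall>a\<in>N. \<forall>b\<in>N. \<forall>c. is_join M (rdiv M) a b c \<longrightarrow> c \<in> N)"
    by (rule join) (simp_all add: pos_join_iff, simp_all add: pos_join_def is_join_def upper_bound_def)
  have "\<iota> ` N \<subseteq> im" using N by (rule image_mono)
  then show ?thesis unfolding parabolic_def std_parabolic_def sub special join1 join2 by simp
qed

end

section \<open>Images under injective group homomorphisms\<close>

locale group_embedding = group_hom G G' \<phi> for G G' :: "'g monoid" and \<phi> +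
  assumes inj: "inj_on \<phi> (carrier G)"
begin

lemma image_iff: "X \<subseteq> carrier G \<Longrightarrow> x \<in> carrier G \<Longrightarrow> \<phi> x \<in> \<phi> ` X \<longleftrightarrow> x \<in> X"
  by (rule inj_on_image_mem_iff[OF inj])

lemma embedding_opp: "group_embedding (opp G) (opp G') \<phi>"
proof (intro group_embedding.intro group_hom.intro group_embedding_axioms.intro)
  show "group (opp G)" "group (opp G')" by (rule group_opp; unfold_locales)+
  show "group_hom_axioms (opp G) (opp G') \<phi>"
    by (rule group_hom_axioms.intro) (auto simp: hom_def)
  show "inj_on \<phi> (carrier (opp G))" using inj by simp
qed

lemma pos_le_image:
  assumes "M \<subseteq> carrier G" "a \<in> carrier G" "b \<in> carrier G"
  shows "pos_le G' (\<phi> ` M) (\<phi> a) (\<phi> b) \<longleftrightarrow> pos_le G M a b"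
proof -
  have "inv\<^bsub>G'\<^esub> \<phi> a \<otimes>\<^bsub>G'\<^esub> \<phi> b = \<phi> (inv\<^bsub>G\<^esub> a \<otimes>\<^bsub>G\<^esub> b)" using assms by simp
  then show ?thesis
    unfolding pos_le_def using image_iff[OF assms(1), of "inv\<^bsub>G\<^esub> a \<otimes>\<^bsub>G\<^esub> b"] assms by simp
qed

lemma pos_join_image:
  assumes "M \<subseteq> carrier G" "a \<in> carrier G" "b \<in> carrier G" "c \<in> carrier G"
  shows "pos_join G' (\<phi> ` M) (\<phi> a) (\<phi> b) (\<phi> c) \<longleftrightarrow> pos_join G M a b c"
proof -
  have "(\<forall>d\<in>\<phi> ` M. pos_le G' (\<phi> ` M) (\<phi> a) d \<longrightarrow> pos_le G' (\<phi> ` M) (\<phi> b) d \<longrightarrow> pos_le G' (\<phi> ` M) (\<phi> c) d)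
    \<longleftrightarrow> (\<forall>d\<in>M. pos_le G M a d \<longrightarrow> pos_le G M b d \<longrightarrow> pos_le G M c d)"
    using pos_le_image[OF assms(1)] assms by (simp add: subset_iff)
  then show ?thesis
    unfolding pos_join_def using pos_le_image[OF assms(1)] image_iff[OF assms(1)] assms by simp
qed

text \<open>Both sides are instances of \<open>parabolic_iff\<close>: for the inclusion of
  \<open>M\<close> in \<open>G\<close> and for the restriction of \<open>\<phi>\<close> to
  \<open>M\<close>.\<close>

lemma parabolic_image:
  assumes M: "submonoid M G" and P: "P \<subseteq> M"
  shows "parabolic G' (\<phi> ` M) (\<phi> ` P) \<longleftrightarrow> parabolic G M P"
proof -
  let ?M = "G\<lparr>carrier := M\<rparr>"
  have Mc: "M \<subseteq> carrier G" by (rule submonoid.subset[OF M])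
  have mon: "monoid ?M" by (rule submonoid.submonoid_is_monoid[OF M G.is_monoid])
  interpret i: monoid_embedding ?M G id
    using mon Mc by (intro monoid_embedding.intro monoid_embedding_axioms.intro G.group_axioms)
      (auto simp: mon_hom_def hom_def)
  have "\<phi> \<in> mon_hom ?M G'"
    unfolding mon_hom_def by (intro CollectI conjI homI) (use Mc in \<open>simp_all add: subset_iff\<close>)
  then interpret f: monoid_embedding ?M G' \<phi>
    using mon inj_on_subset[OF inj Mc]
    by (intro monoid_embedding.intro monoid_embedding_axioms.intro H.group_axioms) simp_all
  show ?thesis using i.parabolic_iff[of P] f.parabolic_iff[of P] P by simp
qed

lemma parabolic_imageE:
  assumes M: "submonoid M G" and P': "parabolic G' (\<phi> ` M) P'"
  obtains P where "parabolic G M P" "P' = \<phi> ` P" "P \<subseteq> carrier G"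
proof -
  have "P' \<subseteq> \<phi> ` M" using parabolicD(2)[OF P'] .
  then obtain P where P: "P \<subseteq> M" "P' = \<phi> ` P" by (auto simp: subset_image_iff)
  then have "P \<subseteq> carrier G" using submonoid.subset[OF M] by blast
  then show ?thesis using that[of P] P P' parabolic_image[OF M P(1)] by blast
qed

lemma generate_image: "P \<subseteq> carrier G \<Longrightarrow> generate G' (\<phi> ` P) = \<phi> ` generate G P"
  using generate_img by simp

lemma bounded_joins_image:
  assumes M: "M \<subseteq> carrier G" and j: "bounded_joins G M"
  shows "bounded_joins G' (\<phi> ` M)"
  unfolding bounded_joins_def
proof (intro ballI impI)
  fix a' b' d' assume a: "a' \<in> \<phi> ` M" "b' \<in> \<phi> ` M" "d' \<in> \<phi> ` M"
    "pos_le G' (\<phi> ` M) a' d'" "pos_le G' (\<phi> ` M) b' d'"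
  then obtain a b d where ab: "a \<in> M" "b \<in> M" "d \<in> M" "a' = \<phi> a" "b' = \<phi> b" "d' = \<phi> d" by blast
  then have c: "a \<in> carrier G" "b \<in> carrier G" "d \<in> carrier G" using M by blast+
  have "pos_le G M a d" "pos_le G M b d" using a(4,5) ab pos_le_image[OF M] c by simp_all
  then obtain e where e: "pos_join G M a b e" using j ab unfolding bounded_joins_def by blast
  then have "e \<in> carrier G" using M unfolding pos_join_def by blast
  then show "\<exists>c. pos_join G' (\<phi> ` M) a' b' c" using pos_join_image[OF M c(1,2)] e ab by blast
qed

lemma has_reps_image:
  assumes sub: "submonoid M G" and r: "has_reps G M"
  shows "has_reps G' (\<phi> ` M)"
  unfolding has_reps_def
proof (intro allI impI)
  have M: "M \<subseteq> carrier G" by (rule submonoid.subset[OF sub])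
  fix P' assume P': "parabolic G' (\<phi> ` M) P'"
  obtain P where P: "parabolic G M P" "P' = \<phi> ` P" "P \<subseteq> carrier G" by (rule parabolic_imageE[OF sub P'])
  obtain R where R: "coset_reps G M P R" using r P(1) unfolding has_reps_def by blast
  have genc: "x \<in> carrier G" if "x \<in> generate G Q" "Q \<subseteq> carrier G" for x Q
    using that G.generate_in_carrier by blast
  have gsub: "generate G Q \<subseteq> carrier G" if "Q \<subseteq> carrier G" for Q
    using that G.generate_incl by blast
  have Rc: "R \<subseteq> carrier G" using R gsub[OF M] unfolding coset_reps_def by blast
  have quot: "inv\<^bsub>G'\<^esub> \<phi> a \<otimes>\<^bsub>G'\<^esub> \<phi> b \<in> \<phi> ` X \<longleftrightarrow> inv\<^bsub>G\<^esub> a \<otimes>\<^bsub>G\<^esub> b \<in> X"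
    if "X \<subseteq> carrier G" "a \<in> carrier G" "b \<in> carrier G" for a b X
    using image_iff[OF that(1), of "inv\<^bsub>G\<^esub> a \<otimes>\<^bsub>G\<^esub> b"] that by simp
  have "coset_reps G' (\<phi> ` M) P' (\<phi> ` R)"
    unfolding coset_reps_def P(2) generate_image[OF M] generate_image[OF P(3)]
  proof (intro conjI ballI allI impI)
    show "\<phi> ` R \<subseteq> \<phi> ` generate G M" using R unfolding coset_reps_def by blast
  next
    fix r s assume rs: "r \<in> \<phi> ` R" "s \<in> \<phi> ` R" "inv\<^bsub>G'\<^esub> r \<otimes>\<^bsub>G'\<^esub> s \<in> \<phi> ` generate G P"
    then obtain a b where ab: "a \<in> R" "b \<in> R" "r = \<phi> a" "s = \<phi> b" by blast
    then have "inv\<^bsub>G\<^esub> a \<otimes>\<^bsub>G\<^esub> b \<in> generate G P"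
      using rs(3) quot[OF gsub[OF P(3)], of a b] Rc by blast
    then have "a = b" using R ab unfolding coset_reps_def by blast
    then show "r = s" using ab by simp
  next
    fix Q' g' assume Q': "parabolic G' (\<phi> ` M) Q'" and g': "g' \<in> generate G' Q'"
    obtain Q where Q: "parabolic G M Q" "Q' = \<phi> ` Q" "Q \<subseteq> carrier G" by (rule parabolic_imageE[OF sub Q'])
    obtain g where g: "g \<in> generate G Q" "g' = \<phi> g" using g' unfolding Q(2) generate_image[OF Q(3)] by blast
    then obtain r where r: "r \<in> R" "r \<in> generate G Q" "inv\<^bsub>G\<^esub> r \<otimes>\<^bsub>G\<^esub> g \<in> generate G P"
      using R Q(1) unfolding coset_reps_def by blast
    then have "inv\<^bsub>G'\<^esub> \<phi> r \<otimes>\<^bsub>G'\<^esub> g' \<in> \<phi> ` generate G P"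
      unfolding g(2) using quot[OF gsub[OF P(3)], of r g] genc[OF g(1) Q(3)] Rc by blast
    then show "\<exists>r\<in>\<phi> ` R \<inter> generate G' Q'. inv\<^bsub>G'\<^esub> r \<otimes>\<^bsub>G'\<^esub> g' \<in> \<phi> ` generate G P"
      unfolding Q(2) generate_image[OF Q(3)] using r by blast
  next
    fix g' assume "g' \<in> \<phi> ` M"
    then obtain g where g: "g \<in> M" "g' = \<phi> g" by blast
    then obtain r where r: "r \<in> R" "r \<in> M" "inv\<^bsub>G\<^esub> r \<otimes>\<^bsub>G\<^esub> g \<in> P"
      using R unfolding coset_reps_def by blast
    then have "inv\<^bsub>G'\<^esub> \<phi> r \<otimes>\<^bsub>G'\<^esub> g' \<in> \<phi> ` P"
      unfolding g(2) using quot[OF P(3), of r g] g(1) M by blast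
    then show "\<exists>r\<in>\<phi> ` R \<inter> \<phi> ` M. inv\<^bsub>G'\<^esub> r \<otimes>\<^bsub>G'\<^esub> g' \<in> \<phi> ` P" using r by blast
  qed
  then show "\<exists>R. coset_reps G' (\<phi> ` M) P' R" ..
qed

lemma extends_image:
  assumes P: "P \<subseteq> carrier G" and ext: "extends_homs G P"
  shows "extends_homs G' (\<phi> ` P)"
  unfolding extends_homs_def
proof (intro allI impI)
  fix L :: "'g monoid" and f
  assume L: "group L" and fc: "f \<in> \<phi> ` P \<rightarrow> carrier L"
    and fm: "\<forall>a\<in>\<phi> ` P. \<forall>b\<in>\<phi> ` P. f (a \<otimes>\<^bsub>G'\<^esub> b) = f a \<otimes>\<^bsub>L\<^esub> f b"
  have Pc: "a \<in> carrier G" if "a \<in> P" for a using that P by blast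
  have gc: "x \<in> carrier G" if "x \<in> generate G P" for x using that G.generate_in_carrier[OF P] by blast
  have "(f \<circ> \<phi>) \<in> P \<rightarrow> carrier L" using fc by auto
  moreover have "\<forall>a\<in>P. \<forall>b\<in>P. (f \<circ> \<phi>) (a \<otimes>\<^bsub>G\<^esub> b) = (f \<circ> \<phi>) a \<otimes>\<^bsub>L\<^esub> (f \<circ> \<phi>) b"
    using fm Pc by simp
  ultimately obtain \<psi> where \<psi>: "\<psi> \<in> generate G P \<rightarrow> carrier L"
    "\<And>x y. x \<in> generate G P \<Longrightarrow> y \<in> generate G P \<Longrightarrow> \<psi> (x \<otimes>\<^bsub>G\<^esub> y) = \<psi> x \<otimes>\<^bsub>L\<^esub> \<psi> y"
    "\<And>a. a \<in> P \<Longrightarrow> \<psi> a = f (\<phi> a)"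
    using ext[unfolded extends_homs_def, rule_format, OF L, of "f \<circ> \<phi>"] by auto
  define \<psi>' where "\<psi>' = \<psi> \<circ> inv_into (carrier G) \<phi>"
  have \<psi>': "\<psi>' (\<phi> x) = \<psi> x" if "x \<in> carrier G" for x
    unfolding \<psi>'_def using inv_into_f_f[OF inj that] by simp
  show "\<exists>\<psi>\<in>generate G' (\<phi> ` P) \<rightarrow> carrier L.
      (\<forall>x\<in>generate G' (\<phi> ` P). \<forall>y\<in>generate G' (\<phi> ` P). \<psi> (x \<otimes>\<^bsub>G'\<^esub> y) = \<psi> x \<otimes>\<^bsub>L\<^esub> \<psi> y) \<and>
      (\<forall>a\<in>\<phi> ` P. \<psi> a = f a)"
    unfolding generate_image[OF P]
  proof (intro bexI[of _ \<psi>'] conjI ballI)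
    show "\<psi>' \<in> \<phi> ` generate G P \<rightarrow> carrier L" using \<psi>(1) \<psi>' gc by auto
    fix x y assume "x \<in> \<phi> ` generate G P" "y \<in> \<phi> ` generate G P"
    then obtain u v where uv: "u \<in> generate G P" "v \<in> generate G P" "x = \<phi> u" "y = \<phi> v" by blast
    have "x \<otimes>\<^bsub>G'\<^esub> y = \<phi> (u \<otimes>\<^bsub>G\<^esub> v)" using uv gc by simp
    then have "\<psi>' (x \<otimes>\<^bsub>G'\<^esub> y) = \<psi> (u \<otimes>\<^bsub>G\<^esub> v)" using uv gc \<psi>'[of "u \<otimes>\<^bsub>G\<^esub> v"] by simp
    then show "\<psi>' (x \<otimes>\<^bsub>G'\<^esub> y) = \<psi>' x \<otimes>\<^bsub>L\<^esub> \<psi>' y"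
      using \<psi>(2) \<psi>' uv gc by simp
  next
    fix a assume "a \<in> \<phi> ` P"
    then show "\<psi>' a = f a" using \<psi>' \<psi>(3) Pc by auto
  qed
qed

lemma good_image:
  assumes g: "good G M"
  shows "good G' (\<phi> ` M)"
proof -
  interpret o: group_embedding "opp G" "opp G'" \<phi> by (rule embedding_opp)
  interpret p: pos_pair G M using g unfolding good_def by blast
  have M: "M \<subseteq> carrier G" by (rule p.subset)
  have "parabolic G' (\<phi> ` M) (\<phi> ` M)"
    using parabolic_self[OF p.is_submonoid] parabolic_image[OF p.is_submonoid subset_refl] by simp
  then have sub: "submonoid (\<phi> ` M) G'" by (rule parabolicD(1))
  have "pos_pair G' (\<phi> ` M)"
  proof (intro pos_pair.intro pos_pair_axioms.intro sub H.group_axioms)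
    show "bounded_joins G' (\<phi> ` M)" by (rule bounded_joins_image[OF M p.joins])
    show "bounded_joins (opp G') (\<phi> ` M)" using o.bounded_joins_image[of M] M p.joins_opp by simp
    show "has_reps G' (\<phi> ` M)" by (rule has_reps_image[OF p.is_submonoid p.reps])
    show "has_reps (opp G') (\<phi> ` M)" using o.has_reps_image[of M] p.is_submonoid p.reps_opp by simp
    fix P' Q' assume P': "parabolic G' (\<phi> ` M) P'" and Q': "parabolic G' (\<phi> ` M) Q'"
    obtain P where P: "parabolic G M P" "P' = \<phi> ` P" "P \<subseteq> carrier G" by (rule parabolic_imageE[OF p.is_submonoid P'])
    obtain Q where Q: "parabolic G M Q" "Q' = \<phi> ` Q" "Q \<subseteq> carrier G" by (rule parabolic_imageE[OF p.is_submonoid Q'])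
    have "generate G P \<subseteq> carrier G" "generate G Q \<subseteq> carrier G"
      using G.generate_incl P(3) Q(3) by blast+
    then have "\<phi> ` generate G P \<inter> \<phi> ` generate G Q = \<phi> ` (generate G P \<inter> generate G Q)"
      using inj_on_image_Int[OF inj] by simp
    also have "\<dots> \<subseteq> \<phi> ` generate G (P \<inter> Q)" using p.inter[OF P(1) Q(1)] by (rule image_mono)
    also have "\<dots> = generate G' (\<phi> ` (P \<inter> Q))" using generate_image[of "P \<inter> Q"] P(3) by blast
    also have "\<phi> ` (P \<inter> Q) = P' \<inter> Q'" unfolding P(2) Q(2) using inj_on_image_Int[OF inj P(3) Q(3)] .
    finally show "generate G' P' \<inter> generate G' Q' \<subseteq> generate G' (P' \<inter> Q')"
      unfolding P(2) Q(2) generate_image[OF P(3)] generate_image[OF Q(3)] .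
  qed
  moreover have "extends_homs G' P'" if P': "parabolic G' (\<phi> ` M) P'" for P'
  proof -
    obtain P where P: "parabolic G M P" "P' = \<phi> ` P" "P \<subseteq> carrier G" by (rule parabolic_imageE[OF p.is_submonoid P'])
    then have "extends_homs G P" using g unfolding good_def by blast
    then show ?thesis unfolding P(2) by (rule extends_image[OF P(3)])
  qed
  moreover have "g' = \<one>\<^bsub>G'\<^esub>" if g': "g' \<in> generate G' (\<phi> ` M)" "n > 0" "g' [^]\<^bsub>G'\<^esub> n = \<one>\<^bsub>G'\<^esub>" for g' and n :: nat
  proof -
    obtain x where x: "x \<in> generate G M" "g' = \<phi> x" using g'(1) unfolding generate_image[OF M] by blast
    then have xc: "x \<in> carrier G" using G.generate_in_carrier[OF M] by blast
    have "\<phi> (x [^]\<^bsub>G\<^esub> n) = \<phi> \<one>\<^bsub>G\<^esub>" using g'(3) x(2) xc by (simp add: hom_nat_pow)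
    then have "x [^]\<^bsub>G\<^esub> n = \<one>\<^bsub>G\<^esub>" using inj_onD[OF inj] xc by simp
    then have "x = \<one>\<^bsub>G\<^esub>" using g x(1) g'(2) unfolding good_def by blast
    then show ?thesis using x(2) by simp
  qed
  ultimately show ?thesis unfolding good_def by blast
qed

end

section \<open>Embedding a Garside monoid into its group\<close>

text \<open>The elements of \<open>BijGroup \<Omega>\<close> are extensional, hence the restriction
  to \<open>\<Omega>\<close>. The lemma serves the action on fractions below and the action on
  normal forms in an amalgam.\<close>

lemma action_hom:
  assumes M: "monoid M" and bij: "\<And>a. a \<in> carrier M \<Longrightarrow> bij_betw (act a) \<Omega> \<Omega>"
    and mult: "\<And>a b w. a \<in> carrier M \<Longrightarrow> b \<in> carrier M \<Longrightarrow> w \<in> \<Omega> \<Longrightarrow> act (a \<otimes>\<^bsub>M\<^esub> b) w = act a (act b w)"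
    and one: "\<And>w. w \<in> \<Omega> \<Longrightarrow> act \<one>\<^bsub>M\<^esub> w = w"
  shows "(\<lambda>a. restrict (act a) \<Omega>) \<in> mon_hom M (BijGroup \<Omega>)"
  unfolding mon_hom_def
proof (intro CollectI conjI homI)
  have Bij: "restrict (act a) \<Omega> \<in> Bij \<Omega>" if "a \<in> carrier M" for a
    using bij[OF that] unfolding Bij_def by (simp add: bij_betw_cong[of \<Omega> "restrict (act a) \<Omega>" "act a"])
  show "restrict (act a) \<Omega> \<in> carrier (BijGroup \<Omega>)" if "a \<in> carrier M" for a
    using Bij[OF that] by (simp add: BijGroup_def)
  show "restrict (act (a \<otimes>\<^bsub>M\<^esub> b)) \<Omega> = restrict (act a) \<Omega> \<otimes>\<^bsub>BijGroup \<Omega>\<^esub> restrict (act b) \<Omega>"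
    if ab: "a \<in> carrier M" "b \<in> carrier M" for a b
  proof -
    have "act b w \<in> \<Omega>" if "w \<in> \<Omega>" for w using bij_betwE[OF bij[OF ab(2)]] that by blast
    then show ?thesis
      using Bij[OF ab(1)] Bij[OF ab(2)] mult[OF ab]
      by (auto simp: BijGroup_def compose_def fun_eq_iff restrict_def)
  qed
  show "restrict (act \<one>\<^bsub>M\<^esub>) \<Omega> = \<one>\<^bsub>BijGroup \<Omega>\<^esub>"
    using one by (auto simp: BijGroup_def fun_eq_iff restrict_def)
qed

section \<open>Powers of the Garside element\<close>

locale garside_pair = monoid M for M :: "'a monoid" (structure) +
  fixes \<Delta>
  assumes gar: "garside_element M \<Delta>"
begin

lemma Delta_closed [simp]: "\<Delta> \<in> carrier M"
  using gar by (simp add: garside_element_def)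

lemma balanced: "a \<in> carrier M \<Longrightarrow> ldiv M a \<Delta> \<longleftrightarrow> rdiv M a \<Delta>"
  using gar unfolding garside_element_def by blast

text \<open>With \<open>\<Delta> = c \<otimes> s \<otimes> d\<close>, the product
  \<open>s \<otimes> d\<close> is a right divisor of \<open>\<Delta>\<close>, hence a left divisor
  by balance, and it begins with \<open>s\<close>.\<close>

lemma factor_ldiv:
  assumes s: "s \<in> carrier M" "factor_of M s \<Delta>"
  shows "ldiv M s \<Delta>"
proof -
  obtain c d where cd: "c \<in> carrier M" "d \<in> carrier M" "\<Delta> = c \<otimes> s \<otimes> d"
    using s(2) unfolding factor_of_def by blast
  have "rdiv M (s \<otimes> d) \<Delta>" unfolding rdiv_def using cd s(1) by (intro bexI[of _ c]) (simp_all add: m_assoc)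
  then obtain e where e: "e \<in> carrier M" "\<Delta> = s \<otimes> d \<otimes> e"
    using balanced[of "s \<otimes> d"] cd(2) s(1) unfolding ldiv_def by auto
  have "\<Delta> = s \<otimes> (d \<otimes> e)" using e cd(2) s(1) by (simp add: m_assoc)
  then show ?thesis unfolding ldiv_def using cd(2) e(1) by (intro bexI[of _ "d \<otimes> e"]) simp_all
qed

lemma garside_induct:
  assumes a: "a \<in> carrier M" and one: "T \<one>"
    and factor: "\<And>s. s \<in> carrier M \<Longrightarrow> ldiv M s \<Delta> \<Longrightarrow> T s"
    and mult: "\<And>a b. a \<in> carrier M \<Longrightarrow> b \<in> carrier M \<Longrightarrow> T a \<Longrightarrow> T b \<Longrightarrow> T (a \<otimes> b)"
  shows "T a"
proof -
  define S where "S = {a \<in> carrier M. T a}"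
  have "submonoid S M" by (rule submonoid.intro) (auto simp: S_def one mult)
  moreover have "{a \<in> carrier M. factor_of M a \<Delta>} \<subseteq> S"
    using factor factor_ldiv by (auto simp: S_def)
  moreover have "\<Inter>{H. submonoid H M \<and> {a \<in> carrier M. factor_of M a \<Delta>} \<subseteq> H} = carrier M"
    using gar unfolding garside_element_def by blast
  ultimately have "carrier M \<subseteq> S" by blast
  then show ?thesis using a by (auto simp: S_def)
qed

text \<open>If \<open>\<Delta> = s \<otimes> t\<close>, the cofactor \<open>t\<close> is a right
  divisor and so a left divisor, say \<open>\<Delta> = t \<otimes> u\<close>; then \<open>s
  \<otimes> \<Delta> = s \<otimes> t \<otimes> u = \<Delta> \<otimes> u\<close>. This passes to
  products.\<close>

lemma Delta_normal:
  assumes "a \<in> carrier M"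
  shows "\<exists>b\<in>carrier M. a \<otimes> \<Delta> = \<Delta> \<otimes> b"
  using assms
proof (rule garside_induct)
  show "\<exists>b\<in>carrier M. \<one> \<otimes> \<Delta> = \<Delta> \<otimes> b" by (intro bexI[of _ \<one>]) simp_all
next
  fix s assume s: "s \<in> carrier M" "ldiv M s \<Delta>"
  then obtain t where t: "t \<in> carrier M" "\<Delta> = s \<otimes> t" unfolding ldiv_def by blast
  then have "rdiv M t \<Delta>" unfolding rdiv_def using s(1) by blast
  then obtain u where u: "u \<in> carrier M" "\<Delta> = t \<otimes> u"
    using balanced[OF t(1)] unfolding ldiv_def by blast
  have "s \<otimes> \<Delta> = s \<otimes> t \<otimes> u" using s(1) t(1) u by (simp add: m_assoc)
  also have "\<dots> = \<Delta> \<otimes> u" using t(2) by simp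
  finally show "\<exists>b\<in>carrier M. s \<otimes> \<Delta> = \<Delta> \<otimes> b" using u(1) by blast
next
  fix a b assume ab: "a \<in> carrier M" "b \<in> carrier M"
    "\<exists>c\<in>carrier M. a \<otimes> \<Delta> = \<Delta> \<otimes> c" "\<exists>c\<in>carrier M. b \<otimes> \<Delta> = \<Delta> \<otimes> c"
  then obtain c d where cd: "c \<in> carrier M" "a \<otimes> \<Delta> = \<Delta> \<otimes> c" "d \<in> carrier M" "b \<otimes> \<Delta> = \<Delta> \<otimes> d"
    by blast
  have "a \<otimes> b \<otimes> \<Delta> = a \<otimes> \<Delta> \<otimes> d" using ab(1,2) cd(3,4) by (simp add: m_assoc)
  also have "\<dots> = \<Delta> \<otimes> c \<otimes> d" unfolding cd(2) ..
  also have "\<dots> = \<Delta> \<otimes> (c \<otimes> d)" using cd(1,3) by (simp add: m_assoc)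
  finally show "\<exists>c\<in>carrier M. a \<otimes> b \<otimes> \<Delta> = \<Delta> \<otimes> c" using cd by blast
qed

text \<open>The quantifier over \<open>x\<close> carries the induction through products: once
  \<open>x \<otimes> \<Delta> [^] i\<close> is a multiple \<open>a \<otimes> y\<close>, the
  statement for \<open>b\<close> is applied to \<open>y\<close>. It yields common multiples and the
  surjectivity of the action on fractions.\<close>

lemma divides_Delta_multiple:
  assumes "a \<in> carrier M"
  shows "\<forall>x\<in>carrier M. \<exists>i::nat. \<exists>y\<in>carrier M. a \<otimes> y = x \<otimes> \<Delta> [^] i"
  using assms
proof (rule garside_induct)
  show "\<forall>x\<in>carrier M. \<exists>i::nat. \<exists>y\<in>carrier M. \<one> \<otimes> y = x \<otimes> \<Delta> [^] i"
    by (intro ballI exI[of _ 0]) simp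
next
  fix s assume s: "s \<in> carrier M" "ldiv M s \<Delta>"
  then obtain t where t: "t \<in> carrier M" "\<Delta> = s \<otimes> t" unfolding ldiv_def by blast
  show "\<forall>x\<in>carrier M. \<exists>i::nat. \<exists>y\<in>carrier M. s \<otimes> y = x \<otimes> \<Delta> [^] i"
  proof
    fix x assume x: "x \<in> carrier M"
    obtain b where b: "b \<in> carrier M" "x \<otimes> \<Delta> = \<Delta> \<otimes> b" using Delta_normal[OF x] by blast
    have "s \<otimes> (t \<otimes> b) = \<Delta> \<otimes> b" unfolding t(2) using s(1) t(1) b(1) by (simp add: m_assoc)
    then have "s \<otimes> (t \<otimes> b) = x \<otimes> \<Delta> [^] (1::nat)" using b(2) by simp
    then show "\<exists>i::nat. \<exists>y\<in>carrier M. s \<otimes> y = x \<otimes> \<Delta> [^] i" using t(1) b(1) by blast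
  qed
next
  fix a b assume ab: "a \<in> carrier M" "b \<in> carrier M"
    and a: "\<forall>x\<in>carrier M. \<exists>i::nat. \<exists>y\<in>carrier M. a \<otimes> y = x \<otimes> \<Delta> [^] i"
    and b: "\<forall>x\<in>carrier M. \<exists>i::nat. \<exists>y\<in>carrier M. b \<otimes> y = x \<otimes> \<Delta> [^] i"
  show "\<forall>x\<in>carrier M. \<exists>i::nat. \<exists>y\<in>carrier M. a \<otimes> b \<otimes> y = x \<otimes> \<Delta> [^] i"
  proof
    fix x assume x: "x \<in> carrier M"
    obtain i :: nat and y where y: "y \<in> carrier M" "a \<otimes> y = x \<otimes> \<Delta> [^] i" using a x by blast
    obtain j :: nat and z where z: "z \<in> carrier M" "b \<otimes> z = y \<otimes> \<Delta> [^] j" using b y(1) by blast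
    have "a \<otimes> b \<otimes> z = a \<otimes> y \<otimes> \<Delta> [^] j" using ab y(1) z by (simp add: m_assoc)
    also have "\<dots> = x \<otimes> \<Delta> [^] (i + j)" unfolding y(2) using x by (simp add: m_assoc nat_pow_mult)
    finally show "\<exists>i::nat. \<exists>y\<in>carrier M. a \<otimes> b \<otimes> y = x \<otimes> \<Delta> [^] i" using z(1) by blast
  qed
qed

lemma common_multiple:
  assumes "a \<in> carrier M" "b \<in> carrier M"
  shows "\<exists>c. upper_bound M (ldiv M) a b c"
proof -
  obtain i :: nat and y where y: "y \<in> carrier M" "a \<otimes> y = b \<otimes> \<Delta> [^] i"
    using divides_Delta_multiple[OF assms(1)] assms(2) by blast
  have "ldiv M a (a \<otimes> y)" unfolding ldiv_def using y(1) by blast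
  moreover have "ldiv M b (a \<otimes> y)" unfolding ldiv_def y(2) by (intro bexI[of _ "\<Delta> [^] i"]) simp_all
  ultimately show ?thesis unfolding upper_bound_def using assms y(1) by (intro exI[of _ "a \<otimes> y"]) simp
qed

text \<open>\<open>M\<close> acts by bijections on the formal right fractions \<open>x \<Delta>\<^sup>-\<^sup>k\<close>.\<close>

lemma env_map_inj:
  assumes canc: "cancellative M"
  shows "inj_on (env_map M) (carrier M)"
proof -
  have rcanc: "x = y" if "x \<in> carrier M" "y \<in> carrier M" "z \<in> carrier M" "x \<otimes> z = y \<otimes> z" for x y z
    using canc[unfolded cancellative_def, rule_format, of x y \<one> z] that by simp
  have lcanc: "x = y" if "x \<in> carrier M" "y \<in> carrier M" "z \<in> carrier M" "z \<otimes> x = z \<otimes> y" for x y z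
    using canc[unfolded cancellative_def, rule_format, of x y z \<one>] that by simp
  \<comment> \<open>\<open>cl x k\<close> stands for \<open>x \<Delta>\<^sup>-\<^sup>k\<close>.
    Fractions are compared by cross multiplication on the right, which is transitive because powers
    of \<open>\<Delta>\<close> commute with each other and \<open>M\<close> is cancellative.\<close>
  define cl where "cl x k = {(y, j :: nat). y \<in> carrier M \<and> x \<otimes> \<Delta> [^] j = y \<otimes> \<Delta> [^] k}" for x and k :: nat
  have self: "(x, k) \<in> cl x k" if "x \<in> carrier M" for x k using that by (simp add: cl_def)
  have comm: "\<Delta> [^] (i::nat) \<otimes> \<Delta> [^] (j::nat) = \<Delta> [^] j \<otimes> \<Delta> [^] i" for i j
    by (simp add: nat_pow_mult add.commute)
  have cross: "x \<otimes> \<Delta> [^] i = z \<otimes> \<Delta> [^] k"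
    if c: "x \<in> carrier M" "y \<in> carrier M" "z \<in> carrier M"
      and xy: "x \<otimes> \<Delta> [^] j = y \<otimes> \<Delta> [^] k" and yz: "y \<otimes> \<Delta> [^] i = z \<otimes> \<Delta> [^] j" for x y z and i j k :: nat
  proof (rule rcanc[of _ _ "\<Delta> [^] j"])
    have "x \<otimes> \<Delta> [^] i \<otimes> \<Delta> [^] j = (x \<otimes> \<Delta> [^] j) \<otimes> \<Delta> [^] i" using c comm[of i j] by (simp add: m_assoc)
    also have "\<dots> = (y \<otimes> \<Delta> [^] i) \<otimes> \<Delta> [^] k" unfolding xy using c comm[of i k] by (simp add: m_assoc)
    also have "\<dots> = z \<otimes> \<Delta> [^] k \<otimes> \<Delta> [^] j" unfolding yz using c comm[of j k] by (simp add: m_assoc)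
    finally show "x \<otimes> \<Delta> [^] i \<otimes> \<Delta> [^] j = z \<otimes> \<Delta> [^] k \<otimes> \<Delta> [^] j" .
  qed (use c in simp_all)
  have cl_eq: "cl x k = cl y j \<longleftrightarrow> x \<otimes> \<Delta> [^] j = y \<otimes> \<Delta> [^] k" if c: "x \<in> carrier M" "y \<in> carrier M" for x y j k
  proof
    assume "cl x k = cl y j"
    then have "(y, j) \<in> cl x k" using self[OF c(2), of j] by simp
    then show "x \<otimes> \<Delta> [^] j = y \<otimes> \<Delta> [^] k" by (simp add: cl_def)
  next
    assume xy: "x \<otimes> \<Delta> [^] j = y \<otimes> \<Delta> [^] k"
    have "x \<otimes> \<Delta> [^] i = z \<otimes> \<Delta> [^] k \<longleftrightarrow> y \<otimes> \<Delta> [^] i = z \<otimes> \<Delta> [^] j" if z: "z \<in> carrier M" for z and i :: nat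
      using cross[OF c(2,1) z xy[symmetric], of i] cross[OF c z xy, of i] by blast
    then show "cl x k = cl y j" unfolding cl_def by auto
  qed
  define \<Omega> where "\<Omega> = {cl x k | x k. x \<in> carrier M}"
  define act where "act a C = (case SOME p. p \<in> C of (x, k) \<Rightarrow> cl (a \<otimes> x) k)" for a C
  have act: "act a (cl x k) = cl (a \<otimes> x) k" if c: "a \<in> carrier M" "x \<in> carrier M" for a x k
  proof -
    obtain y j where yj: "(SOME p. p \<in> cl x k) = (y, j)" by (cases "SOME p. p \<in> cl x k")
    have "(SOME p. p \<in> cl x k) \<in> cl x k" using self[OF c(2)] by (rule someI)
    then have y: "y \<in> carrier M" "x \<otimes> \<Delta> [^] j = y \<otimes> \<Delta> [^] k" unfolding yj by (simp_all add: cl_def)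
    have "a \<otimes> y \<otimes> \<Delta> [^] k = a \<otimes> x \<otimes> \<Delta> [^] j" using y c by (simp add: m_assoc)
    then have "cl (a \<otimes> y) j = cl (a \<otimes> x) k" by (rule cl_eq[THEN iffD2, rotated 2]) (intro m_closed c y(1))+
    then show ?thesis unfolding act_def yj by simp
  qed
  have bij: "bij_betw (act a) \<Omega> \<Omega>" if a: "a \<in> carrier M" for a
  proof (rule bij_betw_imageI)
    show "inj_on (act a) \<Omega>"
    proof (rule inj_onI)
      fix C D assume CD: "C \<in> \<Omega>" "D \<in> \<Omega>" "act a C = act a D"
      obtain x k where x: "C = cl x k" "x \<in> carrier M" using CD(1) unfolding \<Omega>_def by blast
      obtain y j where y: "D = cl y j" "y \<in> carrier M" using CD(2) unfolding \<Omega>_def by blast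
      have "cl (a \<otimes> x) k = act a C" by (simp only: x(1) act[OF a x(2)])
      also have "\<dots> = act a D" by (rule CD(3))
      also have "\<dots> = cl (a \<otimes> y) j" by (simp only: y(1) act[OF a y(2)])
      finally have "cl (a \<otimes> x) k = cl (a \<otimes> y) j" .
      then have "a \<otimes> x \<otimes> \<Delta> [^] j = a \<otimes> y \<otimes> \<Delta> [^] k" by (rule cl_eq[THEN iffD1, rotated 2]) (intro m_closed a x(2) y(2))+
      then have eq: "a \<otimes> (x \<otimes> \<Delta> [^] j) = a \<otimes> (y \<otimes> \<Delta> [^] k)"
        using a x(2) y(2) by (simp add: m_assoc)
      have "x \<otimes> \<Delta> [^] j = y \<otimes> \<Delta> [^] k" using lcanc[OF _ _ a eq] x(2) y(2) by simp
      then have "cl x k = cl y j" by (rule cl_eq[THEN iffD2, rotated 2]) (rule x(2) y(2))+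
      then show "C = D" using x(1) y(1) by simp
    qed
    show "act a ` \<Omega> = \<Omega>"
    proof
      show "act a ` \<Omega> \<subseteq> \<Omega>"
      proof (rule image_subsetI)
        fix C assume "C \<in> \<Omega>"
        then obtain x k where x: "C = cl x k" "x \<in> carrier M" unfolding \<Omega>_def by blast
        show "act a C \<in> \<Omega>" unfolding x(1) act[OF a x(2)] \<Omega>_def using a x(2) by blast
      qed
      show "\<Omega> \<subseteq> act a ` \<Omega>"
      proof
        fix C assume "C \<in> \<Omega>"
        then obtain x k where x: "C = cl x k" "x \<in> carrier M" unfolding \<Omega>_def by blast
        \<comment> \<open>Surjectivity: \<open>x \<Delta>\<^sup>-\<^sup>k\<close> becomes a multiple
          of \<open>a\<close> after expansion by \<open>\<Delta> [^] i\<close>, and the preimage is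
          the cofactor \<open>y\<close> over the exponent \<open>k + i\<close>.\<close>
        obtain i :: nat and y where y: "y \<in> carrier M" "a \<otimes> y = x \<otimes> \<Delta> [^] i"
          using divides_Delta_multiple[OF a] x(2) by blast
        have "a \<otimes> y \<otimes> \<Delta> [^] k = x \<otimes> \<Delta> [^] (k + i)"
          unfolding y(2) using x(2) by (simp add: m_assoc nat_pow_mult add.commute)
        then have "act a (cl y (k + i)) = C"
          unfolding x(1) act[OF a y(1)] using cl_eq[of "a \<otimes> y" x "k + i" k] a y(1) x(2) by simp
        then show "C \<in> act a ` \<Omega>" unfolding \<Omega>_def using y(1) by blast
      qed
    qed
  qed
  have "(\<lambda>a. restrict (act a) \<Omega>) \<in> mon_hom M (BijGroup \<Omega>)"
  proof (rule action_hom[OF monoid_axioms bij])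
    fix a b w assume "a \<in> carrier M" "b \<in> carrier M" "w \<in> \<Omega>"
    then show "act (a \<otimes> b) w = act a (act b w)"
      unfolding \<Omega>_def using act by (auto simp: m_assoc)
  next
    fix w assume "w \<in> \<Omega>"
    then show "act \<one> w = w" unfolding \<Omega>_def using act by auto
  qed
  then obtain h where h: "\<And>a. a \<in> carrier M \<Longrightarrow> h (env_map M a) = restrict (act a) \<Omega>"
    using env_group_universal[OF monoid_axioms group_BijGroup] by blast
  show ?thesis
  proof (rule inj_onI)
    fix a b assume ab: "a \<in> carrier M" "b \<in> carrier M" "env_map M a = env_map M b"
    \<comment> \<open>The fraction \<open>\<one>\<close> is the base point: \<open>a\<close> sends
      it to the fraction \<open>a\<close>, from which \<open>a\<close> is recovered.\<close>
    have "cl \<one> 0 \<in> \<Omega>" unfolding \<Omega>_def by blast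
    moreover have "restrict (act a) \<Omega> = restrict (act b) \<Omega>" using h[OF ab(1)] h[OF ab(2)] ab(3) by simp
    ultimately have "act a (cl \<one> 0) = act b (cl \<one> 0)" by (metis restrict_apply)
    then have "cl a 0 = cl b 0" using act[OF ab(1) one_closed, of 0] act[OF ab(2) one_closed, of 0] ab by simp
    then have "a \<otimes> \<Delta> [^] (0::nat) = b \<otimes> \<Delta> [^] (0::nat)"
      by (rule cl_eq[THEN iffD1, rotated 2]) (rule ab)+
    then show "a = b" using ab by simp
  qed
qed

end

lemma monoid_opp:
  fixes M :: "'a monoid"
  assumes "monoid M"
  shows "monoid (opp M)"
proof -
  interpret monoid M by (rule assms)
  show ?thesis by (rule monoidI) (simp_all add: m_assoc)
qed

lemma garside_element_opp:
  fixes M :: "'a monoid"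
  assumes "monoid M" "garside_element M \<Delta>"
  shows "garside_element (opp M) \<Delta>"
proof -
  interpret monoid M by (rule assms(1))
  have l: "ldiv (opp M) = rdiv M" "rdiv (opp M) = ldiv M"
    by (simp_all add: ldiv_def rdiv_def fun_eq_iff)
  have f: "factor_of (opp M) b a \<longleftrightarrow> factor_of M b a" if "b \<in> carrier M" for a b
    unfolding factor_of_def using that by (auto simp: m_assoc)
  have "{a \<in> carrier M. factor_of (opp M) a \<Delta>} = {a \<in> carrier M. factor_of M a \<Delta>}" using f by blast
  then show ?thesis using assms(2) unfolding garside_element_def l by simp
qed

lemma env_generate:
  assumes "monoid M"
  shows "generate (env_group M) (env_map M ` carrier M) = carrier (env_group M)"
proof
  interpret G: group "env_group M" by (rule env_group_is_group)
  let ?X = "carrier M <+> carrier M" and ?R = "env_rels M"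
  let ?S = "generate (env_group M) (env_map M ` carrier M)"
  have im: "env_map M a \<in> carrier (env_group M)" if "a \<in> carrier M" for a
    using env_map_mon_hom[OF assms] that by (auto simp: mon_hom_def hom_def)
  then have sub: "env_map M ` carrier M \<subseteq> carrier (env_group M)" by blast
  show "?S \<subseteq> carrier (env_group M)" by (rule G.generate_incl[OF sub])
  note c = G.gen_closed[OF sub]
  have gen: "pres_class ?X ?R [x] \<in> ?S" if x: "x \<in> ?X" for x
  proof (cases x)
    case (Inl a)
    then show ?thesis using x unfolding env_map_def by (auto intro: generate.incl)
  next
    case (Inr a)
    then have a: "a \<in> carrier M" using x by auto
    have mem: "pres_class ?X ?R [Inr a] \<in> carrier (env_group M)"
      unfolding env_group_def using a by (auto intro!: pres_class_carrier)
    have "pres_class ?X ?R [Inr a, Inl a] = pres_class ?X ?R []"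
      using a by (intro pres_class_eqI) (auto simp: env_rels_def)
    then have "pres_class ?X ?R [Inr a] \<otimes>\<^bsub>env_group M\<^esub> env_map M a = \<one>\<^bsub>env_group M\<^esub>"
      using a by (simp add: env_map_def env_group_def presented_mult presented_one InlI InrI)
    then have "pres_class ?X ?R [Inr a] = inv\<^bsub>env_group M\<^esub> (env_map M a)"
      using mem im[OF a] by (metis G.inv_equality)
    then show ?thesis using Inr a c(4) by (auto intro: generate.incl)
  qed
  have "pres_class ?X ?R u \<in> ?S" if "u \<in> lists ?X" for u
    using that
  proof (induction u)
    case Nil
    then show ?case using c(2) by (simp add: env_group_def presented_one)
  next
    case (Cons x u)
    then have "pres_class ?X ?R (x # u) = pres_class ?X ?R [x] \<otimes>\<^bsub>env_group M\<^esub> pres_class ?X ?R u"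
      by (simp add: env_group_def presented_mult)
    then show ?case using c(3) gen Cons by simp
  qed
  then show "carrier (env_group M) \<subseteq> ?S"
    unfolding env_group_def by (metis presented_carrierE subsetI)
qed

lemma env_embedding:
  assumes "monoid M" "inj_on (env_map M) (carrier M)"
  shows "monoid_embedding M (env_group M) (env_map M)"
  using assms env_group_is_group env_map_mon_hom
  by (intro monoid_embedding.intro monoid_embedding_axioms.intro)

text \<open>The statement proved by induction over \<open>fc_type\<close>. Injectivity is a separate
  clause because \<open>good\<close> only sees the image of the monoid.\<close>

definition env_good :: "'a monoid \<Rightarrow> bool" where
  "env_good M \<longleftrightarrow> monoid M \<and> inj_on (env_map M) (carrier M) \<and>
    good (env_group M) (env_map M ` carrier M)"

text \<open>Here bounded joins become joins of all pairs: \<open>\<Delta>\<close> provides common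
  multiples on one side and, as a Garside element of \<open>opp M\<close>, on the other. The norm is
  transported along the injective \<open>env_map M\<close>.\<close>

lemma garside_env_good:
  assumes "garside M"
  shows "env_good M"
proof -
  obtain \<Delta> where pg: "pregarside M" and \<Delta>: "garside_element M \<Delta>" using assms unfolding garside_def by blast
  have M: "monoid M" and canc: "cancellative M" and at: "atomic M"
    and jl: "\<And>a b c. a \<in> carrier M \<Longrightarrow> b \<in> carrier M \<Longrightarrow> upper_bound M (ldiv M) a b c \<Longrightarrow>
      \<exists>c. is_join M (ldiv M) a b c"
    and jr: "\<And>a b c. a \<in> carrier M \<Longrightarrow> b \<in> carrier M \<Longrightarrow> upper_bound M (rdiv M) a b c \<Longrightarrow>
      \<exists>c. is_join M (rdiv M) a b c"
    using pg unfolding pregarside_def by blast+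
  interpret P: garside_pair M \<Delta> using M \<Delta> by (intro garside_pair.intro garside_pair_axioms.intro)
  interpret O: garside_pair "opp M" \<Delta>
    using monoid_opp[OF M] garside_element_opp[OF M \<Delta>] by (intro garside_pair.intro garside_pair_axioms.intro)
  have inj: "inj_on (env_map M) (carrier M)" by (rule P.env_map_inj[OF canc])
  interpret E: monoid_embedding M "env_group M" "env_map M" by (rule env_embedding[OF M inj])
  obtain \<nu> :: "'a \<Rightarrow> nat" where \<nu>: "\<And>a. a \<in> carrier M \<Longrightarrow> a \<noteq> \<one>\<^bsub>M\<^esub> \<Longrightarrow> \<nu> a > 0"
    "\<And>a b. a \<in> carrier M \<Longrightarrow> b \<in> carrier M \<Longrightarrow> \<nu> (a \<otimes>\<^bsub>M\<^esub> b) \<ge> \<nu> a + \<nu> b"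
    using at unfolding atomic_def by blast
  define \<mu> where "\<mu> = \<nu> \<circ> inv_into (carrier M) (env_map M)"
  have \<mu>: "\<mu> (env_map M a) = \<nu> a" if "a \<in> carrier M" for a
    unfolding \<mu>_def using inv_into_f_f[OF inj that] by simp
  have lr: "ldiv (opp M) = rdiv M" by (simp add: ldiv_def rdiv_def fun_eq_iff)
  have "lattice_pair (env_group M) E.im \<mu>"
  proof (intro lattice_pair.intro lattice_pair_axioms.intro E.group_axioms E.im_submonoid)
    fix a' assume "a' \<in> E.im" "a' \<noteq> \<one>\<^bsub>env_group M\<^esub>"
    then obtain a where a: "a \<in> carrier M" "a' = env_map M a" "a \<noteq> \<one>\<^bsub>M\<^esub>" using E.hom_simps(3) by blast
    then show "\<mu> a' > 0" using \<mu> \<nu>(1) by simp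
  next
    fix a' b' assume ab': "a' \<in> E.im" "b' \<in> E.im"
    then obtain a b where ab: "a \<in> carrier M" "a' = env_map M a" "b \<in> carrier M" "b' = env_map M b" by blast
    have "a' \<otimes>\<^bsub>env_group M\<^esub> b' = env_map M (a \<otimes>\<^bsub>M\<^esub> b)" using ab E.hom_simps(2) by simp
    then show "\<mu> (a' \<otimes>\<^bsub>env_group M\<^esub> b') \<ge> \<mu> a' + \<mu> b'"
      using ab \<mu> \<nu>(2) P.m_closed by simp
    obtain c where c: "is_join M (ldiv M) a b c"
      using P.common_multiple[OF ab(1,3)] jl[OF ab(1,3)] by blast
    then have "c \<in> carrier M" unfolding is_join_def upper_bound_def by blast
    then show "\<exists>c. pos_join (env_group M) E.im a' b' c"
      using E.pos_join_iff(1)[OF ab(1,3)] c ab(2,4) by blast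
    obtain d where "upper_bound (opp M) (ldiv (opp M)) a b d" using O.common_multiple[of a b] ab by auto
    then have "upper_bound M (rdiv M) a b d" unfolding upper_bound_def lr by simp
    then obtain e where e: "is_join M (rdiv M) a b e" using jr[OF ab(1,3)] by blast
    then have "e \<in> carrier M" unfolding is_join_def upper_bound_def by blast
    then show "\<exists>c. pos_join (opp (env_group M)) E.im a' b' c"
      using E.pos_join_iff(2)[OF ab(1,3)] e ab(2,4) by blast
  qed
  then interpret L: lattice_pair "env_group M" E.im \<mu> .
  show ?thesis unfolding env_good_def using M inj L.lattice_good by blast
qed

section \<open>Reduced words in an amalgamated product of groups\<close>

text \<open>
  Van der Waerden's argument: both factors act on the normal forms \<open>c s\<^sub>1 \<dots> s\<^sub>r\<close>, where \<open>c\<close> lies in the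
  amalgamated subgroup and the \<open>s\<^sub>i\<close> are representatives of right cosets, tagged with their factor.
\<close>

locale amalgam_data =
  fixes Gb :: "bool \<Rightarrow> 'g monoid" and C :: "'c monoid" and hh :: "bool \<Rightarrow> 'c \<Rightarrow> 'g"
  assumes Gb_group: "group (Gb b)" and C_group: "group C"
    and hh_hom: "hh b \<in> hom C (Gb b)" and hh_inj: "inj_on (hh b) (carrier C)"
begin

sublocale Gb: group "Gb b" for b by (rule Gb_group)
sublocale C: group C by (rule C_group)
sublocale hh: group_hom C "Gb b" "hh b" for b
  by (intro group_hom.intro group_hom_axioms.intro Gb_group C_group hh_hom)

section \<open>Normal forms and the action on them\<close>

definition Hb where "Hb b = hh b ` carrier C"
definition hi where "hi b = inv_into (carrier C) (hh b)"
text \<open>Chosen from the coset as a set, hence constant on right cosets. On \<open>Hb b\<close>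
  it need not be the unit; \<open>dec\<close> treats that coset apart.\<close>

definition rep where "rep b x = (SOME y. y \<in> Hb b #>\<^bsub>Gb b\<^esub> x)"
definition starts :: "bool \<Rightarrow> (bool \<times> 'g) list \<Rightarrow> bool" where
  "starts b w \<longleftrightarrow> w \<noteq> [] \<and> fst (hd w) = b"

fun nf :: "(bool \<times> 'g) list \<Rightarrow> bool" where
  "nf [] = True"
| "nf ((b, s) # w) = (s \<in> carrier (Gb b) \<and> s \<notin> Hb b \<and> rep b s = s \<and> \<not> starts b w \<and> nf w)"

definition NF where "NF = {(c, w). c \<in> carrier C \<and> nf w}"

text \<open>Cuts a normal form into an element of \<open>Gb b\<close> and a rest not beginning in
  the factor \<open>b\<close>; \<open>dec\<close> is the inverse. On such pairs the group acts by
  left multiplication on the first component, so the laws of an action need no case distinction on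
  normal forms.\<close>

definition enc where
  "enc b p = (if starts b (snd p) then (hh b (fst p) \<otimes>\<^bsub>Gb b\<^esub> snd (hd (snd p)), tl (snd p))
    else (hh b (fst p), snd p))"

definition dec where
  "dec b q = (if fst q \<in> Hb b then (hi b (fst q), snd q)
    else (hi b (fst q \<otimes>\<^bsub>Gb b\<^esub> inv\<^bsub>Gb b\<^esub> rep b (fst q)), (b, rep b (fst q)) # snd q))"

definition act where "act b g p = dec b (g \<otimes>\<^bsub>Gb b\<^esub> fst (enc b p), snd (enc b p))"

lemma Hb_subgroup: "subgroup (Hb b) (Gb b)"
  unfolding Hb_def by (rule hh.img_is_subgroup)

lemma hi_hh: "c \<in> carrier C \<Longrightarrow> hi b (hh b c) = c"
  unfolding hi_def by (rule inv_into_f_f[OF hh_inj])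

lemma hh_hi: "x \<in> Hb b \<Longrightarrow> hh b (hi b x) = x" "x \<in> Hb b \<Longrightarrow> hi b x \<in> carrier C"
  unfolding hi_def Hb_def by (auto intro: f_inv_into_f inv_into_into)

lemma hh_Hb: "c \<in> carrier C \<Longrightarrow> hh b c \<in> Hb b"
  unfolding Hb_def by simp

lemma Hb_mult_iff:
  assumes "h \<in> Hb b" "x \<in> carrier (Gb b)"
  shows "h \<otimes>\<^bsub>Gb b\<^esub> x \<in> Hb b \<longleftrightarrow> x \<in> Hb b" "x \<otimes>\<^bsub>Gb b\<^esub> h \<in> Hb b \<longleftrightarrow> x \<in> Hb b"
proof -
  interpret H: subgroup "Hb b" "Gb b" by (rule Hb_subgroup)
  have h: "h \<in> carrier (Gb b)" using assms(1) by simp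
  have e: "inv\<^bsub>Gb b\<^esub> h \<otimes>\<^bsub>Gb b\<^esub> (h \<otimes>\<^bsub>Gb b\<^esub> x) = x" "x \<otimes>\<^bsub>Gb b\<^esub> h \<otimes>\<^bsub>Gb b\<^esub> inv\<^bsub>Gb b\<^esub> h = x"
    using h assms(2) by (simp_all add: Gb.group_nf)
  show "h \<otimes>\<^bsub>Gb b\<^esub> x \<in> Hb b \<longleftrightarrow> x \<in> Hb b"
    using assms(1) e(1) H.m_closed H.m_inv_closed by metis
  show "x \<otimes>\<^bsub>Gb b\<^esub> h \<in> Hb b \<longleftrightarrow> x \<in> Hb b"
    using assms(1) e(2) H.m_closed H.m_inv_closed by metis
qed

lemma rep_mem:
  assumes "x \<in> carrier (Gb b)"
  shows "rep b x \<in> Hb b #>\<^bsub>Gb b\<^esub> x"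
  unfolding rep_def using Gb.rcos_self[OF assms Hb_subgroup] by (rule someI)

lemma rep_cong:
  assumes "y \<in> Hb b #>\<^bsub>Gb b\<^esub> x" "x \<in> carrier (Gb b)"
  shows "rep b y = rep b x"
  unfolding rep_def using Gb.repr_independence[OF assms Hb_subgroup] by simp

lemma rep_props:
  assumes x: "x \<in> carrier (Gb b)"
  shows "rep b x \<in> carrier (Gb b)" "rep b (rep b x) = rep b x" "rep b x \<in> Hb b \<longleftrightarrow> x \<in> Hb b"
    "x \<otimes>\<^bsub>Gb b\<^esub> inv\<^bsub>Gb b\<^esub> rep b x \<in> Hb b"
proof -
  obtain h where h: "h \<in> Hb b" "rep b x = h \<otimes>\<^bsub>Gb b\<^esub> x"
    using rep_mem[OF x] unfolding r_coset_def by blast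
  have hc: "h \<in> carrier (Gb b)" using h(1) subgroup.subset[OF Hb_subgroup] by blast
  show "rep b x \<in> carrier (Gb b)" using h(2) hc x by simp
  show "rep b (rep b x) = rep b x" by (rule rep_cong[OF rep_mem[OF x] x])
  show "rep b x \<in> Hb b \<longleftrightarrow> x \<in> Hb b" unfolding h(2) by (rule Hb_mult_iff[OF h(1) x])
  have "x \<otimes>\<^bsub>Gb b\<^esub> inv\<^bsub>Gb b\<^esub> rep b x = inv\<^bsub>Gb b\<^esub> h" unfolding h(2) using hc x by (simp add: Gb.group_nf)
  then show "x \<otimes>\<^bsub>Gb b\<^esub> inv\<^bsub>Gb b\<^esub> rep b x \<in> Hb b"
    using subgroup.m_inv_closed[OF Hb_subgroup h(1)] by simp
qed

lemma rep_lmult: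
  assumes "h \<in> Hb b" "x \<in> carrier (Gb b)"
  shows "rep b (h \<otimes>\<^bsub>Gb b\<^esub> x) = rep b x"
  using assms by (intro rep_cong) (auto simp: r_coset_def)

lemma starts_iff: "starts b w \<longleftrightarrow> (\<exists>s v. w = (b, s) # v)"
  unfolding starts_def by (cases w) auto

lemma enc_in:
  assumes "p \<in> NF"
  shows "fst (enc b p) \<in> carrier (Gb b)" "nf (snd (enc b p))" "\<not> starts b (snd (enc b p))"
  using assms unfolding NF_def enc_def by (auto simp: starts_iff)

lemma dec_in:
  assumes "x \<in> carrier (Gb b)" "nf w" "\<not> starts b w"
  shows "dec b (x, w) \<in> NF"
  unfolding dec_def NF_def using assms rep_props[OF assms(1)] hh_hi(2) by simp

lemma dec_enc:
  assumes "p \<in> NF"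
  shows "dec b (enc b p) = p"
proof -
  obtain c w where p: "p = (c, w)" "c \<in> carrier C" "nf w" using assms unfolding NF_def by auto
  show ?thesis
  proof (cases "starts b w")
    case True
    then obtain s v where w: "w = (b, s) # v" by (auto simp: starts_iff)
    then have s: "s \<in> carrier (Gb b)" "s \<notin> Hb b" "rep b s = s" using p(3) by simp_all
    have h: "hh b c \<in> Hb b" using p(2) by (rule hh_Hb)
    have "hh b c \<otimes>\<^bsub>Gb b\<^esub> s \<notin> Hb b" using Hb_mult_iff(1)[OF h s(1)] s(2) by simp
    moreover have "rep b (hh b c \<otimes>\<^bsub>Gb b\<^esub> s) = s" using rep_lmult[OF h s(1)] s(3) by simp
    moreover have "hh b c \<otimes>\<^bsub>Gb b\<^esub> s \<otimes>\<^bsub>Gb b\<^esub> inv\<^bsub>Gb b\<^esub> s = hh b c" using s(1) p(2) by (simp add: Gb.m_assoc)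
    ultimately show ?thesis unfolding enc_def dec_def using True p w hi_hh by simp
  next
    case False
    then show ?thesis unfolding enc_def dec_def using p hh_Hb hi_hh by simp
  qed
qed

lemma enc_dec:
  assumes "x \<in> carrier (Gb b)" "nf w" "\<not> starts b w"
  shows "enc b (dec b (x, w)) = (x, w)"
proof (cases "x \<in> Hb b")
  case True
  then show ?thesis unfolding enc_def dec_def using assms(3) hh_hi(1) by simp
next
  case False
  note r = rep_props[OF assms(1)]
  have "x \<otimes>\<^bsub>Gb b\<^esub> inv\<^bsub>Gb b\<^esub> rep b x \<otimes>\<^bsub>Gb b\<^esub> rep b x = x" using assms(1) r(1) by (simp add: Gb.m_assoc)
  then show ?thesis unfolding enc_def dec_def using False hh_hi(1)[OF r(4)] by (simp add: starts_def)
qed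

lemma enc_act:
  assumes "g \<in> carrier (Gb b)" "p \<in> NF"
  shows "act b g p \<in> NF" "enc b (act b g p) = (g \<otimes>\<^bsub>Gb b\<^esub> fst (enc b p), snd (enc b p))"
  using assms enc_in[OF assms(2), of b] unfolding act_def by (simp_all add: dec_in enc_dec)

lemma act_mult:
  assumes "g \<in> carrier (Gb b)" "h \<in> carrier (Gb b)" "p \<in> NF"
  shows "act b (g \<otimes>\<^bsub>Gb b\<^esub> h) p = act b g (act b h p)"
  using assms enc_act(2)[OF assms(2,3)] enc_in(1)[OF assms(3), of b]
  by (simp add: act_def[of b g] act_def[of b "g \<otimes>\<^bsub>Gb b\<^esub> h"] Gb.m_assoc)

lemma act_one: "p \<in> NF \<Longrightarrow> act b \<one>\<^bsub>Gb b\<^esub> p = p"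
  unfolding act_def using enc_in(1)[of p b] dec_enc[of p b] by simp

lemma act_bij:
  assumes g: "g \<in> carrier (Gb b)"
  shows "bij_betw (act b g) NF NF"
proof (rule bij_betw_byWitness[where f' = "act b (inv\<^bsub>Gb b\<^esub> g)"])
  show "\<forall>p\<in>NF. act b (inv\<^bsub>Gb b\<^esub> g) (act b g p) = p"
    using act_mult[of "inv\<^bsub>Gb b\<^esub> g" b g, symmetric] g act_one by simp
  show "\<forall>p\<in>NF. act b g (act b (inv\<^bsub>Gb b\<^esub> g) p) = p"
    using act_mult[of g b "inv\<^bsub>Gb b\<^esub> g", symmetric] g act_one by simp
  show "act b g ` NF \<subseteq> NF" "act b (inv\<^bsub>Gb b\<^esub> g) ` NF \<subseteq> NF"
    using enc_act(1) g by auto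
qed

text \<open>In either factor \<open>h\<close> multiplies the leading element and leaves the letters
  alone. The formula does not involve \<open>b\<close>, so the two actions agree on the amalgamated
  subgroup.\<close>

lemma act_H:
  assumes h: "h \<in> carrier C" and p: "(c, w) \<in> NF"
  shows "act b (hh b h) (c, w) = (h \<otimes>\<^bsub>C\<^esub> c, w)"
proof -
  have c: "c \<in> carrier C" "nf w" using p unfolding NF_def by auto
  then have hc: "(h \<otimes>\<^bsub>C\<^esub> c, w) \<in> NF" using h unfolding NF_def by simp
  have "(hh b h \<otimes>\<^bsub>Gb b\<^esub> fst (enc b (c, w)), snd (enc b (c, w))) = enc b (h \<otimes>\<^bsub>C\<^esub> c, w)"
  proof (cases "starts b w")
    case True
    then obtain s v where "w = (b, s) # v" by (auto simp: starts_iff)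
    then show ?thesis unfolding enc_def using True h c by (simp add: Gb.m_assoc)
  next
    case False
    then show ?thesis unfolding enc_def using h c by simp
  qed
  then show ?thesis unfolding act_def using dec_enc[OF hc, of b] by simp
qed

definition rho where "rho b g = restrict (act b g) NF"

lemma rho_hom: "rho b \<in> mon_hom (Gb b) (BijGroup NF)"
  unfolding rho_def using action_hom[OF Gb.is_monoid act_bij act_mult act_one] .

lemma rho_H: "c \<in> carrier C \<Longrightarrow> rho b (hh b c) = rho d (hh d c)"
  unfolding rho_def using act_H by (auto simp: restrict_def fun_eq_iff)

lemma base_in: "(c, []) \<in> NF \<longleftrightarrow> c \<in> carrier C"
  by (simp add: NF_def)

lemma act_outside:
  assumes x: "x \<in> carrier (Gb b)" "x \<notin> Hb b" and p: "(c, w) \<in> NF" "\<not> starts b w"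
  shows "\<exists>c' s. act b x (c, w) = (c', (b, s) # w)"
proof -
  have c: "c \<in> carrier C" using p(1) unfolding NF_def by simp
  have "x \<otimes>\<^bsub>Gb b\<^esub> hh b c \<notin> Hb b" using Hb_mult_iff(2)[OF hh_Hb[OF c] x(1)] x(2) by simp
  then show ?thesis unfolding act_def enc_def dec_def using p(2) by simp
qed

end

section \<open>From the action to the normal form theorem\<close>

text \<open>\<open>G\<close> is any group to which the factors map compatibly and to which their
  actions on normal forms extend. The existence of \<open>h\<close> already yields injectivity of
  the maps \<open>j b\<close> and the normal form theorem for their images.\<close>

locale amalgam_image = amalgam_data Gb C hh + group G
  for Gb :: "bool \<Rightarrow> 'g monoid" and C :: "'c monoid" and hh :: "bool \<Rightarrow> 'c \<Rightarrow> 'g" and G :: "'g monoid" (structure) +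
  fixes j :: "bool \<Rightarrow> 'g \<Rightarrow> 'g" and h
  assumes j_hom: "j b \<in> hom (Gb b) G"
    and j_H: "c \<in> carrier C \<Longrightarrow> j b (hh b c) = j d (hh d c)"
    and h_hom: "h \<in> hom G (BijGroup NF)"
    and h_j: "x \<in> carrier (Gb b) \<Longrightarrow> h (j b x) = rho b x"
begin

sublocale j: group_hom "Gb b" G "j b" for b
  by (intro group_hom.intro group_hom_axioms.intro Gb_group group_axioms j_hom)

lemma h_apply_mult:
  assumes "x \<in> carrier (Gb b)" "g \<in> carrier G" "p \<in> NF"
  shows "h (j b x \<otimes> g) p = act b x (h g p)"
proof -
  have "h g \<in> carrier (BijGroup NF)" "rho b x \<in> carrier (BijGroup NF)"
    using h_hom rho_hom assms(1,2) unfolding mon_hom_def hom_def by auto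
  moreover then have "h g p \<in> NF" using assms(3) unfolding BijGroup_def Bij_def by (auto dest: bij_betwE)
  moreover have "h (j b x \<otimes> g) = rho b x \<otimes>\<^bsub>BijGroup NF\<^esub> h g"
    using hom_mult[OF h_hom, of "j b x" g] assms h_j by simp
  ultimately show ?thesis
    using assms(3) unfolding BijGroup_def by (simp add: compose_def rho_def)
qed

lemma h_apply:
  assumes "x \<in> carrier (Gb b)" "p \<in> NF"
  shows "h (j b x) p = act b x p"
  using h_j[OF assms(1)] assms(2) by (simp add: rho_def)

lemma h_one: "p \<in> NF \<Longrightarrow> h \<one> p = p"
  using h_apply[OF Gb.one_closed, of p True] act_one by simp

lemma j_inj: "inj_on (j b) (carrier (Gb b))"
proof (rule inj_onI)
  fix x y assume xy: "x \<in> carrier (Gb b)" "y \<in> carrier (Gb b)" "j b x = j b y"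
  have p: "(\<one>\<^bsub>C\<^esub>, []) \<in> NF" by (simp add: base_in)
  have "act b x (\<one>\<^bsub>C\<^esub>, []) = act b y (\<one>\<^bsub>C\<^esub>, [])" using h_apply[OF xy(1) p] h_apply[OF xy(2) p] xy(3) by simp
  then have "enc b (act b x (\<one>\<^bsub>C\<^esub>, [])) = enc b (act b y (\<one>\<^bsub>C\<^esub>, []))" by simp
  then show "x = y" using enc_act(2)[OF xy(1) p] enc_act(2)[OF xy(2) p] xy(1,2) by (simp add: enc_def starts_def)
qed

definition A where "A b = j b ` carrier (Gb b)"
definition H where "H = j True ` Hb True"

lemma H_eq: "H = j b ` Hb b"
  unfolding H_def Hb_def image_image using j_H by (intro image_cong HOL.refl) auto

text \<open>A letter outside \<open>H\<close> puts one new letter on the normal form reached so far,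
  because that form does not begin in the factor of the letter. The length of the word can thus be
  read off from its action on the base point.\<close>

lemma alt_run:
  assumes "alt A H b xs"
  shows "wprod G xs \<in> carrier G \<and>
    (\<exists>c w. h (wprod G xs) (\<one>\<^bsub>C\<^esub>, []) = (c, w) \<and> (c, w) \<in> NF \<and> length w = length xs \<and> \<not> starts (\<not> b) w)"
  using assms
proof (induction xs arbitrary: b)
  case Nil
  have "(\<one>\<^bsub>C\<^esub>, []) \<in> NF" by (simp add: base_in)
  then show ?case using h_one by (simp add: starts_def)
next
  case (Cons y xs)
  then have "y \<in> A b" and y: "y \<notin> H" "alt A H (\<not> b) xs" by simp_all
  then obtain x where x: "x \<in> carrier (Gb b)" "y = j b x" "y \<notin> H" "alt A H (\<not> b) xs"
    unfolding A_def by blast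
  have xH: "x \<notin> Hb b" using x(2,3) H_eq[of b] by blast
  have p: "(\<one>\<^bsub>C\<^esub>, []) \<in> NF" by (simp add: base_in)
  obtain c w where cw: "wprod G xs \<in> carrier G" "h (wprod G xs) (\<one>\<^bsub>C\<^esub>, []) = (c, w)" "(c, w) \<in> NF"
    "length w = length xs" "\<not> starts b w"
    using Cons.IH[OF x(4)] by auto
  obtain c' s where act: "act b x (c, w) = (c', (b, s) # w)"
    using act_outside[OF x(1) xH cw(3,5)] by blast
  have "h (wprod G (y # xs)) (\<one>\<^bsub>C\<^esub>, []) = (c', (b, s) # w)"
    using h_apply_mult[OF x(1) cw(1) p] x(2) cw(2) act by simp
  moreover have "(c', (b, s) # w) \<in> NF" using enc_act(1)[OF x(1) cw(3)] act by simp
  ultimately show ?case using cw(1,4) x(1,2) by (simp add: starts_def)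
qed

lemma alt_notin:
  assumes "alt A H b xs" "wprod G xs \<in> H"
  shows "xs = []"
proof -
  have p: "(\<one>\<^bsub>C\<^esub>, []) \<in> NF" by (simp add: base_in)
  obtain c w where cw: "h (wprod G xs) (\<one>\<^bsub>C\<^esub>, []) = (c, w)" "length w = length xs"
    using alt_run[OF assms(1)] by blast
  obtain e where e: "e \<in> carrier C" "wprod G xs = j True (hh True e)"
    using assms(2) unfolding H_def Hb_def by blast
  have "hh True e \<in> carrier (Gb True)" using e(1) by simp
  then have "h (wprod G xs) (\<one>\<^bsub>C\<^esub>, []) = (e, [])"
    using h_apply[OF _ p] act_H[OF e(1) p] e by simp
  then show ?thesis using cw by simp
qed

lemma amalgam_group: "amalgam_group G A H"
proof (intro amalgam_group.intro amalgam_group_axioms.intro)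
  show "group G" by (rule group_axioms)
  show A: "subgroup (A b) G" for b unfolding A_def by (rule j.img_is_subgroup)
  show "subgroup H G" unfolding H_def by (rule j.subgroup_img_is_subgroup[OF Hb_subgroup])
  have HA: "H \<subseteq> A b" for b
    unfolding H_eq[of b] A_def using subgroup.subset[OF Hb_subgroup] by (rule image_mono)
  show "A b \<inter> A (\<not> b) = H" for b
  proof
    show "H \<subseteq> A b \<inter> A (\<not> b)" using HA by blast
    show "A b \<inter> A (\<not> b) \<subseteq> H"
    proof (rule subsetI, rule ccontr)
      fix z assume z: "z \<in> A b \<inter> A (\<not> b)" "z \<notin> H"
      have zc: "z \<in> carrier G" using z(1) subgroup.subset[OF A] by blast
      have "inv z \<notin> H"
        using z(2) subgroup.m_inv_closed[OF \<open>subgroup H G\<close>, of "inv z"] zc by auto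
      \<comment> \<open>An element common to both factors but outside \<open>H\<close> would give a
        reduced word of length two with trivial product.\<close>
      then have "alt A H b [inv z, z]" using z subgroup.m_inv_closed[OF A[of b]] by simp
      moreover have "wprod G [inv z, z] \<in> H"
        using zc subgroup.one_closed[OF \<open>subgroup H G\<close>] by simp
      ultimately show False using alt_notin by blast
    qed
  qed
  show "xs = []" if "alt A H b xs" "wprod G xs \<in> H" for b xs
    using that by (rule alt_notin)
qed

end

section \<open>The enveloping group of an amalgam\<close>

lemma env_map_hom:
  assumes "monoid M"
  shows "a \<in> carrier M \<Longrightarrow> env_map M a \<in> carrier (env_group M)"
    "a \<in> carrier M \<Longrightarrow> b \<in> carrier M \<Longrightarrow>
      env_map M (a \<otimes>\<^bsub>M\<^esub> b) = env_map M a \<otimes>\<^bsub>env_group M\<^esub> env_map M b"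
    "env_map M \<one>\<^bsub>M\<^esub> = \<one>\<^bsub>env_group M\<^esub>"
  using env_map_mon_hom[OF assms] by (auto simp: mon_hom_def hom_def)

text \<open>The amalgam in abstract form, indexed by \<open>bool\<close> so that the factors are
  treated alike. The target type in \<open>univ\<close> is that of the permutations of normal forms
  over the enveloping groups of the factors, to which the universal property is applied.\<close>

locale amalgam_monoid =
  fixes Mo :: "bool \<Rightarrow> 'a monoid" and Nm :: "'a monoid" and i :: "bool \<Rightarrow> 'a \<Rightarrow> 'a"
    and M :: "'a monoid" and q :: "bool \<Rightarrow> 'a \<Rightarrow> 'a"
  assumes Mo_good: "env_good (Mo b)" and Nm_monoid: "monoid Nm"
    and i_hom: "i b \<in> mon_hom Nm (Mo b)" and i_inj: "inj_on (i b) (carrier Nm)"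
    and i_parabolic: "std_parabolic (i b ` carrier Nm) (Mo b)"
    and M_monoid: "monoid M" and q_hom: "q b \<in> mon_hom (Mo b) M"
    and q_i: "n \<in> carrier Nm \<Longrightarrow> q b (i b n) = q d (i d n)"
    and q_gen: "submonoid T M \<Longrightarrow> (\<And>b. q b ` carrier (Mo b) \<subseteq> T) \<Longrightarrow> carrier M \<subseteq> T"
    and univ: "\<And>(L :: (('a + 'a) list set \<times> (bool \<times> ('a + 'a) list set) list \<Rightarrow>
        ('a + 'a) list set \<times> (bool \<times> ('a + 'a) list set) list) monoid) f. group L \<Longrightarrow>
      (\<And>b. f b \<in> mon_hom (Mo b) L) \<Longrightarrow>
      (\<And>n. n \<in> carrier Nm \<Longrightarrow> f True (i True n) = f False (i False n)) \<Longrightarrow>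
      \<exists>u\<in>mon_hom M L. \<forall>b. \<forall>a\<in>carrier (Mo b). u (q b a) = f b a"
begin

abbreviation "E b \<equiv> env_group (Mo b)"
abbreviation "e b \<equiv> env_map (Mo b)"
abbreviation "G \<equiv> env_group M"
abbreviation "\<iota> \<equiv> env_map M"

definition NE where "NE b = e b ` i b ` carrier Nm"

lemma Mo_monoid: "monoid (Mo b)" and e_inj: "inj_on (e b) (carrier (Mo b))"
  and E_good: "good (E b) (e b ` carrier (Mo b))"
  using Mo_good[of b] by (simp_all add: env_good_def)

sublocale E: monoid_embedding "Mo b" "E b" "e b" for b
  by (rule env_embedding[OF Mo_monoid e_inj])

sublocale G: group G by (rule env_group_is_group)

sublocale M: monoid M by (rule M_monoid)

lemma i_in: "n \<in> carrier Nm \<Longrightarrow> i b n \<in> carrier (Mo b)"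
  using i_hom[of b] by (auto simp: mon_hom_def hom_def)

lemma i_mult: "m \<in> carrier Nm \<Longrightarrow> n \<in> carrier Nm \<Longrightarrow> i b (m \<otimes>\<^bsub>Nm\<^esub> n) = i b m \<otimes>\<^bsub>Mo b\<^esub> i b n"
  using i_hom[of b] by (auto simp: mon_hom_def hom_def)

lemma q_in: "a \<in> carrier (Mo b) \<Longrightarrow> q b a \<in> carrier M"
  and q_mult: "a \<in> carrier (Mo b) \<Longrightarrow> c \<in> carrier (Mo b) \<Longrightarrow> q b (a \<otimes>\<^bsub>Mo b\<^esub> c) = q b a \<otimes>\<^bsub>M\<^esub> q b c"
  and q_one: "q b \<one>\<^bsub>Mo b\<^esub> = \<one>\<^bsub>M\<^esub>"
  using q_hom[of b] by (auto simp: mon_hom_def hom_def)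

lemmas \<iota>_hom = env_map_hom[OF M_monoid]

lemma NE_parabolic: "parabolic (E b) (e b ` carrier (Mo b)) (NE b)"
  unfolding NE_def using E.parabolic_iff[of "i b ` carrier Nm" b] i_parabolic i_in by blast

lemma NE_carrier: "NE b \<subseteq> carrier (E b)"
  using parabolicD(3)[OF NE_parabolic] .

lemma ei_inj: "inj_on (e b \<circ> i b) (carrier Nm)"
  using i_inj[of b] e_inj[of b] i_in by (intro comp_inj_on inj_on_subset[OF e_inj]) auto

text \<open>The passage from one copy of \<open>Nm\<close> to the other is well defined because
  \<open>e b \<circ> i b\<close> is injective, and \<open>extends_homs\<close> carries it from the
  monoid to the subgroup it generates.\<close>

lemma NE_extends:
  obtains \<theta> where "\<theta> \<in> generate (E b) (NE b) \<rightarrow> carrier (E d)"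
    "\<And>x y. x \<in> generate (E b) (NE b) \<Longrightarrow> y \<in> generate (E b) (NE b) \<Longrightarrow> \<theta> (x \<otimes>\<^bsub>E b\<^esub> y) = \<theta> x \<otimes>\<^bsub>E d\<^esub> \<theta> y"
    "\<And>n. n \<in> carrier Nm \<Longrightarrow> \<theta> (e b (i b n)) = e d (i d n)"
proof -
  interpret Nm: monoid Nm by (rule Nm_monoid)
  define f where "f = (e d \<circ> i d) \<circ> inv_into (carrier Nm) (e b \<circ> i b)"
  have f: "f (e b (i b n)) = e d (i d n)" if "n \<in> carrier Nm" for n
    unfolding f_def using inv_into_f_f[OF ei_inj that, of b] by simp
  have ext: "extends_homs (E b) (NE b)"
    using E_good[of b] NE_parabolic[of b] unfolding good_def by blast
  have fc: "f \<in> NE b \<rightarrow> carrier (E d)"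
    unfolding NE_def using f i_in[of _ d] E.hom_simps(1)[of _ d] by auto
  have fm: "f (x \<otimes>\<^bsub>E b\<^esub> y) = f x \<otimes>\<^bsub>E d\<^esub> f y" if xy: "x \<in> NE b" "y \<in> NE b" for x y
  proof -
    obtain m n where mn: "m \<in> carrier Nm" "n \<in> carrier Nm" "x = e b (i b m)" "y = e b (i b n)"
      using xy unfolding NE_def by blast
    have eq: "x \<otimes>\<^bsub>E b\<^esub> y = e b (i b (m \<otimes>\<^bsub>Nm\<^esub> n))"
      unfolding mn(3,4) i_mult[OF mn(1,2)] by (intro E.hom_simps(2)[symmetric] i_in mn(1,2))
    have "f (x \<otimes>\<^bsub>E b\<^esub> y) = e d (i d (m \<otimes>\<^bsub>Nm\<^esub> n))"
      unfolding eq using mn by (intro f) simp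
    also have "\<dots> = e d (i d m) \<otimes>\<^bsub>E d\<^esub> e d (i d n)"
      unfolding i_mult[OF mn(1,2)] by (intro E.hom_simps(2) i_in mn(1,2))
    also have "\<dots> = f x \<otimes>\<^bsub>E d\<^esub> f y" unfolding mn(3,4) f[OF mn(1)] f[OF mn(2)] ..
    finally show ?thesis .
  qed
  have "\<exists>\<psi>\<in>generate (E b) (NE b) \<rightarrow> carrier (E d).
      (\<forall>x\<in>generate (E b) (NE b). \<forall>y\<in>generate (E b) (NE b). \<psi> (x \<otimes>\<^bsub>E b\<^esub> y) = \<psi> x \<otimes>\<^bsub>E d\<^esub> \<psi> y) \<and>
      (\<forall>a\<in>NE b. \<psi> a = f a)"
    by (rule ext[unfolded extends_homs_def, rule_format, OF env_group_is_group fc fm])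
  then obtain \<psi> where \<psi>: "\<psi> \<in> generate (E b) (NE b) \<rightarrow> carrier (E d)"
    "\<forall>x\<in>generate (E b) (NE b). \<forall>y\<in>generate (E b) (NE b). \<psi> (x \<otimes>\<^bsub>E b\<^esub> y) = \<psi> x \<otimes>\<^bsub>E d\<^esub> \<psi> y"
    "\<forall>a\<in>NE b. \<psi> a = f a" by (elim bexE conjE)
  show ?thesis
  proof (rule that[OF \<psi>(1)])
    show "\<psi> (e b (i b n)) = e d (i d n)" if "n \<in> carrier Nm" for n
      using \<psi>(3) f[OF that] that unfolding NE_def by simp
  qed (use \<psi>(2) in simp)
qed

definition C where "C = (E True)\<lparr>carrier := generate (E True) (NE True)\<rparr>"

lemma C_group: "group C"
  unfolding C_def
  using subgroup.subgroup_is_group[OF group.generate_is_subgroup[OF env_group_is_group NE_carrier] env_group_is_group] .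

text \<open>\<open>NE_extends\<close> gives homomorphisms in both directions between the subgroups
  generated by the two copies of \<open>Nm\<close>. They are inverse on generators, hence
  everywhere, so the factors share an isomorphic copy of one group, realised as the subgroup
  \<open>C\<close> of the first.\<close>

lemma identification:
  "\<exists>hh. \<forall>b. hh b \<in> hom C (E b) \<and> inj_on (hh b) (carrier C) \<and>
    hh b ` carrier C = generate (E b) (NE b) \<and> (\<forall>n\<in>carrier Nm. hh b (e True (i True n)) = e b (i b n))"
proof -
  let ?T = "generate (E True) (NE True)" and ?F = "generate (E False) (NE False)"
  interpret ET: group "E True" by (rule env_group_is_group)
  interpret EF: group "E False" by (rule env_group_is_group)
  obtain \<theta> where \<theta>: "\<theta> \<in> ?T \<rightarrow> carrier (E False)"
    "\<And>x y. x \<in> ?T \<Longrightarrow> y \<in> ?T \<Longrightarrow> \<theta> (x \<otimes>\<^bsub>E True\<^esub> y) = \<theta> x \<otimes>\<^bsub>E False\<^esub> \<theta> y"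
    "\<And>n. n \<in> carrier Nm \<Longrightarrow> \<theta> (e True (i True n)) = e False (i False n)"
    using NE_extends[of True False] by blast
  obtain \<eta> where \<eta>: "\<eta> \<in> ?F \<rightarrow> carrier (E True)"
    "\<And>x y. x \<in> ?F \<Longrightarrow> y \<in> ?F \<Longrightarrow> \<eta> (x \<otimes>\<^bsub>E False\<^esub> y) = \<eta> x \<otimes>\<^bsub>E True\<^esub> \<eta> y"
    "\<And>n. n \<in> carrier Nm \<Longrightarrow> \<eta> (e False (i False n)) = e True (i True n)"
    using NE_extends[of False True] by blast
  have \<theta>_hom: "\<theta> \<in> hom C (E False)" using \<theta>(1,2) unfolding C_def hom_def by simp
  interpret \<theta>: group_hom C "E False" \<theta>
    by (intro group_hom.intro group_hom_axioms.intro C_group env_group_is_group \<theta>_hom)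
  have "NE True \<subseteq> ?T" by (rule group.gen_subset[OF env_group_is_group])
  then have gen_C: "generate C (NE True) = ?T"
    unfolding C_def
    by (rule group.generate_consistent[OF env_group_is_group _
          group.generate_is_subgroup[OF env_group_is_group NE_carrier]])
  have "NE True \<subseteq> carrier C" unfolding C_def using \<open>NE True \<subseteq> ?T\<close> by simp
  moreover have "\<theta> ` NE True = NE False" unfolding NE_def image_image using \<theta>(3) by simp
  ultimately have img: "\<theta> ` ?T = ?F" using \<theta>.generate_img[of "NE True"] gen_C by simp
  have T_in: "x \<in> carrier (E True)" if "x \<in> ?T" for x
    using that group.generate_in_carrier[OF env_group_is_group NE_carrier] by blast
  have \<theta>F: "\<theta> x \<in> ?F" if "x \<in> ?T" for x using img that by blast
  have inv: "\<eta> (\<theta> x) = x" if x: "x \<in> ?T" for x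
  proof -
    have "(\<eta> \<circ> \<theta>) x = id x"
    proof (rule group.hom_on_generate_eq[OF env_group_is_group env_group_is_group NE_carrier,
            where f = "\<eta> \<circ> \<theta>" and g = id])
      show "x \<in> ?T" by (rule x)
      show "(\<eta> \<circ> \<theta>) y \<in> carrier (E True)" if "y \<in> ?T" for y using \<eta>(1) \<theta>F[OF that] by auto
      show "(\<eta> \<circ> \<theta>) (y \<otimes>\<^bsub>E True\<^esub> z) = (\<eta> \<circ> \<theta>) y \<otimes>\<^bsub>E True\<^esub> (\<eta> \<circ> \<theta>) z"
        if "y \<in> ?T" "z \<in> ?T" for y z
        using \<theta>(2)[OF that] \<eta>(2)[OF \<theta>F \<theta>F] that by simp
      show "(\<eta> \<circ> \<theta>) y = id y" if "y \<in> NE True" for y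
        using that \<theta>(3) \<eta>(3) unfolding NE_def by auto
    qed (simp_all add: T_in)
    then show ?thesis by simp
  qed
  define hh where "hh b = (if b then id else \<theta>)" for b :: bool
  show ?thesis
  proof (intro exI[of _ hh] allI conjI ballI)
    show "hh b \<in> hom C (E b)" for b
      unfolding hh_def using \<theta>_hom T_in by (auto simp: C_def hom_def)
    show "inj_on (hh b) (carrier C)" for b
      unfolding hh_def C_def using inv by (auto intro: inj_on_inverseI)
    show "hh b ` carrier C = generate (E b) (NE b)" for b
      unfolding hh_def using img by (simp add: C_def)
    show "hh b (e True (i True n)) = e b (i b n)" if "n \<in> carrier Nm" for b n
      unfolding hh_def using \<theta>(3)[OF that] by simp
  qed
qed

section \<open>The factors inside the enveloping group of the amalgam\<close>

lemma j_ex: "\<exists>j\<in>hom (E b) G. \<forall>a\<in>carrier (Mo b). j (e b a) = \<iota> (q b a)"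
proof (rule env_group_universal[OF Mo_monoid env_group_is_group])
  show "(\<lambda>a. \<iota> (q b a)) \<in> mon_hom (Mo b) G"
    using \<iota>_hom q_in[of _ b] q_mult[of _ b] q_one[of b] by (auto simp: mon_hom_def hom_def)
qed

definition j where "j b = (SOME j. j \<in> hom (E b) G \<and> (\<forall>a\<in>carrier (Mo b). j (e b a) = \<iota> (q b a)))"

lemma j: "j b \<in> hom (E b) G" "a \<in> carrier (Mo b) \<Longrightarrow> j b (e b a) = \<iota> (q b a)"
proof -
  have "j b \<in> hom (E b) G \<and> (\<forall>a\<in>carrier (Mo b). j b (e b a) = \<iota> (q b a))"
    unfolding j_def by (rule someI_ex[OF j_ex[unfolded Bex_def]])
  then show "j b \<in> hom (E b) G" "a \<in> carrier (Mo b) \<Longrightarrow> j b (e b a) = \<iota> (q b a)" by simp_all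
qed

sublocale j: group_hom "E b" G "j b" for b
  by (intro group_hom.intro group_hom_axioms.intro env_group_is_group j(1))

definition A where "A b = j b ` carrier (E b)"
definition H where "H = j True ` generate (E True) (NE True)"
definition Mb where "Mb b = j b ` e b ` carrier (Mo b)"
definition N where "N = j True ` NE True"

lemma Mb_eq: "Mb b = \<iota> ` q b ` carrier (Mo b)"
  unfolding Mb_def image_image using j(2) by simp

lemma N_eq: "N = j b ` NE b"
proof -
  have "j b ` NE b = (\<lambda>n. \<iota> (q b (i b n))) ` carrier Nm" for b
    unfolding NE_def image_image by (intro image_cong HOL.refl j(2) i_in)
  moreover have "(\<lambda>n. \<iota> (q b (i b n))) ` carrier Nm = (\<lambda>n. \<iota> (q True (i True n))) ` carrier Nm"
    using q_i[of _ b True] by (intro image_cong HOL.refl) simp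
  ultimately show ?thesis unfolding N_def by simp
qed

text \<open>The actions of the groups \<open>E b\<close> on normal forms are restricted to the
  monoids, glued to an action of \<open>M\<close> by \<open>univ\<close>, and extended to
  \<open>G\<close> by the universal property of the enveloping group. This supplies the map
  \<open>h\<close> of \<open>amalgam_image\<close>.\<close>

lemma amalgam_group_and_inj: "amalgam_group G A H \<and> (\<forall>b. inj_on (j b) (carrier (E b)))"
proof -
  obtain hh where hh: "\<And>b. hh b \<in> hom C (E b)" "\<And>b. inj_on (hh b) (carrier C)"
    "\<And>b. hh b ` carrier C = generate (E b) (NE b)"
    "\<And>b n. n \<in> carrier Nm \<Longrightarrow> hh b (e True (i True n)) = e b (i b n)"
  proof -
    obtain hh where "\<forall>b. hh b \<in> hom C (E b) \<and> inj_on (hh b) (carrier C) \<and>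
      hh b ` carrier C = generate (E b) (NE b) \<and> (\<forall>n\<in>carrier Nm. hh b (e True (i True n)) = e b (i b n))"
      using identification ..
    then show ?thesis by (intro that[of hh]) blast+
  qed
  interpret D: amalgam_data E C hh
    by (intro amalgam_data.intro env_group_is_group C_group hh(1,2))
  have NE_C: "e True (i True n) \<in> carrier C" if "n \<in> carrier Nm" for n
    unfolding C_def NE_def using that by (auto intro: generate.incl)
  have rho_e: "(\<lambda>a. D.rho b (e b a)) \<in> mon_hom (Mo b) (BijGroup D.NF)" for b
    using D.rho_hom[of b] E.hom_simps by (auto simp: mon_hom_def hom_def)
  have "\<exists>u\<in>mon_hom M (BijGroup D.NF). \<forall>b. \<forall>a\<in>carrier (Mo b). u (q b a) = D.rho b (e b a)"
  proof (rule univ[OF group_BijGroup rho_e])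
    fix n assume n: "n \<in> carrier Nm"
    show "D.rho True (e True (i True n)) = D.rho False (e False (i False n))"
      using D.rho_H[OF NE_C[OF n], of True False] hh(4)[OF n] by simp
  qed
  then obtain u where u: "u \<in> mon_hom M (BijGroup D.NF)"
    "\<And>b a. a \<in> carrier (Mo b) \<Longrightarrow> u (q b a) = D.rho b (e b a)" by blast
  obtain h where h: "h \<in> hom G (BijGroup D.NF)" "\<And>a. a \<in> carrier M \<Longrightarrow> h (\<iota> a) = u a"
    using env_group_universal[OF M_monoid group_BijGroup u(1)] by blast
  have hj: "h (j b x) = D.rho b x" if x: "x \<in> carrier (E b)" for b x
  proof -
    have "(h \<circ> j b) x = D.rho b x"
    proof (rule env_group_unique[OF Mo_monoid group_BijGroup _ _ _ x])
      show "h \<circ> j b \<in> hom (E b) (BijGroup D.NF)" using j(1) h(1) by (rule hom_compose)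
      show "D.rho b \<in> hom (E b) (BijGroup D.NF)" using D.rho_hom[of b] by (simp add: mon_hom_def)
      show "(h \<circ> j b) (e b a) = D.rho b (e b a)" if "a \<in> carrier (Mo b)" for a
        using j(2)[OF that] h(2)[OF q_in[OF that]] u(2)[OF that] by simp
    qed
    then show ?thesis by simp
  qed
  have T_in: "hh b c \<in> carrier (E b)" if "c \<in> carrier C" for b c
    using hh(1)[of b] that by (auto simp: hom_def)
  have j_hh: "j b (hh b c) = j d (hh d c)" if c: "c \<in> carrier C" for b d c
  proof -
    have "(j b \<circ> hh b) c = (j d \<circ> hh d) c"
    proof (rule group.hom_on_generate_eq[OF env_group_is_group G.group_axioms NE_carrier[of True],
            where f = "j b \<circ> hh b" and g = "j d \<circ> hh d"])
      show "c \<in> generate (E True) (NE True)" using c by (simp add: C_def)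
      fix x assume "x \<in> generate (E True) (NE True)"
      then have x: "x \<in> carrier C" by (simp add: C_def)
      show "(j b \<circ> hh b) x \<in> carrier G" "(j d \<circ> hh d) x \<in> carrier G" using T_in[OF x] by simp_all
      fix y assume "y \<in> generate (E True) (NE True)"
      then have y: "y \<in> carrier C" by (simp add: C_def)
      have m: "hh b' (x \<otimes>\<^bsub>E True\<^esub> y) = hh b' x \<otimes>\<^bsub>E b'\<^esub> hh b' y" for b'
        using hom_mult[OF hh(1) x y] by (simp add: C_def)
      show "(j b \<circ> hh b) (x \<otimes>\<^bsub>E True\<^esub> y) = (j b \<circ> hh b) x \<otimes>\<^bsub>G\<^esub> (j b \<circ> hh b) y"
        "(j d \<circ> hh d) (x \<otimes>\<^bsub>E True\<^esub> y) = (j d \<circ> hh d) x \<otimes>\<^bsub>G\<^esub> (j d \<circ> hh d) y"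
        using m T_in[OF x] T_in[OF y] by simp_all
    next
      fix x assume "x \<in> NE True"
      then obtain n where n: "n \<in> carrier Nm" "x = e True (i True n)" unfolding NE_def by blast
      show "(j b \<circ> hh b) x = (j d \<circ> hh d) x"
        using n hh(4)[OF n(1)] j(2) i_in[OF n(1)] q_i[OF n(1), of b d] by simp
    qed
    then show ?thesis by simp
  qed
  interpret I: amalgam_image E C hh G j h
    by (intro amalgam_image.intro amalgam_image_axioms.intro D.amalgam_data_axioms G.group_axioms
        j(1) j_hh h(1) hj)
  have "I.A = A" by (simp add: I.A_def A_def fun_eq_iff)
  moreover have "I.H = H" unfolding I.H_def H_def D.Hb_def hh(3) ..
  ultimately show ?thesis using I.amalgam_group I.j_inj by simp
qed

lemma j_inj: "inj_on (j b) (carrier (E b))"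
  using amalgam_group_and_inj by blast

lemma j_embedding: "group_embedding (E b) G (j b)"
  by (intro group_embedding.intro group_embedding_axioms.intro j.group_hom_axioms j_inj)

lemma im_carrier: "e b ` carrier (Mo b) \<subseteq> carrier (E b)"
  using E.hom_simps(1) by blast

lemma Mb_good: "good G (Mb b)"
  unfolding Mb_def by (rule group_embedding.good_image[OF j_embedding E_good])

lemma amalgam_pair: "amalgam_pair G A H Mb N"
proof (intro amalgam_pair.intro amalgam_pair_axioms.intro)
  show "amalgam_group G A H" using amalgam_group_and_inj by blast
  fix b
  show "pos_pair G (Mb b)" using Mb_good unfolding good_def by blast
  show "parabolic G (Mb b) N"
    unfolding N_eq[of b] Mb_def
    using group_embedding.parabolic_image[OF j_embedding E.im_submonoid parabolicD(2)[OF NE_parabolic]]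
      NE_parabolic by blast
  show "A b = generate G (Mb b)"
    unfolding A_def Mb_def group_embedding.generate_image[OF j_embedding im_carrier]
    using env_generate[OF Mo_monoid] by simp
  show "H = generate G N"
    unfolding H_def N_def group_embedding.generate_image[OF j_embedding NE_carrier] ..
qed

sublocale AP: amalgam_pair G A H Mb N
  by (rule amalgam_pair)

lemma AP_M: "AP.M = \<iota> ` carrier M"
proof
  show "AP.M \<subseteq> \<iota> ` carrier M"
    unfolding AP.M_def
  proof (rule AP.S.padded_least)
    show "Mb c \<subseteq> \<iota> ` carrier M" for c unfolding Mb_eq using q_in by blast
    show "x \<otimes>\<^bsub>G\<^esub> y \<in> \<iota> ` carrier M" if xy: "x \<in> \<iota> ` carrier M" "y \<in> \<iota> ` carrier M" for x y
    proof -
      obtain a c where "a \<in> carrier M" "c \<in> carrier M" "x = \<iota> a" "y = \<iota> c" using xy by blast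
      then show ?thesis using \<iota>_hom(2)[of a c] by (intro image_eqI[of _ _ "a \<otimes>\<^bsub>M\<^esub> c"]) simp_all
    qed
    show "\<one>\<^bsub>G\<^esub> \<in> \<iota> ` carrier M" unfolding \<iota>_hom(3)[symmetric] by (rule imageI[OF M.one_closed])
  qed
  have "submonoid {a \<in> carrier M. \<iota> a \<in> AP.M} M"
  proof (rule submonoid.intro)
    show "x \<otimes>\<^bsub>M\<^esub> y \<in> {a \<in> carrier M. \<iota> a \<in> AP.M}"
      if "x \<in> {a \<in> carrier M. \<iota> a \<in> AP.M}" "y \<in> {a \<in> carrier M. \<iota> a \<in> AP.M}" for x y
      using that \<iota>_hom(2) AP.M.m_closed by simp
    show "\<one>\<^bsub>M\<^esub> \<in> {a \<in> carrier M. \<iota> a \<in> AP.M}" using \<iota>_hom(3) AP.M.one_closed by simp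
  qed simp
  moreover have "q b ` carrier (Mo b) \<subseteq> {a \<in> carrier M. \<iota> a \<in> AP.M}" for b
    using q_in AP.Mb_M[of _ b] unfolding Mb_eq by blast
  ultimately have "carrier M \<subseteq> {a \<in> carrier M. \<iota> a \<in> AP.M}" by (rule q_gen)
  then show "\<iota> ` carrier M \<subseteq> AP.M" by blast
qed

section \<open>Injectivity of the canonical morphism of the amalgam\<close>

abbreviation "S b \<equiv> q b ` carrier (Mo b)"

definition HM where "HM = {u. \<iota> u \<in> H}"

text \<open>On the factor, \<open>\<iota> \<circ> q b\<close> equals \<open>j b \<circ> e b\<close>,
  a composition of two injections.\<close>

lemma S_inj:
  assumes "x \<in> S b" "y \<in> S b" "\<iota> x = \<iota> y"
  shows "x = y"
proof -
  obtain a c where ac: "a \<in> carrier (Mo b)" "c \<in> carrier (Mo b)" "x = q b a" "y = q b c"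
    using assms by blast
  then have "j b (e b a) = j b (e b c)" using j(2) assms(3) by simp
  then have "e b a = e b c" using inj_onD[OF j_inj] ac E.hom_simps(1) by blast
  then have "a = c" using inj_onD[OF e_inj] ac by blast
  then show ?thesis using ac by simp
qed

lemma S_N:
  assumes "v \<in> N"
  obtains u where "\<iota> u = v" "\<forall>b. u \<in> S b"
proof -
  obtain n where n: "n \<in> carrier Nm" "v = j True (e True (i True n))"
    using assms unfolding N_def NE_def by blast
  have "q True (i True n) \<in> S b" for b
    using q_i[OF n(1), of True b] i_in[OF n(1), of b] by simp
  moreover have "\<iota> (q True (i True n)) = v" using n(2) j(2) i_in[OF n(1)] by simp
  ultimately show ?thesis using that by blast
qed

lemma S_Mb: "x \<in> S b \<Longrightarrow> \<iota> x \<in> Mb b"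
  unfolding Mb_eq by blast

lemma S_system: "alt_system M S HM"
proof (intro alt_system.intro alt_system_axioms.intro M_monoid)
  interpret Mo: monoid "Mo b" for b by (rule Mo_monoid)
  show "S b \<subseteq> carrier M" for b using q_in by blast
  show "\<one>\<^bsub>M\<^esub> \<in> S b" for b unfolding q_one[of b, symmetric] by (rule imageI[OF Mo.one_closed])
  show "x \<otimes>\<^bsub>M\<^esub> y \<in> S b" if xy: "x \<in> S b" "y \<in> S b" for x y b
  proof -
    obtain a c where "a \<in> carrier (Mo b)" "c \<in> carrier (Mo b)" "x = q b a" "y = q b c" using xy by blast
    then show ?thesis using q_mult[of a b c] by (intro image_eqI[of _ _ "a \<otimes>\<^bsub>Mo b\<^esub> c"]) simp_all
  qed
  show "x \<in> S (\<not> b)" if x: "x \<in> S b" "x \<in> HM" for x b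
  proof -
    have "\<iota> x \<in> N" using AP.Mb_H(2)[OF S_Mb[OF x(1)]] x(2) unfolding HM_def by blast
    then obtain u where u: "\<iota> u = \<iota> x" "\<forall>b. u \<in> S b" by (rule S_N)
    have "u = x" using S_inj[OF u(2)[rule_format] x(1) u(1)] .
    then show ?thesis using u(2) by blast
  qed
qed

sublocale MS: alt_system M S HM
  by (rule S_system)

lemma alt_image:
  assumes "alt S HM b xs"
  shows "alt Mb H b (map \<iota> xs)" "wprod G (map \<iota> xs) = \<iota> (wprod M xs)"
proof -
  show "alt Mb H b (map \<iota> xs)"
    using assms by (induction xs arbitrary: b) (auto simp: HM_def S_Mb)
  show "wprod G (map \<iota> xs) = \<iota> (wprod M xs)"
    using assms
  proof (induction xs arbitrary: b)
    case (Cons x xs)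
    then have "x \<in> S b" "alt S HM (\<not> b) xs" by simp_all
    then show ?case
      using Cons.IH \<iota>_hom(2)[OF MS.sys_in MS.alt_in] by simp
  qed (simp add: \<iota>_hom(3))
qed

text \<open>Equal images have the same length, and their first letters share the divisor
  \<open>t\<close> with remainders in \<open>N\<close>. All of these come from single factors, where
  \<open>\<iota>\<close> is injective, so the decomposition can be lifted to \<open>M\<close>, the
  common part cancelled in \<open>G\<close>, and the remainders absorbed by the second
  letters.\<close>

lemma word_inj:
  assumes "x \<in> S b" "y \<in> S b" "alt S HM (\<not> b) xs" "alt S HM (\<not> b) ys"
    "\<iota> (x \<otimes>\<^bsub>M\<^esub> wprod M xs) = \<iota> (y \<otimes>\<^bsub>M\<^esub> wprod M ys)"
  shows "x \<otimes>\<^bsub>M\<^esub> wprod M xs = y \<otimes>\<^bsub>M\<^esub> wprod M ys"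
  using assms
proof (induction xs arbitrary: x y b ys)
  case Nil
  have c: "x \<in> carrier M" "y \<in> carrier M" "wprod M ys \<in> carrier M"
    using Nil.prems MS.sys_in MS.alt_in by blast+
  have "\<iota> x \<otimes>\<^bsub>G\<^esub> wprod G (map \<iota> []) = \<iota> y \<otimes>\<^bsub>G\<^esub> wprod G (map \<iota> ys)"
    using Nil.prems(5) alt_image(2)[OF Nil.prems(4)] \<iota>_hom(1,2) c by simp
  from AP.M_unique(2)[OF S_Mb[OF Nil.prems(1)] S_Mb[OF Nil.prems(2)] _ alt_image(1)[OF Nil.prems(4)] this]
  have "ys = []" by simp
  then have "\<iota> x = \<iota> y" using Nil.prems(5) c by simp
  then show ?case using S_inj[OF Nil.prems(1,2)] \<open>ys = []\<close> by simp
next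
  case (Cons x1 xs)
  have x1: "x1 \<in> S (\<not> b)" "alt S HM (\<not> \<not> b) xs" using Cons.prems(3) by simp_all
  have c: "x \<in> carrier M" "y \<in> carrier M" "wprod M ys \<in> carrier M" "wprod M (x1 # xs) \<in> carrier M"
    "x1 \<in> carrier M" "wprod M xs \<in> carrier M"
    using Cons.prems x1 MS.sys_in MS.alt_in by blast+
  have eq: "\<iota> x \<otimes>\<^bsub>G\<^esub> wprod G (map \<iota> (x1 # xs)) = \<iota> y \<otimes>\<^bsub>G\<^esub> wprod G (map \<iota> ys)"
    using Cons.prems(5) alt_image(2)[OF Cons.prems(3)] alt_image(2)[OF Cons.prems(4)]
      \<iota>_hom(2)[OF c(1,4)] \<iota>_hom(2)[OF c(2,3)] by simp
  note u = AP.M_unique[OF S_Mb[OF Cons.prems(1)] S_Mb[OF Cons.prems(2)]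
      alt_image(1)[OF Cons.prems(3)] alt_image(1)[OF Cons.prems(4)] eq]
  obtain y1 ys1 where ys: "ys = y1 # ys1" using u(2) by (cases ys) auto
  have y1: "y1 \<in> S (\<not> b)" "alt S HM (\<not> \<not> b) ys1" using Cons.prems(4) ys by simp_all
  have c': "y1 \<in> carrier M" "wprod M ys1 \<in> carrier M" using y1 MS.sys_in MS.alt_in by blast+
  obtain t where t: "t \<in> AP.NR b" "t \<in> Mb b" "inv\<^bsub>G\<^esub> t \<otimes>\<^bsub>G\<^esub> \<iota> x \<in> N"
    using AP.NR_ex[OF S_Mb[OF Cons.prems(1)]] .
  have ty: "inv\<^bsub>G\<^esub> t \<otimes>\<^bsub>G\<^esub> \<iota> y \<in> N"
    using AP.NR_transfer[OF S_Mb[OF Cons.prems(1)] S_Mb[OF Cons.prems(2)] u(1) t] .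
  \<comment> \<open>\<open>w\<close>, \<open>z\<close> and \<open>z'\<close> lift \<open>t\<close>
    and the two remainders to \<open>M\<close>. The remainders lie in both factors, so they can
    multiply the next letters.\<close>
  obtain w where w: "w \<in> S b" "t = \<iota> w" using t(2) unfolding Mb_eq by blast
  obtain z where z: "\<iota> z = inv\<^bsub>G\<^esub> t \<otimes>\<^bsub>G\<^esub> \<iota> x" "\<forall>b. z \<in> S b" using S_N[OF t(3)] .
  note z = z(1) z(2)[rule_format]
  obtain z' where z': "\<iota> z' = inv\<^bsub>G\<^esub> t \<otimes>\<^bsub>G\<^esub> \<iota> y" "\<forall>b. z' \<in> S b" using S_N[OF ty] .
  note z' = z'(1) z'(2)[rule_format]
  have cc: "w \<in> carrier M" "z \<in> carrier M" "z' \<in> carrier M" using w z(2) z'(2) MS.sys_in by blast+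
  note ic = \<iota>_hom(1)
  have factor: "v = w \<otimes>\<^bsub>M\<^esub> s" if "v \<in> S b" "s \<in> S b" "\<iota> s = inv\<^bsub>G\<^esub> t \<otimes>\<^bsub>G\<^esub> \<iota> v" for v s
  proof (rule S_inj[OF that(1) MS.sys_mult[OF w(1) that(2)]])
    show "\<iota> v = \<iota> (w \<otimes>\<^bsub>M\<^esub> s)"
      using \<iota>_hom(2)[OF cc(1) MS.sys_in[OF that(2)]] that(3) w(2) ic[OF cc(1)] ic[OF MS.sys_in[OF that(1)]]
      by (simp add: G.inv_cancel_left)
  qed
  have x: "x = w \<otimes>\<^bsub>M\<^esub> z" by (rule factor[OF Cons.prems(1) z(2) z(1)])
  have y: "y = w \<otimes>\<^bsub>M\<^esub> z'" by (rule factor[OF Cons.prems(2) z'(2) z'(1)])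
  have ex: "x \<otimes>\<^bsub>M\<^esub> wprod M (x1 # xs) = w \<otimes>\<^bsub>M\<^esub> ((z \<otimes>\<^bsub>M\<^esub> x1) \<otimes>\<^bsub>M\<^esub> wprod M xs)"
    unfolding x using c cc by (simp add: M.m_assoc)
  have ey: "y \<otimes>\<^bsub>M\<^esub> wprod M ys = w \<otimes>\<^bsub>M\<^esub> ((z' \<otimes>\<^bsub>M\<^esub> y1) \<otimes>\<^bsub>M\<^esub> wprod M ys1)"
    unfolding y ys using c' cc by (simp add: M.m_assoc)
  have "\<iota> w \<otimes>\<^bsub>G\<^esub> \<iota> ((z \<otimes>\<^bsub>M\<^esub> x1) \<otimes>\<^bsub>M\<^esub> wprod M xs) = \<iota> w \<otimes>\<^bsub>G\<^esub> \<iota> ((z' \<otimes>\<^bsub>M\<^esub> y1) \<otimes>\<^bsub>M\<^esub> wprod M ys1)"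
    using Cons.prems(5) unfolding ex ey using \<iota>_hom(2) c c' cc by simp
  then have "\<iota> ((z \<otimes>\<^bsub>M\<^esub> x1) \<otimes>\<^bsub>M\<^esub> wprod M xs) = \<iota> ((z' \<otimes>\<^bsub>M\<^esub> y1) \<otimes>\<^bsub>M\<^esub> wprod M ys1)"
    using ic c c' cc by simp
  then have "(z \<otimes>\<^bsub>M\<^esub> x1) \<otimes>\<^bsub>M\<^esub> wprod M xs = (z' \<otimes>\<^bsub>M\<^esub> y1) \<otimes>\<^bsub>M\<^esub> wprod M ys1"
    using Cons.IH[OF MS.sys_mult[OF z(2) x1(1)] MS.sys_mult[OF z'(2) y1(1)] x1(2) y1(2)] by blast
  then show ?case unfolding ex ey by simp
qed

lemma \<iota>_inj: "inj_on \<iota> (carrier M)"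
proof (rule inj_onI)
  have "carrier M \<subseteq> padded M S HM True"
    using MS.padded_submonoid MS.sys_subset_padded by (rule q_gen)
  moreover fix x y assume xy: "x \<in> carrier M" "y \<in> carrier M" "\<iota> x = \<iota> y"
  ultimately have p: "x \<in> padded M S HM True" "y \<in> padded M S HM True" by blast+
  obtain a as where a: "a \<in> S True" "alt S HM (\<not> True) as" "x = a \<otimes>\<^bsub>M\<^esub> wprod M as"
    using p(1) by (rule paddedE)
  obtain c cs where c: "c \<in> S True" "alt S HM (\<not> True) cs" "y = c \<otimes>\<^bsub>M\<^esub> wprod M cs"
    using p(2) by (rule paddedE)
  show "x = y" using word_inj[OF a(1) c(1) a(2) c(2)] xy(3) a(3) c(3) by simp
qed

lemma M_env_good: "env_good M"
  unfolding env_good_def using M_monoid \<iota>_inj AP.M_good[OF Mb_good] AP_M by simp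

end

section \<open>Monoids of FC type\<close>

lemma amalgam_generated:
  assumes M1: "monoid M1" and M2: "monoid M2" and i: "i1 \<in> mon_hom N M1" "i2 \<in> mon_hom N M2"
    and T: "submonoid T (amalgam N i1 i2 M1 M2)"
    and in1: "amalgam_in1 N i1 i2 M1 M2 ` carrier M1 \<subseteq> T"
    and in2: "amalgam_in2 N i1 i2 M1 M2 ` carrier M2 \<subseteq> T"
  shows "carrier (amalgam N i1 i2 M1 M2) \<subseteq> T"
proof
  let ?X = "carrier M1 <+> carrier M2" and ?R = "amalgam_rels N i1 i2 M1 M2"
  have letter: "pres_class ?X ?R [x] \<in> T" if "x \<in> ?X" for x
    using that in1 in2 unfolding amalgam_in1_def amalgam_in2_def by (elim PlusE) auto
  have word: "pres_class ?X ?R u \<in> T" if "u \<in> lists ?X" for u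
    using that
  proof (induction u)
    case Nil
    then show ?case
      using submonoid.one_closed[OF T] by (simp add: amalgam_def presented_one)
  next
    case (Cons x u)
    then have "pres_class ?X ?R (x # u) = pres_class ?X ?R [x] \<otimes>\<^bsub>amalgam N i1 i2 M1 M2\<^esub> pres_class ?X ?R u"
      by (simp add: amalgam_def presented_mult)
    then show ?case using submonoid.m_closed[OF T letter[OF Cons.hyps(1)] Cons.IH] by simp
  qed
  fix a assume "a \<in> carrier (amalgam N i1 i2 M1 M2)"
  then obtain u where "u \<in> lists ?X" "a = pres_class ?X ?R u"
    unfolding amalgam_def by (rule presented_carrierE)
  then show "a \<in> T" using word by simp
qed

text \<open>Members of \<open>iso\<close> are only known to be multiplicative; surjectivity provides
  a preimage of the unit, against which the image of the unit is tested.\<close>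

lemma iso_one:
  assumes "monoid M" "monoid K" "\<kappa> \<in> iso M K"
  shows "\<kappa> \<one>\<^bsub>M\<^esub> = \<one>\<^bsub>K\<^esub>"
proof -
  interpret M: monoid M by (rule assms(1))
  interpret K: monoid K by (rule assms(2))
  have h: "\<kappa> \<in> hom M K" "\<kappa> ` carrier M = carrier K"
    using assms(3) by (simp_all add: iso_iff)
  then obtain y where y: "y \<in> carrier M" "\<kappa> y = \<one>\<^bsub>K\<^esub>" using K.one_closed by (metis imageE)
  have "\<kappa> \<one>\<^bsub>M\<^esub> \<otimes>\<^bsub>K\<^esub> \<kappa> y = \<kappa> y" using hom_mult[OF h(1) M.one_closed y(1)] y(1) by simp
  moreover have "\<kappa> \<one>\<^bsub>M\<^esub> \<in> carrier K" using h(2) by blast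
  ultimately show ?thesis using y(2) by simp
qed

lemma amalgam_env_good:
  fixes M M1 M2 N :: "'a monoid"
  assumes good: "env_good M1" "env_good M2" and N: "monoid N"
    and i1: "i1 \<in> mon_hom N M1" "inj_on i1 (carrier N)" "std_parabolic (i1 ` carrier N) M1"
    and i2: "i2 \<in> mon_hom N M2" "inj_on i2 (carrier N)" "std_parabolic (i2 ` carrier N) M2"
    and M: "monoid M" and iso: "M \<cong> amalgam N i1 i2 M1 M2"
  shows "env_good M"
proof -
  let ?A = "amalgam N i1 i2 M1 M2"
  have M1: "monoid M1" and M2: "monoid M2" using good by (simp_all add: env_good_def)
  have A: "monoid ?A" unfolding amalgam_def by (rule presented_monoid_is_monoid)
  interpret M: monoid M by (rule M)
  interpret A: monoid ?A by (rule A)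
  obtain \<kappa> where \<kappa>: "\<kappa> \<in> iso M ?A" using iso unfolding is_iso_def by blast
  define \<mu> where "\<mu> = inv_into (carrier M) \<kappa>"
  have \<kappa>_hom: "\<kappa> \<in> mon_hom M ?A"
    using \<kappa> iso_one[OF M A \<kappa>] by (simp add: mon_hom_def iso_iff)
  have \<kappa>_inj: "inj_on \<kappa> (carrier M)" and \<kappa>_img: "\<kappa> ` carrier M = carrier ?A"
    using \<kappa> by (simp_all add: iso_iff)
  have \<mu>\<kappa>: "\<mu> (\<kappa> x) = x" if "x \<in> carrier M" for x
    unfolding \<mu>_def using inv_into_f_f[OF \<kappa>_inj that] .
  have \<kappa>\<mu>: "\<kappa> (\<mu> y) = y" and \<mu>_in: "\<mu> y \<in> carrier M" if "y \<in> carrier ?A" for y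
    unfolding \<mu>_def
    using f_inv_into_f[of y \<kappa> "carrier M"] inv_into_into[of y \<kappa> "carrier M"] that \<kappa>_img by simp_all
  have \<kappa>_mult: "\<kappa> (x \<otimes>\<^bsub>M\<^esub> y) = \<kappa> x \<otimes>\<^bsub>?A\<^esub> \<kappa> y" if "x \<in> carrier M" "y \<in> carrier M" for x y
    using \<kappa>_hom that by (simp add: mon_hom_def hom_mult)
  have \<kappa>_one: "\<kappa> \<one>\<^bsub>M\<^esub> = \<one>\<^bsub>?A\<^esub>" using \<kappa>_hom by (simp add: mon_hom_def)
  have \<mu>_mult: "\<mu> (x \<otimes>\<^bsub>?A\<^esub> y) = \<mu> x \<otimes>\<^bsub>M\<^esub> \<mu> y" if xy: "x \<in> carrier ?A" "y \<in> carrier ?A" for x y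
  proof -
    have "x \<otimes>\<^bsub>?A\<^esub> y = \<kappa> (\<mu> x \<otimes>\<^bsub>M\<^esub> \<mu> y)" using \<kappa>_mult[OF \<mu>_in[OF xy(1)] \<mu>_in[OF xy(2)]] \<kappa>\<mu> xy by simp
    then show ?thesis using \<mu>\<kappa> \<mu>_in xy by simp
  qed
  have \<mu>_one: "\<mu> \<one>\<^bsub>?A\<^esub> = \<one>\<^bsub>M\<^esub>" using \<mu>\<kappa>[OF M.one_closed] \<kappa>_one by simp
  define in1 in2 where "in1 = amalgam_in1 N i1 i2 M1 M2" and "in2 = amalgam_in2 N i1 i2 M1 M2"
  have in_hom: "in1 \<in> mon_hom M1 ?A" "in2 \<in> mon_hom M2 ?A"
    and in_eq: "\<And>n. n \<in> carrier N \<Longrightarrow> in1 (i1 n) = in2 (i2 n)"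
    unfolding in1_def in2_def using amalgam_cocone[OF M1 M2 i1(1) i2(1)] by blast+
  have in1_in: "in1 a \<in> carrier ?A" if "a \<in> carrier M1" for a
    using in_hom(1) that by (auto simp: mon_hom_def hom_def)
  have in2_in: "in2 a \<in> carrier ?A" if "a \<in> carrier M2" for a
    using in_hom(2) that by (auto simp: mon_hom_def hom_def)
  define Mo where "Mo b = (if b then M1 else M2)" for b :: bool
  define i where "i b = (if b then i1 else i2)" for b :: bool
  define q where "q b = (if b then \<mu> \<circ> in1 else \<mu> \<circ> in2)" for b :: bool
  have "amalgam_monoid Mo N i M q"
  proof (rule amalgam_monoid.intro)
    show "env_good (Mo b)" for b using good by (simp add: Mo_def)
    show "i b \<in> mon_hom N (Mo b)" "inj_on (i b) (carrier N)" "std_parabolic (i b ` carrier N) (Mo b)" for b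
      using i1 i2 by (simp_all add: Mo_def i_def)
    show "q b \<in> mon_hom (Mo b) M" for b
      using in_hom \<mu>_in \<mu>_mult \<mu>_one in1_in in2_in by (auto simp: q_def Mo_def mon_hom_def hom_def)
    show "q b (i b n) = q d (i d n)" if "n \<in> carrier N" for b d n
      using in_eq[OF that] by (simp add: q_def i_def)
  next
    fix T assume T: "submonoid T M" and qT: "\<And>b. q b ` carrier (Mo b) \<subseteq> T"
    interpret T: submonoid T M by (rule T)
    have "submonoid {y \<in> carrier ?A. \<mu> y \<in> T} ?A"
      by (rule submonoid.intro) (simp_all add: \<mu>_mult \<mu>_one)
    moreover have "in1 ` carrier M1 \<subseteq> {y \<in> carrier ?A. \<mu> y \<in> T}"
      using in1_in qT[of True] by (auto simp: q_def Mo_def)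
    moreover have "in2 ` carrier M2 \<subseteq> {y \<in> carrier ?A. \<mu> y \<in> T}"
      using in2_in qT[of False] by (auto simp: q_def Mo_def)
    ultimately have sub: "carrier ?A \<subseteq> {y \<in> carrier ?A. \<mu> y \<in> T}"
      unfolding in1_def in2_def by (rule amalgam_generated[OF M1 M2 i1(1) i2(1)])
    show "carrier M \<subseteq> T"
    proof
      fix x assume x: "x \<in> carrier M"
      then have "\<kappa> x \<in> carrier ?A" using \<kappa>_img by blast
      then have "\<mu> (\<kappa> x) \<in> T" using sub by blast
      then show "x \<in> T" using \<mu>\<kappa>[OF x] by simp
    qed
  next
    fix L :: "(('a + 'a) list set \<times> (bool \<times> ('a + 'a) list set) list \<Rightarrow>
        ('a + 'a) list set \<times> (bool \<times> ('a + 'a) list set) list) monoid" and f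
    assume L: "group L" and f: "\<And>b. f b \<in> mon_hom (Mo b) L"
      and eq: "\<And>n. n \<in> carrier N \<Longrightarrow> f True (i True n) = f False (i False n)"
    have "f True \<in> mon_hom M1 L" "f False \<in> mon_hom M2 L"
      using f[of True] f[of False] by (simp_all add: Mo_def)
    moreover have "f True (i1 n) = f False (i2 n)" if "n \<in> carrier N" for n
      using eq[OF that] by (simp add: i_def)
    ultimately obtain u where u: "u \<in> mon_hom ?A L" "\<And>a. a \<in> carrier M1 \<Longrightarrow> u (in1 a) = f True a"
      "\<And>a. a \<in> carrier M2 \<Longrightarrow> u (in2 a) = f False a"
      using amalgam_universal[OF M1 M2 group.is_monoid[OF L], of "f True" "f False" N i1 i2]
      unfolding in1_def in2_def by blast
    have hom: "u \<circ> \<kappa> \<in> mon_hom M L"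
      using u(1) \<kappa>_hom hom_compose[of \<kappa> M ?A u L] by (simp add: mon_hom_def)
    have "(u \<circ> \<kappa>) (q b a) = f b a" if "a \<in> carrier (Mo b)" for b a
      using that u(2,3) \<kappa>\<mu> in1_in in2_in by (cases b) (simp_all add: q_def Mo_def)
    then show "\<exists>u\<in>mon_hom M L. \<forall>b. \<forall>a\<in>carrier (Mo b). u (q b a) = f b a"
      by (intro bexI[OF _ hom] allI ballI)
  qed (rule N, rule M)
  then show ?thesis by (rule amalgam_monoid.M_env_good)
qed

lemma fc_type_env_good: "fc_type M \<Longrightarrow> env_good M"
proof (induction rule: fc_type.induct)
  case (garside M)
  then show ?case by (rule garside_env_good)
next
  case (amalgam M1 M2 N i1 i2 M)
  show ?case
    by (rule amalgam_env_good[OF amalgam.IH amalgam.hyps(3-)])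
qed

section \<open>Enveloping groups of parabolic submonoids\<close>

text \<open>The enveloping group of \<open>N\<close> has the same underlying type as that of
  \<open>M\<close>, so it is an admissible target for \<open>extends_homs\<close>. The resulting map
  is inverse to the one given by the universal property, as both compositions are the identity on
  generators.\<close>

lemma env_iso_parabolic:
  assumes good: "env_good M" and N: "std_parabolic N M"
  shows "\<exists>\<phi> \<in> iso (env_group (M\<lparr>carrier := N\<rparr>))
      ((env_group M)\<lparr>carrier := std_parabolic_subgroup M N\<rparr>).
    \<forall>a\<in>N. \<phi> (env_map (M\<lparr>carrier := N\<rparr>) a) = env_map M a"
proof -
  let ?N = "M\<lparr>carrier := N\<rparr>" and ?G = "env_group M" and ?\<iota> = "env_map M"
  let ?K = "generate ?G (?\<iota> ` N)"
  have M: "monoid M" and inj: "inj_on ?\<iota> (carrier M)" and gd: "good ?G (?\<iota> ` carrier M)"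
    using good by (simp_all add: env_good_def)
  interpret E: monoid_embedding M ?G ?\<iota> by (rule env_embedding[OF M inj])
  have sub: "submonoid N M" using N unfolding std_parabolic_def by blast
  have Nc: "N \<subseteq> carrier M" by (rule submonoid.subset[OF sub])
  have Nm: "monoid ?N" by (rule submonoid.submonoid_is_monoid[OF sub M])
  have P: "parabolic ?G (?\<iota> ` carrier M) (?\<iota> ` N)" using E.parabolic_iff[OF Nc] N by blast
  have Pc: "?\<iota> ` N \<subseteq> carrier ?G" by (rule parabolicD(3)[OF P])
  have K_sub: "subgroup ?K ?G" by (rule E.generate_is_subgroup[OF Pc])
  have K: "group (?G\<lparr>carrier := ?K\<rparr>)"
    using subgroup.subgroup_is_group[OF K_sub E.group_axioms] .
  have EN: "group (env_group ?N)" by (rule env_group_is_group)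
  note eN = env_map_hom[OF Nm, simplified]
  have gen_in: "x \<in> carrier ?G" if "x \<in> ?K" for x using that E.generate_in_carrier[OF Pc] by blast
  have "?\<iota> \<in> mon_hom ?N (?G\<lparr>carrier := ?K\<rparr>)"
    unfolding mon_hom_def
  proof (intro CollectI conjI homI)
    fix x y assume "x \<in> carrier ?N" "y \<in> carrier ?N"
    then show "?\<iota> (x \<otimes>\<^bsub>?N\<^esub> y) = ?\<iota> x \<otimes>\<^bsub>?G\<lparr>carrier := ?K\<rparr>\<^esub> ?\<iota> y"
      using E.hom_simps(2)[of x y] Nc by auto
  qed (auto simp: E.hom_simps(3) intro: generate.incl)
  then obtain \<phi> where \<phi>: "\<phi> \<in> hom (env_group ?N) (?G\<lparr>carrier := ?K\<rparr>)"
    "\<And>a. a \<in> N \<Longrightarrow> \<phi> (env_map ?N a) = ?\<iota> a"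
    using env_group_universal[OF Nm K, of ?\<iota>] by auto
  have \<phi>_in: "\<phi> x \<in> ?K" if "x \<in> carrier (env_group ?N)" for x
    using \<phi>(1) that by (auto simp: hom_def)
  have \<phi>_mult: "\<phi> (x \<otimes>\<^bsub>env_group ?N\<^esub> y) = \<phi> x \<otimes>\<^bsub>?G\<^esub> \<phi> y"
    if "x \<in> carrier (env_group ?N)" "y \<in> carrier (env_group ?N)" for x y
    using hom_mult[OF \<phi>(1) that] by simp
  define f where "f = env_map ?N \<circ> inv_into (carrier M) ?\<iota>"
  have f: "f (?\<iota> a) = env_map ?N a" if "a \<in> N" for a
    unfolding f_def using inv_into_f_f[OF inj, of a] that Nc by auto
  have fc: "f \<in> ?\<iota> ` N \<rightarrow> carrier (env_group ?N)" using f eN(1) by auto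
  have fm: "f (x \<otimes>\<^bsub>?G\<^esub> y) = f x \<otimes>\<^bsub>env_group ?N\<^esub> f y" if xy: "x \<in> ?\<iota> ` N" "y \<in> ?\<iota> ` N" for x y
  proof -
    obtain a b where ab: "a \<in> N" "b \<in> N" "x = ?\<iota> a" "y = ?\<iota> b" using xy by blast
    have "x \<otimes>\<^bsub>?G\<^esub> y = ?\<iota> (a \<otimes>\<^bsub>M\<^esub> b)" unfolding ab(3,4) using ab(1,2) Nc by (intro E.hom_simps(2)[symmetric]) blast+
    then have "f (x \<otimes>\<^bsub>?G\<^esub> y) = env_map ?N (a \<otimes>\<^bsub>M\<^esub> b)"
      using f[OF submonoid.m_closed[OF sub ab(1,2)]] by simp
    then show ?thesis using eN(2)[OF ab(1,2)] f ab by simp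
  qed
  have ext: "extends_homs ?G (?\<iota> ` N)" using gd P unfolding good_def by blast
  have "\<exists>\<psi>\<in>?K \<rightarrow> carrier (env_group ?N).
      (\<forall>x\<in>?K. \<forall>y\<in>?K. \<psi> (x \<otimes>\<^bsub>?G\<^esub> y) = \<psi> x \<otimes>\<^bsub>env_group ?N\<^esub> \<psi> y) \<and> (\<forall>a\<in>?\<iota> ` N. \<psi> a = f a)"
    by (rule ext[unfolded extends_homs_def, rule_format, OF EN fc fm])
  then obtain \<psi> where \<psi>_in: "\<psi> \<in> ?K \<rightarrow> carrier (env_group ?N)"
    and \<psi>_mult: "\<forall>x\<in>?K. \<forall>y\<in>?K. \<psi> (x \<otimes>\<^bsub>?G\<^esub> y) = \<psi> x \<otimes>\<^bsub>env_group ?N\<^esub> \<psi> y"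
    and \<psi>: "\<forall>a\<in>?\<iota> ` N. \<psi> a = f a"
    by (elim bexE conjE)
  have \<psi>_hom: "\<psi> \<in> hom (?G\<lparr>carrier := ?K\<rparr>) (env_group ?N)"
    using \<psi>_in \<psi>_mult by (simp add: hom_def)
  have \<psi>\<phi>: "\<psi> (\<phi> x) = x" if x: "x \<in> carrier (env_group ?N)" for x
  proof -
    have "(\<psi> \<circ> \<phi>) x = id x"
    proof (rule env_group_unique[OF Nm EN _ _ _ x])
      show "\<psi> \<circ> \<phi> \<in> hom (env_group ?N) (env_group ?N)" using \<phi>(1) \<psi>_hom by (rule hom_compose)
      show "id \<in> hom (env_group ?N) (env_group ?N)" by (simp add: hom_def)
      show "(\<psi> \<circ> \<phi>) (env_map ?N a) = id (env_map ?N a)" if "a \<in> carrier ?N" for a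
        using that \<phi>(2) \<psi> f by simp
    qed
    then show ?thesis by simp
  qed
  have \<phi>\<psi>: "\<phi> (\<psi> x) = x" if x: "x \<in> ?K" for x
  proof -
    have "(\<phi> \<circ> \<psi>) x = id x"
    proof (rule E.hom_on_generate_eq[OF E.group_axioms Pc, where f = "\<phi> \<circ> \<psi>" and g = id])
      show "x \<in> ?K" by (rule x)
      show "(\<phi> \<circ> \<psi>) y \<in> carrier ?G" "id y \<in> carrier ?G" if "y \<in> ?K" for y
        using gen_in[OF \<phi>_in[OF funcset_mem[OF \<psi>_in that]]] gen_in[OF that] by simp_all
      show "(\<phi> \<circ> \<psi>) (y \<otimes>\<^bsub>?G\<^esub> z) = (\<phi> \<circ> \<psi>) y \<otimes>\<^bsub>?G\<^esub> (\<phi> \<circ> \<psi>) z"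
        if "y \<in> ?K" "z \<in> ?K" for y z
        using \<psi>_mult that \<phi>_mult[OF funcset_mem[OF \<psi>_in that(1)] funcset_mem[OF \<psi>_in that(2)]] by simp
      show "(\<phi> \<circ> \<psi>) a = id a" if "a \<in> ?\<iota> ` N" for a
        using that \<psi> f \<phi>(2) by auto
    qed simp
    then show ?thesis by simp
  qed
  have "bij_betw \<phi> (carrier (env_group ?N)) ?K"
    using \<psi>\<phi> \<phi>\<psi> \<phi>_in \<psi>_in by (intro bij_betw_byWitness[where f' = \<psi>]) auto
  then have "\<phi> \<in> iso (env_group ?N) (?G\<lparr>carrier := ?K\<rparr>)" using \<phi>(1) by (simp add: iso_def)
  then show ?thesis using \<phi>(2) by blast
qed

theorem theorem4p10:
  fixes M :: "'a monoid"
  assumes "pregarside M" and "fc_type M"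
  shows
    "inj_on (env_map M) (carrier M) \<and>
     (\<forall>N. std_parabolic N M \<longrightarrow>
        (\<exists>\<phi> \<in> iso (env_group (M\<lparr>carrier := N\<rparr>))
                    ((env_group M)\<lparr>carrier := std_parabolic_subgroup M N\<rparr>).
           \<forall>a\<in>N. \<phi> (env_map (M\<lparr>carrier := N\<rparr>) a) = env_map M a) \<and>
        std_parabolic_subgroup M N \<inter> env_map M ` carrier M = env_map M ` N) \<and>
     (\<forall>N N'. std_parabolic N M \<longrightarrow> std_parabolic N' M \<longrightarrow>
        std_parabolic (N \<inter> N') M \<and>
        std_parabolic_subgroup M N \<inter> std_parabolic_subgroup M N' =
          std_parabolic_subgroup M (N \<inter> N')) \<and>
     torsion_free (env_group M)"
proof -
  have env_good: "env_good M" using assms(2) by (rule fc_type_env_good)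
  then have M: "monoid M" and inj: "inj_on (env_map M) (carrier M)"
    and gd: "good (env_group M) (env_map M ` carrier M)"
    by (simp_all add: env_good_def)
  interpret E: monoid_embedding M "env_group M" "env_map M" by (rule env_embedding[OF M inj])
  interpret P: pos_pair "env_group M" "env_map M ` carrier M" using gd unfolding good_def by blast
  have par: "N \<subseteq> carrier M" "parabolic (env_group M) (env_map M ` carrier M) (env_map M ` N)"
    if "std_parabolic N M" for N
  proof -
    show "N \<subseteq> carrier M" using that unfolding std_parabolic_def submonoid_def by blast
    then show "parabolic (env_group M) (env_map M ` carrier M) (env_map M ` N)"
      using E.parabolic_iff that by blast
  qed
  have int: "std_parabolic (N \<inter> N') M \<and>
      std_parabolic_subgroup M N \<inter> std_parabolic_subgroup M N' = std_parabolic_subgroup M (N \<inter> N')"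
    if N: "std_parabolic N M" and N': "std_parabolic N' M" for N N'
  proof
    have eq: "env_map M ` (N \<inter> N') = env_map M ` N \<inter> env_map M ` N'"
      using inj_on_image_Int[OF inj par(1)[OF N] par(1)[OF N']] .
    have "N \<inter> N' \<subseteq> carrier M" using par(1)[OF N] by blast
    then show "std_parabolic (N \<inter> N') M"
      using E.parabolic_iff[of "N \<inter> N'"] parabolic_Int[OF par(2)[OF N] par(2)[OF N']] eq by simp
    show "std_parabolic_subgroup M N \<inter> std_parabolic_subgroup M N' = std_parabolic_subgroup M (N \<inter> N')"
    proof
      show "std_parabolic_subgroup M N \<inter> std_parabolic_subgroup M N' \<subseteq> std_parabolic_subgroup M (N \<inter> N')"
        unfolding eq by (rule P.inter[OF par(2)[OF N] par(2)[OF N']])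
      show "std_parabolic_subgroup M (N \<inter> N') \<subseteq> std_parabolic_subgroup M N \<inter> std_parabolic_subgroup M N'"
        unfolding eq by (intro Int_greatest E.mono_generate) blast+
    qed
  qed
  \<comment> \<open>\<open>good\<close> speaks of torsion in the subgroup generated by the image of
    \<open>M\<close>, which \<open>env_generate\<close> shows to be the whole group.\<close>
  have tf: "torsion_free (env_group M)"
    unfolding torsion_free_def
    using gd env_generate[OF M] unfolding good_def by auto
  show ?thesis
  proof (intro conjI allI impI inj tf)
    fix N assume N: "std_parabolic N M"
    show "\<exists>\<phi> \<in> iso (env_group (M\<lparr>carrier := N\<rparr>))
        ((env_group M)\<lparr>carrier := std_parabolic_subgroup M N\<rparr>).
      \<forall>a\<in>N. \<phi> (env_map (M\<lparr>carrier := N\<rparr>) a) = env_map M a"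
      by (rule env_iso_parabolic[OF env_good N])
    show "std_parabolic_subgroup M N \<inter> env_map M ` carrier M = env_map M ` N"
      by (rule P.generate_Int_monoid[OF par(2)[OF N]])
  qed (use int in blast)+
qed

end
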